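(* $\mathsf{WKL}_0 + \mathsf{GP}^2_2$ is $\Pi^1_1$-conservative over $\mathsf{RCA}_0 + \mathsf{B}\Sigma^0_2$.
   Context: A largeness notion is a family $\mathcal{L}$ of finite subsets of $\mathbb{N}$ that is closed under supersets and such that every infinite set has a finite subset in $\mathcal{L}$; members of $\mathcal{L}$ are called $\mathcal{L}$-large. For $A<B$ meaning every element of $A$ is below every element of $B$: given a largeness notion $\mathcal{L}$ and $f:[\mathbb{N}]^2\to 2$, an $\mathcal{L}$-grouping for $f$ is a (finite or infinite) sequence $F_0<F_1<\dots$ of $\mathcal{L}$-large finite sets such that for all indices $i<j$, $f$ is constant on $F_i\times F_j$. $\mathsf{GP}^2_2$ is the statement: for every largeness notion $\mathcal{L}$ and every coloring $f:[\mathbb{N}]^2\to 2$, there is an infinite $\mathcal{L}$-grouping for $f$. *)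

theory Defs
  imports Main
begin

section \<open>The language of second-order arithmetic\<close>

text \<open>
  Two-sorted first-order syntax with de Bruijn indices. Number variables and set variables
  live in two independent index spaces: a number quantifier binds number index 0 and leaves
  the set indices alone, and conversely. \<open>Unit\<close> is the constant 1. Equality is primitive for
  numbers only.
\<close>

datatype tm = Var nat | Zero | Unit | Add tm tm (infixl "\<^bold>+" 65) | Mul tm tm (infixl "\<^bold>\<cdot>" 70)

datatype fm =
    Eq tm tm (infix "\<^bold>=" 50)
  | Less tm tm (infix "\<^bold><" 50)
  | Mem tm nat (infix "\<^bold>\<in>" 50)
  | Falsum
  | Imp fm fm (infixr "\<^bold>\<longrightarrow>" 25)
  | AllN fm
  | AllS fm

abbreviation Neg :: "fm \<Rightarrow> fm" ("\<^bold>\<not> _" [40] 40) where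
  "\<^bold>\<not> p \<equiv> p \<^bold>\<longrightarrow> Falsum"

abbreviation Or :: "fm \<Rightarrow> fm \<Rightarrow> fm" (infixr "\<^bold>\<or>" 30) where
  "p \<^bold>\<or> q \<equiv> \<^bold>\<not> p \<^bold>\<longrightarrow> q"

abbreviation And :: "fm \<Rightarrow> fm \<Rightarrow> fm" (infixr "\<^bold>\<and>" 35) where
  "p \<^bold>\<and> q \<equiv> \<^bold>\<not> (p \<^bold>\<longrightarrow> \<^bold>\<not> q)"

abbreviation Iff :: "fm \<Rightarrow> fm \<Rightarrow> fm" (infixr "\<^bold>\<longleftrightarrow>" 25) where
  "p \<^bold>\<longleftrightarrow> q \<equiv> (p \<^bold>\<longrightarrow> q) \<^bold>\<and> (q \<^bold>\<longrightarrow> p)"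

abbreviation ExN :: "fm \<Rightarrow> fm" where
  "ExN p \<equiv> \<^bold>\<not> (AllN (\<^bold>\<not> p))"

abbreviation ExS :: "fm \<Rightarrow> fm" where
  "ExS p \<equiv> \<^bold>\<not> (AllS (\<^bold>\<not> p))"

subsection \<open>Substitution\<close>

primrec subst_tm :: "(nat \<Rightarrow> tm) \<Rightarrow> tm \<Rightarrow> tm" where
  "subst_tm \<sigma> (Var i) = \<sigma> i"
| "subst_tm \<sigma> Zero = Zero"
| "subst_tm \<sigma> Unit = Unit"
| "subst_tm \<sigma> (s \<^bold>+ t) = subst_tm \<sigma> s \<^bold>+ subst_tm \<sigma> t"
| "subst_tm \<sigma> (s \<^bold>\<cdot> t) = subst_tm \<sigma> s \<^bold>\<cdot> subst_tm \<sigma> t"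

definition shift :: "nat \<Rightarrow> tm \<Rightarrow> tm" where
  "shift d = subst_tm (\<lambda>i. Var (i + d))"

definition push_tm :: "(nat \<Rightarrow> tm) \<Rightarrow> nat \<Rightarrow> tm" where
  "push_tm \<sigma> = case_nat (Var 0) (\<lambda>i. shift 1 (\<sigma> i))"

definition push_ren :: "(nat \<Rightarrow> nat) \<Rightarrow> nat \<Rightarrow> nat" where
  "push_ren \<rho> = case_nat 0 (\<lambda>i. Suc (\<rho> i))"

primrec substN :: "(nat \<Rightarrow> tm) \<Rightarrow> fm \<Rightarrow> fm" where
  "substN \<sigma> (s \<^bold>= t) = (subst_tm \<sigma> s \<^bold>= subst_tm \<sigma> t)"
| "substN \<sigma> (s \<^bold>< t) = (subst_tm \<sigma> s \<^bold>< subst_tm \<sigma> t)"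
| "substN \<sigma> (t \<^bold>\<in> X) = (subst_tm \<sigma> t \<^bold>\<in> X)"
| "substN \<sigma> Falsum = Falsum"
| "substN \<sigma> (p \<^bold>\<longrightarrow> q) = (substN \<sigma> p \<^bold>\<longrightarrow> substN \<sigma> q)"
| "substN \<sigma> (AllN p) = AllN (substN (push_tm \<sigma>) p)"
| "substN \<sigma> (AllS p) = AllS (substN \<sigma> p)"

text \<open>The only terms of the set sort are variables, so substitution for sets is renaming.\<close>

primrec substS :: "(nat \<Rightarrow> nat) \<Rightarrow> fm \<Rightarrow> fm" where
  "substS \<rho> (s \<^bold>= t) = (s \<^bold>= t)"
| "substS \<rho> (s \<^bold>< t) = (s \<^bold>< t)"
| "substS \<rho> (t \<^bold>\<in> X) = (t \<^bold>\<in> \<rho> X)"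
| "substS \<rho> Falsum = Falsum"
| "substS \<rho> (p \<^bold>\<longrightarrow> q) = (substS \<rho> p \<^bold>\<longrightarrow> substS \<rho> q)"
| "substS \<rho> (AllN p) = AllN (substS \<rho> p)"
| "substS \<rho> (AllS p) = AllS (substS (push_ren \<rho>) p)"

abbreviation instN :: "tm \<Rightarrow> fm \<Rightarrow> fm" where
  "instN t \<equiv> substN (case_nat t Var)"

abbreviation instS :: "nat \<Rightarrow> fm \<Rightarrow> fm" where
  "instS X \<equiv> substS (case_nat X id)"

abbreviation liftN :: "fm \<Rightarrow> fm" where
  "liftN \<equiv> substN (\<lambda>i. Var (Suc i))"

abbreviation liftS :: "fm \<Rightarrow> fm" where
  "liftS \<equiv> substS Suc"

subsection \<open>Classes of formulas\<close>

abbreviation BAll :: "tm \<Rightarrow> fm \<Rightarrow> fm" where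
  "BAll t p \<equiv> AllN (Var 0 \<^bold>< shift 1 t \<^bold>\<longrightarrow> p)"

abbreviation BEx :: "tm \<Rightarrow> fm \<Rightarrow> fm" where
  "BEx t p \<equiv> ExN (Var 0 \<^bold>< shift 1 t \<^bold>\<and> p)"

inductive bounded :: "fm \<Rightarrow> bool" where
  "bounded (s \<^bold>= t)"
| "bounded (s \<^bold>< t)"
| "bounded (t \<^bold>\<in> X)"
| "bounded Falsum"
| "bounded p \<Longrightarrow> bounded q \<Longrightarrow> bounded (p \<^bold>\<longrightarrow> q)"
| "bounded p \<Longrightarrow> bounded (BAll t p)"
| "bounded p \<Longrightarrow> bounded (BEx t p)"

fun Sigma0 :: "nat \<Rightarrow> fm \<Rightarrow> bool" and Pi0 :: "nat \<Rightarrow> fm \<Rightarrow> bool" where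
  "Sigma0 0 p = bounded p"
| "Sigma0 (Suc k) p = (\<exists>q. Pi0 k q \<and> p = ExN q)"
| "Pi0 0 p = bounded p"
| "Pi0 (Suc k) p = (\<exists>q. Sigma0 k q \<and> p = AllN q)"

text \<open>Arithmetical formulas may contain free set variables.\<close>

primrec arithmetical :: "fm \<Rightarrow> bool" where
  "arithmetical (s \<^bold>= t) = True"
| "arithmetical (s \<^bold>< t) = True"
| "arithmetical (t \<^bold>\<in> X) = True"
| "arithmetical Falsum = True"
| "arithmetical (p \<^bold>\<longrightarrow> q) = (arithmetical p \<and> arithmetical q)"
| "arithmetical (AllN p) = arithmetical p"
| "arithmetical (AllS p) = False"

definition Pi11 :: "fm \<Rightarrow> bool" where
  "Pi11 p \<longleftrightarrow> (\<exists>q. arithmetical q \<and> p = AllS q)"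

primrec closed_tm :: "nat \<Rightarrow> tm \<Rightarrow> bool" where
  "closed_tm m (Var i) = (i < m)"
| "closed_tm m Zero = True"
| "closed_tm m Unit = True"
| "closed_tm m (s \<^bold>+ t) = (closed_tm m s \<and> closed_tm m t)"
| "closed_tm m (s \<^bold>\<cdot> t) = (closed_tm m s \<and> closed_tm m t)"

primrec closed_fm :: "nat \<Rightarrow> nat \<Rightarrow> fm \<Rightarrow> bool" where
  "closed_fm m n (s \<^bold>= t) = (closed_tm m s \<and> closed_tm m t)"
| "closed_fm m n (s \<^bold>< t) = (closed_tm m s \<and> closed_tm m t)"
| "closed_fm m n (t \<^bold>\<in> X) = (closed_tm m t \<and> X < n)"
| "closed_fm m n Falsum = True"
| "closed_fm m n (p \<^bold>\<longrightarrow> q) = (closed_fm m n p \<and> closed_fm m n q)"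
| "closed_fm m n (AllN p) = closed_fm (Suc m) n p"
| "closed_fm m n (AllS p) = closed_fm m (Suc n) p"

abbreviation sentence :: "fm \<Rightarrow> bool" where
  "sentence \<equiv> closed_fm 0 0"

section \<open>Provability and conservation\<close>

text \<open>
  A Hilbert calculus for classical two-sorted first-order logic with equality. Because
  generalization is unrestricted, a nonlogical axiom with free variables (parameters)
  stands for its universal closure.
\<close>

inductive proves :: "fm set \<Rightarrow> fm \<Rightarrow> bool" (infix "\<turnstile>" 50) for T :: "fm set" where
  Ax: "p \<in> T \<Longrightarrow> T \<turnstile> p"
| MP: "T \<turnstile> (p \<^bold>\<longrightarrow> q) \<Longrightarrow> T \<turnstile> p \<Longrightarrow> T \<turnstile> q"
| K: "T \<turnstile> (p \<^bold>\<longrightarrow> q \<^bold>\<longrightarrow> p)"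
| S: "T \<turnstile> ((p \<^bold>\<longrightarrow> q \<^bold>\<longrightarrow> r) \<^bold>\<longrightarrow> (p \<^bold>\<longrightarrow> q) \<^bold>\<longrightarrow> p \<^bold>\<longrightarrow> r)"
| DN: "T \<turnstile> (\<^bold>\<not> \<^bold>\<not> p \<^bold>\<longrightarrow> p)"
| GenN: "T \<turnstile> p \<Longrightarrow> T \<turnstile> AllN p"
| InstN: "T \<turnstile> (AllN p \<^bold>\<longrightarrow> instN t p)"
| DistN: "T \<turnstile> (AllN (p \<^bold>\<longrightarrow> q) \<^bold>\<longrightarrow> AllN p \<^bold>\<longrightarrow> AllN q)"
| VacN: "T \<turnstile> (p \<^bold>\<longrightarrow> AllN (liftN p))"
| GenS: "T \<turnstile> p \<Longrightarrow> T \<turnstile> AllS p"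
| InstS: "T \<turnstile> (AllS p \<^bold>\<longrightarrow> instS X p)"
| DistS: "T \<turnstile> (AllS (p \<^bold>\<longrightarrow> q) \<^bold>\<longrightarrow> AllS p \<^bold>\<longrightarrow> AllS q)"
| VacS: "T \<turnstile> (p \<^bold>\<longrightarrow> AllS (liftS p))"
| Refl: "T \<turnstile> (t \<^bold>= t)"
| Leibniz: "T \<turnstile> (s \<^bold>= t \<^bold>\<longrightarrow> instN s p \<^bold>\<longrightarrow> instN t p)"

definition conservative_over :: "(fm \<Rightarrow> bool) \<Rightarrow> fm set \<Rightarrow> fm set \<Rightarrow> bool" where
  "conservative_over \<Gamma> T T\<^sub>0 \<longleftrightarrow> (\<forall>p. \<Gamma> p \<and> sentence p \<and> T \<turnstile> p \<longrightarrow> T\<^sub>0 \<turnstile> p)"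

section \<open>\<open>RCA\<^sub>0\<close> and collection\<close>

definition basic_axioms :: "fm set" where
  "basic_axioms =
    {\<^bold>\<not> (Var 0 \<^bold>+ Unit \<^bold>= Zero),
     Var 0 \<^bold>+ Unit \<^bold>= Var 1 \<^bold>+ Unit \<^bold>\<longrightarrow> Var 0 \<^bold>= Var 1,
     Var 0 \<^bold>+ Zero \<^bold>= Var 0,
     Var 0 \<^bold>+ (Var 1 \<^bold>+ Unit) \<^bold>= (Var 0 \<^bold>+ Var 1) \<^bold>+ Unit,
     Var 0 \<^bold>\<cdot> Zero \<^bold>= Zero,
     Var 0 \<^bold>\<cdot> (Var 1 \<^bold>+ Unit) \<^bold>= (Var 0 \<^bold>\<cdot> Var 1) \<^bold>+ Var 0,
     \<^bold>\<not> (Var 0 \<^bold>< Zero),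
     Var 0 \<^bold>< Var 1 \<^bold>+ Unit \<^bold>\<longleftrightarrow> Var 0 \<^bold>< Var 1 \<^bold>\<or> Var 0 \<^bold>= Var 1}"

definition induction_axiom :: "fm \<Rightarrow> fm" where
  "induction_axiom p =
    (instN Zero p \<^bold>\<and> AllN (p \<^bold>\<longrightarrow> substN (case_nat (Var 0 \<^bold>+ Unit) (\<lambda>i. Var (Suc i))) p)
      \<^bold>\<longrightarrow> AllN p)"

text \<open>Lifting \<open>p\<close> keeps the newly bound set variable from occurring in it.\<close>

definition comprehension_axiom :: "fm \<Rightarrow> fm \<Rightarrow> fm" where
  "comprehension_axiom p q =
    (AllN (p \<^bold>\<longleftrightarrow> q) \<^bold>\<longrightarrow> ExS (AllN (Var 0 \<^bold>\<in> 0 \<^bold>\<longleftrightarrow> liftS p)))"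

definition RCA0 :: "fm set" where
  "RCA0 = basic_axioms
    \<union> {induction_axiom p | p. Sigma0 1 p}
    \<union> {comprehension_axiom p q | p q. Sigma0 1 p \<and> Pi0 1 q}"

text \<open>
  In \<open>collection_axiom p\<close> the formula \<open>p\<close> has \<open>y\<close> as number variable 0 and \<open>x\<close> as number
  variable 1, and the axiom, with its free number variable 0 as \<open>a\<close>, reads
  \<open>(\<forall>x<a. \<exists>y. p) \<longrightarrow> (\<exists>b. \<forall>x<a. \<exists>y<b. p)\<close>. The substitution makes room for \<open>b\<close>.
\<close>

definition collection_axiom :: "fm \<Rightarrow> fm" where
  "collection_axiom p =
    (BAll (Var 0) (ExN p) \<^bold>\<longrightarrow>
      ExN (BAll (Var 1) (BEx (Var 1) (substN (\<lambda>i. Var (if i < 2 then i else Suc i)) p))))"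

definition B_Sigma0 :: "nat \<Rightarrow> fm set" where
  "B_Sigma0 k = {collection_axiom p | p. Sigma0 k p}"

section \<open>Coding of pairs, finite sets and finite sequences\<close>

definition pair :: "tm \<Rightarrow> tm \<Rightarrow> tm" where
  "pair s t = (s \<^bold>+ t) \<^bold>\<cdot> (s \<^bold>+ t) \<^bold>+ s"

text \<open>
  The number \<open>c = (k, (m, n))\<close> represents the finite set of all \<open>i < k\<close> such that
  \<open>m(i + 1) + 1\<close> divides \<open>n\<close>; the code of a finite set is the least number representing it.
  (A number that is not of the form \<open>(k, (m, n))\<close> represents the empty set, whose code is 0.)
\<close>

definition in_code :: "tm \<Rightarrow> tm \<Rightarrow> fm" where
  "in_code t c =
    ExN (ExN (ExN (shift 3 c \<^bold>= pair (Var 2) (pair (Var 1) (Var 0)) \<^bold>\<and> shift 3 t \<^bold>< Var 2 \<^bold>\<and>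
      ExN (Var 0 \<^bold>\<cdot> (Var 2 \<^bold>\<cdot> (shift 4 t \<^bold>+ Unit) \<^bold>+ Unit) \<^bold>= Var 1))))"

definition finset_code :: "tm \<Rightarrow> fm" where
  "finset_code c =
    BAll c (\<^bold>\<not> (AllN (in_code (Var 0) (Var 1) \<^bold>\<longleftrightarrow> in_code (Var 0) (shift 2 c))))"

definition code_sub_code :: "tm \<Rightarrow> tm \<Rightarrow> fm" where
  "code_sub_code c d = AllN (in_code (Var 0) (shift 1 c) \<^bold>\<longrightarrow> in_code (Var 0) (shift 1 d))"

definition code_sub_set :: "tm \<Rightarrow> nat \<Rightarrow> fm" where
  "code_sub_set c X = AllN (in_code (Var 0) (shift 1 c) \<^bold>\<longrightarrow> Var 0 \<^bold>\<in> X)"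

definition code_before :: "tm \<Rightarrow> tm \<Rightarrow> fm" where
  "code_before c d =
    AllN (AllN (in_code (Var 1) (shift 2 c) \<^bold>\<and> in_code (Var 0) (shift 2 d) \<^bold>\<longrightarrow> Var 1 \<^bold>< Var 0))"

definition infinite_set :: "nat \<Rightarrow> fm" where
  "infinite_set X = AllN (ExN (Var 1 \<^bold>< Var 0 \<^bold>\<and> Var 0 \<^bold>\<in> X))"

text \<open>A function is represented by its graph, a set of pairs.\<close>

definition function_NN :: "nat \<Rightarrow> fm" where
  "function_NN F =
    (AllN (Var 0 \<^bold>\<in> F \<^bold>\<longrightarrow> ExN (ExN (Var 2 \<^bold>= pair (Var 1) (Var 0)))) \<^bold>\<and>
     AllN (ExN (pair (Var 1) (Var 0) \<^bold>\<in> F)) \<^bold>\<and>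
     AllN (AllN (AllN (pair (Var 2) (Var 1) \<^bold>\<in> F \<^bold>\<and> pair (Var 2) (Var 0) \<^bold>\<in> F
       \<^bold>\<longrightarrow> Var 1 \<^bold>= Var 0))))"

text \<open>\<open>seq_code s l\<close>: \<open>s\<close> codes the graph of a function with domain \<open>{j. j < l}\<close>.\<close>

definition seq_code :: "tm \<Rightarrow> tm \<Rightarrow> fm" where
  "seq_code s l =
    (finset_code s \<^bold>\<and>
     AllN (in_code (Var 0) (shift 1 s) \<^bold>\<longrightarrow> ExN (ExN (Var 2 \<^bold>= pair (Var 1) (Var 0)))) \<^bold>\<and>
     AllN (AllN (AllN (in_code (pair (Var 2) (Var 1)) (shift 3 s) \<^bold>\<and>
       in_code (pair (Var 2) (Var 0)) (shift 3 s) \<^bold>\<longrightarrow> Var 1 \<^bold>= Var 0))) \<^bold>\<and>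
     AllN (Var 0 \<^bold>< shift 1 l \<^bold>\<longleftrightarrow> ExN (in_code (pair (Var 1) (Var 0)) (shift 2 s))))"

definition binary_seq_code :: "tm \<Rightarrow> fm" where
  "binary_seq_code s =
    (ExN (seq_code (shift 1 s) (Var 0)) \<^bold>\<and>
     AllN (AllN (in_code (pair (Var 1) (Var 0)) (shift 2 s) \<^bold>\<longrightarrow> Var 0 \<^bold>< Unit \<^bold>+ Unit)))"

section \<open>Weak Koenig's lemma\<close>

text \<open>
  On codes of finite sequences, \<open>code_sub_code\<close> is the initial segment relation.
\<close>

definition binary_tree :: "nat \<Rightarrow> fm" where
  "binary_tree T =
    (AllN (Var 0 \<^bold>\<in> T \<^bold>\<longrightarrow> binary_seq_code (Var 0)) \<^bold>\<and>
     AllN (AllN (Var 1 \<^bold>\<in> T \<^bold>\<and> binary_seq_code (Var 0) \<^bold>\<and> code_sub_code (Var 0) (Var 1)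
       \<^bold>\<longrightarrow> Var 0 \<^bold>\<in> T)))"

text \<open>\<open>g\<close> is a function all of whose finite restrictions \<open>\<langle>g 0, \<dots>, g (n - 1)\<rangle>\<close> lie in \<open>T\<close>.\<close>

definition path_through :: "nat \<Rightarrow> nat \<Rightarrow> fm" where
  "path_through g T =
    (function_NN g \<^bold>\<and>
     AllN (ExN (seq_code (Var 0) (Var 1) \<^bold>\<and> code_sub_set (Var 0) g \<^bold>\<and> Var 0 \<^bold>\<in> T)))"

definition WKL :: fm where
  "WKL = AllS (binary_tree 0 \<^bold>\<and> infinite_set 0 \<^bold>\<longrightarrow> ExS (path_through 0 1))"

definition WKL0 :: "fm set" where
  "WKL0 = RCA0 \<union> {WKL}"

section \<open>The grouping principle\<close>

definition largeness_notion :: "nat \<Rightarrow> fm" where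
  "largeness_notion L =
    (AllN (Var 0 \<^bold>\<in> L \<^bold>\<longrightarrow> finset_code (Var 0)) \<^bold>\<and>
     AllN (AllN (Var 1 \<^bold>\<in> L \<^bold>\<and> finset_code (Var 0) \<^bold>\<and> code_sub_code (Var 1) (Var 0)
       \<^bold>\<longrightarrow> Var 0 \<^bold>\<in> L)) \<^bold>\<and>
     AllS (infinite_set 0 \<^bold>\<longrightarrow> ExN (Var 0 \<^bold>\<in> Suc L \<^bold>\<and> code_sub_set (Var 0) 0)))"

text \<open>
  A coloring of \<open>[\<nat>]\<^sup>2\<close> with colors 0 and 1 is the set of all \<open>((x, y), v)\<close> such that
  \<open>x < y\<close> and \<open>v\<close> is the color of \<open>{x, y}\<close>.
\<close>

definition pair_coloring :: "nat \<Rightarrow> fm" where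
  "pair_coloring f =
    (AllN (Var 0 \<^bold>\<in> f \<^bold>\<longrightarrow> ExN (ExN (ExN (Var 3 \<^bold>= pair (pair (Var 2) (Var 1)) (Var 0) \<^bold>\<and>
       Var 2 \<^bold>< Var 1 \<^bold>\<and> Var 0 \<^bold>< Unit \<^bold>+ Unit)))) \<^bold>\<and>
     AllN (AllN (Var 1 \<^bold>< Var 0 \<^bold>\<longrightarrow> ExN (pair (pair (Var 2) (Var 1)) (Var 0) \<^bold>\<in> f))) \<^bold>\<and>
     AllN (AllN (AllN (AllN (pair (pair (Var 3) (Var 2)) (Var 1) \<^bold>\<in> f \<^bold>\<and>
       pair (pair (Var 3) (Var 2)) (Var 0) \<^bold>\<in> f \<^bold>\<longrightarrow> Var 1 \<^bold>= Var 0)))))"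

definition constant_on_product :: "nat \<Rightarrow> tm \<Rightarrow> tm \<Rightarrow> fm" where
  "constant_on_product f c d =
    ExN (AllN (AllN (in_code (Var 1) (shift 3 c) \<^bold>\<and> in_code (Var 0) (shift 3 d)
      \<^bold>\<longrightarrow> pair (pair (Var 1) (Var 0)) (Var 2) \<^bold>\<in> f)))"

definition infinite_grouping :: "nat \<Rightarrow> nat \<Rightarrow> nat \<Rightarrow> fm" where
  "infinite_grouping L f F =
    (function_NN F \<^bold>\<and>
     AllN (AllN (pair (Var 1) (Var 0) \<^bold>\<in> F \<^bold>\<longrightarrow> Var 0 \<^bold>\<in> L)) \<^bold>\<and>
     AllN (AllN (AllN (AllN (Var 3 \<^bold>< Var 2 \<^bold>\<and> pair (Var 3) (Var 1) \<^bold>\<in> F \<^bold>\<and> pair (Var 2) (Var 0) \<^bold>\<in> F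
       \<^bold>\<longrightarrow> code_before (Var 1) (Var 0) \<^bold>\<and> constant_on_product f (Var 1) (Var 0))))))"

definition GP22 :: fm where
  "GP22 = AllS (AllS (largeness_notion 1 \<^bold>\<and> pair_coloring 0 \<^bold>\<longrightarrow> ExS (infinite_grouping 2 1 0)))"

end

theory Submission
  imports Defs "HOL-Library.Countable_Set"
begin

text \<open>
  Suppose that \<open>RCA\<^sub>0 + B\<Sigma>\<^sup>0\<^sub>2\<close> does not prove \<open>\<forall>X. q(X)\<close>. By completeness and compactness there
  is a countable model of it in which \<open>q(A)\<close> fails for some \<open>A\<close>, and which has a set \<open>V\<close> that is universal for
  the bounded formulas without set variables. Such a \<open>V\<close> yields a set that is universal for the \<open>\<Sigma>\<^sub>1\<close>
  sets of the sets recursive in \<open>A \<oplus> V\<close>, and by \<open>B\<Sigma>\<^sub>2\<close> its jump generates a second structure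
  \<open>T\<close> that satisfies \<open>B\<Sigma>\<^sub>1\<close>. As long as the jump of a universal set lies in such a \<open>T\<close>, the
  model satisfies \<open>I\<Sigma>\<^sub>1\<close>. Preserving this, one adds solutions of instances of \<open>WKL\<close> and
  \<open>GP\<^sup>2\<^sub>2\<close> one at a time, \<open>\<omega>\<close> times in all, without changing the first-order part.

  A path of a tree is added by the low basis theorem: its jump is decided along the construction, so that it
  is again in \<open>T\<close>. For a grouping there are two cases. If some unbounded set \<open>X\<close> and some \<open>d\<close> are such
  that arbitrarily long families of \<open>d\<close> finite sets are homogeneous on no large subset of \<open>X\<close>, then a
  low infinite such family exists by the low basis theorem, and a set homogeneous for it shows that the given family is not
  a largeness notion. Otherwise the grouping is built block by block, where the jump is decided for
  boundedly many computations at a time: the families of sets that bar a computation from converging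
  are few enough for a large block to be homogeneous for all of them.
\<close>

section \<open>Discretely ordered semirings with finite coding\<close>

text \<open>The obstacle is that \<open>T\<close> satisfies collection but not Sigma_1 induction, so
  a construction recursive in \<open>T\<close> cannot be indexed by its stages. Conditions therefore
  form a run with increasing codes: the run is decidable and unbounded in the model even if its
  steps cannot be counted there, and each step has to decide the jump on a whole interval of
  computations. Extremal sets of such computations are found by the ordinary least number principle,
  applied to a rank. Colorings need not be stable; limit colors are supplied by a set
  \<open>P\<close>, a generic path through a tree recursive in \<open>T\<close>. There is no reason
  for \<open>P\<close> to be low; it only has to preserve collection in the enlarged
  \<open>T\<close>, in which the jump of the grouping is then found. The universal set
  \<open>V\<close> comes from compactness, which replaces a formalized truth definition. What the
  coding of finite sets takes from Sigma_1 induction, apart from least elements, are common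
  multiples and products of moduli; this is why they are assumptions of
  \<open>arith\<close>.\<close>

class arith = linordered_semidom + canonically_ordered_monoid_add +
  assumes less_imp_add1_le: "a < b \<Longrightarrow> a + 1 \<le> b"
    and common_multiple_ex: "\<exists>m>0. \<forall>i. 0 < i \<and> i \<le> k \<longrightarrow> i dvd m"
    and product_ex: "\<exists>N>0. \<forall>i<k. m * (i + 1) + 1 dvd N"

lemma less_add1_iff: "(x::'a::arith) < y + 1 \<longleftrightarrow> x \<le> y"
proof
  assume "x < y + 1" then show "x \<le> y" using less_imp_add1_le[of y x] by (meson leD leI)
next
  assume "x \<le> y" also have "y < y + 1" by (rule less_add_one) finally show "x < y + 1" .
qed

lemma add1_le_iff: "(x::'a::arith) + 1 \<le> y \<longleftrightarrow> x < y"
  using less_add_one[of x] less_imp_add1_le by (blast intro: less_le_trans)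

lemma one_le_iff: "(1::'a::arith) \<le> x \<longleftrightarrow> 0 < x"
  using add1_le_iff[of 0 x] by simp

lemma le_square: "(x::'a::arith) \<le> x * x"
proof (cases "x = 0")
  case False
  then have "1 \<le> x" by (simp add: one_le_iff zero_less_iff_neq_zero)
  then have "x * 1 \<le> x * x" by (rule mult_left_mono) simp
  then show ?thesis by simp
qed simp

lemma arith_cases: obtains "(x::'a::arith) = 0" | y where "x = y + 1"
proof (cases "x = 0")
  case False
  then have "1 \<le> x" by (simp add: one_le_iff zero_less_iff_neq_zero)
  then obtain y where "x = y + 1" by (metis add.commute le_iff_add)
  then show ?thesis using that by blast
qed (use that in blast)

subsection \<open>Pairs\<close>

lemma (in arith) pair_less_of_sum_less:
  assumes "a + b < c + d" shows "(a + b) * (a + b) + a < (c + d) * (c + d) + c"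
proof -
  have "(a + b) * (a + b) + a \<le> (a + b) * (a + b) + (a + b)" by (simp add: add_left_mono)
  also have "\<dots> < (a + b) * (a + b) + (a + b) + (a + b + 1)"
    using add_strict_left_mono[of 0 "a + b + 1" "(a + b) * (a + b) + (a + b)"] by (simp add: add_nonneg_pos)
  also have "\<dots> = (a + b + 1) * (a + b + 1)" by (simp add: algebra_simps)
  also have "\<dots> \<le> (c + d) * (c + d)"
    using less_imp_add1_le[OF assms] by (intro mult_mono) auto
  also have "\<dots> \<le> (c + d) * (c + d) + c" by simp
  finally show ?thesis .
qed

lemma (in arith) pair_inject:
  assumes eq: "(a + b) * (a + b) + a = (c + d) * (c + d) + c" shows "a = c \<and> b = d"
proof -
  have "a + b = c + d"
  proof (rule linorder_cases[of "a + b" "c + d"])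
    assume "a + b < c + d" from pair_less_of_sum_less[OF this] show ?thesis unfolding eq by simp
  next
    assume "c + d < a + b" from pair_less_of_sum_less[OF this] show ?thesis unfolding eq by simp
  qed
  then show ?thesis using eq by simp
qed

lemma (in arith) pair_ge: "b \<le> (a + b) * (a + b) + a"
proof (cases "b = 0")
  case False
  then have "0 < a + b" by (simp add: add_nonneg_pos zero_less_iff_neq_zero)
  then have "1 \<le> a + b" using less_imp_add1_le[of 0 "a + b"] by simp
  then have "(a + b) * 1 \<le> (a + b) * (a + b)" by (rule mult_left_mono) simp
  then have "a + b \<le> (a + b) * (a + b)" by simp
  moreover have "b \<le> a + b" by simp
  moreover have "(a + b) * (a + b) \<le> (a + b) * (a + b) + a" by simp
  ultimately show ?thesis by (blast intro: order_trans)
qed simp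

definition pr :: "'a::arith \<Rightarrow> 'a \<Rightarrow> 'a" ("\<langle>_,/ _\<rangle>") where
  "\<langle>a, b\<rangle> = (a + b) * (a + b) + a"

lemma pr_less_of_sum_less: "a + b < c + d \<Longrightarrow> \<langle>a, b\<rangle> < \<langle>c, (d::'a::arith)\<rangle>"
  unfolding pr_def by (rule pair_less_of_sum_less)

lemma pr_inject [simp]: "\<langle>a, b\<rangle> = \<langle>c, d\<rangle> \<longleftrightarrow> a = c \<and> (b::'a::arith) = d"
  unfolding pr_def using pair_inject[of a b c d] by auto

text \<open>The pairing is not surjective. With the default 0 both projections never exceed their
  argument, and 0, the pair of two zeros, is still split correctly.\<close>

definition fs :: "'a::arith \<Rightarrow> 'a" where
  "fs z = (if \<exists>a b. z = \<langle>a, b\<rangle> then THE a. \<exists>b. z = \<langle>a, b\<rangle> else 0)"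

definition sn :: "'a::arith \<Rightarrow> 'a" where
  "sn z = (if \<exists>a b. z = \<langle>a, b\<rangle> then THE b. \<exists>a. z = \<langle>a, b\<rangle> else 0)"

lemma fs_pr [simp]: "fs \<langle>a, b\<rangle> = (a::'a::arith)"
  unfolding fs_def by auto

lemma sn_pr [simp]: "sn \<langle>a, b\<rangle> = (b::'a::arith)"
  unfolding sn_def by auto

lemma pr_ge1: "a \<le> \<langle>a, (b::'a::arith)\<rangle>"
  unfolding pr_def by (metis add.commute le_iff_add)

lemma pr_ge2: "b \<le> \<langle>a, (b::'a::arith)\<rangle>"
  unfolding pr_def by (rule pair_ge)

lemma pr_mono: "a \<le> a' \<Longrightarrow> b \<le> b' \<Longrightarrow> \<langle>a, b\<rangle> \<le> \<langle>a', (b'::'a::arith)\<rangle>"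
  unfolding pr_def by (intro add_mono mult_mono) auto

lemma pr_0 [simp]: "\<langle>0, 0\<rangle> = (0::'a::arith)"
  by (simp add: pr_def)

lemma pr_collapse_or: "\<langle>fs z, sn z\<rangle> = z \<or> fs z = 0 \<and> sn z = (0::'a::arith)"
  by (cases "\<exists>a b. z = \<langle>a, b\<rangle>") (auto simp: fs_def sn_def)

lemma fs_le: "fs z \<le> (z::'a::arith)"
  by (metis pr_collapse_or pr_ge1 zero_le)

lemma sn_le: "sn z \<le> (z::'a::arith)"
  by (metis pr_collapse_or pr_ge2 zero_le)

section \<open>Elementary functions and polynomial majorants\<close>

inductive elem_fun :: "('a::arith \<Rightarrow> 'a) \<Rightarrow> bool" where
  elem_id: "elem_fun (\<lambda>x. x)"
| elem_const: "elem_fun (\<lambda>x. c)"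
| elem_fs: "elem_fun f \<Longrightarrow> elem_fun (\<lambda>x. fs (f x))"
| elem_sn: "elem_fun f \<Longrightarrow> elem_fun (\<lambda>x. sn (f x))"
| elem_pr: "elem_fun f \<Longrightarrow> elem_fun g \<Longrightarrow> elem_fun (\<lambda>x. \<langle>f x, g x\<rangle>)"
| elem_add: "elem_fun f \<Longrightarrow> elem_fun g \<Longrightarrow> elem_fun (\<lambda>x. f x + g x)"
| elem_mult: "elem_fun f \<Longrightarrow> elem_fun g \<Longrightarrow> elem_fun (\<lambda>x. f x * g x)"

lemmas elem_intros = elem_fun.intros

lemma elem_comp: "elem_fun g \<Longrightarrow> elem_fun f \<Longrightarrow> elem_fun (\<lambda>x. g (f x))"
  by (induction rule: elem_fun.induct) (auto intro: elem_intros)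

text \<open>Unlike \<open>fs\<close> and \<open>sn\<close>, polynomials are monotone. A polynomial
  majorant bounds how much of a set a bounded property can inspect, see
  \<open>Delta0_normal_form\<close>.\<close>

inductive poly_fun :: "('a::arith \<Rightarrow> 'a) \<Rightarrow> bool" where
  poly_id: "poly_fun (\<lambda>x. x)"
| poly_const: "poly_fun (\<lambda>x. c)"
| poly_add: "poly_fun f \<Longrightarrow> poly_fun g \<Longrightarrow> poly_fun (\<lambda>x. f x + g x)"
| poly_mult: "poly_fun f \<Longrightarrow> poly_fun g \<Longrightarrow> poly_fun (\<lambda>x. f x * g x)"

lemma poly_elem: "poly_fun f \<Longrightarrow> elem_fun f"
  by (induction rule: poly_fun.induct) (auto intro: elem_intros)

lemma poly_mono: "poly_fun f \<Longrightarrow> x \<le> y \<Longrightarrow> f x \<le> f y"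
  by (induction rule: poly_fun.induct) (auto intro: add_mono mult_mono)

lemma poly_comp: "poly_fun g \<Longrightarrow> poly_fun f \<Longrightarrow> poly_fun (\<lambda>x. g (f x))"
  by (induction rule: poly_fun.induct) (auto intro: poly_fun.intros)

lemma elem_bound: "elem_fun f \<Longrightarrow> \<exists>h. poly_fun h \<and> (\<forall>x. f x \<le> h x)"
proof (induction rule: elem_fun.induct)
  case (elem_fs f) then show ?case by (meson fs_le order_trans)
next
  case (elem_sn f) then show ?case by (meson sn_le order_trans)
next
  case (elem_pr f g)
  then obtain h k where h: "poly_fun h" "\<forall>x. f x \<le> h x" "poly_fun k" "\<forall>x. g x \<le> k x" by blast
  have "poly_fun (\<lambda>x. \<langle>h x, k x\<rangle>)" unfolding pr_def by (intro poly_fun.intros h)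
  then show ?case using h pr_mono by (intro exI[of _ "\<lambda>x. \<langle>h x, k x\<rangle>"]) blast
next
  case (elem_add f g)
  then obtain h k where "poly_fun h" "\<forall>x. f x \<le> h x" "poly_fun k" "\<forall>x. g x \<le> k x" by blast
  then show ?case by (intro exI[of _ "\<lambda>x. h x + k x"]) (auto intro: poly_fun.intros add_mono)
next
  case (elem_mult f g)
  then obtain h k where "poly_fun h" "\<forall>x. f x \<le> h x" "poly_fun k" "\<forall>x. g x \<le> k x" by blast
  then show ?case by (intro exI[of _ "\<lambda>x. h x * k x"]) (auto intro: poly_fun.intros mult_mono)
qed (use poly_fun.intros in blast)+

subsection \<open>Coded finite sets\<close>

definition elts :: "'a::arith \<Rightarrow> 'a set" where
  "elts c = {x. \<exists>k m n. c = \<langle>k, \<langle>m, n\<rangle>\<rangle> \<and> x < k \<and> m * (x + 1) + 1 dvd n}"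

lemma elts_less: "x \<in> elts c \<Longrightarrow> x < (c::'a::arith)"
  unfolding elts_def using pr_ge1 less_le_trans by blast

lemma elts_pr [simp]: "elts \<langle>k, \<langle>m, n\<rangle>\<rangle> = {x. x < (k::'a::arith) \<and> m * (x + 1) + 1 dvd n}"
  by (auto simp: elts_def)

text \<open>The quotient that witnesses divisibility is at most the multiple, so membership in a
  coded set is a bounded property.\<close>

lemma elts_iff:
  "x \<in> elts c \<longleftrightarrow> c = \<langle>fs c, \<langle>fs (sn c), sn (sn c)\<rangle>\<rangle> \<and> x < fs c \<and>
     (\<exists>q<sn (sn c) + 1. q * (fs (sn c) * (x + 1) + 1) = sn (sn (c::'a::arith)))" (is "?L \<longleftrightarrow> ?R")
proof
  assume ?L
  then obtain k m n where c: "c = \<langle>k, \<langle>m, n\<rangle>\<rangle>" "x < k" and d: "m * (x + 1) + 1 dvd n" by (auto simp: elts_def)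
  from d obtain q where q: "n = (m * (x + 1) + 1) * q" ..
  then have "n = q + m * (x + 1) * q" by (simp add: algebra_simps)
  then have "q \<le> n" by (metis le_iff_add)
  then show ?R using c q by (auto simp: less_add1_iff mult.commute intro!: exI[of _ q])
next
  assume ?R then show ?L unfolding elts_def by (metis (mono_tags, lifting) dvd_triv_right mem_Collect_eq)
qed

text \<open>The moduli of a common multiple of \<^term>\<open>{1..k}\<close> are pairwise coprime.\<close>

lemma modulus_dvd_mult:
  fixes m :: "'a::arith"
  assumes m: "\<forall>i. 0 < i \<and> i \<le> k \<longrightarrow> i dvd m" and ij: "i \<noteq> j" "i < k" "j < k"
    and d: "m * (i + 1) + 1 dvd (m * (j + 1) + 1) * y"
  shows "m * (i + 1) + 1 dvd y"
proof -
  let ?p = "m * (i + 1) + 1" and ?q = "m * (j + 1) + 1"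
  obtain e where e: "e dvd m" "?p dvd e * y"
  proof (cases "i < j")
    case True
    then obtain e where j: "j = i + e" and e: "0 < e" by (metis add.right_neutral add_less_cancel_left le_iff_add less_imp_le)
    have ek: "e \<le> k" using j ij by (metis add.commute le_iff_add less_imp_le order_trans)
    have "?q * y * (i + 1) + e * y = ?p * (y * (j + 1))"
      unfolding j by (simp add: algebra_simps)
    then have "?p dvd ?q * y * (i + 1) + e * y" by simp
    moreover have "?p dvd ?q * y * (i + 1)" using d by (rule dvd_mult2)
    ultimately have "?p dvd e * y" by (simp only: dvd_add_right_iff)
    then show ?thesis using that[of e] m e ek by blast
  next
    case False
    then obtain e where i: "i = j + e" and e: "0 < e"
      using ij by (metis add.right_neutral le_iff_add not_less zero_less_iff_neq_zero)
    have ek: "e \<le> k" using i ij by (metis add.commute le_iff_add less_imp_le order_trans)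
    have "?q * y * (i + 1) = e * y + ?p * (y * (j + 1))"
      unfolding i by (simp add: algebra_simps)
    then have "?p dvd e * y + ?p * (y * (j + 1))" using d using dvd_mult2[OF d, of "i + 1"] by (simp only:)
    then have "?p dvd e * y" by (simp only: dvd_add_left_iff dvd_triv_left)
    then show ?thesis using that[of e] m e ek by blast
  qed
  have "e * y dvd m * y" using e(1) by (rule mult_dvd_mono) simp
  with e(2) have "?p dvd m * y" by (rule dvd_trans)
  then have "?p dvd m * y * (i + 1)" by (rule dvd_mult2)
  moreover have "?p * y = m * y * (i + 1) + y" by (simp add: algebra_simps)
  then have "?p dvd m * y * (i + 1) + y" by (metis dvd_triv_left)
  ultimately show ?thesis by (simp only: dvd_add_right_iff)
qed

section \<open>Classes of sets closed under definability\<close>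

definition dec :: "'a::arith set set \<Rightarrow> ('a \<Rightarrow> bool) \<Rightarrow> bool" where
  "dec S P \<longleftrightarrow> Collect P \<in> S"

definition lst :: "('a::arith \<Rightarrow> bool) \<Rightarrow> 'a" where
  "lst P = (THE y. P y \<and> (\<forall>z<y. \<not> P z))"

lemma lst_eqI: "P y \<Longrightarrow> (\<And>z. z < y \<Longrightarrow> \<not> P z) \<Longrightarrow> lst P = y"
  unfolding lst_def by (rule the_equality) (auto intro: antisym_conv3[THEN iffD1])

text \<open>The least code is taken because this is what \<open>finset_code\<close> demands of the
  code of a finite set.\<close>

definition cod :: "'a::arith set \<Rightarrow> 'a" where
  "cod F = lst (\<lambda>c. elts c = F)"

definition coded :: "'a::arith set \<Rightarrow> bool" where
  "coded F \<longleftrightarrow> (\<exists>c. elts c = F)"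

definition str :: "'a::arith set \<Rightarrow> 'a \<Rightarrow> 'a" where
  "str X m = \<langle>m, cod {x. x < m \<and> x \<in> X}\<rangle>"

definition cm :: "'a::arith \<Rightarrow> 'a" where
  "cm k = lst (\<lambda>m. 0 < m \<and> (\<forall>i\<le>k. 0 < i \<longrightarrow> (\<exists>q\<le>m. m = i * q)))"

definition cp :: "'a::arith \<Rightarrow> 'a" where
  "cp k = lst (\<lambda>N. 0 < N \<and> (\<forall>i<k. \<exists>q\<le>N. N = (cm k * (i + 1) + 1) * q))"

text \<open>A substitute for the power 2^k: it exceeds the least code of every decidable set of
  numbers below k, so quantifiers over subsets of an initial segment become bounded.\<close>

definition pw :: "'a::arith \<Rightarrow> 'a" where
  "pw k = \<langle>k, \<langle>cm k, cp k\<rangle>\<rangle> + 1"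

text \<open>The rank of \<^term>\<open>{x. x < k \<and> P x}\<close> is the least common multiple of its moduli.
  It is strictly monotone with respect to inclusion.\<close>

definition rk :: "'a::arith \<Rightarrow> ('a \<Rightarrow> bool) \<Rightarrow> 'a" where
  "rk k P = lst (\<lambda>n. 0 < n \<and> (\<forall>i<k. P i \<longrightarrow> (\<exists>q\<le>n. n = (cm k * (i + 1) + 1) * q)))"

text \<open>\<open>d0\<close> collects closure rules whose terms are elementary functions, valid in
  every \<open>delta0_class\<close>; those in \<open>dc\<close> admit arbitrary recursive functions
  as terms, which takes Delta_1 comprehension.\<close>

named_theorems d0 and dc

text \<open>Sets are unary: several variables are packed into one number by pairing, and parameters
  enter through the constant functions of \<open>elem_fun\<close>. A single rule for bounded
  quantifiers over pairs then covers all cases.\<close>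

locale delta0_class =
  fixes S :: "'a::arith set set"
  assumes compl: "X \<in> S \<Longrightarrow> - X \<in> S"
    and inter: "X \<in> S \<Longrightarrow> Y \<in> S \<Longrightarrow> X \<inter> Y \<in> S"
    and less: "{z. fs z < sn z} \<in> S"
    and eq: "{z. fs z = sn z} \<in> S"
    and pre: "X \<in> S \<Longrightarrow> elem_fun f \<Longrightarrow> {x. f x \<in> X} \<in> S"
    and ball: "X \<in> S \<Longrightarrow> {z. \<forall>y<sn z. \<langle>fs z, y\<rangle> \<in> X} \<in> S"
begin

lemma d0_not [d0, dc]: "dec S P \<Longrightarrow> dec S (\<lambda>x. \<not> P x)"
  unfolding dec_def using compl by (simp add: Collect_neg_eq)

lemma d0_conj [d0, dc]: "dec S P \<Longrightarrow> dec S Q \<Longrightarrow> dec S (\<lambda>x. P x \<and> Q x)"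
  unfolding dec_def using inter by (simp add: Collect_conj_eq)

lemma d0_disj [d0, dc]:
  assumes "dec S P" "dec S Q" shows "dec S (\<lambda>x. P x \<or> Q x)"
proof -
  have "dec S (\<lambda>x. \<not> (\<not> P x \<and> \<not> Q x))" by (intro d0_not d0_conj assms)
  then show ?thesis by simp
qed

lemma d0_imp [d0, dc]:
  assumes "dec S P" "dec S Q" shows "dec S (\<lambda>x. P x \<longrightarrow> Q x)"
  using d0_disj[OF d0_not[OF assms(1)] assms(2)] by simp

lemma d0_iff [d0, dc]:
  assumes "dec S P" "dec S Q" shows "dec S (\<lambda>x. P x \<longleftrightarrow> Q x)"
proof -
  have "(\<lambda>x. P x \<longleftrightarrow> Q x) = (\<lambda>x. (P x \<longrightarrow> Q x) \<and> (Q x \<longrightarrow> P x))" by blast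
  then show ?thesis using d0_conj[OF d0_imp[OF assms] d0_imp[OF assms(2,1)]] by (simp only:)
qed

lemma d0_elem: "dec S P \<Longrightarrow> elem_fun f \<Longrightarrow> dec S (\<lambda>x. P (f x))"
  unfolding dec_def using pre[of "Collect P" f] by simp

lemma d0_mem [d0]: "X \<in> S \<Longrightarrow> elem_fun f \<Longrightarrow> dec S (\<lambda>x. f x \<in> X)"
  unfolding dec_def by (rule pre)

lemma d0_less [d0]: "elem_fun f \<Longrightarrow> elem_fun g \<Longrightarrow> dec S (\<lambda>x. f x < g x)"
  using d0_elem[of "\<lambda>z. fs z < sn z", OF _ elem_pr[of f g]] less by (simp add: dec_def)

lemma d0_eq [d0]: "elem_fun f \<Longrightarrow> elem_fun g \<Longrightarrow> dec S (\<lambda>x. f x = g x)"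
  using d0_elem[of "\<lambda>z. fs z = sn z", OF _ elem_pr[of f g]] eq by (simp add: dec_def)

lemma d0_le [d0]: "elem_fun f \<Longrightarrow> elem_fun g \<Longrightarrow> dec S (\<lambda>x. f x \<le> g x)"
  using d0_not[OF d0_less[of g f]] by (simp add: not_less)

lemma d0_const [d0, dc]: "dec S (\<lambda>x. c)"
  by (cases c) (use d0_eq[OF elem_id elem_id] d0_not[OF d0_eq[OF elem_id elem_id]] in simp_all)

lemma d0_ball [d0]:
  assumes "dec S (\<lambda>z. P (fs z) (sn z))" "elem_fun f"
  shows "dec S (\<lambda>x. \<forall>y<f x. P x y)"
proof -
  have "dec S (\<lambda>z. \<forall>y<sn z. P (fs z) y)" using ball[of "{z. P (fs z) (sn z)}"] assms(1) by (simp add: dec_def)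
  from d0_elem[OF this elem_pr[OF elem_id assms(2)]] show ?thesis by simp
qed

lemma d0_bex [d0]:
  assumes "dec S (\<lambda>z. P (fs z) (sn z))" "elem_fun f"
  shows "dec S (\<lambda>x. \<exists>y<f x. P x y)"
  using d0_not[OF d0_ball[of "\<lambda>x y. \<not> P x y", OF d0_not[OF assms(1)] assms(2)]] by simp

lemma d0_elts [d0]: "elem_fun f \<Longrightarrow> elem_fun g \<Longrightarrow> dec S (\<lambda>x. f x \<in> elts (g x))"
proof -
  have "dec S (\<lambda>v. fs v \<in> elts (sn v))"
    unfolding elts_iff by (intro d0 d0_eq d0_less d0_bex elem_intros)
  from d0_elem[OF this, of "\<lambda>x. \<langle>f x, g x\<rangle>"] show "elem_fun f \<Longrightarrow> elem_fun g \<Longrightarrow> ?thesis" by (simp add: elem_intros)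
qed

end

inductive_set Delta0 :: "'a::arith set set \<Rightarrow> 'a set set" for X where
  Delta0_base: "Y \<in> X \<Longrightarrow> Y \<in> Delta0 X"
| Delta0_compl: "Y \<in> Delta0 X \<Longrightarrow> - Y \<in> Delta0 X"
| Delta0_inter: "Y \<in> Delta0 X \<Longrightarrow> Z \<in> Delta0 X \<Longrightarrow> Y \<inter> Z \<in> Delta0 X"
| Delta0_less: "{z. fs z < sn z} \<in> Delta0 X"
| Delta0_eq: "{z. fs z = sn z} \<in> Delta0 X"
| Delta0_pre: "Y \<in> Delta0 X \<Longrightarrow> elem_fun f \<Longrightarrow> {x. f x \<in> Y} \<in> Delta0 X"
| Delta0_ball: "Y \<in> Delta0 X \<Longrightarrow> {z. \<forall>y<sn z. \<langle>fs z, y\<rangle> \<in> Y} \<in> Delta0 X"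

interpretation Delta0: delta0_class "Delta0 X" for X
  by unfold_locales (rule Delta0.intros; assumption)+

lemma (in delta0_class) Delta0_subset: "X \<subseteq> S \<Longrightarrow> Delta0 X \<subseteq> S"
proof
  fix Y assume "X \<subseteq> S" "Y \<in> Delta0 X"
  from this(2,1) show "Y \<in> S"
    by (induction rule: Delta0.induct) (auto intro: compl inter less eq pre ball)
qed

definition rec :: "'a::arith set set \<Rightarrow> ('a \<Rightarrow> 'a) \<Rightarrow> bool" where
  "rec S f \<longleftrightarrow> dec S (\<lambda>z. sn z = f (fs z))"

locale delta1_class = delta0_class +
  assumes delta1: "X \<in> S \<Longrightarrow> Y \<in> S \<Longrightarrow> (\<And>x. (\<exists>y. \<langle>x, y\<rangle> \<in> X) \<longleftrightarrow> \<not> (\<exists>y. \<langle>x, y\<rangle> \<in> Y)) \<Longrightarrow> {x. \<exists>y. \<langle>x, y\<rangle> \<in> X} \<in> S"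
begin

lemma dec_delta1:
  assumes "dec S (\<lambda>z. P (fs z) (sn z))" "dec S (\<lambda>z. Q (fs z) (sn z))" "\<And>x. (\<exists>y. P x y) \<longleftrightarrow> \<not> (\<exists>y. Q x y)"
  shows "dec S (\<lambda>x. \<exists>y. P x y)"
  using delta1[of "{z. P (fs z) (sn z)}" "{z. Q (fs z) (sn z)}"] assms by (simp add: dec_def)

text \<open>\<open>P (f x)\<close> amounts to \<open>\<exists>y. y = f x \<and> P y\<close>, and
  also to the negation of the same with \<open>\<not> P y\<close>, so Delta_1 comprehension
  applies.\<close>

lemma dec_comp:
  assumes P: "dec S P" and f: "rec S f"
  shows "dec S (\<lambda>x. P (f x))"
proof -
  have "dec S (\<lambda>x. \<exists>y. y = f x \<and> P y)"
  proof (rule dec_delta1[where Q = "\<lambda>x y. y = f x \<and> \<not> P y"])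
    show "dec S (\<lambda>z. sn z = f (fs z) \<and> P (sn z))" "dec S (\<lambda>z. sn z = f (fs z) \<and> \<not> P (sn z))"
      using f[unfolded rec_def] P by (auto intro!: d0 d0_elem[of P] elem_intros)
  qed auto
  then show ?thesis by simp
qed

lemma rec_elem:
  assumes "elem_fun f" shows "rec S f"
  unfolding rec_def by (rule d0_eq[OF elem_sn[OF elem_id] elem_comp[OF assms elem_fs[OF elem_id]]])

lemma rec_pr [dc]:
  assumes "rec S f" "rec S g" shows "rec S (\<lambda>x. \<langle>f x, g x\<rangle>)"
proof -
  have "dec S (\<lambda>z. sn z = \<langle>fs (sn z), sn (sn z)\<rangle>)" by (intro d0_eq elem_intros)
  moreover have "dec S (\<lambda>z. fs (sn z) = f (fs z))"
    using d0_elem[of "\<lambda>z. sn z = f (fs z)" "\<lambda>z. \<langle>fs z, fs (sn z)\<rangle>"] assms by (simp add: rec_def elem_intros)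
  moreover have "dec S (\<lambda>z. sn (sn z) = g (fs z))"
    using d0_elem[of "\<lambda>z. sn z = g (fs z)" "\<lambda>z. \<langle>fs z, sn (sn z)\<rangle>"] assms by (simp add: rec_def elem_intros)
  ultimately have "dec S (\<lambda>z. sn z = \<langle>fs (sn z), sn (sn z)\<rangle> \<and> fs (sn z) = f (fs z) \<and> sn (sn z) = g (fs z))"
    by (intro d0_conj)
  moreover have "(sn z = \<langle>fs (sn z), sn (sn z)\<rangle> \<and> fs (sn z) = f (fs z) \<and> sn (sn z) = g (fs z)) \<longleftrightarrow>
      sn z = \<langle>f (fs z), g (fs z)\<rangle>" for z by (metis fs_pr sn_pr)
  ultimately show ?thesis by (simp add: rec_def)
qed

lemma rec_comp:
  assumes g: "rec S g" and f: "rec S f" shows "rec S (\<lambda>x. g (f x))"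
proof -
  have "rec S (\<lambda>z. f (fs z))" unfolding rec_def
    using d0_elem[of "\<lambda>z. sn z = f (fs z)" "\<lambda>z. \<langle>fs (fs z), sn z\<rangle>"] f by (simp add: rec_def elem_intros)
  then have "rec S (\<lambda>z. \<langle>f (fs z), sn z\<rangle>)" by (rule rec_pr) (intro rec_elem elem_intros)
  from dec_comp[OF g[unfolded rec_def] this] show ?thesis by (simp add: rec_def)
qed

lemma rec_id [dc]: "rec S (\<lambda>x. x)" by (intro rec_elem elem_intros)
lemma rec_const [dc]: "rec S (\<lambda>x. c)" by (intro rec_elem elem_intros)
lemma rec_fs [dc]: "rec S f \<Longrightarrow> rec S (\<lambda>x. fs (f x))" by (erule rec_comp[rotated]) (intro rec_elem elem_intros)
lemma rec_sn [dc]: "rec S f \<Longrightarrow> rec S (\<lambda>x. sn (f x))" by (erule rec_comp[rotated]) (intro rec_elem elem_intros)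

lemma rec_comp2:
  assumes "rec S (\<lambda>z. h (fs z) (sn z))" "rec S f" "rec S g" shows "rec S (\<lambda>x. h (f x) (g x))"
  using rec_comp[OF assms(1) rec_pr[OF assms(2,3)]] by simp

lemma dec_comp2:
  assumes "dec S (\<lambda>z. P (fs z) (sn z))" "rec S f" "rec S g" shows "dec S (\<lambda>x. P (f x) (g x))"
  using dec_comp[OF assms(1) rec_pr[OF assms(2,3)]] by simp

lemma rec_add [dc]: "rec S f \<Longrightarrow> rec S g \<Longrightarrow> rec S (\<lambda>x. f x + g x)"
  by (rule rec_comp2[of "\<lambda>x y. x + y"]) (intro rec_elem elem_intros)
lemma rec_mult [dc]: "rec S f \<Longrightarrow> rec S g \<Longrightarrow> rec S (\<lambda>x. f x * g x)"
  by (rule rec_comp2[of "\<lambda>x y. x * y"]) (intro rec_elem elem_intros)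

lemma dec_less [dc]: "rec S f \<Longrightarrow> rec S g \<Longrightarrow> dec S (\<lambda>x. f x < g x)"
  by (rule dec_comp2[of "\<lambda>x y. x < y"]) (intro d0_less elem_intros)
lemma dec_eq [dc]: "rec S f \<Longrightarrow> rec S g \<Longrightarrow> dec S (\<lambda>x. f x = g x)"
  by (rule dec_comp2[of "\<lambda>x y. x = y"]) (intro d0_eq elem_intros)
lemma dec_le [dc]: "rec S f \<Longrightarrow> rec S g \<Longrightarrow> dec S (\<lambda>x. f x \<le> g x)"
  by (rule dec_comp2[of "\<lambda>x y. x \<le> y"]) (intro d0_le elem_intros)
lemma dec_elts [dc]: "rec S f \<Longrightarrow> rec S g \<Longrightarrow> dec S (\<lambda>x. f x \<in> elts (g x))"
  by (rule dec_comp2[of "\<lambda>x y. x \<in> elts y"]) (intro d0_elts elem_intros)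
lemma dec_mem [dc]: "X \<in> S \<Longrightarrow> rec S f \<Longrightarrow> dec S (\<lambda>x. f x \<in> X)"
  by (rule dec_comp[of "\<lambda>x. x \<in> X"]) (simp_all add: dec_def)

lemma dec_all_less [dc]:
  assumes "dec S (\<lambda>z. P (fs z) (sn z))" "rec S f" shows "dec S (\<lambda>x. \<forall>y<f x. P x y)"
  using dec_comp2[of "\<lambda>x b. \<forall>y<b. P x y", OF _ rec_id assms(2)] ball[of "{z. P (fs z) (sn z)}"] assms(1)
  by (simp add: dec_def)

lemma dec_ex_less [dc]:
  assumes "dec S (\<lambda>z. P (fs z) (sn z))" "rec S f" shows "dec S (\<lambda>x. \<exists>y<f x. P x y)"
  using d0_not[OF dec_all_less[of "\<lambda>x y. \<not> P x y", OF d0_not[OF assms(1)] assms(2)]] by simp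

lemma dec_all_le [dc]:
  assumes "dec S (\<lambda>z. P (fs z) (sn z))" "rec S f" shows "dec S (\<lambda>x. \<forall>y\<le>f x. P x y)"
  using dec_all_less[OF assms(1), of "\<lambda>x. f x + 1"] assms(2) by (simp add: less_add1_iff dc)

lemma dec_ex_le [dc]:
  assumes "dec S (\<lambda>z. P (fs z) (sn z))" "rec S f" shows "dec S (\<lambda>x. \<exists>y\<le>f x. P x y)"
  using dec_ex_less[OF assms(1), of "\<lambda>x. f x + 1"] assms(2) by (simp add: less_add1_iff dc)

lemma dec_Ball_elts [dc]:
  assumes "dec S (\<lambda>z. P (fs z) (sn z))" "rec S f" shows "dec S (\<lambda>x. \<forall>y\<in>elts (f x). P x y)"
proof -
  have "dec S (\<lambda>x. \<forall>y<f x. y \<in> elts (f x) \<longrightarrow> P x y)"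
    by (intro dc assms rec_comp[OF assms(2)])
  moreover have "(\<forall>y<f x. y \<in> elts (f x) \<longrightarrow> P x y) \<longleftrightarrow> (\<forall>y\<in>elts (f x). P x y)" for x using elts_less by blast
  ultimately show ?thesis by simp
qed

lemma dec_Bex_elts [dc]:
  assumes "dec S (\<lambda>z. P (fs z) (sn z))" "rec S f" shows "dec S (\<lambda>x. \<exists>y\<in>elts (f x). P x y)"
  using d0_not[OF dec_Ball_elts[of "\<lambda>x y. \<not> P x y", OF d0_not[OF assms(1)] assms(2)]] by simp

lemma dec_set: "dec S P \<Longrightarrow> Collect P \<in> S" by (simp add: dec_def)

lemma set_dec: "X \<in> S \<Longrightarrow> dec S (\<lambda>x. x \<in> X)" by (simp add: dec_def)

lemma rec_if [dc]: "dec S P \<Longrightarrow> rec S f \<Longrightarrow> rec S g \<Longrightarrow> rec S (\<lambda>x. if P x then f x else g x)"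
proof -
  assume *: "dec S P" "rec S f" "rec S g"
  have "dec S (\<lambda>z. (P (fs z) \<and> sn z = f (fs z)) \<or> (\<not> P (fs z) \<and> sn z = g (fs z)))"
    using *(2,3) by (intro d0_disj d0_conj d0_not dec_comp[OF *(1)] rec_fs rec_id) (simp_all add: rec_def)
  moreover have "((P (fs z) \<and> sn z = f (fs z)) \<or> (\<not> P (fs z) \<and> sn z = g (fs z))) \<longleftrightarrow>
     sn z = (if P (fs z) then f (fs z) else g (fs z))" for z by auto
  ultimately show ?thesis by (simp add: rec_def)
qed

end

text \<open>This is what the sets of the model and the Delta_2 sets collected in \<open>T\<close>
  have in common: Delta_1 comprehension, collection and least elements, but no Sigma_1
  induction.\<close>

locale collection_class = delta1_class +
  assumes collection: "X \<in> S \<Longrightarrow> (\<And>x. x < a \<Longrightarrow> \<exists>y. \<langle>x, y\<rangle> \<in> X) \<Longrightarrow> \<exists>b. \<forall>x<a. \<exists>y<b. \<langle>x, y\<rangle> \<in> X"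
    and least: "X \<in> S \<Longrightarrow> x \<in> X \<Longrightarrow> \<exists>y\<in>X. \<forall>z<y. z \<notin> X"
begin

lemma dec_collection:
  assumes "dec S (\<lambda>z. P (fs z) (sn z))" "\<And>x. x < a \<Longrightarrow> \<exists>y. P x y"
  shows "\<exists>b. \<forall>x<a. \<exists>y<b. P x y"
  using collection[of "{z. P (fs z) (sn z)}" a] assms by (simp add: dec_def)

lemma dec_least:
  assumes "dec S P" "P x" obtains y where "P y" "\<And>z. z < y \<Longrightarrow> \<not> P z" "y \<le> x"
  using least[of "Collect P" x] assms by (auto simp: dec_def) (meson not_less)

lemma dec_induct:
  assumes P: "dec S P" and 0: "P 0" and Suc: "\<And>x. P x \<Longrightarrow> P (x + 1)"
  shows "P x"
proof (rule ccontr)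
  assume "\<not> P x"
  from dec_least[OF d0_not[OF P] this] obtain y where y: "\<not> P y" "\<And>z. z < y \<Longrightarrow> P z" by (metis (full_types))
  show False
    by (cases y rule: arith_cases) (use y 0 Suc less_add_one in metis)+
qed

lemma dec_greatest:
  assumes P: "dec S P" and x: "P x" "\<And>y. P y \<Longrightarrow> y \<le> b"
  obtains y where "P y" "\<And>z. P z \<Longrightarrow> z \<le> y"
proof -
  have "dec S (\<lambda>v. \<forall>y\<le>b. P y \<longrightarrow> y \<le> v)" by (intro dc dec_comp[OF P])
  then obtain v where v: "\<forall>y\<le>b. P y \<longrightarrow> y \<le> v"
    and least: "\<And>w. w < v \<Longrightarrow> \<not> (\<forall>y\<le>b. P y \<longrightarrow> y \<le> w)" by (rule dec_least[of _ b]) blast+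
  have le: "z \<le> v" if "P z" for z using v x(2) that by blast
  have "P v"
  proof (rule ccontr)
    assume "\<not> P v"
    then have lt: "z < v" if "P z" for z using le that by (metis order_le_less)
    then obtain w where w: "v = w + 1" using x(1) by (metis arith_cases not_less_zero)
    then have "z \<le> w" if "P z" for z using lt that less_add1_iff by blast
    then show False using least[of w] w less_add_one by blast
  qed
  then show ?thesis using that le by blast
qed

text \<open>A bounded nonempty decidable set has a greatest element, which \<open>step\<close>
  contradicts. This takes the place of iteration: an increasing process passes every bound although
  its steps are not counted.\<close>

lemma dec_unbounded:
  assumes P: "dec S P" and x: "P x" and step: "\<And>x. P x \<Longrightarrow> \<exists>y>x. P y"
  shows "\<exists>y>b. P y"
proof (rule ccontr)
  assume "\<not> ?thesis"
  then have "y \<le> b" if "P y" for y using that by (meson not_le)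
  from dec_greatest[OF P x this] step show False by (metis leD)
qed

lemma lst_props:
  assumes "dec S P" "P x" shows "P (lst P)" "\<And>z. z < lst P \<Longrightarrow> \<not> P z" "lst P \<le> x"
proof -
  obtain y where y: "P y" "\<And>z. z < y \<Longrightarrow> \<not> P z" "y \<le> x" using dec_least[OF assms] by metis
  then have "lst P = y" by (intro lst_eqI)
  then show "P (lst P)" "\<And>z. z < lst P \<Longrightarrow> \<not> P z" "lst P \<le> x" using y by auto
qed

lemma rec_lst [dc]:
  assumes P: "dec S (\<lambda>z. P (fs z) (sn z))" and ex: "\<And>x. \<exists>y. P x y"
  shows "rec S (\<lambda>x. lst (P x))"
proof -
  have Px: "dec S (P x)" for x using dec_comp2[OF P rec_const rec_id, of x] by simp
  have "dec S (\<lambda>z. P (fs z) (sn z) \<and> (\<forall>y<sn z. \<not> P (fs z) y))"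
    by (intro dc P dec_comp2[OF P])
  moreover have "(P (fs z) (sn z) \<and> (\<forall>y<sn z. \<not> P (fs z) y)) \<longleftrightarrow> sn z = lst (P (fs z))" for z
    using lst_props[OF Px] ex[of "fs z"] lst_eqI[of "P (fs z)" "sn z"] by metis
  ultimately show ?thesis by (simp add: rec_def)
qed

lemma elts_cod: "coded (F :: 'a set) \<Longrightarrow> elts (cod F) = F"
proof -
  assume "coded F"
  then obtain c where c: "elts c = F" by (auto simp: coded_def)
  have "dec S (\<lambda>d. (\<forall>x\<in>elts d. x \<in> elts c) \<and> (\<forall>x\<in>elts c. x \<in> elts d))" by (intro dc)
  moreover have "(\<lambda>d. (\<forall>x\<in>elts d. x \<in> elts c) \<and> (\<forall>x\<in>elts c. x \<in> elts d)) = (\<lambda>d. elts d = F)" using c by auto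
  ultimately show ?thesis using lst_props(1)[of "\<lambda>d. elts d = F" c] c unfolding cod_def by simp
qed

lemma dvd_bounded: "0 < i \<Longrightarrow> i dvd m \<longleftrightarrow> (\<exists>q\<le>m. m = i * q)" for i m :: 'a
proof
  assume "0 < i" "i dvd m"
  then obtain q where q: "m = i * q" by blast
  have "1 * q \<le> i * q" using \<open>0 < i\<close> by (intro mult_right_mono) (auto simp: one_le_iff)
  then show "\<exists>q\<le>m. m = i * q" using q by auto
qed auto

lemma dvd_bounded1: "m * (i + 1) + 1 dvd N \<longleftrightarrow> (\<exists>q\<le>N. N = (m * (i + 1) + 1) * q)" for i m N :: 'a
  by (rule dvd_bounded) (simp add: add_nonneg_pos)

lemma rec_cm [dc]: "rec S f \<Longrightarrow> rec S (\<lambda>x. cm (f x))"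
proof (erule rec_comp[rotated])
  have "\<exists>m. 0 < m \<and> (\<forall>i\<le>k. 0 < i \<longrightarrow> (\<exists>q\<le>m. m = i * q))" for k :: 'a
    using common_multiple_ex[of k] by (metis dvd_bounded)
  then show "rec S cm" unfolding cm_def[abs_def] by (intro dc)
qed

lemma cm_props:
  fixes k :: 'a shows "0 < cm k" "0 < i \<Longrightarrow> i \<le> k \<Longrightarrow> i dvd cm k"
proof -
  have "dec S (\<lambda>m. 0 < m \<and> (\<forall>i\<le>k. 0 < i \<longrightarrow> (\<exists>q\<le>m. m = i * q)))" by (intro dc)
  moreover obtain m where "0 < m" "\<forall>i. 0 < i \<and> i \<le> k \<longrightarrow> i dvd m" using common_multiple_ex[of k] by blast
  then have "0 < m \<and> (\<forall>i\<le>k. 0 < i \<longrightarrow> (\<exists>q\<le>m. m = i * q))" by (metis dvd_bounded)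
  ultimately have "0 < cm k \<and> (\<forall>i\<le>k. 0 < i \<longrightarrow> (\<exists>q\<le>cm k. cm k = i * q))"
    unfolding cm_def by (rule lst_props(1))
  then show "0 < cm k" "0 < i \<Longrightarrow> i \<le> k \<Longrightarrow> i dvd cm k" using dvd_bounded by blast+
qed

lemma rec_cp [dc]: "rec S f \<Longrightarrow> rec S (\<lambda>x. cp (f x))"
proof (erule rec_comp[rotated])
  have "\<exists>N. 0 < N \<and> (\<forall>i<k. \<exists>q\<le>N. N = (cm k * (i + 1) + 1) * q)" for k :: 'a
    using product_ex[of k "cm k"] by (simp only: dvd_bounded1)
  then show "rec S cp" unfolding cp_def[abs_def] by (intro dc)
qed

lemma cp_props:
  fixes k :: 'a shows "0 < cp k" "i < k \<Longrightarrow> cm k * (i + 1) + 1 dvd cp k"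
proof -
  have "dec S (\<lambda>N. 0 < N \<and> (\<forall>i<k. \<exists>q\<le>N. N = (cm k * (i + 1) + 1) * q))" by (intro dc)
  moreover obtain N where "0 < N" "\<forall>i<k. cm k * (i + 1) + 1 dvd N" using product_ex[of k "cm k"] by blast
  then have "0 < N \<and> (\<forall>i<k. \<exists>q\<le>N. N = (cm k * (i + 1) + 1) * q)" unfolding dvd_bounded1 by simp
  ultimately have "0 < cp k \<and> (\<forall>i<k. \<exists>q\<le>cp k. cp k = (cm k * (i + 1) + 1) * q)"
    unfolding cp_def by (rule lst_props(1))
  then have "0 < cp k \<and> (\<forall>i<k. cm k * (i + 1) + 1 dvd cp k)" unfolding dvd_bounded1 .
  then show "0 < cp k" "i < k \<Longrightarrow> cm k * (i + 1) + 1 dvd cp k" by blast+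
qed

lemma rec_pw [dc]: "rec S f \<Longrightarrow> rec S (\<lambda>x. pw (f x))"
  unfolding pw_def by (intro dc)

lemma rk_props:
  assumes "dec S P"
  shows "0 < rk k P" "i < k \<Longrightarrow> P i \<Longrightarrow> cm k * (i + 1) + 1 dvd rk k P" "rk k P \<le> cp k"
    "0 < n \<Longrightarrow> (\<And>i. i < k \<Longrightarrow> P i \<Longrightarrow> cm k * (i + 1) + 1 dvd n) \<Longrightarrow> rk k P \<le> n"
proof -
  let ?A = "\<lambda>n. 0 < n \<and> (\<forall>i<k. P i \<longrightarrow> (\<exists>q\<le>n. n = (cm k * (i + 1) + 1) * q))"
  have d: "dec S ?A" by (intro dc dec_comp[OF assms])
  have eq: "?A n \<longleftrightarrow> 0 < n \<and> (\<forall>i<k. P i \<longrightarrow> cm k * (i + 1) + 1 dvd n)" for n unfolding dvd_bounded1 ..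
  have *: "?A (cp k)" unfolding eq using cp_props by blast
  show "0 < rk k P" "i < k \<Longrightarrow> P i \<Longrightarrow> cm k * (i + 1) + 1 dvd rk k P"
    using lst_props(1)[OF d *, folded rk_def] unfolding eq by blast+
  show "rk k P \<le> cp k" unfolding rk_def by (rule lst_props(3)[OF d *])
  show "0 < n \<Longrightarrow> (\<And>i. i < k \<Longrightarrow> P i \<Longrightarrow> cm k * (i + 1) + 1 dvd n) \<Longrightarrow> rk k P \<le> n"
    unfolding rk_def by (rule lst_props(3)[OF d]) (unfold eq, blast)
qed

text \<open>The moduli are pairwise coprime. Dividing the rank of Q by the modulus of j, which is
  larger than 1, leaves a multiple of all the moduli for P.\<close>

lemma rk_remove:
  assumes P: "dec S P" and Q: "dec S Q" and j: "j < k" "Q j" "\<not> P j" and sub: "\<And>i. i < k \<Longrightarrow> P i \<Longrightarrow> Q i"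
  shows "rk k P < rk k Q"
proof -
  let ?p = "\<lambda>i. cm k * (i + 1) + 1"
  have pos: "1 < ?p j" using cm_props(1)[of k] by (simp add: add_nonneg_pos)
  obtain q where q: "rk k Q = ?p j * q" using rk_props(2)[OF Q j(1,2)] by blast
  have q0: "0 < q" using rk_props(1)[OF Q, of k] q zero_less_iff_neq_zero by fastforce
  have "?p i dvd q" if "i < k" "P i" for i
  proof (rule modulus_dvd_mult[of k])
    show "\<forall>i. 0 < i \<and> i \<le> k \<longrightarrow> i dvd cm k" using cm_props by blast
    show "?p i dvd ?p j * q" using rk_props(2)[OF Q \<open>i < k\<close>] sub that q by simp
  qed (use that j in auto)
  then have "rk k P \<le> q" using rk_props(4)[OF P q0] by blast
  also have "q < ?p j * q" using mult_strict_right_mono[OF pos q0] by simp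
  finally show ?thesis using q by simp
qed

text \<open>The set is coded by its own rank. No further modulus divides the rank, for otherwise
  adding its index to P would not increase the rank, against \<open>rk_remove\<close>.\<close>

lemma ex_code:
  assumes P: "dec S P" shows "\<exists>c<pw k. elts c = {x. x < k \<and> P x}"
proof (intro exI conjI)
  let ?c = "\<langle>k, \<langle>cm k, rk k P\<rangle>\<rangle>"
  show "?c < pw k" unfolding pw_def less_add1_iff using rk_props(3)[OF P] by (intro pr_mono) auto
  have "P i" if i: "i < k" "cm k * (i + 1) + 1 dvd rk k P" for i
  proof (rule ccontr)
    assume "\<not> P i"
    have d: "dec S (\<lambda>j. P j \<or> j = i)" by (intro dc P)
    have "rk k P < rk k (\<lambda>j. P j \<or> j = i)" using rk_remove[OF P d i(1)] \<open>\<not> P i\<close> by blast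
    moreover have "rk k (\<lambda>j. P j \<or> j = i) \<le> rk k P"
      by (rule rk_props(4)[OF d]) (use rk_props(1,2)[OF P] i in auto)
    ultimately show False by simp
  qed
  then show "elts ?c = {x. x < k \<and> P x}" using rk_props(2)[OF P] by auto
qed

lemma coded_Collect: "dec S P \<Longrightarrow> coded {x. x < k \<and> P x}"
  using ex_code coded_def by blast

lemma cod_less_pw: "dec S P \<Longrightarrow> cod {x. x < k \<and> P x} < pw k"
proof -
  assume P: "dec S P"
  let ?F = "{x. x < k \<and> P x}"
  obtain c where c: "c < pw k" "elts c = ?F" using ex_code[OF P] by blast
  have "dec S (\<lambda>d. (\<forall>x\<in>elts d. x \<in> elts c) \<and> (\<forall>x\<in>elts c. x \<in> elts d))" by (intro dc)
  moreover have "(\<lambda>d. (\<forall>x\<in>elts d. x \<in> elts c) \<and> (\<forall>x\<in>elts c. x \<in> elts d)) = (\<lambda>d. elts d = ?F)" using c by auto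
  ultimately have "cod ?F \<le> c" using lst_props(3)[of "\<lambda>d. elts d = ?F" c] c unfolding cod_def by simp
  then show ?thesis using c by simp
qed

lemma elts_cod_Collect [simp]: "dec S P \<Longrightarrow> elts (cod {x. x < k \<and> P x}) = {x. x < k \<and> P x}"
  using elts_cod coded_Collect by blast

lemma rec_cod [dc]:
  assumes P: "dec S (\<lambda>z. P (fs z) (sn z))" and f: "rec S f"
  shows "rec S (\<lambda>x. cod {y. y < f x \<and> P x y})"
proof -
  have Px: "dec S (P x)" for x using dec_comp2[OF P rec_const rec_id, of x] by simp
  have "dec S (\<lambda>z. (\<forall>y\<in>elts (sn z). y < f (fs z) \<and> P (fs z) y) \<and> (\<forall>y<f (fs z). P (fs z) y \<longrightarrow> y \<in> elts (sn z)))"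
    by (intro dc dec_comp2[OF P] rec_comp[OF f])
  moreover have "(\<lambda>z. (\<forall>y\<in>elts (sn z). y < f (fs z) \<and> P (fs z) y) \<and> (\<forall>y<f (fs z). P (fs z) y \<longrightarrow> y \<in> elts (sn z)))
     = (\<lambda>z. elts (sn z) = {y. y < f (fs z) \<and> P (fs z) y})" by auto
  ultimately have "dec S (\<lambda>z. elts (sn z) = {y. y < f (fs z) \<and> P (fs z) y})" by simp
  from rec_lst[OF this] show ?thesis using ex_code[OF Px] unfolding cod_def by blast
qed

end

section \<open>Delta_1 closure of a class with collection\<close>

definition Sg :: "'a::arith set set \<Rightarrow> ('a \<Rightarrow> bool) \<Rightarrow> bool" where
  "Sg D P \<longleftrightarrow> (\<exists>R\<in>D. \<forall>x. P x \<longleftrightarrow> (\<exists>y. \<langle>x, y\<rangle> \<in> R))"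

definition Delta1 :: "'a::arith set set \<Rightarrow> 'a set set" where
  "Delta1 D = {X. Sg D (\<lambda>x. x \<in> X) \<and> Sg D (\<lambda>x. x \<notin> X)}"

context delta0_class begin

lemma sg_dec: assumes "dec S P" shows "Sg S P"
proof -
  have "dec S (\<lambda>z. P (fs z))" by (rule d0_elem[OF assms]) (intro elem_intros)
  then show ?thesis unfolding Sg_def dec_def by (intro bexI[of _ "{z. P (fs z)}"]) auto
qed

lemma sg_elem: assumes "Sg S P" "elem_fun f" shows "Sg S (\<lambda>x. P (f x))"
proof -
  obtain R where R: "R \<in> S" "\<And>x. P x \<longleftrightarrow> (\<exists>y. \<langle>x, y\<rangle> \<in> R)" using assms(1) unfolding Sg_def by blast
  have "elem_fun (\<lambda>z. f (fs z))" by (rule elem_comp[OF assms(2)]) (intro elem_intros)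
  then have "{z. \<langle>f (fs z), sn z\<rangle> \<in> R} \<in> S" by (intro pre R elem_intros)
  then show ?thesis unfolding Sg_def using R(2) by (intro bexI) auto
qed

lemma sg_ex: assumes "Sg S (\<lambda>z. P (fs z) (sn z))" shows "Sg S (\<lambda>x. \<exists>y. P x y)"
proof -
  obtain R where R: "R \<in> S" "\<And>z. P (fs z) (sn z) \<longleftrightarrow> (\<exists>y. \<langle>z, y\<rangle> \<in> R)" using assms unfolding Sg_def by blast
  have "{z. \<langle>\<langle>fs z, fs (sn z)\<rangle>, sn (sn z)\<rangle> \<in> R} \<in> S" by (intro pre R elem_intros)
  moreover have "(\<exists>y. P x y) \<longleftrightarrow> (\<exists>w. \<langle>\<langle>x, fs w\<rangle>, sn w\<rangle> \<in> R)" for x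
    using R(2)[of "\<langle>x, _\<rangle>"] by (metis fs_pr sn_pr)
  ultimately show ?thesis unfolding Sg_def by (intro bexI) auto
qed

lemma sg_conj: assumes "Sg S P" "Sg S Q" shows "Sg S (\<lambda>x. P x \<and> Q x)"
proof -
  obtain R R' where R: "R \<in> S" "\<And>x. P x \<longleftrightarrow> (\<exists>y. \<langle>x, y\<rangle> \<in> R)" "R' \<in> S" "\<And>x. Q x \<longleftrightarrow> (\<exists>y. \<langle>x, y\<rangle> \<in> R')"
    using assms unfolding Sg_def by blast
  have "{z. \<langle>fs z, fs (sn z)\<rangle> \<in> R} \<inter> {z. \<langle>fs z, sn (sn z)\<rangle> \<in> R'} \<in> S" by (intro inter pre R elem_intros)
  moreover have "P x \<and> Q x \<longleftrightarrow> (\<exists>w. \<langle>x, fs w\<rangle> \<in> R \<and> \<langle>x, sn w\<rangle> \<in> R')" for x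
    unfolding R by (metis fs_pr sn_pr)
  ultimately show ?thesis unfolding Sg_def by (intro bexI) auto
qed

lemma sg_disj: assumes "Sg S P" "Sg S Q" shows "Sg S (\<lambda>x. P x \<or> Q x)"
proof -
  obtain R R' where R: "R \<in> S" "\<And>x. P x \<longleftrightarrow> (\<exists>y. \<langle>x, y\<rangle> \<in> R)" "R' \<in> S" "\<And>x. Q x \<longleftrightarrow> (\<exists>y. \<langle>x, y\<rangle> \<in> R')"
    using assms unfolding Sg_def by blast
  have "dec S (\<lambda>x. x \<in> R \<or> x \<in> R')" by (intro d0_disj) (simp_all add: dec_def R)
  then have "{x. x \<in> R \<or> x \<in> R'} \<in> S" by (simp add: dec_def)
  then show ?thesis unfolding Sg_def using R(2,4) by (intro bexI) auto
qed

end

locale delta0_collection = delta0_class +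
  assumes collection0: "X \<in> S \<Longrightarrow> (\<And>x. x < a \<Longrightarrow> \<exists>y. \<langle>x, y\<rangle> \<in> X) \<Longrightarrow> \<exists>b. \<forall>x<a. \<exists>y<b. \<langle>x, y\<rangle> \<in> X"
    and least0: "X \<in> S \<Longrightarrow> x \<in> X \<Longrightarrow> \<exists>y\<in>X. \<forall>z<y. z \<notin> X"
begin

text \<open>Collection bounds the witnesses for all \<open>y < sn z\<close> at once, so the
  unbounded existential quantifier moves to the front.\<close>

lemma sg_ball: assumes "Sg S (\<lambda>z. P (fs z) (sn z))" shows "Sg S (\<lambda>z. \<forall>y<sn z. P (fs z) y)"
proof -
  obtain R where R: "R \<in> S" "\<And>z. P (fs z) (sn z) \<longleftrightarrow> (\<exists>y. \<langle>z, y\<rangle> \<in> R)" using assms unfolding Sg_def by blast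
  have "dec S (\<lambda>v. \<langle>\<langle>fs (fs (fs v)), sn (fs v)\<rangle>, sn v\<rangle> \<in> R)" by (intro d0_mem R elem_intros)
  then have "dec S (\<lambda>z. \<forall>y<sn (fs z). \<exists>v<sn z. \<langle>\<langle>fs (fs z), y\<rangle>, v\<rangle> \<in> R)"
    by (intro d0_ball d0_bex elem_intros d0_mem R)
  then have in_S: "{z. \<forall>y<sn (fs z). \<exists>v<sn z. \<langle>\<langle>fs (fs z), y\<rangle>, v\<rangle> \<in> R} \<in> S" by (simp add: dec_def)
  have "(\<forall>y<sn x. P (fs x) y) \<longleftrightarrow> (\<exists>b. \<forall>y<sn x. \<exists>v<b. \<langle>\<langle>fs x, y\<rangle>, v\<rangle> \<in> R)" for x
  proof
    assume *: "\<forall>y<sn x. P (fs x) y"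
    have "{z. \<langle>\<langle>fs x, fs z\<rangle>, sn z\<rangle> \<in> R} \<in> S" by (intro pre R elem_intros)
    from collection0[OF this, of "sn x"] show "\<exists>b. \<forall>y<sn x. \<exists>v<b. \<langle>\<langle>fs x, y\<rangle>, v\<rangle> \<in> R"
      using * R(2)[of "\<langle>fs x, _\<rangle>"] by auto
  next
    assume "\<exists>b. \<forall>y<sn x. \<exists>v<b. \<langle>\<langle>fs x, y\<rangle>, v\<rangle> \<in> R"
    then show "\<forall>y<sn x. P (fs x) y" using R(2)[of "\<langle>fs x, _\<rangle>"] by auto
  qed
  then show ?thesis unfolding Sg_def using in_S by (intro bexI) auto
qed

lemma collection_Delta1: "collection_class (Delta1 S)"
proof unfold_locales
  fix X Y assume "X \<in> Delta1 S" "Y \<in> Delta1 S"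
  then have XY: "Sg S (\<lambda>x. x \<in> X)" "Sg S (\<lambda>x. x \<notin> X)" "Sg S (\<lambda>x. x \<in> Y)" "Sg S (\<lambda>x. x \<notin> Y)" by (auto simp: Delta1_def)
  then show "- X \<in> Delta1 S" by (simp add: Delta1_def)
  show "X \<inter> Y \<in> Delta1 S" using sg_conj[OF XY(1,3)] sg_disj[OF XY(2,4)] by (simp add: Delta1_def)
  show "{x. f x \<in> X} \<in> Delta1 S" if "elem_fun f" for f
    using sg_elem[OF XY(1) that] sg_elem[OF XY(2) that] by (simp add: Delta1_def)
  have Xp: "Sg S (\<lambda>z. \<langle>fs z, sn z\<rangle> \<in> X)" "Sg S (\<lambda>z. \<langle>fs z, sn z\<rangle> \<notin> X)"
    using sg_elem[OF XY(1), of "\<lambda>z. \<langle>fs z, sn z\<rangle>"] sg_elem[OF XY(2), of "\<lambda>z. \<langle>fs z, sn z\<rangle>"]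
    by (simp_all add: elem_intros)
  have Yp: "Sg S (\<lambda>z. \<langle>fs z, sn z\<rangle> \<in> Y)"
    using sg_elem[OF XY(3), of "\<lambda>z. \<langle>fs z, sn z\<rangle>"] by (simp_all add: elem_intros)
  have "Sg S (\<lambda>z. sn z < sn (fs z) \<and> \<langle>fs (fs z), sn z\<rangle> \<notin> X)"
  proof (rule sg_conj)
    show "Sg S (\<lambda>z. sn z < sn (fs z))" by (intro sg_dec d0_less elem_intros)
    show "Sg S (\<lambda>z. \<langle>fs (fs z), sn z\<rangle> \<notin> X)"
      using sg_elem[OF XY(2), of "\<lambda>z. \<langle>fs (fs z), sn z\<rangle>"] by (simp_all add: elem_intros)
  qed
  from sg_ex[OF this] have "Sg S (\<lambda>x. \<exists>y<sn x. \<langle>fs x, y\<rangle> \<notin> X)" by simp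
  moreover have "Sg S (\<lambda>z. \<forall>y<sn z. \<langle>fs z, y\<rangle> \<in> X)" by (rule sg_ball[OF Xp(1)])
  ultimately show "{z. \<forall>y<sn z. \<langle>fs z, y\<rangle> \<in> X} \<in> Delta1 S" by (simp add: Delta1_def)
  show "{x. \<exists>y. \<langle>x, y\<rangle> \<in> X} \<in> Delta1 S" if "\<And>x. (\<exists>y. \<langle>x, y\<rangle> \<in> X) \<longleftrightarrow> \<not> (\<exists>y. \<langle>x, y\<rangle> \<in> Y)"
    using sg_ex[OF Xp(1)] sg_ex[OF Yp] that by (simp add: Delta1_def)
  obtain R R' where R: "R \<in> S" "\<And>x. x \<in> X \<longleftrightarrow> (\<exists>y. \<langle>x, y\<rangle> \<in> R)" and R': "R' \<in> S" "\<And>x. x \<notin> X \<longleftrightarrow> (\<exists>y. \<langle>x, y\<rangle> \<in> R')"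
    using XY(1,2) unfolding Sg_def by metis
  show "\<exists>b. \<forall>x<a. \<exists>y<b. \<langle>x, y\<rangle> \<in> X" if *: "\<And>x. x < a \<Longrightarrow> \<exists>y. \<langle>x, y\<rangle> \<in> X" for a
  proof -
    have "{z. \<langle>\<langle>fs z, fs (sn z)\<rangle>, sn (sn z)\<rangle> \<in> R} \<in> S" by (intro pre R elem_intros)
    moreover have "\<exists>y. \<langle>x, y\<rangle> \<in> {z. \<langle>\<langle>fs z, fs (sn z)\<rangle>, sn (sn z)\<rangle> \<in> R}" if x: "x < a" for x
    proof -
      obtain y v where "\<langle>\<langle>x, y\<rangle>, v\<rangle> \<in> R" using *[OF x] R(2) by blast
      then show ?thesis by (intro exI[of _ "\<langle>y, v\<rangle>"]) simp
    qed
    ultimately obtain b where b: "\<forall>x<a. \<exists>w<b. \<langle>\<langle>x, fs w\<rangle>, sn w\<rangle> \<in> R" using collection0[of _ a] by fastforce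
    then show ?thesis using R(2) fs_le le_less_trans by (intro exI[of _ b]) blast
  qed
  show "\<exists>y\<in>X. \<forall>z<y. z \<notin> X" if x: "x \<in> X" for x
  proof -
    \<comment> \<open>Every \<open>y \<le> x\<close> has a witness for membership in X or in its
      complement. Collection bounds these witnesses, so the part of X up to x lies in S itself and
      has a least element there.\<close>
    have "dec S (\<lambda>z. z \<in> R \<or> z \<in> R')" by (intro d0_disj) (simp_all add: dec_def R R')
    then have "{z. z \<in> R \<or> z \<in> R'} \<in> S" by (simp add: dec_def)
    moreover have "\<exists>v. \<langle>y, v\<rangle> \<in> {z. z \<in> R \<or> z \<in> R'}" for y using R(2)[of y] R'(2)[of y] by blast
    ultimately obtain b where b: "\<forall>y<x + 1. \<exists>v<b. \<langle>y, v\<rangle> \<in> R \<or> \<langle>y, v\<rangle> \<in> R'" using collection0[of _ "x + 1"] by blast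
    have "dec S (\<lambda>y. y < x + 1 \<and> (\<exists>v<b. \<langle>y, v\<rangle> \<in> R))" by (intro d0 R elem_intros)
    then have "{y. y < x + 1 \<and> (\<exists>v<b. \<langle>y, v\<rangle> \<in> R)} \<in> S" by (simp add: dec_def)
    moreover have "y < x + 1 \<and> (\<exists>v<b. \<langle>y, v\<rangle> \<in> R) \<longleftrightarrow> y \<le> x \<and> y \<in> X" for y
      using b[unfolded less_add1_iff] R(2)[of y] R'(2)[of y] unfolding less_add1_iff by blast
    ultimately have "{y. y \<le> x \<and> y \<in> X} \<in> S" by simp
    from least0[OF this, of x] x obtain y where y: "y \<le> x" "y \<in> X" "\<forall>z<y. \<not> (z \<le> x \<and> z \<in> X)" by auto
    then have "\<forall>z<y. z \<notin> X" by (meson less_imp_le less_le_trans)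
    then show ?thesis using y by blast
  qed
next
  have D: "X \<in> Delta1 S" if "X \<in> S" for X
    using that sg_dec[of "\<lambda>x. x \<in> X"] sg_dec[of "\<lambda>x. x \<notin> X"] compl[of X] by (simp add: Delta1_def dec_def Collect_neg_eq)
  show "{z. fs z < sn z} \<in> Delta1 S" "{z. fs z = sn z} \<in> Delta1 S" using less eq D by blast+
qed

lemma subset_Delta1: "S \<subseteq> Delta1 S"
proof
  fix X assume "X \<in> S" then show "X \<in> Delta1 S"
    using sg_dec[of "\<lambda>x. x \<in> X"] sg_dec[of "\<lambda>x. x \<notin> X"] compl[of X] by (simp add: Delta1_def dec_def Collect_neg_eq)
qed

end

lemma (in delta1_class) Delta1_subset: assumes "D \<subseteq> S" shows "Delta1 D \<subseteq> S"
proof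
  fix X assume "X \<in> Delta1 D"
  then obtain R R' where "R \<in> D" "R' \<in> D" "\<And>x. x \<in> X \<longleftrightarrow> (\<exists>y. \<langle>x, y\<rangle> \<in> R)" "\<And>x. x \<notin> X \<longleftrightarrow> (\<exists>y. \<langle>x, y\<rangle> \<in> R')"
    unfolding Delta1_def Sg_def by auto
  moreover from this have "X = {x. \<exists>y. \<langle>x, y\<rangle> \<in> R}" by blast
  ultimately show "X \<in> S" using delta1[of R R'] assms by (metis subsetD)
qed

subsection \<open>Normal forms relative to a generic set\<close>

text \<open>This is amenability: every initial segment of G is coded in the model. It can fail for
  an arbitrary set of numbers.\<close>

definition amen :: "'a::arith set \<Rightarrow> bool" where
  "amen G \<longleftrightarrow> (\<forall>m. elts (cod {x. x < m \<and> x \<in> G}) = {x. x < m \<and> x \<in> G})"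

lemma amenD: "amen G \<Longrightarrow> elts (cod {x. x < m \<and> x \<in> G}) = {x. x < m \<and> x \<in> G}" by (simp add: amen_def)

lemma fs_str [simp]: "fs (str G m) = m" by (simp add: str_def)

lemma elts_sn_str: "amen G \<Longrightarrow> elts (sn (str G m)) = {x. x < m \<and> x \<in> G}" by (simp add: str_def amenD)

lemma (in collection_class) amen: "X \<in> S \<Longrightarrow> amen X"
  unfolding amen_def using elts_cod_Collect[OF set_dec] by blast

text \<open>The use principle: a bounded question about x inspects G only below a polynomial in x.
  The oracle can be replaced by any sufficiently long initial segment, and what remains is a set W
  defined without G.\<close>

lemma Delta0_normal_form:
  assumes G: "amen G" and R: "R \<in> Delta0 (insert G Y)"
  shows "\<exists>W\<in>Delta0 Y. \<exists>h. poly_fun h \<and> (\<forall>x m. h x \<le> m \<longrightarrow> (x \<in> R \<longleftrightarrow> \<langle>x, str G m\<rangle> \<in> W))"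
  using R
proof (induction rule: Delta0.induct)
  case (Delta0_base X)
  show ?case
  proof (cases "X = G")
    case True
    have "dec (Delta0 Y) (\<lambda>z. fs z \<in> elts (sn (sn z)))" by (intro Delta0.d0_elts elem_intros)
    then show ?thesis unfolding dec_def
      by (intro bexI[of _ "{z. fs z \<in> elts (sn (sn z))}"] exI[of _ "\<lambda>x. x + 1"])
        (auto simp: True elts_sn_str[OF G] add1_le_iff intro: poly_fun.intros)
  next
    case False
    then have "X \<in> Delta0 Y" using Delta0_base by (auto intro: Delta0.Delta0_base)
    then have "{z. fs z \<in> X} \<in> Delta0 Y" by (intro Delta0_pre elem_intros)
    then show ?thesis by (intro bexI[of _ "{z. fs z \<in> X}"] exI[of _ "\<lambda>x. x"]) (auto intro: poly_fun.intros)
  qed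
next
  case (Delta0_compl X)
  then obtain W h where "W \<in> Delta0 Y" "poly_fun h" "\<forall>x m. h x \<le> m \<longrightarrow> (x \<in> X \<longleftrightarrow> \<langle>x, str G m\<rangle> \<in> W)" by blast
  then show ?case by (intro bexI[of _ "- W"] exI[of _ h]) (auto intro: Delta0.Delta0_compl)
next
  case (Delta0_inter X Z)
  then obtain W h V k where W: "W \<in> Delta0 Y" "poly_fun h" "\<And>x m. h x \<le> m \<Longrightarrow> (x \<in> X \<longleftrightarrow> \<langle>x, str G m\<rangle> \<in> W)"
    "V \<in> Delta0 Y" "poly_fun k" "\<And>x m. k x \<le> m \<Longrightarrow> (x \<in> Z \<longleftrightarrow> \<langle>x, str G m\<rangle> \<in> V)" by meson
  have le: "h x \<le> m" "k x \<le> m" if "h x + k x \<le> m" for x m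
  proof -
    have "h x \<le> h x + k x" "k x \<le> h x + k x" by simp_all
    then show "h x \<le> m" "k x \<le> m" using that by (blast intro: order_trans)+
  qed
  have "x \<in> X \<inter> Z \<longleftrightarrow> \<langle>x, str G m\<rangle> \<in> W \<inter> V" if "h x + k x \<le> m" for x m
    using W(3)[OF le(1)[OF that]] W(6)[OF le(2)[OF that]] by simp
  then show ?case using W by (intro bexI[of _ "W \<inter> V"] exI[of _ "\<lambda>x. h x + k x"]) (auto intro: Delta0.Delta0_inter poly_fun.intros)
next
  case Delta0_less
  have "{z. fs (fs z) < sn (fs z)} \<in> Delta0 Y"
    using Delta0.d0_less[of "\<lambda>z. fs (fs z)" "\<lambda>z. sn (fs z)"] by (simp add: dec_def elem_intros)
  then show ?case by (intro bexI exI[of _ "\<lambda>x. x"]) (auto intro: poly_fun.intros)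
next
  case Delta0_eq
  have "{z. fs (fs z) = sn (fs z)} \<in> Delta0 Y"
    using Delta0.d0_eq[of "\<lambda>z. fs (fs z)" "\<lambda>z. sn (fs z)"] by (simp add: dec_def elem_intros)
  then show ?case by (intro bexI exI[of _ "\<lambda>x. x"]) (auto intro: poly_fun.intros)
next
  case (Delta0_pre X f)
  then obtain W h where W: "W \<in> Delta0 Y" "poly_fun h" "\<And>x m. h x \<le> m \<Longrightarrow> (x \<in> X \<longleftrightarrow> \<langle>x, str G m\<rangle> \<in> W)" by meson
  obtain k where k: "poly_fun k" "\<And>x. f x \<le> k x" using elem_bound[OF Delta0_pre(2)] by blast
  have "elem_fun (\<lambda>z. f (fs z))" by (rule elem_comp[OF Delta0_pre(2)]) (intro elem_intros)
  then have "{z. \<langle>f (fs z), sn z\<rangle> \<in> W} \<in> Delta0 Y" by (intro Delta0.Delta0_pre W elem_intros)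
  moreover have "h (f x) \<le> m" if "h (k x) \<le> m" for x m using that poly_mono[OF W(2) k(2)] order_trans by blast
  ultimately show ?case using W(3) by (intro bexI exI[of _ "\<lambda>x. h (k x)"]) (auto intro: poly_comp W k)
next
  case (Delta0_ball X)
  then obtain W h where W: "W \<in> Delta0 Y" "poly_fun h" "\<And>x m. h x \<le> m \<Longrightarrow> (x \<in> X \<longleftrightarrow> \<langle>x, str G m\<rangle> \<in> W)" by meson
  have "dec (Delta0 Y) (\<lambda>z. \<forall>y<sn (fs z). \<langle>\<langle>fs (fs z), y\<rangle>, sn z\<rangle> \<in> W)"
    by (intro Delta0.d0_ball Delta0.d0_mem W elem_intros)
  then have W': "{z. \<forall>y<sn (fs z). \<langle>\<langle>fs (fs z), y\<rangle>, sn z\<rangle> \<in> W} \<in> Delta0 Y" by (simp add: dec_def)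
  \<comment> \<open>Both components are at most z, so monotonicity gives one bound for all instances
    of the bounded quantifier.\<close>
  have le: "h \<langle>fs z, y\<rangle> \<le> m" if "h \<langle>z, z\<rangle> \<le> m" "y < sn z" for z y m
  proof -
    have "y \<le> z" using that(2) sn_le[of z] by simp
    then have "\<langle>fs z, y\<rangle> \<le> \<langle>z, z\<rangle>" using fs_le[of z] by (intro pr_mono)
    then have "h \<langle>fs z, y\<rangle> \<le> h \<langle>z, z\<rangle>" by (rule poly_mono[OF W(2)])
    then show ?thesis using that(1) by (rule order_trans)
  qed
  have p: "poly_fun (\<lambda>z. h \<langle>z, z\<rangle>)"
    unfolding pr_def by (rule poly_comp[OF W(2)]) (intro poly_fun.intros)
  have eq: "(\<forall>y<sn x. \<langle>fs x, y\<rangle> \<in> X) \<longleftrightarrow> (\<forall>y<sn x. \<langle>\<langle>fs x, y\<rangle>, str G m\<rangle> \<in> W)" if "h \<langle>x, x\<rangle> \<le> m" for x m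
    using W(3)[OF le[OF that]] by blast
  show ?case by (rule bexI[OF _ W'], rule exI[of _ "\<lambda>x. h \<langle>x, x\<rangle>"]) (simp add: p eq)
qed

text \<open>The search for a witness y and the search for a long enough segment of G are merged: W
  accepts a string once it is long enough to certify some y up to its length.\<close>

lemma Sg_normal_form:
  assumes G: "amen G" and S: "delta0_class Y" and R: "R \<in> Delta0 (insert G Y)"
  obtains W where "W \<in> Y" "\<And>x m. \<langle>x, str G m\<rangle> \<in> W \<Longrightarrow> \<exists>y\<le>m. \<langle>x, y\<rangle> \<in> R"
    "\<And>x y. \<langle>x, y\<rangle> \<in> R \<Longrightarrow> \<exists>m. \<langle>x, str G m\<rangle> \<in> W"
proof -
  interpret delta0_class Y by fact
  obtain W h where W0: "W \<in> Delta0 Y" and h: "poly_fun h" and Wh: "\<And>x m. h x \<le> m \<Longrightarrow> (x \<in> R \<longleftrightarrow> \<langle>x, str G m\<rangle> \<in> W)"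
    using Delta0_normal_form[OF G R] by blast
  have W: "W \<in> Y" using W0 Delta0_subset by blast
  have he: "elem_fun (\<lambda>z. h \<langle>fs (fs z), sn z\<rangle>)"
    by (rule elem_comp[OF poly_elem[OF h]]) (intro elem_intros)
  let ?W = "{z. \<exists>y<fs (sn z) + 1. h \<langle>fs z, y\<rangle> \<le> fs (sn z) \<and> \<langle>\<langle>fs z, y\<rangle>, sn z\<rangle> \<in> W}"
  have "dec Y (\<lambda>z. \<exists>y<fs (sn z) + 1. h \<langle>fs z, y\<rangle> \<le> fs (sn z) \<and> \<langle>\<langle>fs z, y\<rangle>, sn z\<rangle> \<in> W)"
    by (intro d0_bex d0_conj d0_le he d0_mem W elem_intros)
  then have "?W \<in> Y" by (simp add: dec_def)
  moreover have "\<exists>y\<le>m. \<langle>x, y\<rangle> \<in> R" if "\<langle>x, str G m\<rangle> \<in> ?W" for x m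
    using that Wh by (auto simp: less_add1_iff)
  moreover have "\<exists>m. \<langle>x, str G m\<rangle> \<in> ?W" if "\<langle>x, y\<rangle> \<in> R" for x y
  proof (intro exI[of _ "h \<langle>x, y\<rangle> + y"])
    have "h \<langle>x, y\<rangle> \<le> h \<langle>x, y\<rangle> + y" "y \<le> h \<langle>x, y\<rangle> + y" by simp_all
    then show "\<langle>x, str G (h \<langle>x, y\<rangle> + y)\<rangle> \<in> ?W"
      using Wh[of "\<langle>x, y\<rangle>" "h \<langle>x, y\<rangle> + y"] that by (auto simp: less_add1_iff intro!: exI[of _ y])
  qed
  ultimately show ?thesis using that by blast
qed

definition ext :: "'a::arith set set \<Rightarrow> 'a set \<Rightarrow> 'a set set" where
  "ext S G = Delta1 (Delta0 (insert G S))"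

text \<open>By the normal form, a set of the extension is determined by one set W of S.\<close>

lemma countable_ext:
  assumes "amen G" "delta0_class S" "countable S" shows "countable (ext S G)"
proof -
  let ?f = "\<lambda>W. {x. \<exists>m. \<langle>x, str G m\<rangle> \<in> W}"
  have "X \<in> ?f ` S" if X: "X \<in> ext S G" for X
  proof -
    obtain R where R: "R \<in> Delta0 (insert G S)" "\<And>x. x \<in> X \<longleftrightarrow> (\<exists>y. \<langle>x, y\<rangle> \<in> R)"
      using X unfolding ext_def Delta1_def Sg_def by auto
    obtain W where W: "W \<in> S" "\<And>x m. \<langle>x, str G m\<rangle> \<in> W \<Longrightarrow> \<exists>y\<le>m. \<langle>x, y\<rangle> \<in> R" "\<And>x y. \<langle>x, y\<rangle> \<in> R \<Longrightarrow> \<exists>m. \<langle>x, str G m\<rangle> \<in> W"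
      using Sg_normal_form[OF assms(1,2) R(1)] by blast
    then have "X = ?f W" using R(2) by blast
    then show ?thesis using W(1) by blast
  qed
  then have "ext S G \<subseteq> ?f ` S" by blast
  then show ?thesis using assms(3) by (meson countable_image countable_subset)
qed

text \<open>The extension lies inside a class that satisfies collection and inherits collection and
  least elements from it. This is how every extension of the model is kept sound: its generator
  belongs to a suitable \<open>T\<close>.\<close>

lemma (in collection_class) collection_ext:
  assumes "X \<subseteq> S" "G \<in> S"
  shows "collection_class (ext X G)" "X \<subseteq> ext X G" "G \<in> ext X G" "ext X G \<subseteq> S"
proof -
  have sub: "Delta0 (insert G X) \<subseteq> S" using assms Delta0_subset by simp
  interpret D: delta0_collection "Delta0 (insert G X)"
  proof unfold_locales
    fix Y assume "Y \<in> Delta0 (insert G X)"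
    then have "Y \<in> S" using sub by blast
    then show "\<exists>b. \<forall>x<a. \<exists>y<b. \<langle>x, y\<rangle> \<in> Y" if "\<And>x. x < a \<Longrightarrow> \<exists>y. \<langle>x, y\<rangle> \<in> Y" for a
      using collection that by blast
    show "\<exists>y\<in>Y. \<forall>z<y. z \<notin> Y" if "x \<in> Y" for x using least \<open>Y \<in> S\<close> that by blast
  qed
  show "collection_class (ext X G)" unfolding ext_def by (rule D.collection_Delta1)
  show "X \<subseteq> ext X G" "G \<in> ext X G" unfolding ext_def using D.subset_Delta1 Delta0_base by blast+
  show "ext X G \<subseteq> S" unfolding ext_def by (rule Delta1_subset[OF sub])
qed

section \<open>Models with a controlled jump\<close>

text \<open>\<open>w\<close> pairs an index with an input, and the computation so described
  converges with the string u as its oracle. The jump of the extension by G is then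
  \<open>{w. \<exists>m. Uc C w (str G m)}\<close>.\<close>

definition Uc :: "'a::arith set \<Rightarrow> 'a \<Rightarrow> 'a \<Rightarrow> bool" where
  "Uc C w u \<longleftrightarrow> (\<exists>t. \<langle>fs w, \<langle>\<langle>sn w, u\<rangle>, t\<rangle>\<rangle> \<in> C)"

text \<open>The set \<^term>\<open>C\<close> is universal for the \<open>\<Sigma>\<^sub>1\<close> sets of \<^term>\<open>S\<close>, and its jump lies in \<^term>\<open>T\<close>, which is
  a stock of \<open>\<Delta>\<^sub>2\<close> sets. Collection in \<^term>\<open>T\<close> is what \<open>B\<Sigma>\<^sub>2\<close> is used for.\<close>

definition good :: "'a::arith set set \<Rightarrow> 'a set \<Rightarrow> 'a set set \<Rightarrow> bool" where
  "good S C T \<longleftrightarrow> countable S \<and> countable T \<and> collection_class S \<and> collection_class T \<and> S \<subseteq> T \<and> C \<in> S \<and>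
     (\<forall>W\<in>S. \<exists>e. \<forall>x. (\<exists>y. \<langle>x, y\<rangle> \<in> W) \<longleftrightarrow> (\<exists>t. \<langle>e, \<langle>x, t\<rangle>\<rangle> \<in> C)) \<and> {w. \<exists>t. \<langle>fs w, \<langle>sn w, t\<rangle>\<rangle> \<in> C} \<in> T"

lemma good_universal: "good S C T \<Longrightarrow> W \<in> S \<Longrightarrow> \<exists>e. \<forall>x. (\<exists>y. \<langle>x, y\<rangle> \<in> W) \<longleftrightarrow> (\<exists>t. \<langle>e, \<langle>x, t\<rangle>\<rangle> \<in> C)"
  by (simp add: good_def)

text \<open>Universality turns a Sigma_1 predicate into a section of the jump, which lies in
  \<open>T\<close>. Least elements in \<open>T\<close> thus give Sigma_1 induction for
  \<open>S\<close>.\<close>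

lemma good_sigma1:
  assumes "good S C T" "dec S (\<lambda>z. P (fs z) (sn z))" shows "dec T (\<lambda>x. \<exists>y. P x y)"
proof -
  interpret T: collection_class T using assms(1) by (simp add: good_def)
  have "{z. P (fs z) (sn z)} \<in> S" using assms(2) by (simp add: dec_def)
  from good_universal[OF assms(1) this] obtain e
    where "\<forall>x. (\<exists>y. \<langle>x, y\<rangle> \<in> {z. P (fs z) (sn z)}) \<longleftrightarrow> (\<exists>t. \<langle>e, \<langle>x, t\<rangle>\<rangle> \<in> C)" ..
  then have e: "(\<exists>y. P x y) \<longleftrightarrow> \<langle>e, x\<rangle> \<in> {w. \<exists>t. \<langle>fs w, \<langle>sn w, t\<rangle>\<rangle> \<in> C}" for x by simp
  have "{w. \<exists>t. \<langle>fs w, \<langle>sn w, t\<rangle>\<rangle> \<in> C} \<in> T" using assms(1) by (simp add: good_def)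
  then show ?thesis unfolding e by (intro T.dec_mem T.rec_pr T.rec_const T.rec_id)
qed

lemma good_pi1:
  assumes "good S C T" "dec S (\<lambda>z. P (fs z) (sn z))" shows "dec T (\<lambda>x. \<forall>y. P x y)"
proof -
  interpret S: collection_class S using assms(1) by (simp add: good_def)
  interpret T: collection_class T using assms(1) by (simp add: good_def)
  have "dec T (\<lambda>x. \<exists>y. \<not> P x y)" by (rule good_sigma1[OF assms(1)]) (intro S.d0_not assms(2))
  from T.d0_not[OF this] show ?thesis by simp
qed

lemma good_ext:
  fixes G :: "'a::arith set"
  assumes S: "good S C T" and T': "countable T'" "collection_class T'" "T \<subseteq> T'" and G: "G \<in> T'"
    and jump: "{w. \<exists>m. Uc C w (str G m)} \<in> T'"
  shows "\<exists>C'. good (ext S G) C' T'"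
proof -
  interpret S: collection_class S using S by (simp add: good_def)
  interpret T': collection_class T' by fact
  have "S \<subseteq> T'" using S T' by (auto simp: good_def)
  note E = T'.collection_ext[OF this G]
  interpret E: collection_class "ext S G" by (rule E(1))
  have am: "amen G" by (rule T'.amen[OF G])
  let ?str = "\<lambda>x. str G (fs (sn (sn x)))"
  \<comment> \<open>The old universal set, with a segment of G supplied as part of the input; the
    time of a new computation packs the length of that segment and the old time.\<close>
  let ?C = "{z. \<langle>fs z, \<langle>\<langle>fs (sn z), ?str z\<rangle>, sn (sn (sn z))\<rangle>\<rangle> \<in> C}"
  have CS: "C \<in> S" using S by (simp add: good_def)
  have "dec (ext S G) (\<lambda>z. \<langle>fs z, \<langle>\<langle>fs (sn z), ?str z\<rangle>, sn (sn (sn z))\<rangle>\<rangle> \<in> C)"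
    unfolding str_def using CS E(2) E(3) by (intro dc) blast+
  then have C': "?C \<in> ext S G" by (simp add: dec_def)
  have "\<exists>e. \<forall>x. (\<exists>y. \<langle>x, y\<rangle> \<in> X) \<longleftrightarrow> (\<exists>t. \<langle>e, \<langle>x, t\<rangle>\<rangle> \<in> ?C)" if X: "X \<in> ext S G" for X
  proof -
    obtain R0 where R0: "R0 \<in> Delta0 (insert G S)" "\<And>x. x \<in> X \<longleftrightarrow> (\<exists>y. \<langle>x, y\<rangle> \<in> R0)"
      using X unfolding ext_def Delta1_def Sg_def by auto
    let ?R = "{z. \<langle>\<langle>fs z, fs (sn z)\<rangle>, sn (sn z)\<rangle> \<in> R0}"
    have R: "?R \<in> Delta0 (insert G S)" by (intro Delta0_pre R0 elem_intros)
    have XR: "(\<exists>y. \<langle>x, y\<rangle> \<in> X) \<longleftrightarrow> (\<exists>v. \<langle>x, v\<rangle> \<in> ?R)" for x unfolding R0(2) by simp (metis fs_pr sn_pr)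
    obtain W where W: "W \<in> S" "\<And>x m. \<langle>x, str G m\<rangle> \<in> W \<Longrightarrow> \<exists>y\<le>m. \<langle>x, y\<rangle> \<in> ?R" "\<And>x y. \<langle>x, y\<rangle> \<in> ?R \<Longrightarrow> \<exists>m. \<langle>x, str G m\<rangle> \<in> W"
      using Sg_normal_form[OF am S.delta0_class_axioms R] by blast
    have "{z. fs z \<in> W} \<in> S" by (intro S.pre W elem_intros)
    from good_universal[OF S this] obtain e
      where "\<forall>x. (\<exists>y. \<langle>x, y\<rangle> \<in> {z. fs z \<in> W}) \<longleftrightarrow> (\<exists>t. \<langle>e, \<langle>x, t\<rangle>\<rangle> \<in> C)" ..
    then have e: "v \<in> W \<longleftrightarrow> (\<exists>t. \<langle>e, \<langle>v, t\<rangle>\<rangle> \<in> C)" for v by simp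
    have "(\<exists>y. \<langle>x, y\<rangle> \<in> X) \<longleftrightarrow> (\<exists>m t. \<langle>e, \<langle>\<langle>x, str G m\<rangle>, t\<rangle>\<rangle> \<in> C)" for x
      unfolding XR using W(2,3) e by blast
    also have "(\<exists>m t. \<langle>e, \<langle>\<langle>x, str G m\<rangle>, t\<rangle>\<rangle> \<in> C) \<longleftrightarrow> (\<exists>t. \<langle>e, \<langle>x, t\<rangle>\<rangle> \<in> ?C)" for x
      by simp (metis fs_pr sn_pr)
    finally show ?thesis by blast
  qed
  moreover have "(\<exists>t. \<langle>fs w, \<langle>sn w, t\<rangle>\<rangle> \<in> ?C) \<longleftrightarrow> (\<exists>m. Uc C w (str G m))" for w
    unfolding Uc_def by simp (metis fs_pr sn_pr)
  then have "{w. \<exists>t. \<langle>fs w, \<langle>sn w, t\<rangle>\<rangle> \<in> ?C} \<in> T'" using jump by (simp only:)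
  moreover have "countable (ext S G)" using countable_ext[OF am S.delta0_class_axioms] S by (simp add: good_def)
  ultimately have "good (ext S G) ?C T'" unfolding good_def using E C' T' by blast
  then show ?thesis by blast
qed

subsection \<open>Primitive recursion\<close>

text \<open>That the iteration is total is proved by induction on a Sigma_1 statement, hence in
  \<open>T\<close>. A run is a finite set of pairs in which each pair is initial or has a
  predecessor; it can be extended by one pair without any bookkeeping of lengths.\<close>

lemma good_iteration:
  fixes f :: "'a::arith \<Rightarrow> 'a"
  assumes S: "good S C T" and f: "rec S f"
  obtains g where "rec S g" "g 0 = a" "\<And>x. g (x + 1) = f (g x)"
proof -
  interpret S: collection_class S using S by (simp add: good_def)
  interpret T: collection_class T using S by (simp add: good_def)
  define Run where "Run \<sigma> \<longleftrightarrow> (\<forall>p\<in>elts \<sigma>. (fs p = 0 \<and> sn p = a) \<or> (\<exists>q\<in>elts \<sigma>. fs p = fs q + 1 \<and> sn p = f (sn q)))" for \<sigma>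
  have Run [intro]: "dec S (\<lambda>x. Run (h x))" if "rec S h" for h
    unfolding Run_def using that by (intro dc S.rec_comp[OF f] S.rec_comp[OF that])
  define Gr where "Gr i y \<sigma> \<longleftrightarrow> Run \<sigma> \<and> (\<exists>p\<in>elts \<sigma>. fs p = i \<and> sn p = y)" for i y \<sigma>
  have uniq: "y = y'" if g1: "Gr i y \<sigma>" and g2: "Gr i y' \<sigma>'" for i y y' \<sigma> \<sigma>'
  proof -
    have "dec S (\<lambda>i. \<forall>p\<in>elts \<sigma>. \<forall>q\<in>elts \<sigma>'. fs p = i \<and> fs q = i \<longrightarrow> sn p = sn q)" by (intro dc)
    then have "\<forall>p\<in>elts \<sigma>. \<forall>q\<in>elts \<sigma>'. fs p = i \<and> fs q = i \<longrightarrow> sn p = sn q"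
    proof (rule S.dec_induct)
      have nz: "0 \<noteq> x + (1::'a)" for x using less_add_one[of x] not_less_zero by metis
      show "\<forall>p\<in>elts \<sigma>. \<forall>q\<in>elts \<sigma>'. fs p = 0 \<and> fs q = 0 \<longrightarrow> sn p = sn q"
        using g1 g2 unfolding Gr_def Run_def by (metis nz)
      fix x assume IH: "\<forall>p\<in>elts \<sigma>. \<forall>q\<in>elts \<sigma>'. fs p = x \<and> fs q = x \<longrightarrow> sn p = sn q"
      show "\<forall>p\<in>elts \<sigma>. \<forall>q\<in>elts \<sigma>'. fs p = x + 1 \<and> fs q = x + 1 \<longrightarrow> sn p = sn q"
      proof (intro ballI impI)
        fix p q assume pq: "p \<in> elts \<sigma>" "q \<in> elts \<sigma>'" "fs p = x + 1 \<and> fs q = x + 1"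
        obtain p' where p': "p' \<in> elts \<sigma>" "fs p = fs p' + 1" "sn p = f (sn p')"
          using pq(1,3) g1 nz unfolding Gr_def Run_def by (metis (no_types))
        obtain q' where q': "q' \<in> elts \<sigma>'" "fs q = fs q' + 1" "sn q = f (sn q')"
          using pq(2,3) g2 nz unfolding Gr_def Run_def by (metis (no_types))
        show "sn p = sn q" using IH p' q' pq(3) by simp
      qed
    qed
    then show ?thesis using g1 g2 unfolding Gr_def by blast
  qed
  have add: "\<exists>\<sigma>'. Run \<sigma>' \<and> p \<in> elts \<sigma>' \<and> elts \<sigma> \<subseteq> elts \<sigma>'"
    if "Run \<sigma>" "(fs p = 0 \<and> sn p = a) \<or> (\<exists>q\<in>elts \<sigma>. fs p = fs q + 1 \<and> sn p = f (sn q))" for \<sigma> p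
  proof -
    have d: "dec S (\<lambda>x. x \<in> elts \<sigma> \<or> x = p)" by (intro dc)
    let ?\<sigma> = "cod {x. x < \<sigma> + p + 1 \<and> (x \<in> elts \<sigma> \<or> x = p)}"
    have "x < \<sigma> + p + 1" if "x \<in> elts \<sigma>" for x
    proof -
      have "x < \<sigma>" by (rule elts_less[OF that])
      also have "\<sigma> \<le> \<sigma> + p + 1" by (simp add: add.assoc)
      finally show ?thesis .
    qed
    moreover have "p < \<sigma> + p + 1" by (simp add: less_add1_iff)
    ultimately have "elts ?\<sigma> = insert p (elts \<sigma>)" unfolding S.elts_cod_Collect[OF d] by auto
    then show ?thesis using that unfolding Run_def by (intro exI[of _ ?\<sigma>]) auto
  qed
  have Run0: "Run 0"
  proof -
    have "elts (0::'a) = {}" using elts_less not_less_zero by blast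
    then show ?thesis by (simp add: Run_def)
  qed
  have tot: "\<exists>v. Gr i (fs v) (sn v)" for i
  proof -
    have "dec S (\<lambda>z. Gr (fs z) (fs (sn z)) (sn (sn z)))" unfolding Gr_def by (intro dc Run)
    from good_sigma1[OF S this] show ?thesis
    proof (rule T.dec_induct)
      obtain \<sigma> where "Run \<sigma>" "\<langle>0, a\<rangle> \<in> elts \<sigma>" using add[OF Run0, of "\<langle>0, a\<rangle>"] by auto
      then have "Gr 0 a \<sigma>" unfolding Gr_def by (metis fs_pr sn_pr)
      then show "\<exists>v. Gr 0 (fs v) (sn v)" by (metis fs_pr sn_pr)
      fix x assume "\<exists>v. Gr x (fs v) (sn v)"
      then obtain y \<sigma> p where "Run \<sigma>" "p \<in> elts \<sigma>" "fs p = x" "sn p = y" unfolding Gr_def by blast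
      then obtain \<sigma>' where "Run \<sigma>'" "\<langle>x + 1, f y\<rangle> \<in> elts \<sigma>'" using add[of \<sigma> "\<langle>x + 1, f y\<rangle>"] by auto
      then have "Gr (x + 1) (f y) \<sigma>'" unfolding Gr_def by (metis fs_pr sn_pr)
      then show "\<exists>v. Gr (x + 1) (fs v) (sn v)" by (metis fs_pr sn_pr)
    qed
  qed
  define g where "g i = (THE y. \<exists>\<sigma>. Gr i y \<sigma>)" for i
  have g: "g i = y \<longleftrightarrow> (\<exists>\<sigma>. Gr i y \<sigma>)" for i y
  proof -
    obtain y0 \<sigma>0 where *: "Gr i y0 \<sigma>0" using tot by blast
    then have "g i = y0" unfolding g_def using uniq by (intro the_equality) blast+
    then show ?thesis using * uniq by blast
  qed
  have "dec S (\<lambda>z. \<exists>\<sigma>. Gr (fs z) (sn z) \<sigma>)"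
  proof (rule S.dec_delta1)
    show "dec S (\<lambda>z. Gr (fs (fs z)) (sn (fs z)) (sn z))" unfolding Gr_def by (intro dc Run)
    show "dec S (\<lambda>z. Run (sn z) \<and> (\<exists>p\<in>elts (sn z). fs p = fs (fs z) \<and> sn p \<noteq> sn (fs z)))" by (intro dc Run)
    show "(\<exists>\<sigma>. Gr (fs x) (sn x) \<sigma>) \<longleftrightarrow> \<not> (\<exists>\<sigma>. Run \<sigma> \<and> (\<exists>p\<in>elts \<sigma>. fs p = fs x \<and> sn p \<noteq> sn x))" for x
    proof -
      have "(\<exists>\<sigma>. Run \<sigma> \<and> (\<exists>p\<in>elts \<sigma>. fs p = fs x \<and> sn p \<noteq> sn x)) \<longleftrightarrow> (\<exists>y. y \<noteq> sn x \<and> (\<exists>\<sigma>. Gr (fs x) y \<sigma>))"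
        unfolding Gr_def by blast
      then show ?thesis by (simp add: g[symmetric])
    qed
  qed
  moreover have "(\<exists>\<sigma>. Gr (fs z) (sn z) \<sigma>) \<longleftrightarrow> sn z = g (fs z)" for z using g[of "fs z" "sn z"] by auto
  ultimately have "rec S g" unfolding rec_def by (simp only:)
  moreover have "g 0 = a"
  proof -
    obtain \<sigma> where "Run \<sigma>" "\<langle>0, a\<rangle> \<in> elts \<sigma>" using add[OF Run0, of "\<langle>0, a\<rangle>"] by auto
    then show ?thesis unfolding g Gr_def by (metis fs_pr sn_pr)
  qed
  moreover have "g (x + 1) = f (g x)" for x
  proof -
    obtain \<sigma> p where "Run \<sigma>" "p \<in> elts \<sigma>" "fs p = x" "sn p = g x" using g[of x "g x"] unfolding Gr_def by blast
    then have "\<exists>q\<in>elts \<sigma>. fs \<langle>x + 1, f (g x)\<rangle> = fs q + 1 \<and> sn \<langle>x + 1, f (g x)\<rangle> = f (sn q)"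
      by (intro bexI[of _ p]) simp_all
    then obtain \<sigma>' where "Run \<sigma>'" "\<langle>x + 1, f (g x)\<rangle> \<in> elts \<sigma>'" using add[OF \<open>Run \<sigma>\<close>] by blast
    then show ?thesis unfolding g Gr_def by (metis fs_pr sn_pr)
  qed
  ultimately show ?thesis using that by blast
qed

subsection \<open>Controlling the jump along conditions\<close>

text \<open>A condition c carries an initial segment \<open>s c\<close> of length \<open>n c\<close>
  and the set \<open>E c\<close> of those computations below \<open>b c\<close> that are declared
  convergent. Extensions are picked by least witnesses. Without Sigma_1 induction in
  \<open>T'\<close> the resulting chain is not a function of a stage number; what is decidable is
  whether a given c occurs in it.\<close>

lemma jump_control:
  fixes s n b E :: "'a::arith \<Rightarrow> 'a" and c0 :: 'a
  defines "Ext \<equiv> \<lambda>c c'. n c \<le> n c' \<and> b c \<le> b c' \<and> (\<forall>x<n c. x \<in> elts (s c') \<longleftrightarrow> x \<in> elts (s c)) \<and>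
      (\<forall>x<b c. x \<in> elts (E c') \<longleftrightarrow> x \<in> elts (E c))"
  assumes S: "good S C T" and T': "countable T'" "collection_class T'" "T \<subseteq> T'"
    and comp: "rec T' s" "rec T' n" "rec T' b" "rec T' E" and b_le: "\<And>c. b c \<le> c"
    and V: "dec T' Val" "Val c0"
    and pos: "\<And>c w. Val c \<Longrightarrow> w \<in> elts (E c) \<Longrightarrow> \<exists>m\<le>n c. Uc C w (str (elts (s c)) m)"
    and neg: "\<And>c w m. Val c \<Longrightarrow> w < b c \<Longrightarrow> w \<notin> elts (E c) \<Longrightarrow> m \<le> n c \<Longrightarrow> \<not> Uc C w (str (elts (s c)) m)"
    and step: "\<And>c a. Val c \<Longrightarrow> \<exists>c'. Val c' \<and> Ext c c' \<and> a \<le> b c' \<and> a \<le> n c'"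
  obtains G C' where "good (ext S G) C' T'" "S \<subseteq> ext S G" "G \<in> ext S G"
    "\<And>a. \<exists>c. Val c \<and> a \<le> n c \<and> a \<le> b c \<and> (\<forall>x<n c. x \<in> G \<longleftrightarrow> x \<in> elts (s c))"
proof -
  interpret T': collection_class T' by fact
  have ST': "S \<subseteq> T'" using S T' by (auto simp: good_def)
  \<comment> \<open>Both bounds of the successor exceed the code of c. As
    \<open>b c \<le> c\<close>, codes increase along the chain: predecessors can be sought below a
    given code, and unbounded codes yield unbounded \<open>n\<close> and \<open>b\<close>.\<close>
  define N where "N c c' \<longleftrightarrow> (Val c \<longrightarrow> Val c' \<and> Ext c c' \<and> c + 1 \<le> b c' \<and> c + 1 \<le> n c')" for c c'
  have Nex: "\<exists>c'. N c c'" for c unfolding N_def using step by blast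
  have decN: "dec T' (\<lambda>z. N (fs z) (sn z))" unfolding N_def Ext_def
    by (intro dc T'.dec_comp[OF V(1)] T'.rec_comp[OF comp(1)] T'.rec_comp[OF comp(2)] T'.rec_comp[OF comp(3)] T'.rec_comp[OF comp(4)])
  define nx where "nx c = lst (N c)" for c
  have rec_nx: "rec T' nx" unfolding nx_def[abs_def] by (rule T'.rec_lst[OF decN Nex])
  have Nnx: "N c (nx c)" for c
  proof -
    have "dec T' (N c)" using T'.dec_comp2[OF decN T'.rec_const T'.rec_id, of c] by simp
    then show ?thesis unfolding nx_def using T'.lst_props(1) Nex by blast
  qed
  have nx: "Val (nx c)" "Ext c (nx c)" "c + 1 \<le> b (nx c)" "c + 1 \<le> n (nx c)" "c < nx c" if "Val c" for c
  proof -
    show "Val (nx c)" "Ext c (nx c)" "c + 1 \<le> b (nx c)" "c + 1 \<le> n (nx c)" using Nnx[of c] that unfolding N_def by blast+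
    then show "c < nx c" using b_le[of "nx c"] by (meson add1_le_iff order_trans)
  qed
  define Run where "Run \<sigma> \<longleftrightarrow> (\<forall>c\<in>elts \<sigma>. c = c0 \<or> (\<exists>c'\<in>elts \<sigma>. c' < c \<and> Val c' \<and> c = nx c'))" for \<sigma>
  have decRun: "dec T' (\<lambda>x. Run (h x))" if "rec T' h" for h
    unfolding Run_def using that by (intro dc T'.dec_comp[OF V(1)] T'.rec_comp[OF rec_nx] T'.rec_comp[OF that])
  \<comment> \<open>A run remains a run when it is cut off at c, because predecessors are smaller. A
    code below \<open>pw (c + 1)\<close> therefore suffices, and \<open>R\<close> is
    decidable.\<close>
  define R where "R c \<longleftrightarrow> (\<exists>\<sigma><pw (c + 1). Run \<sigma> \<and> c \<in> elts \<sigma>)" for c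
  have decR: "dec T' R" unfolding R_def by (intro dc decRun)
  have RI: "R c" if "Run \<sigma>" "c \<in> elts \<sigma>" for c \<sigma>
  proof -
    have d: "dec T' (\<lambda>x. x \<in> elts \<sigma>)" by (intro dc)
    let ?\<sigma> = "cod {x. x < c + 1 \<and> x \<in> elts \<sigma>}"
    have e: "elts ?\<sigma> = {x. x < c + 1 \<and> x \<in> elts \<sigma>}" by (rule T'.elts_cod_Collect[OF d])
    have "Run ?\<sigma>" unfolding Run_def e
    proof
      fix x assume x: "x \<in> {x. x < c + 1 \<and> x \<in> elts \<sigma>}"
      then consider "x = c0" | y where "y \<in> elts \<sigma>" "y < x" "Val y" "x = nx y" using \<open>Run \<sigma>\<close> unfolding Run_def by blast
      then show "x = c0 \<or> (\<exists>c'\<in>{x. x < c + 1 \<and> x \<in> elts \<sigma>}. c' < x \<and> Val c' \<and> x = nx c')"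
      proof cases
        case 2
        then have "y < c + 1" using x by auto
        then show ?thesis using 2 by blast
      qed simp
    qed
    moreover have "c \<in> elts ?\<sigma>" unfolding e using that by (simp add: less_add_one)
    moreover have "?\<sigma> < pw (c + 1)" by (rule T'.cod_less_pw[OF d])
    ultimately show ?thesis unfolding R_def by blast
  qed
  have RE': "c = c0 \<or> (\<exists>c'. R c' \<and> Val c' \<and> c' < c \<and> c = nx c')" if "R c" for c
  proof -
    obtain \<sigma> where \<sigma>: "Run \<sigma>" "c \<in> elts \<sigma>" using \<open>R c\<close> unfolding R_def by blast
    then have "c = c0 \<or> (\<exists>c'\<in>elts \<sigma>. c' < c \<and> Val c' \<and> c = nx c')" unfolding Run_def by blast
    then show ?thesis using RI[OF \<sigma>(1)] by blast
  qed
  then have RE: "c = c0 \<or> (\<exists>c'. R c' \<and> c' < c \<and> c = nx c')" if "R c" for c using that by blast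
  have RVal: "Val c" if "R c" for c
    using RE'[OF that] V(2) nx(1) by blast
  have R0: "R c0"
  proof -
    have d: "dec T' (\<lambda>x. x = c0)" by (intro dc)
    have e: "elts (cod {x. x < c0 + 1 \<and> x = c0}) = {x. x < c0 + 1 \<and> x = c0}" by (rule T'.elts_cod_Collect[OF d])
    have "Run (cod {x. x < c0 + 1 \<and> x = c0})" unfolding Run_def e by blast
    then show ?thesis by (rule RI) (unfold e, simp add: less_add_one)
  qed
  have Rnx: "R (nx c)" if "R c" for c
  proof -
    obtain \<sigma> where \<sigma>: "Run \<sigma>" "c \<in> elts \<sigma>" using \<open>R c\<close> unfolding R_def by blast
    have d: "dec T' (\<lambda>x. x \<in> elts \<sigma> \<or> x = nx c)" by (intro dc)
    let ?\<sigma> = "cod {x. x < \<sigma> + nx c + 1 \<and> (x \<in> elts \<sigma> \<or> x = nx c)}"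
    have lt: "x < \<sigma> + nx c + 1" if "x \<in> elts \<sigma>" for x
    proof -
      have "x < \<sigma>" by (rule elts_less[OF that])
      also have "\<sigma> \<le> \<sigma> + nx c + 1" by (simp add: add.assoc)
      finally show ?thesis .
    qed
    have lt': "nx c < \<sigma> + nx c + 1" by (simp add: less_add1_iff)
    have e: "elts ?\<sigma> = insert (nx c) (elts \<sigma>)" unfolding T'.elts_cod_Collect[OF d] using lt lt' by blast
    have "Run ?\<sigma>" unfolding Run_def e using \<sigma> nx(5)[OF RVal[OF \<open>R c\<close>]] RVal[OF \<open>R c\<close>] unfolding Run_def by blast
    then show ?thesis by (rule RI) (simp add: e)
  qed
  have c0_le: "c0 \<le> c" if "R c" for c
  proof (rule ccontr)
    assume "\<not> c0 \<le> c"
    have d: "dec T' (\<lambda>c. R c \<and> \<not> c0 \<le> c)" by (intro dc decR)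
    obtain y where y: "R y \<and> \<not> c0 \<le> y" "\<And>z. z < y \<Longrightarrow> \<not> (R z \<and> \<not> c0 \<le> z)"
      using T'.dec_least[OF d] \<open>R c\<close> \<open>\<not> c0 \<le> c\<close> by blast
    from y(1) obtain c' where c': "R c'" "c' < y" "y = nx c'" using RE[of y] by auto
    have "\<not> c0 \<le> c'" using y(1) c'(2) by auto
    then show False using y(2)[OF c'(2)] c'(1) by blast
  qed
  \<comment> \<open>No member of the chain lies strictly between c' and its successor. Together with
    \<open>c0_le\<close> this makes the chain linear, so that \<open>Ext\<close> can be proved along
    it by least counterexample.\<close>
  have gap: "nx c' \<le> c" if "R c" "R c'" "c' < c" for c c'
  proof (rule ccontr)
    assume "\<not> nx c' \<le> c"
    have d: "dec T' (\<lambda>c. R c \<and> (\<exists>c'<c. R c' \<and> c < nx c'))" by (intro dc decR T'.rec_comp[OF rec_nx] T'.dec_comp[OF decR])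
    have "R c \<and> (\<exists>c'<c. R c' \<and> c < nx c')" using that \<open>\<not> nx c' \<le> c\<close> by (auto simp: not_le)
    then obtain y where y: "R y" "\<exists>c'<y. R c' \<and> y < nx c'" "\<And>z. z < y \<Longrightarrow> \<not> (R z \<and> (\<exists>c'<z. R c' \<and> z < nx c'))"
      using T'.dec_least[OF d] by blast
    obtain u where u: "u < y" "R u" "y < nx u" using y(2) by blast
    have "y \<noteq> c0" using c0_le[OF u(2)] u(1) by auto
    then obtain v where v: "R v" "v < y" "y = nx v" using RE[OF y(1)] by blast
    show False
    proof (cases u v rule: linorder_cases)
      case less
      then show ?thesis using y(3)[OF v(2)] v(1,2) u(2,3) by (meson less_trans)
    next
      case greater
      then show ?thesis using y(3)[OF u(1)] v u by blast
    qed (use u v in simp)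
  qed
  have Ext_trans: "Ext c c''" if "Ext c c'" "Ext c' c''" for c c' c''
  proof -
    have le: "n c \<le> n c'" "n c' \<le> n c''" "b c \<le> b c'" "b c' \<le> b c''" using that unfolding Ext_def by blast+
    have "n c \<le> n c''" "b c \<le> b c''" using le by (auto intro: order_trans)
    moreover have "x \<in> elts (s c'') \<longleftrightarrow> x \<in> elts (s c)" if x: "x < n c" for x
    proof -
      have "x < n c'" using x le(1) by (rule less_le_trans)
      then show ?thesis using x \<open>Ext c c'\<close> \<open>Ext c' c''\<close> unfolding Ext_def by simp
    qed
    moreover have "x \<in> elts (E c'') \<longleftrightarrow> x \<in> elts (E c)" if x: "x < b c" for x
    proof -
      have "x < b c'" using x le(3) by (rule less_le_trans)
      then show ?thesis using x \<open>Ext c c'\<close> \<open>Ext c' c''\<close> unfolding Ext_def by simp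
    qed
    ultimately show ?thesis unfolding Ext_def by blast
  qed
  have Ext: "Ext c c'" if "R c" "R c'" "c \<le> c'" for c c'
  proof (rule ccontr)
    assume "\<not> Ext c c'"
    have d: "dec T' (\<lambda>c'. R c' \<and> c \<le> c' \<and> \<not> Ext c c')" unfolding Ext_def
      by (intro dc decR T'.rec_comp[OF comp(1)] T'.rec_comp[OF comp(2)] T'.rec_comp[OF comp(3)] T'.rec_comp[OF comp(4)])
    obtain y where y: "R y" "c \<le> y" "\<not> Ext c y" "\<And>z. z < y \<Longrightarrow> \<not> (R z \<and> c \<le> z \<and> \<not> Ext c z)"
      using T'.dec_least[OF d] \<open>R c'\<close> \<open>c \<le> c'\<close> \<open>\<not> Ext c c'\<close> by blast
    have "c \<noteq> y" using y(3) unfolding Ext_def by auto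
    then have cy: "c < y" using y(2) by simp
    then have "y \<noteq> c0" using c0_le[OF \<open>R c\<close>] by auto
    then obtain v where v: "R v" "v < y" "y = nx v" using RE[OF y(1)] by blast
    have "c \<le> v"
    proof (rule ccontr)
      assume "\<not> c \<le> v"
      then have "nx v \<le> c" using gap[OF \<open>R c\<close> v(1)] by simp
      then show False using v(3) cy by simp
    qed
    then have "Ext c v" using y(4)[OF v(2)] v(1) by blast
    moreover have "Ext v y" using nx(2)[OF RVal[OF v(1)]] v(3) by simp
    ultimately show False using Ext_trans y(3) by blast
  qed
  have agree: "x \<in> elts (s c) \<longleftrightarrow> x \<in> elts (s c')" if "R c" "R c'" "x < n c" "x < n c'" for x c c'
    using Ext[OF that(1,2)] Ext[OF that(2,1)] that(3,4) unfolding Ext_def by (metis linear)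
  have agreeE: "x \<in> elts (E c) \<longleftrightarrow> x \<in> elts (E c')" if "R c" "R c'" "x < b c" "x < b c'" for x c c'
    using Ext[OF that(1,2)] Ext[OF that(2,1)] that(3,4) unfolding Ext_def by (metis linear)
  have unb: "\<exists>c. R c \<and> a \<le> n c \<and> a \<le> b c" for a
  proof -
    have "\<exists>c>a. R c" by (rule T'.dec_unbounded[OF decR R0]) (use Rnx nx(5) RVal in blast)
    then obtain c where c: "a < c" "R c" by blast
    have "a \<le> c + 1" using c(1) less_add_one[of c] by (meson less_imp_le less_trans)
    then have "a \<le> n (nx c)" "a \<le> b (nx c)" using nx(3,4)[OF RVal[OF c(2)]] by (auto intro: order_trans)
    then show ?thesis using Rnx[OF c(2)] by blast
  qed
  define G where "G = {x. \<exists>c. R c \<and> x < n c \<and> x \<in> elts (s c)}"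
  have Giff: "x \<in> G \<longleftrightarrow> x \<in> elts (s c)" if "R c" "x < n c" for x c
    unfolding G_def using agree[OF that(1)] that by blast
  have nlt: "\<exists>c. R c \<and> x < n c \<and> x < b c" for x using unb[of "x + 1"] by (simp add: add1_le_iff)
  \<comment> \<open>Some member of the chain is long enough to decide x and all such members agree,
    so both G and its complement are Sigma_1 over \<open>T'\<close>.\<close>
  have GT': "G \<in> T'" unfolding G_def
  proof (rule T'.dec_set, rule T'.dec_delta1)
    show "dec T' (\<lambda>z. R (sn z) \<and> fs z < n (sn z) \<and> fs z \<in> elts (s (sn z)))"
      by (intro dc T'.dec_comp[OF decR] T'.rec_comp[OF comp(1)] T'.rec_comp[OF comp(2)])
    show "dec T' (\<lambda>z. R (sn z) \<and> fs z < n (sn z) \<and> fs z \<notin> elts (s (sn z)))"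
      by (intro dc T'.dec_comp[OF decR] T'.rec_comp[OF comp(1)] T'.rec_comp[OF comp(2)])
    show "(\<exists>c. R c \<and> x < n c \<and> x \<in> elts (s c)) \<longleftrightarrow> \<not> (\<exists>c. R c \<and> x < n c \<and> x \<notin> elts (s c))" for x
      using agree nlt[of x] by blast
  qed
  have strG: "str G m = str (elts (s c)) m" if "R c" "m \<le> n c" for c m
  proof -
    have "{x. x < m \<and> x \<in> G} = {x. x < m \<and> x \<in> elts (s c)}"
      using Giff[OF that(1)] that(2) by (auto dest: less_le_trans)
    then show ?thesis unfolding str_def by (simp only:)
  qed
  \<comment> \<open>If a computation declared divergent converged on G, it would converge on a
    segment that some condition of the chain covers, where \<open>neg\<close> forbids it.\<close>
  have jmp: "(\<exists>m. Uc C w (str G m)) \<longleftrightarrow> w \<in> elts (E c)" if "R c" "w < b c" for w c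
  proof
    assume "\<exists>m. Uc C w (str G m)"
    then obtain m where m: "Uc C w (str G m)" by blast
    obtain c' where c': "R c'" "w < b c'" "m \<le> n c'" using unb[of "w + 1 + m"] add1_le_iff
      by (metis add_le_same_cancel1 le_iff_add add.commute order_trans)
    have "w \<in> elts (E c')" using neg[OF RVal[OF c'(1)] c'(2) _ c'(3)] m strG[OF c'(1,3)] by auto
    then show "w \<in> elts (E c)" using agreeE[OF that(1) c'(1) that(2) c'(2)] by blast
  next
    assume "w \<in> elts (E c)"
    then obtain m where "m \<le> n c" "Uc C w (str (elts (s c)) m)" using pos[OF RVal[OF \<open>R c\<close>]] by blast
    then show "\<exists>m. Uc C w (str G m)" using strG[OF that(1)] by metis
  qed
  have "dec T' (\<lambda>w. \<exists>c. R c \<and> w < b c \<and> w \<in> elts (E c))"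
  proof (rule T'.dec_delta1)
    show "dec T' (\<lambda>z. R (sn z) \<and> fs z < b (sn z) \<and> fs z \<in> elts (E (sn z)))"
      by (intro dc T'.dec_comp[OF decR] T'.rec_comp[OF comp(3)] T'.rec_comp[OF comp(4)])
    show "dec T' (\<lambda>z. R (sn z) \<and> fs z < b (sn z) \<and> fs z \<notin> elts (E (sn z)))"
      by (intro dc T'.dec_comp[OF decR] T'.rec_comp[OF comp(3)] T'.rec_comp[OF comp(4)])
    show "(\<exists>c. R c \<and> w < b c \<and> w \<in> elts (E c)) \<longleftrightarrow> \<not> (\<exists>c. R c \<and> w < b c \<and> w \<notin> elts (E c))" for w
      using agreeE nlt[of w] by blast
  qed
  moreover have "(\<exists>c. R c \<and> w < b c \<and> w \<in> elts (E c)) \<longleftrightarrow> (\<exists>m. Uc C w (str G m))" for w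
    using jmp nlt[of w] by blast
  ultimately have jump: "{w. \<exists>m. Uc C w (str G m)} \<in> T'" by (simp add: dec_def)
  obtain C' where "good (ext S G) C' T'" using good_ext[OF S T' GT' jump] by blast
  moreover have "S \<subseteq> ext S G" "G \<in> ext S G" using T'.collection_ext[OF ST' GT'] by blast+
  moreover have "\<exists>c. Val c \<and> a \<le> n c \<and> a \<le> b c \<and> (\<forall>x<n c. x \<in> G \<longleftrightarrow> x \<in> elts (s c))" for a
    using unb[of a] RVal Giff by blast
  ultimately show ?thesis using that by blast
qed

section \<open>Trees of finite binary strings\<close>

text \<open>The binary strings are the numbers \<^term>\<open>str X n\<close>; the length of \<^term>\<open>\<sigma>\<close> is \<^term>\<open>fs \<sigma>\<close>,
  and \<^term>\<open>rs \<sigma> m\<close> is its restriction to length \<^term>\<open>m\<close>.\<close>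

definition rs :: "'a::arith \<Rightarrow> 'a \<Rightarrow> 'a" where
  "rs \<sigma> m = str (elts (sn \<sigma>)) m"

definition tree :: "'a::arith set \<Rightarrow> bool" where
  "tree K \<longleftrightarrow> (\<forall>\<sigma>\<in>K. rs \<sigma> (fs \<sigma>) = \<sigma>) \<and> (\<forall>\<sigma>\<in>K. \<forall>m\<le>fs \<sigma>. rs \<sigma> m \<in> K) \<and> (\<forall>n. \<exists>\<sigma>\<in>K. fs \<sigma> = n)"

lemma treeD:
  assumes "tree K"
  shows "\<sigma> \<in> K \<Longrightarrow> rs \<sigma> (fs \<sigma>) = \<sigma>" "\<sigma> \<in> K \<Longrightarrow> m \<le> fs \<sigma> \<Longrightarrow> rs \<sigma> m \<in> K" "\<exists>\<sigma>\<in>K. fs \<sigma> = n"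
  using assms unfolding tree_def by blast+

lemma fs_rs [simp]: "fs (rs \<sigma> m) = m" by (simp add: rs_def)

context collection_class begin

lemma elts_rs [simp]: "elts (sn (rs \<sigma> m)) = {x. x < m \<and> x \<in> elts (sn (\<sigma>::'a))}"
proof -
  have "dec S (\<lambda>x. x \<in> elts (sn \<sigma>))" by (intro dc)
  then show ?thesis unfolding rs_def str_def sn_pr by (rule elts_cod_Collect)
qed

lemma rs_rs: "k \<le> m \<Longrightarrow> rs (rs \<sigma> m) k = rs (\<sigma>::'a) k"
proof -
  assume "k \<le> m"
  then have "{x. x < k \<and> x \<in> elts (sn (rs \<sigma> m))} = {x. x < k \<and> x \<in> elts (sn \<sigma>)}" by auto
  then show ?thesis unfolding rs_def[of _ k] str_def by (simp only:)
qed

lemma rs_less: "rs (\<sigma>::'a) m < \<langle>m, pw m\<rangle>"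
proof -
  have "dec S (\<lambda>x. x \<in> elts (sn \<sigma>))" by (intro dc)
  then have "cod {x. x < m \<and> x \<in> elts (sn \<sigma>)} < pw m" by (rule cod_less_pw)
  then show ?thesis unfolding rs_def str_def by (intro pr_less_of_sum_less add_strict_left_mono)
qed

lemma rec_rs [dc]: "rec S f \<Longrightarrow> rec S g \<Longrightarrow> rec S (\<lambda>x. rs (f x) (g x))"
  by (rule rec_comp2[of rs]) (unfold rs_def str_def, intro dc)

lemma rs_eq_of_tree: "tree K \<Longrightarrow> \<sigma> \<in> K \<Longrightarrow> fs \<sigma> = n \<Longrightarrow> (\<sigma>::'a) < \<langle>n, pw n\<rangle>"
  using rs_less[of \<sigma> n] treeD(1)[of K \<sigma>] by simp

text \<open>If for some \<open>x < a\<close> there are strings of every length on which W does not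
  accept x, these strings form the subtree. Otherwise each x is accepted along all strings of some
  level, and collection provides one level for all \<open>x < a\<close>; the tree is then kept as it
  is.\<close>

lemma tree_decide:
  assumes K: "tree K" "K \<in> S" and W: "W \<in> S"
  obtains K' where "K' \<subseteq> K" "K' \<in> S" "tree K'"
    "(\<exists>x<a. \<forall>\<sigma>\<in>K'. \<forall>m\<le>fs \<sigma>. \<langle>x, rs \<sigma> m\<rangle> \<notin> W) \<or> (\<exists>b. \<forall>x<a. \<forall>\<sigma>\<in>K'. fs \<sigma> = b \<longrightarrow> (\<exists>m\<le>b. \<langle>x, rs \<sigma> m\<rangle> \<in> W))"
proof (cases "\<exists>x<a. \<forall>n. \<exists>\<sigma>\<in>K. fs \<sigma> = n \<and> (\<forall>m\<le>fs \<sigma>. \<langle>x, rs \<sigma> m\<rangle> \<notin> W)")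
  case True
  then obtain x where x: "x < a" "\<And>n. \<exists>\<sigma>\<in>K. fs \<sigma> = n \<and> (\<forall>m\<le>fs \<sigma>. \<langle>x, rs \<sigma> m\<rangle> \<notin> W)" by blast
  let ?K = "{\<sigma>. \<sigma> \<in> K \<and> (\<forall>m\<le>fs \<sigma>. \<langle>x, rs \<sigma> m\<rangle> \<notin> W)}"
  have "dec S (\<lambda>\<sigma>. \<sigma> \<in> K \<and> (\<forall>m\<le>fs \<sigma>. \<langle>x, rs \<sigma> m\<rangle> \<notin> W))" by (intro dc K W)
  then have "?K \<in> S" by (rule dec_set)
  moreover have "tree ?K" unfolding tree_def
  proof (intro conjI ballI allI impI)
    fix \<sigma> assume s: "\<sigma> \<in> ?K"
    then show "rs \<sigma> (fs \<sigma>) = \<sigma>" using treeD(1)[OF K(1)] by blast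
    fix m assume m: "m \<le> fs \<sigma>"
    have "rs \<sigma> m \<in> K" using s m treeD(2)[OF K(1)] by blast
    moreover have "\<langle>x, rs (rs \<sigma> m) k\<rangle> \<notin> W" if "k \<le> m" for k
      using s rs_rs[OF that, of \<sigma>] order_trans[OF that m] by simp
    ultimately show "rs \<sigma> m \<in> ?K" by simp
  next
    fix n show "\<exists>\<sigma>\<in>?K. fs \<sigma> = n" using x(2)[of n] by blast
  qed
  ultimately show ?thesis using that[of ?K] x(1) by blast
next
  case False
  define Q where "Q x n \<longleftrightarrow> (\<forall>\<sigma><\<langle>n, pw n\<rangle>. \<sigma> \<in> K \<and> fs \<sigma> = n \<longrightarrow> (\<exists>m\<le>n. \<langle>x, rs \<sigma> m\<rangle> \<in> W))" for x n
  have dQ: "dec S (\<lambda>z. Q (fs z) (sn z))" unfolding Q_def by (intro dc K W)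
  have "\<exists>n. Q x n" if x: "x < a" for x
  proof -
    obtain n where "\<forall>\<sigma>\<in>K. fs \<sigma> = n \<longrightarrow> \<not> (\<forall>m\<le>fs \<sigma>. \<langle>x, rs \<sigma> m\<rangle> \<notin> W)" using False x by blast
    then show ?thesis unfolding Q_def by (intro exI[of _ n]) auto
  qed
  from dec_collection[of Q, OF dQ this] obtain b where b: "\<forall>x<a. \<exists>n<b. Q x n" by blast
  have "\<exists>m\<le>b. \<langle>x, rs \<sigma> m\<rangle> \<in> W" if x: "x < a" and s: "\<sigma> \<in> K" "fs \<sigma> = b" for x \<sigma>
  proof -
    obtain n where n: "n < b" "Q x n" using b x by blast
    have "rs \<sigma> n \<in> K" using treeD(2)[OF K(1) s(1)] s(2) n(1) by simp
    then obtain m where m: "m \<le> n" "\<langle>x, rs (rs \<sigma> n) m\<rangle> \<in> W" using n(2) rs_less[of \<sigma> n] unfolding Q_def by auto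
    then have "\<langle>x, rs \<sigma> m\<rangle> \<in> W" by (simp add: rs_rs)
    moreover have "m \<le> b" using m(1) n(1) by simp
    ultimately show ?thesis by blast
  qed
  then show ?thesis using that[of K] K by blast
qed

text \<open>If each string of length a were without extensions on some level, collection over the
  boundedly many such strings would leave a level of the tree without nodes.\<close>

lemma tree_extend:
  assumes K: "tree K" "K \<in> S"
  obtains K' \<tau> where "K' \<subseteq> K" "K' \<in> S" "tree K'" "\<And>\<sigma>. \<sigma> \<in> K' \<Longrightarrow> a \<le> fs \<sigma> \<Longrightarrow> rs \<sigma> a = \<tau>"
proof -
  have "\<exists>\<tau>. \<forall>n\<ge>a. \<exists>\<sigma>\<in>K. fs \<sigma> = n \<and> rs \<sigma> a = \<tau>"
  proof (rule ccontr)
    assume no: "\<not> ?thesis"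
    define Q where "Q \<tau> n \<longleftrightarrow> a \<le> n \<and> (\<forall>\<sigma><\<langle>n, pw n\<rangle>. \<sigma> \<in> K \<and> fs \<sigma> = n \<longrightarrow> rs \<sigma> a \<noteq> \<tau>)" for \<tau> n
    have dQ: "dec S (\<lambda>z. Q (fs z) (sn z))" unfolding Q_def by (intro dc K)
    have "\<exists>n. Q \<tau> n" for \<tau> using no unfolding Q_def by blast
    from dec_collection[of Q, OF dQ this] obtain b where b: "\<forall>\<tau><\<langle>a, pw a\<rangle>. \<exists>n<b. Q \<tau> n" by blast
    obtain \<sigma> where s: "\<sigma> \<in> K" "fs \<sigma> = a + b" using treeD(3)[OF K(1)] by blast
    obtain n where n: "n < b" "a \<le> n" "\<forall>\<sigma>'<\<langle>n, pw n\<rangle>. \<sigma>' \<in> K \<and> fs \<sigma>' = n \<longrightarrow> rs \<sigma>' a \<noteq> rs \<sigma> a"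
      using b rs_less[of \<sigma> a] unfolding Q_def by blast
    have "n \<le> a + b" using n(1) by (simp add: add_increasing less_imp_le)
    then have "rs \<sigma> n \<in> K" using treeD(2)[OF K(1) s(1)] s(2) by simp
    then have "rs (rs \<sigma> n) a \<noteq> rs \<sigma> a" using n(3) rs_less[of \<sigma> n] by simp
    then show False using rs_rs[OF n(2)] by blast
  qed
  then obtain \<tau> where \<tau>: "\<And>n. a \<le> n \<Longrightarrow> \<exists>\<sigma>\<in>K. fs \<sigma> = n \<and> rs \<sigma> a = \<tau>" by blast
  then obtain \<sigma>0 where "\<sigma>0 \<in> K" "fs \<sigma>0 = a" "rs \<sigma>0 a = \<tau>" by blast
  then have tau: "\<tau> \<in> K" "fs \<tau> = a" using treeD(1)[OF K(1)] by auto
  let ?K = "{\<sigma>. \<sigma> \<in> K \<and> (a \<le> fs \<sigma> \<longrightarrow> rs \<sigma> a = \<tau>) \<and> (fs \<sigma> < a \<longrightarrow> rs \<tau> (fs \<sigma>) = \<sigma>)}"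
  have "dec S (\<lambda>\<sigma>. \<sigma> \<in> K \<and> (a \<le> fs \<sigma> \<longrightarrow> rs \<sigma> a = \<tau>) \<and> (fs \<sigma> < a \<longrightarrow> rs \<tau> (fs \<sigma>) = \<sigma>))" by (intro dc K)
  then have "?K \<in> S" by (rule dec_set)
  moreover have "tree ?K" unfolding tree_def
  proof (intro conjI ballI allI impI)
    fix \<sigma> assume s: "\<sigma> \<in> ?K"
    then show "rs \<sigma> (fs \<sigma>) = \<sigma>" using treeD(1)[OF K(1)] by blast
    fix m assume m: "m \<le> fs \<sigma>"
    have "rs \<sigma> m \<in> K" using s m treeD(2)[OF K(1)] by blast
    moreover have "rs (rs \<sigma> m) a = \<tau>" if "a \<le> m"
      using rs_rs[OF that, of \<sigma>] order_trans[OF that m] s by simp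
    moreover have "rs \<tau> m = rs \<sigma> m" if "m < a"
    proof (cases "a \<le> fs \<sigma>")
      case True
      then have "rs \<sigma> a = \<tau>" using s by blast
      then show ?thesis using rs_rs[of m a \<sigma>] that by simp
    next
      case False
      then have "rs \<tau> (fs \<sigma>) = \<sigma>" using s by (simp add: not_le)
      then show ?thesis using rs_rs[OF m, of \<tau>] by simp
    qed
    ultimately show "rs \<sigma> m \<in> ?K" by simp
  next
    fix n show "\<exists>\<sigma>\<in>?K. fs \<sigma> = n"
    proof (cases "a \<le> n")
      case True
      then show ?thesis using \<tau>[OF True] by fastforce
    next
      case False
      then have "rs \<tau> n \<in> K" using treeD(2)[OF K(1) tau(1)] tau(2) by simp
      then show ?thesis using False by (intro bexI[of _ "rs \<tau> n"]) auto
    qed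
  qed
  ultimately show ?thesis using that[of ?K \<tau>] by blast
qed

end

text \<open>Forcing with the trees in S. There is one requirement for each W in S and each bound a;
  being countably many, they are met along the true natural numbers, outside the model. The path
  preserves collection because either some \<open>x < a\<close> never gets a witness or one level
  supplies witnesses for all of them.\<close>

lemma generic_path:
  fixes S :: "'a::{arith,countable} set set"
  assumes S: "collection_class S" "countable S" and K: "tree K" "K \<in> S"
  obtains P where "\<And>n. str P n \<in> K" "collection_class (ext S P)" "countable (ext S P)" "S \<subseteq> ext S P" "P \<in> ext S P"
proof -
  interpret collection_class S by fact
  define Dc where "Dc W a K' \<longleftrightarrow> (\<exists>x<a. \<forall>\<sigma>\<in>K'. \<forall>m\<le>fs \<sigma>. \<langle>x, rs \<sigma> m\<rangle> \<notin> W) \<or>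
     (\<exists>b. \<forall>x<a. \<forall>\<sigma>\<in>K'. fs \<sigma> = b \<longrightarrow> (\<exists>m\<le>b. \<langle>x, rs \<sigma> m\<rangle> \<in> W))" for W and a :: 'a and K'
  define Ex where "Ex a K' \<longleftrightarrow> (\<exists>\<tau>. \<forall>\<sigma>\<in>K'. a \<le> fs \<sigma> \<longrightarrow> rs \<sigma> a = \<tau>)" for a :: 'a and K'
  define r where "r = from_nat_into (S \<times> (UNIV :: 'a set))"
  have r: "\<exists>i. r i = (W, a)" if "W \<in> S" for W a
  proof -
    have "countable (S \<times> (UNIV :: 'a set))" using S(2) by simp
    then have "(W, a) \<in> range r" unfolding r_def using that by (subst range_from_nat_into) auto
    then show ?thesis by (metis rangeE)
  qed
  have rS: "fst (r i) \<in> S" for i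
  proof -
    have "r i \<in> S \<times> UNIV" unfolding r_def by (rule from_nat_into) (use K in blast)
    then show ?thesis by (simp add: mem_Times_iff)
  qed
  have step: "\<exists>K''. (K'' \<in> S \<and> tree K'' \<and> K'' \<subseteq> K) \<and> (K'' \<subseteq> K' \<and> Dc (fst (r i)) (snd (r i)) K'' \<and> Ex (snd (r i)) K'')"
    if K': "K' \<in> S \<and> tree K' \<and> K' \<subseteq> K" for K' i
  proof -
    obtain K1 where K1: "K1 \<subseteq> K'" "K1 \<in> S" "tree K1" "Dc (fst (r i)) (snd (r i)) K1"
      using tree_decide[of K' "fst (r i)" "snd (r i)"] K' rS unfolding Dc_def by metis
    obtain K2 \<tau> where K2: "K2 \<subseteq> K1" "K2 \<in> S" "tree K2" "\<And>\<sigma>. \<sigma> \<in> K2 \<Longrightarrow> snd (r i) \<le> fs \<sigma> \<Longrightarrow> rs \<sigma> (snd (r i)) = \<tau>"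
      using tree_extend[OF K1(3,2)] by blast
    have "Dc (fst (r i)) (snd (r i)) K2" using K1(4) K2(1) unfolding Dc_def by (meson subsetD)
    moreover have "Ex (snd (r i)) K2" unfolding Ex_def using K2(4) by blast
    ultimately show ?thesis using K1 K2 K' by blast
  qed
  have "\<exists>f. \<forall>i. (f i \<in> S \<and> tree (f i) \<and> f i \<subseteq> K) \<and> (f (Suc i) \<subseteq> f i \<and> Dc (fst (r i)) (snd (r i)) (f (Suc i)) \<and> Ex (snd (r i)) (f (Suc i)))"
    by (rule dependent_nat_choice) (use K step in auto)
  then obtain f where f: "\<And>i. f i \<in> S" "\<And>i. tree (f i)" "\<And>i. f i \<subseteq> K" "\<And>i. f (Suc i) \<subseteq> f i"
    "\<And>i. Dc (fst (r i)) (snd (r i)) (f (Suc i))" "\<And>i. Ex (snd (r i)) (f (Suc i))" by blast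
  have mono: "f j \<subseteq> f i" if "i \<le> j" for i j using that by (rule lift_Suc_antimono_le[of f, OF f(4)])
  define P where "P = {x. \<exists>i. \<forall>\<sigma>\<in>f i. x < fs \<sigma> \<longrightarrow> x \<in> elts (sn \<sigma>)}"
  have ex_stem: "\<exists>i \<tau>. \<forall>\<sigma>\<in>f i. a \<le> fs \<sigma> \<longrightarrow> rs \<sigma> a = \<tau>" for a
    using f(6) r[OF K(2), of a] unfolding Ex_def by (metis snd_conv)
  have Piff: "x \<in> P \<longleftrightarrow> x \<in> elts (sn \<sigma>)" if stem: "\<And>\<sigma>. \<sigma> \<in> f i \<Longrightarrow> a \<le> fs \<sigma> \<Longrightarrow> rs \<sigma> a = rs \<rho> a" and "\<rho> \<in> f i" "a \<le> fs \<rho>" "x < a" "\<sigma> \<in> f i" "a \<le> fs \<sigma>" for x i a \<rho> \<sigma>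
  proof -
    have *: "y \<in> elts (sn \<sigma>') \<longleftrightarrow> y \<in> elts (sn \<rho>)" if "\<sigma>' \<in> f i" "a \<le> fs \<sigma>'" "y < a" for y \<sigma>'
    proof -
      have "elts (sn (rs \<sigma>' a)) = elts (sn (rs \<rho> a))" using stem that by simp
      then show ?thesis using that(3) by auto
    qed
    obtain k \<upsilon> where k: "\<And>\<sigma>. \<sigma> \<in> f k \<Longrightarrow> x + 1 \<le> fs \<sigma> \<Longrightarrow> rs \<sigma> (x + 1) = \<upsilon>" using ex_stem[of "x + 1"] by blast
    have xa: "x + 1 \<le> a" using \<open>x < a\<close> by (simp add: add1_le_iff)
    show ?thesis
    proof
      assume "x \<in> P"
      then obtain j where j: "\<And>\<sigma>. \<sigma> \<in> f j \<Longrightarrow> x < fs \<sigma> \<Longrightarrow> x \<in> elts (sn \<sigma>)" unfolding P_def by blast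
      obtain \<sigma>' where s': "\<sigma>' \<in> f (max i j)" "fs \<sigma>' = a" using treeD(3)[OF f(2)] by blast
      then have "\<sigma>' \<in> f i" "\<sigma>' \<in> f j" using mono[of i "max i j"] mono[of j "max i j"] by auto
      then show "x \<in> elts (sn \<sigma>)" using j[of \<sigma>'] s'(2) * that(4-6) by auto
    next
      assume xs: "x \<in> elts (sn \<sigma>)"
      obtain \<sigma>' where s': "\<sigma>' \<in> f (max i k)" "fs \<sigma>' = a" using treeD(3)[OF f(2)] by blast
      then have "\<sigma>' \<in> f i" "\<sigma>' \<in> f k" using mono[of i "max i k"] mono[of k "max i k"] by auto
      then have "x \<in> elts (sn \<sigma>')" using xs * that(4-6) s'(2) by auto
      then have "x \<in> elts (sn (rs \<sigma>' (x + 1)))" by (simp add: less_add1_iff)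
      then have u: "x \<in> elts (sn \<upsilon>)" using k[OF \<open>\<sigma>' \<in> f k\<close>] s'(2) xa by simp
      have "x \<in> elts (sn \<sigma>'')" if "\<sigma>'' \<in> f k" "x < fs \<sigma>''" for \<sigma>''
      proof -
        have "rs \<sigma>'' (x + 1) = \<upsilon>" using k[OF that(1)] that(2) by (simp add: add1_le_iff)
        then have "x \<in> elts (sn (rs \<sigma>'' (x + 1)))" using u by simp
        then show ?thesis by simp
      qed
      then show "x \<in> P" unfolding P_def by blast
    qed
  qed
  have str_in: "str P a \<in> f i" for a i
  proof -
    obtain k \<tau> where k: "\<And>\<sigma>. \<sigma> \<in> f k \<Longrightarrow> a \<le> fs \<sigma> \<Longrightarrow> rs \<sigma> a = \<tau>" using ex_stem[of a] by blast
    let ?j = "max i k"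
    have kj: "rs \<sigma> a = \<tau>" if "\<sigma> \<in> f ?j" "a \<le> fs \<sigma>" for \<sigma> using k mono[of k ?j] that by auto
    obtain \<rho> where p: "\<rho> \<in> f ?j" "fs \<rho> = a" using treeD(3)[OF f(2)] by blast
    have "x \<in> P \<longleftrightarrow> x \<in> elts (sn \<rho>)" if "x < a" for x
      by (rule Piff[of ?j a \<rho>]) (use kj p that in auto)
    then have "{x. x < a \<and> x \<in> P} = {x. x < a \<and> x \<in> elts (sn \<rho>)}" by blast
    then have "str P a = rs \<rho> a" unfolding rs_def str_def by (simp only:)
    also have "rs \<rho> a = \<rho>" using treeD(1)[OF f(2) p(1)] p(2) by simp
    finally show ?thesis using p(1) mono[of i ?j] by auto
  qed
  have am: "amen P" unfolding amen_def
  proof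
    fix a
    have "rs (str P a) a = str P a" using treeD(1)[OF f(2) str_in[of a 0]] by simp
    then have 1: "elts (sn (str P a)) = {x. x < a \<and> x \<in> elts (sn (str P a))}" by (metis elts_rs)
    obtain k \<tau> where k: "\<And>\<sigma>. \<sigma> \<in> f k \<Longrightarrow> a \<le> fs \<sigma> \<Longrightarrow> rs \<sigma> a = \<tau>" using ex_stem[of a] by blast
    have "x \<in> P \<longleftrightarrow> x \<in> elts (sn (str P a))" if "x < a" for x
      by (rule Piff[of k a "str P a"]) (use k str_in that in auto)
    then have "elts (sn (str P a)) = {x. x < a \<and> x \<in> P}" using 1 by blast
    then show "elts (cod {x. x < a \<and> x \<in> P}) = {x. x < a \<and> x \<in> P}" by (simp add: str_def)
  qed
  have rs_str: "rs (str P b) m = str P m" if "m \<le> b" for b m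
  proof -
    have "{x. x < m \<and> x \<in> elts (sn (str P b))} = {x. x < m \<and> x \<in> P}"
      unfolding elts_sn_str[OF am] using that by auto
    then show ?thesis unfolding rs_def str_def[of _ m] by (simp only:)
  qed
  interpret D: delta0_collection "Delta0 (insert P S)"
  proof unfold_locales
    fix X assume X: "X \<in> Delta0 (insert P S)"
    show "\<exists>b. \<forall>x<a. \<exists>y<b. \<langle>x, y\<rangle> \<in> X" if tot: "\<And>x. x < a \<Longrightarrow> \<exists>y. \<langle>x, y\<rangle> \<in> X" for a
    proof -
      obtain W where W: "W \<in> S" "\<And>x m. \<langle>x, str P m\<rangle> \<in> W \<Longrightarrow> \<exists>y\<le>m. \<langle>x, y\<rangle> \<in> X" "\<And>x y. \<langle>x, y\<rangle> \<in> X \<Longrightarrow> \<exists>m. \<langle>x, str P m\<rangle> \<in> W"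
        using Sg_normal_form[OF am delta0_class_axioms X] by blast
      obtain i where i: "r i = (W, a)" using r[OF W(1)] by blast
      have "Dc W a (f (Suc i))" using f(5)[of i] i by simp
      then consider x where "x < a" "\<forall>\<sigma>\<in>f (Suc i). \<forall>m\<le>fs \<sigma>. \<langle>x, rs \<sigma> m\<rangle> \<notin> W"
        | b where "\<forall>x<a. \<forall>\<sigma>\<in>f (Suc i). fs \<sigma> = b \<longrightarrow> (\<exists>m\<le>b. \<langle>x, rs \<sigma> m\<rangle> \<in> W)" unfolding Dc_def by blast
      then show ?thesis
      proof cases
        case 1
        obtain y where "\<langle>x, y\<rangle> \<in> X" using tot[OF 1(1)] by blast
        then obtain m where m: "\<langle>x, str P m\<rangle> \<in> W" using W(3) by blast
        have "\<langle>x, rs (str P m) m\<rangle> \<notin> W" using 1(2) str_in[of m "Suc i"] by auto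
        then show ?thesis using m rs_str[of m m] by simp
      next
        case 2
        have "\<exists>y<b + 1. \<langle>x, y\<rangle> \<in> X" if x: "x < a" for x
        proof -
          obtain m where m: "m \<le> b" "\<langle>x, rs (str P b) m\<rangle> \<in> W" using 2 x str_in[of b "Suc i"] fs_str[of P b] by blast
          then have "\<langle>x, str P m\<rangle> \<in> W" by (simp add: rs_str)
          then obtain y where "y \<le> m" "\<langle>x, y\<rangle> \<in> X" using W(2) by blast
          then show ?thesis using m(1) less_add1_iff order_trans by blast
        qed
        then show ?thesis by blast
      qed
    qed
    show "\<exists>y\<in>X. \<forall>z<y. z \<notin> X" if x: "x \<in> X" for x
    proof -
      \<comment> \<open>One segment of P is long enough for all \<open>y \<le> x\<close> by
        monotonicity of h, and with it as a parameter the least element is found in S.\<close>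
      obtain W h where W0: "W \<in> Delta0 S" and h: "poly_fun h" and Wh: "\<And>x m. h x \<le> m \<Longrightarrow> (x \<in> X \<longleftrightarrow> \<langle>x, str P m\<rangle> \<in> W)"
        using Delta0_normal_form[OF am X] by blast
      have W: "W \<in> S" using W0 Delta0_subset by blast
      have d: "dec S (\<lambda>y. y \<le> x \<and> \<langle>y, str P (h x)\<rangle> \<in> W)" by (intro dc W)
      have eq: "y \<le> x \<and> \<langle>y, str P (h x)\<rangle> \<in> W \<longleftrightarrow> y \<le> x \<and> y \<in> X" for y
        using Wh[OF poly_mono[OF h, of y x]] by blast
      obtain y where "y \<le> x" "y \<in> X" "\<And>z. z < y \<Longrightarrow> \<not> (z \<le> x \<and> z \<in> X)"
        using dec_least[OF d, of x] x unfolding eq by blast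
      then show ?thesis by (meson less_imp_le less_le_trans)
    qed
  qed
  show ?thesis
  proof (rule that[of P])
    show "str P n \<in> K" for n using str_in[of n 0] f(3) by blast
    show "collection_class (ext S P)" unfolding ext_def by (rule D.collection_Delta1)
    show "countable (ext S P)" by (rule countable_ext[OF am delta0_class_axioms S(2)])
    show "S \<subseteq> ext S P" "P \<in> ext S P" unfolding ext_def using D.subset_Delta1 Delta0_base by blast+
  qed
qed

section \<open>The low basis theorem\<close>

text \<open>\<^term>\<open>cv C N w \<sigma>\<close>: the computation \<^term>\<open>w\<close> is seen to converge on \<^term>\<open>\<sigma>\<close> with all
  witnesses below \<^term>\<open>N\<close>.\<close>

definition cv :: "'a::arith set \<Rightarrow> 'a \<Rightarrow> 'a \<Rightarrow> 'a \<Rightarrow> bool" where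
  "cv C N w \<sigma> \<longleftrightarrow> (\<exists>m<N. \<exists>t<N. \<langle>fs w, \<langle>\<langle>sn w, rs \<sigma> m\<rangle>, t\<rangle>\<rangle> \<in> C)"

lemma fs_0 [simp]: "fs 0 = (0::'a::arith)" and sn_0 [simp]: "sn 0 = (0::'a::arith)"
  using fs_le[of "0::'a"] sn_le[of "0::'a"] by simp_all

lemma (in collection_class) dec_cv [dc]:
  "C \<in> S \<Longrightarrow> rec S f \<Longrightarrow> rec S g \<Longrightarrow> rec S h \<Longrightarrow> dec S (\<lambda>x. cv C (f x) (g x) (h x))"
proof -
  assume *: "C \<in> S" "rec S f" "rec S g" "rec S h"
  have "dec S (\<lambda>z. cv C (fs z) (fs (sn z)) (sn (sn z)))" unfolding cv_def by (intro dc *(1))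
  from dec_comp[OF this rec_pr[OF *(2) rec_pr[OF *(3,4)]]] show ?thesis by simp
qed

lemma cv_mono: "cv C N w \<sigma> \<Longrightarrow> N \<le> N' \<Longrightarrow> cv C N' w \<sigma>"
  unfolding cv_def by (meson less_le_trans)

lemma cv_Uc: "cv C N w \<sigma> \<Longrightarrow> \<exists>m<N. Uc C w (rs \<sigma> m)"
  unfolding cv_def Uc_def by blast

lemma Uc_cv: "Uc C w (rs \<sigma> m) \<Longrightarrow> \<exists>N. cv C N w \<sigma>"
proof -
  assume "Uc C w (rs \<sigma> m)"
  then obtain t where t: "\<langle>fs w, \<langle>\<langle>sn w, rs \<sigma> m\<rangle>, t\<rangle>\<rangle> \<in> C" unfolding Uc_def by blast
  have "m < m + t + 1" "t < m + t + 1" by (simp_all add: less_add1_iff)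
  then show ?thesis unfolding cv_def using t by blast
qed

lemma (in collection_class) cv_agree:
  assumes "rs (\<sigma>::'a) n = rs \<tau> n" "N \<le> n" shows "cv C N w \<sigma> \<longleftrightarrow> cv C N w \<tau>"
proof -
  have "rs \<sigma> m = rs \<tau> m" if "m < N" for m
  proof -
    have "m \<le> n" using that assms(2) by simp
    then show ?thesis using assms(1) rs_rs by metis
  qed
  then show ?thesis unfolding cv_def by (metis (no_types, lifting))
qed

lemma (in collection_class) rec_rk:
  assumes "rec S f" shows "rec S (\<lambda>x. rk k (\<lambda>i. i \<in> elts (f x)))"
  unfolding rk_def
proof (rule rec_lst)
  show "dec S (\<lambda>z. 0 < sn z \<and> (\<forall>i<k. i \<in> elts (f (fs z)) \<longrightarrow> (\<exists>q\<le>sn z. sn z = (cm k * (i + 1) + 1) * q)))"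
    by (intro dc rec_comp[OF assms])
  show "\<exists>n. 0 < n \<and> (\<forall>i<k. i \<in> elts (f x) \<longrightarrow> (\<exists>q\<le>n. n = (cm k * (i + 1) + 1) * q))" for x
    using cp_props(1)[of k] cp_props(2)[of _ k, unfolded dvd_bounded1] by (intro exI[of _ "cp k"]) simp
qed

text \<open>A condition is a node with a set E of computations that converge on it, such that the
  subtree on which no other computation below b converges reaches every level. This last requirement
  is Pi_1 over S, hence decidable in \<open>T\<close>, so that \<open>jump_control\<close> applies
  with \<open>T\<close> itself.\<close>

lemma low_basis:
  fixes S :: "'a::arith set set"
  assumes S: "good S C T" and K: "tree K" "K \<in> S"
  obtains G C' where "good (ext S G) C' T" "S \<subseteq> ext S G" "G \<in> ext S G" "\<And>n. str G n \<in> K"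
proof -
  interpret S: collection_class S using S by (simp add: good_def)
  interpret T: collection_class T using S by (simp add: good_def)
  have ST: "S \<subseteq> T" and CS: "C \<in> S" using S by (auto simp: good_def)
  then have CT: "C \<in> T" and KT: "K \<in> T" using K by auto
  note tK = treeD[OF K(1)]
  define good_node where "good_node \<sigma> n b E N v \<longleftrightarrow> v \<in> K \<and> fs v = N \<and> rs v n = \<sigma> \<and> (\<forall>w<b. w \<notin> elts E \<longrightarrow> \<not> cv C N w v)"
    for \<sigma> n b E N v
  \<comment> \<open>Nodes of level N satisfy the bound on v anyway; stating it makes
    \<open>HN\<close> decidable in S and \<open>H\<close> a Pi_1 predicate.\<close>
  define HN where "HN \<sigma> n b E N \<longleftrightarrow> (n \<le> N \<longrightarrow> (\<exists>v<\<langle>N, pw N\<rangle>. good_node \<sigma> n b E N v))" for \<sigma> n b E N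
  have HNI: "HN \<sigma> n b E N" if g: "n \<le> N \<Longrightarrow> good_node \<sigma> n b E N v" for \<sigma> n b E N v
    unfolding HN_def
  proof
    assume "n \<le> N"
    then have v: "good_node \<sigma> n b E N v" by (rule g)
    then have "v < \<langle>N, pw N\<rangle>" using S.rs_eq_of_tree[OF K(1), of v N] unfolding good_node_def by blast
    then show "\<exists>v<\<langle>N, pw N\<rangle>. good_node \<sigma> n b E N v" using v by blast
  qed
  have HND: "\<exists>v. good_node \<sigma> n b E N v" if "HN \<sigma> n b E N" "n \<le> N" for \<sigma> n b E N
    using that unfolding HN_def by blast
  have dgn: "dec S (\<lambda>z. good_node (f1 z) (f2 z) (f3 z) (f4 z) (f5 z) (f6 z))"
    if "rec S f1" "rec S f2" "rec S f3" "rec S f4" "rec S f5" "rec S f6" for f1 f2 f3 f4 f5 f6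
  proof -
    have "dec S (\<lambda>z. good_node (fs z) (fs (sn z)) (fs (sn (sn z))) (fs (sn (sn (sn z)))) (fs (sn (sn (sn (sn z)))))
        (sn (sn (sn (sn (sn z))))))" unfolding good_node_def by (intro dc CS K)
    from S.dec_comp[OF this S.rec_pr[OF that(1) S.rec_pr[OF that(2) S.rec_pr[OF that(3) S.rec_pr[OF that(4) S.rec_pr[OF that(5,6)]]]]]]
    show ?thesis by simp
  qed
  have dHN: "dec S (\<lambda>z. HN (f1 z) (f2 z) (f3 z) (f4 z) (f5 z))"
    if "rec S f1" "rec S f2" "rec S f3" "rec S f4" "rec S f5" for f1 f2 f3 f4 f5
  proof -
    have "dec S (\<lambda>z. HN (fs z) (fs (sn z)) (fs (sn (sn z))) (fs (sn (sn (sn z)))) (sn (sn (sn (sn z)))))"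
      unfolding HN_def by (intro dc dgn)
    from S.dec_comp[OF this S.rec_pr[OF that(1) S.rec_pr[OF that(2) S.rec_pr[OF that(3) S.rec_pr[OF that(4,5)]]]]]
    show ?thesis by simp
  qed
  define H where "H \<sigma> n b E \<longleftrightarrow> (\<forall>N. HN \<sigma> n b E N)" for \<sigma> n b E
  have dH: "dec T (\<lambda>z. H (f1 z) (f2 z) (f3 z) (f4 z))"
    if "rec T f1" "rec T f2" "rec T f3" "rec T f4" for f1 f2 f3 f4
  proof -
    have "dec T (\<lambda>z. H (fs z) (fs (sn z)) (fs (sn (sn z))) (sn (sn (sn z))))"
      unfolding H_def by (rule good_pi1[OF S]) (intro dHN dc)
    from T.dec_comp[OF this T.rec_pr[OF that(1) T.rec_pr[OF that(2) T.rec_pr[OF that(3,4)]]]]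
    show ?thesis by simp
  qed
  define Val where "Val c \<longleftrightarrow> fs c \<in> K \<and> (\<forall>w\<in>elts (sn (sn c)). w < fs (sn c) \<and> cv C (fs (fs c)) w (fs c)) \<and>
     H (fs c) (fs (fs c)) (fs (sn c)) (sn (sn c))" for c
  obtain \<sigma>0 where s0: "\<sigma>0 \<in> K" "fs \<sigma>0 = 0" using tK(3) by blast
  have e0: "elts (0::'a) = {}" using elts_less not_less_zero by blast
  show ?thesis
  proof (rule jump_control[where n = "\<lambda>c. fs (fs c)" and s = "\<lambda>c. sn (fs c)" and b = "\<lambda>c. fs (sn c)" and
        E = "\<lambda>c. sn (sn c)" and Val = Val and ?c0.0 = "\<langle>\<sigma>0, \<langle>0, 0\<rangle>\<rangle>", OF S])
    show "countable T" "collection_class T" using S by (simp_all add: good_def)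
    show "rec T (\<lambda>c. sn (fs c))" "rec T (\<lambda>c. fs (fs c))" "rec T (\<lambda>c. fs (sn c))" "rec T (\<lambda>c. sn (sn c))" by (intro dc)+
    show "fs (sn c) \<le> c" for c :: 'a using fs_le sn_le order_trans by blast
    show "dec T Val" unfolding Val_def using CT KT by (intro dc dH)
    have gn: "good_node \<sigma>0 0 0 0 N v" if "v \<in> K" "fs v = N" for N v
    proof -
      have "rs v 0 = rs \<sigma>0 0" unfolding rs_def str_def by simp
      then show ?thesis unfolding good_node_def using that tK(1)[OF s0(1)] s0(2) by simp
    qed
    have "H \<sigma>0 0 0 0" unfolding H_def
    proof
      fix N
      obtain v where "v \<in> K" "fs v = N" using tK(3) by blast
      then show "HN \<sigma>0 0 0 0 N" by (intro HNI[OF gn])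
    qed
    then show "Val \<langle>\<sigma>0, \<langle>0, 0\<rangle>\<rangle>" unfolding Val_def using s0 e0 by simp
    show "\<exists>m\<le>fs (fs c). Uc C w (str (elts (sn (fs c))) m)" if "Val c" "w \<in> elts (sn (sn c))" for c w
    proof -
      have "cv C (fs (fs c)) w (fs c)" using that unfolding Val_def by blast
      from cv_Uc[OF this] show ?thesis unfolding rs_def using less_imp_le by blast
    qed
    show "\<not> Uc C w (str (elts (sn (fs c))) m)" if c: "Val c" "w < fs (sn c)" "w \<notin> elts (sn (sn c))" "m \<le> fs (fs c)" for c w m
    proof
      assume "Uc C w (str (elts (sn (fs c))) m)"
      then have U: "Uc C w (rs (fs c) m)" by (simp add: rs_def)
      have "H (fs c) (fs (fs c)) (fs (sn c)) (sn (sn c))" using c(1) unfolding Val_def by blast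
      then have HN: "HN (fs c) (fs (fs c)) (fs (sn c)) (sn (sn c)) N" for N unfolding H_def by blast
      obtain t where t: "\<langle>fs w, \<langle>\<langle>sn w, rs (fs c) m\<rangle>, t\<rangle>\<rangle> \<in> C" using U unfolding Uc_def by blast
      let ?N = "fs (fs c) + t + 1"
      have le: "fs (fs c) \<le> ?N" by (simp add: add.assoc)
      obtain v where v: "good_node (fs c) (fs (fs c)) (fs (sn c)) (sn (sn c)) ?N v" using HND[OF HN le] by blast
      have "rs v m = rs (rs v (fs (fs c))) m" using S.rs_rs[OF c(4)] by simp
      then have "rs v m = rs (fs c) m" using v unfolding good_node_def by simp
      moreover have "m < ?N" "t < ?N" using c(4) by (auto simp: less_add1_iff intro: add_increasing2)
      ultimately have "cv C ?N w v" unfolding cv_def using t by metis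
      then show False using v c(2,3) unfolding good_node_def by blast
    qed
    show "\<exists>c'. Val c' \<and> (fs (fs c) \<le> fs (fs c') \<and> fs (sn c) \<le> fs (sn c') \<and>
        (\<forall>x<fs (fs c). x \<in> elts (sn (fs c')) \<longleftrightarrow> x \<in> elts (sn (fs c))) \<and>
        (\<forall>x<fs (sn c). x \<in> elts (sn (sn c')) \<longleftrightarrow> x \<in> elts (sn (sn c)))) \<and> a \<le> fs (sn c') \<and> a \<le> fs (fs c')"
      if c: "Val c" for c a
    proof -
      define \<sigma> where "\<sigma> = fs c"
      define n where "n = fs \<sigma>"
      define b where "b = fs (sn c)"
      define E where "E = sn (sn c)"
      have c1: "\<sigma> \<in> K" "\<And>w. w \<in> elts E \<Longrightarrow> w < b" "\<And>w. w \<in> elts E \<Longrightarrow> cv C n w \<sigma>" "H \<sigma> n b E"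
        using c unfolding Val_def \<sigma>_def n_def b_def E_def by blast+
      define b' where "b' = b + a"
      define adm where "adm X \<longleftrightarrow> (\<forall>w\<in>elts X. w < b') \<and> (\<forall>w<b. w \<in> elts X \<longleftrightarrow> w \<in> elts E) \<and> H \<sigma> n b' X" for X
      have dH': "dec T (\<lambda>X. H \<sigma> n b' X)" by (intro dH dc)
      let ?P0 = "\<lambda>w. w \<in> elts E \<or> b \<le> w"
      have d0: "dec S ?P0" by (intro dc)
      \<comment> \<open>Allowing every computation from b up to \<open>b'\<close> to converge adds
        no demand on the subtree, so there is an admissible set to start from.\<close>
      define X0 where "X0 = cod {w. w < b' \<and> ?P0 w}"
      have eX0: "elts X0 = {w. w < b' \<and> ?P0 w}" unfolding X0_def by (rule S.elts_cod_Collect[OF d0])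
      have bb': "b \<le> b'" by (simp add: b'_def)
      have "adm X0" unfolding adm_def
      proof (intro conjI allI impI ballI)
        show "w < b'" if "w \<in> elts X0" for w using that unfolding eX0 by blast
        show "w \<in> elts X0 \<longleftrightarrow> w \<in> elts E" if "w < b" for w using that bb' unfolding eX0 by auto
        show "H \<sigma> n b' X0" unfolding H_def
        proof
          fix N
          have "good_node \<sigma> n b' X0 N v" if "good_node \<sigma> n b E N v" for v
          proof -
            have "w < b \<and> w \<notin> elts E" if "w < b'" "w \<notin> elts X0" for w using that unfolding eX0 by (auto simp: not_le)
            then show ?thesis using that unfolding good_node_def by blast
          qed
          then show "HN \<sigma> n b' X0 N" using c1(4) unfolding H_def HN_def by blast
        qed
      qed
      \<comment> \<open>Minimal rank stands in for minimality under inclusion, because only the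
        former is accessible to the least number principle. Once X has minimal rank, dropping any
        new w from it is no longer admissible.\<close>
      define Rk where "Rk r \<longleftrightarrow> (\<exists>X<pw b'. adm X \<and> rk b' (\<lambda>w. w \<in> elts X) = r)" for r
      have dRk: "dec T Rk" unfolding Rk_def adm_def by (intro dc T.rec_rk T.dec_comp[OF dH'])
      have X0less: "X0 < pw b'" unfolding X0_def by (rule S.cod_less_pw[OF d0])
      then have "Rk (rk b' (\<lambda>w. w \<in> elts X0))" unfolding Rk_def using \<open>adm X0\<close> by blast
      then obtain r where r: "Rk r" and rmin: "\<And>r'. r' < r \<Longrightarrow> \<not> Rk r'"
        using T.dec_least[OF dRk] by blast
      obtain X where X: "adm X" "rk b' (\<lambda>w. w \<in> elts X) = r" using r unfolding Rk_def by blast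
      define Xm where "Xm w = cod {i. i < b' \<and> (i \<in> elts X \<and> i \<noteq> w)}" for w
      have dXm: "dec S (\<lambda>i. i \<in> elts X \<and> i \<noteq> w)" for w by (intro dc)
      have eXm: "elts (Xm w) = {i. i < b' \<and> (i \<in> elts X \<and> i \<noteq> w)}" for w unfolding Xm_def by (rule S.elts_cod_Collect[OF dXm])
      have recXm: "rec S Xm" unfolding Xm_def[abs_def] by (intro dc)
      have Xb: "w < b'" if "w \<in> elts X" for w using X(1) that unfolding adm_def by blast
      have fail: "\<exists>N. \<not> HN \<sigma> n b' (Xm w) N" if w: "w \<in> elts X" "b \<le> w" for w
      proof (rule ccontr)
        assume "\<not> ?thesis"
        then have "H \<sigma> n b' (Xm w)" unfolding H_def by blast
        then have "adm (Xm w)" using X(1) w(2) bb' unfolding adm_def eXm by auto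
        moreover have "Xm w < pw b'" unfolding Xm_def by (rule S.cod_less_pw[OF dXm])
        moreover have "rk b' (\<lambda>i. i \<in> elts (Xm w)) < r" unfolding X(2)[symmetric]
        proof (rule S.rk_remove)
          show "dec S (\<lambda>i. i \<in> elts (Xm w))" "dec S (\<lambda>i. i \<in> elts X)" by (intro dc)+
        qed (use w Xb in \<open>auto simp: eXm\<close>)
        ultimately show False using rmin unfolding Rk_def by blast
      qed
      define Q where "Q w N \<longleftrightarrow> (w \<in> elts X \<and> b \<le> w \<longrightarrow> \<not> HN \<sigma> n b' (Xm w) N)" for w N
      have dQ: "dec S (\<lambda>z. Q (fs z) (sn z))" unfolding Q_def by (intro dc dHN S.rec_comp[OF recXm])
      have "\<exists>N. Q w N" for w using fail unfolding Q_def by blast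
      \<comment> \<open>By collection, the subtrees that belong to X with one new w dropped all have
        a level without nodes below a common bound.\<close>
      from S.dec_collection[of Q, OF dQ this] obtain B where B: "\<forall>w<b'. \<exists>N<B. Q w N" by blast
      define N1 where "N1 = B + n + a"
      have nN1: "n \<le> N1" "a \<le> N1" "B \<le> N1" unfolding N1_def by (simp_all add: add.assoc add_increasing)
      \<comment> \<open>Restrict v to the level where the subtree for X without w has no node: some
        computation outside that set converges there. As v is good for X, this computation is w
        itself.\<close>
      have conv: "cv C N1 w v" if v: "good_node \<sigma> n b' X N1 v" and w: "w \<in> elts X" "b \<le> w" for v w
      proof -
        obtain N where N: "N < B" "Q w N" using B Xb[OF w(1)] by blast
        then have nHN: "\<not> HN \<sigma> n b' (Xm w) N" using w unfolding Q_def by blast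
        then have "n \<le> N" unfolding HN_def by blast
        have NN1: "N \<le> N1" using N(1) nN1(3) by simp
        have vK: "v \<in> K" "fs v = N1" "rs v n = \<sigma>" using v unfolding good_node_def by blast+
        have "rs v N \<in> K" using tK(2)[OF vK(1)] vK(2) NN1 by simp
        moreover have "rs (rs v N) n = \<sigma>" using S.rs_rs[OF \<open>n \<le> N\<close>] vK(3) by simp
        moreover have "\<not> good_node \<sigma> n b' (Xm w) N (rs v N)" using nHN HNI by blast
        ultimately obtain w' where w': "w' < b'" "w' \<notin> elts (Xm w)" "cv C N w' (rs v N)" unfolding good_node_def by auto
        have "rs (rs v N) N = rs v N" by (rule S.rs_rs) simp
        then have "cv C N w' v" using S.cv_agree[of "rs v N" N v N] w'(3) by simp
        then have "cv C N1 w' v" using NN1 by (rule cv_mono)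
        moreover from this have "w' \<in> elts X" using v w'(1) unfolding good_node_def by blast
        ultimately show ?thesis using w'(1,2) unfolding eXm by blast
      qed
      have HX: "H \<sigma> n b' X" using X(1) unfolding adm_def by blast
      \<comment> \<open>There are boundedly many nodes on level \<open>N1\<close>. If each of them
        failed to have good extensions on some level, collection would bound these levels, and a
        good node beyond the bound would contradict the failure of its own restriction to
        \<open>N1\<close>.\<close>
      have "\<exists>v. good_node \<sigma> n b' X N1 v \<and> H v N1 b' X"
      proof (rule ccontr)
        assume no: "\<not> ?thesis"
        define Q' where "Q' v N \<longleftrightarrow> (good_node \<sigma> n b' X N1 v \<longrightarrow> \<not> HN v N1 b' X N)" for v N
        have dQ': "dec S (\<lambda>z. Q' (fs z) (sn z))" unfolding Q'_def by (intro dc dHN dgn)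
        have "\<exists>N. Q' v N" for v using no unfolding Q'_def H_def by blast
        from S.dec_collection[of Q', OF dQ' this] obtain B2 where B2: "\<forall>v<\<langle>N1, pw N1\<rangle>. \<exists>N<B2. Q' v N" by blast
        have le2: "N1 \<le> N1 + B2" "n \<le> N1 + B2" using nN1(1) by (simp_all add: add_increasing2)
        obtain v' where v': "good_node \<sigma> n b' X (N1 + B2) v'" using HND[of \<sigma> n b' X "N1 + B2"] HX le2 unfolding H_def by blast
        have v'K: "v' \<in> K" "fs v' = N1 + B2" "rs v' n = \<sigma>" "\<And>w. w < b' \<Longrightarrow> w \<notin> elts X \<Longrightarrow> \<not> cv C (N1 + B2) w v'"
          using v' unfolding good_node_def by blast+
        have restr: "rs v' N \<in> K" "fs (rs v' N) = N" "\<And>w. w < b' \<Longrightarrow> w \<notin> elts X \<Longrightarrow> \<not> cv C N w (rs v' N)" if "N \<le> N1 + B2" for N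
        proof -
          show "rs v' N \<in> K" "fs (rs v' N) = N" using tK(2)[OF v'K(1)] v'K(2) that by simp_all
          show "\<not> cv C N w (rs v' N)" if w: "w < b'" "w \<notin> elts X" for w
          proof
            assume "cv C N w (rs v' N)"
            moreover have "rs (rs v' N) N = rs v' N" by (rule S.rs_rs) simp
            ultimately have "cv C N w v'" using S.cv_agree[of "rs v' N" N v' N] by simp
            then show False using cv_mono[OF _ \<open>N \<le> N1 + B2\<close>] v'K(4)[OF w] by blast
          qed
        qed
        let ?v = "rs v' N1"
        have gv: "good_node \<sigma> n b' X N1 ?v" unfolding good_node_def
          using restr[OF le2(1)] S.rs_rs[OF nN1(1), of v'] v'K(3) by simp
        obtain N where N: "N < B2" "Q' ?v N" using B2 S.rs_less[of v' N1] by blast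
        have nHN: "\<not> HN ?v N1 b' X N" using N(2) gv unfolding Q'_def by blast
        then have N1N: "N1 \<le> N" unfolding HN_def by blast
        have "N \<le> N1 + B2" using N(1) by (simp add: add_increasing less_imp_le)
        then have "good_node ?v N1 b' X N (rs v' N)" unfolding good_node_def
          using restr[of N] S.rs_rs[OF N1N, of v'] by simp
        then show False using nHN HNI by blast
      qed
      then obtain v where v: "good_node \<sigma> n b' X N1 v" "H v N1 b' X" by blast
      have vK: "v \<in> K" "fs v = N1" "rs v n = \<sigma>" using v(1) unfolding good_node_def by blast+
      have "cv C N1 w v" if w: "w \<in> elts X" for w
      proof (cases "b \<le> w")
        case True then show ?thesis using conv[OF v(1) w] by blast
      next
        case False
        then have "w \<in> elts E" using X(1) w unfolding adm_def by (meson not_le)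
        then have "cv C n w \<sigma>" by (rule c1(3))
        moreover have "rs v n = rs \<sigma> n" using vK(3) tK(1)[OF c1(1)] n_def by simp
        ultimately have "cv C n w v" using S.cv_agree[of v n \<sigma> n] by simp
        then show ?thesis using nN1(1) by (rule cv_mono)
      qed
      then have "Val \<langle>v, \<langle>b', X\<rangle>\<rangle>" unfolding Val_def using vK v(2) Xb by simp
      moreover have "x \<in> elts (sn v) \<longleftrightarrow> x \<in> elts (sn \<sigma>)" if "x < n" for x
      proof -
        have "elts (sn \<sigma>) = {x. x < n \<and> x \<in> elts (sn v)}" using S.elts_rs[of v n] vK(3) by simp
        then show ?thesis using that by blast
      qed
      moreover have "x \<in> elts X \<longleftrightarrow> x \<in> elts E" if "x < b" for x using X(1) that unfolding adm_def by blast
      moreover have "a \<le> b'" by (simp add: b'_def add_increasing)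
      ultimately show ?thesis using nN1 bb' vK(2) unfolding \<sigma>_def[symmetric] n_def[symmetric] b_def[symmetric] E_def[symmetric]
        by (intro exI[of _ "\<langle>v, \<langle>b', X\<rangle>\<rangle>"]) simp
    qed
    fix G C'
    assume G: "good (ext S G) C' T" "S \<subseteq> ext S G" "G \<in> ext S G"
      and approx: "\<And>a. \<exists>c. Val c \<and> a \<le> fs (fs c) \<and> a \<le> fs (sn c) \<and> (\<forall>x<fs (fs c). x \<in> G \<longleftrightarrow> x \<in> elts (sn (fs c)))"
    have "str G n \<in> K" for n
    proof -
      obtain c where c: "Val c" "n \<le> fs (fs c)" "\<forall>x<fs (fs c). x \<in> G \<longleftrightarrow> x \<in> elts (sn (fs c))" using approx by blast
      have "{x. x < n \<and> x \<in> G} = {x. x < n \<and> x \<in> elts (sn (fs c))}" using c(2,3) by (auto dest: less_le_trans)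
      then have "str G n = rs (fs c) n" unfolding rs_def str_def by (simp only:)
      also have "\<dots> \<in> K" using tK(2)[of "fs c" n] c(1,2) unfolding Val_def by blast
      finally show ?thesis .
    qed
    then show thesis using G that by blast
  qed simp
qed

section \<open>Groupings\<close>

definition unb :: "'a::arith set \<Rightarrow> bool" where
  "unb X \<longleftrightarrow> (\<forall>b. \<exists>y>b. y \<in> X)"

text \<open>The columns of Z with indices below d are d sets, so one number codes a finite family of
  finite sets.\<close>

definition homs :: "'a::arith \<Rightarrow> 'a set \<Rightarrow> 'a \<Rightarrow> bool" where
  "homs d Z c \<longleftrightarrow> (\<forall>j<d. (\<forall>x\<in>elts c. \<langle>j, x\<rangle> \<in> Z) \<or> (\<forall>x\<in>elts c. \<langle>j, x\<rangle> \<notin> Z))"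

lemma homs_cong:
  assumes "\<And>z. z < N \<Longrightarrow> z \<in> Z \<longleftrightarrow> z \<in> Z'" "\<langle>d, c\<rangle> \<le> N" shows "homs d Z c \<longleftrightarrow> homs d Z' c"
proof -
  have "\<langle>j, x\<rangle> \<in> Z \<longleftrightarrow> \<langle>j, x\<rangle> \<in> Z'" if "j < d" "x \<in> elts c" for j x
  proof -
    have "\<langle>j, x\<rangle> < \<langle>d, c\<rangle>" using that elts_less[of x c] by (intro pr_less_of_sum_less add_strict_mono)
    then show ?thesis using assms by (meson less_le_trans)
  qed
  then show ?thesis unfolding homs_def by blast
qed

lemma homs_antimono: "homs d Z c \<Longrightarrow> d' \<le> d \<Longrightarrow> homs d' Z c"
  unfolding homs_def by (meson less_le_trans)

lemma (in collection_class) dec_homs [dc]: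
  assumes "rec S f" "rec S g" "rec S h" shows "dec S (\<lambda>x. homs (f x) (elts (g x)) (h x))"
proof -
  have "dec S (\<lambda>z. homs (fs z) (elts (fs (sn z))) (sn (sn z)))" unfolding homs_def by (intro dc)
  from dec_comp[OF this rec_pr[OF assms(1) rec_pr[OF assms(2,3)]]] show ?thesis by simp
qed

text \<open>If \<^term>\<open>L\<close> can be avoided inside \<^term>\<open>X\<close> by the homogeneous sets of finite families of
  sets, then a low such family makes \<^term>\<open>L\<close> fail to be a largeness notion.\<close>

lemma avoid_large:
  fixes S :: "'a::arith set set"
  assumes S: "good S C T" and L: "L \<in> S" and X: "X \<in> S" "unb X"
    and avoid: "\<And>N. \<exists>Z. \<forall>c\<in>L. elts c \<subseteq> X \<longrightarrow> \<langle>d, c\<rangle> < N \<longrightarrow> \<not> homs d (elts Z) c"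
  obtains S' C' Y where "good S' C' T" "S \<subseteq> S'" "Y \<in> S'" "unb Y" "\<And>c. c \<in> L \<Longrightarrow> \<not> elts c \<subseteq> Y"
proof -
  interpret S: collection_class S using S by (simp add: good_def)
  interpret T: collection_class T using S by (simp add: good_def)
  \<comment> \<open>A string is an initial part of a family and stays in the tree as long as it
    shows no member of L inside X to be homogeneous. By \<open>homs_cong\<close> the string
    determines this for c once \<open>\<langle>d, c\<rangle>\<close> is below its length.\<close>
  let ?K = "\<lambda>\<sigma>. rs \<sigma> (fs \<sigma>) = \<sigma> \<and> (\<forall>c<fs \<sigma>. c \<in> L \<and> (\<forall>x\<in>elts c. x \<in> X) \<and> \<langle>d, c\<rangle> < fs \<sigma> \<longrightarrow> \<not> homs d (elts (sn \<sigma>)) c)"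
  define K where "K = {\<sigma>. ?K \<sigma>}"
  have "dec S ?K" by (intro dc L X)
  then have KS: "K \<in> S" unfolding K_def by (rule S.dec_set)
  have K_rs: "rs \<sigma> n \<in> K" if "\<forall>c\<in>L. elts c \<subseteq> X \<longrightarrow> \<langle>d, c\<rangle> < n \<longrightarrow> \<not> homs d (elts (sn \<sigma>)) c" for \<sigma> n
  proof -
    have "homs d (elts (sn (rs \<sigma> n))) c \<longleftrightarrow> homs d (elts (sn \<sigma>)) c" if "\<langle>d, c\<rangle> < n" for c
      by (rule homs_cong[of n]) (use that in auto)
    then show ?thesis unfolding K_def using that S.rs_rs[of n n \<sigma>] by auto
  qed
  have "tree K" unfolding tree_def
  proof (intro conjI ballI allI impI)
    fix \<sigma> assume s: "\<sigma> \<in> K"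
    then show "rs \<sigma> (fs \<sigma>) = \<sigma>" unfolding K_def by blast
    fix m assume m: "m \<le> fs \<sigma>"
    show "rs \<sigma> m \<in> K"
    proof (rule K_rs, intro ballI impI)
      fix c assume c: "c \<in> L" "elts c \<subseteq> X" "\<langle>d, c\<rangle> < m"
      have "\<langle>d, c\<rangle> < fs \<sigma>" using c(3) m by (rule less_le_trans)
      moreover from this have "c < fs \<sigma>" using pr_ge2 by (rule le_less_trans[rotated])
      ultimately show "\<not> homs d (elts (sn \<sigma>)) c" using s c(1,2) unfolding K_def by blast
    qed
  next
    fix n
    obtain Z where Z: "\<forall>c\<in>L. elts c \<subseteq> X \<longrightarrow> \<langle>d, c\<rangle> < n \<longrightarrow> \<not> homs d (elts Z) c" using avoid by blast
    have "rs \<langle>0, Z\<rangle> n \<in> K" by (rule K_rs) (use Z in simp)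
    then show "\<exists>\<sigma>\<in>K. fs \<sigma> = n" by (intro bexI[of _ "rs \<langle>0, Z\<rangle> n"]) simp_all
  qed
  from low_basis[OF S this KS] obtain G C'
    where G: "good (ext S G) C' T" "S \<subseteq> ext S G" "G \<in> ext S G" "\<And>n. str G n \<in> K" by metis
  interpret S': collection_class "ext S G" using G(1) by (simp add: good_def)
  have amG: "amen G" by (rule S'.amen[OF G(3)])
  have noG: "\<not> homs d G c" if c: "c \<in> L" "elts c \<subseteq> X" for c
  proof -
    let ?N = "\<langle>d, c\<rangle> + 1"
    have lt: "\<langle>d, c\<rangle> < ?N" "c < ?N" using pr_ge2[of c d] by (auto simp: less_add1_iff)
    have "\<not> homs d (elts (sn (str G ?N))) c" using G(4)[of ?N] c lt unfolding K_def by auto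
    moreover have "homs d (elts (sn (str G ?N))) c \<longleftrightarrow> homs d G c"
      by (rule homs_cong[of ?N]) (use lt in \<open>auto simp: elts_sn_str[OF amG]\<close>)
    ultimately show ?thesis by blast
  qed
  have XS': "X \<in> ext S G" using X G(2) by blast
  define Yp where "Yp v x \<longleftrightarrow> x \<in> X \<and> (\<forall>j<d. j \<in> elts v \<longleftrightarrow> \<langle>j, x\<rangle> \<in> G)" for v x
  have dYp: "dec (ext S G) (\<lambda>z. Yp (f z) (g z))" if "rec (ext S G) f" "rec (ext S G) g" for f g
  proof -
    have "dec (ext S G) (\<lambda>z. Yp (fs z) (sn z))" unfolding Yp_def by (intro dc XS' G(3))
    from S'.dec_comp2[of Yp, OF this that] show ?thesis .
  qed
  \<comment> \<open>Pigeonhole over the patterns that the elements of X have with respect to the d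
    sets. That a pattern occurs boundedly often is Pi_1, so the collection used is that of
    \<open>T\<close>; this is why the family has to be low.\<close>
  have "\<exists>v. unb {x. Yp v x}"
  proof (rule ccontr)
    assume no: "\<not> ?thesis"
    have "\<exists>b. \<forall>x. Yp v x \<longrightarrow> x \<le> b" for v using no unfolding unb_def mem_Collect_eq by (meson not_less)
    moreover have "dec T (\<lambda>z. \<forall>x. Yp (fs z) x \<longrightarrow> x \<le> sn z)"
      by (rule good_pi1[OF G(1)]) (intro dc dYp)
    ultimately obtain B where B: "\<forall>v<pw d. \<exists>b<B. \<forall>x. Yp v x \<longrightarrow> x \<le> b"
      using T.dec_collection[of "\<lambda>v b. \<forall>x. Yp v x \<longrightarrow> x \<le> b" "pw d"] by blast
    obtain x where x: "x > B" "x \<in> X" using X(2) unfolding unb_def by blast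
    have dG: "dec (ext S G) (\<lambda>j. \<langle>j, x\<rangle> \<in> G)" by (intro dc G(3))
    let ?v = "cod {j. j < d \<and> \<langle>j, x\<rangle> \<in> G}"
    have "Yp ?v x" unfolding Yp_def S'.elts_cod_Collect[OF dG] using x by blast
    moreover have "?v < pw d" by (rule S'.cod_less_pw[OF dG])
    ultimately obtain b where "b < B" "x \<le> b" using B by blast
    then show False using x(1) by auto
  qed
  then obtain v where v: "unb {x. Yp v x}" by blast
  have Y: "{x. Yp v x} \<in> ext S G" by (rule S'.dec_set) (intro dYp dc)
  have "\<not> elts c \<subseteq> {x. Yp v x}" if "c \<in> L" for c
  proof
    assume c: "elts c \<subseteq> {x. Yp v x}"
    then have "homs d G c" unfolding homs_def Yp_def by blast
    moreover have "elts c \<subseteq> X" using c unfolding Yp_def by blast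
    ultimately show False using noG[OF \<open>c \<in> L\<close>] by blast
  qed
  then show ?thesis using that[of "ext S G" C' "{x. Yp v x}"] G Y v by blast
qed

section \<open>Unions of coded sets\<close>

definition un :: "'a::arith \<Rightarrow> 'a \<Rightarrow> 'a" where
  "un s t = cod (elts s \<union> elts t)"

context collection_class begin

lemma un_eq:
  assumes "\<And>x. x \<in> elts s \<Longrightarrow> x < k" "\<And>x. x \<in> elts t \<Longrightarrow> x < (k::'a)"
  shows "un s t = cod {x. x < k \<and> (x \<in> elts s \<or> x \<in> elts t)}"
proof -
  have "elts s \<union> elts t = {x. x < k \<and> (x \<in> elts s \<or> x \<in> elts t)}" using assms by blast
  then show ?thesis unfolding un_def by (simp only:)
qed

lemma un_eq_add: "un s t = cod {x. x < s + t \<and> (x \<in> elts s \<or> x \<in> elts (t::'a))}"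
proof (rule un_eq)
  show "x < s + t" if "x \<in> elts s" for x
  proof -
    have "s \<le> s + t" by simp
    with elts_less[OF that] show ?thesis by (rule less_le_trans)
  qed
  show "x < s + t" if "x \<in> elts t" for x
  proof -
    have "t \<le> s + t" by simp
    with elts_less[OF that] show ?thesis by (rule less_le_trans)
  qed
qed

lemma rec_un [dc]: assumes "rec S f" "rec S g" shows "rec S (\<lambda>x. un (f x) (g x))"
proof -
  have "rec S (\<lambda>z. un (fs z) (sn z))" unfolding un_eq_add by (intro dc)
  from rec_comp2[of un, OF this assms] show ?thesis .
qed

lemma elts_un [simp]: "elts (un s (t::'a)) = elts s \<union> elts t"
proof -
  have d: "dec S (\<lambda>x. x \<in> elts s \<or> x \<in> elts t)" by (intro dc)
  have "elts (un s t) = {x. x < s + t \<and> (x \<in> elts s \<or> x \<in> elts t)}"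
    unfolding un_eq_add by (rule elts_cod_Collect[OF d])
  moreover have "x < s + t" if "x \<in> elts s \<or> x \<in> elts t" for x
    using that
  proof
    assume "x \<in> elts s"
    moreover have "s \<le> s + t" by simp
    ultimately show ?thesis using elts_less less_le_trans by blast
  next
    assume "x \<in> elts t"
    moreover have "t \<le> s + t" by simp
    ultimately show ?thesis using elts_less less_le_trans by blast
  qed
  ultimately show ?thesis by blast
qed

lemma un_less_pw:
  assumes "\<And>x. x \<in> elts s \<Longrightarrow> x < k" "\<And>x. x \<in> elts t \<Longrightarrow> x < (k::'a)"
  shows "un s t < pw k"
proof -
  have "dec S (\<lambda>x. x \<in> elts s \<or> x \<in> elts t)" by (intro dc)
  then have "cod {x. x < k \<and> (x \<in> elts s \<or> x \<in> elts t)} < pw k" by (rule cod_less_pw)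
  moreover have "un s t = cod {x. x < k \<and> (x \<in> elts s \<or> x \<in> elts t)}" by (rule un_eq) (use assms in auto)
  ultimately show ?thesis by (simp only:)
qed

lemma cv_sets:
  assumes "\<And>x. x < n \<Longrightarrow> x \<in> elts u \<longleftrightarrow> x \<in> elts (u'::'a)" "N \<le> n"
  shows "cv C N w \<langle>0, u\<rangle> \<longleftrightarrow> cv C N w \<langle>0, u'\<rangle>"
proof (rule cv_agree[OF _ assms(2)])
  have "{x. x < n \<and> x \<in> elts u} = {x. x < n \<and> x \<in> elts u'}" using assms(1) by blast
  then show "rs \<langle>0, u\<rangle> n = rs \<langle>0, u'\<rangle> n" unfolding rs_def str_def sn_pr by (simp only:)
qed

lemma cv_sets_eq: "elts u = elts (u'::'a) \<Longrightarrow> cv C N w \<langle>0, u\<rangle> \<longleftrightarrow> cv C N w \<langle>0, u'\<rangle>"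
  by (rule cv_sets[of N]) simp_all

end

lemma dec_mono: "S \<subseteq> T \<Longrightarrow> dec S P \<Longrightarrow> dec T P"
  unfolding dec_def by blast

lemma rec_mono: "S \<subseteq> T \<Longrightarrow> rec S f \<Longrightarrow> rec T f"
  unfolding rec_def by (rule dec_mono)

lemma elts_0 [simp]: "elts (0::'a::arith) = {}"
  using elts_less not_less_zero by blast

section \<open>Conditions for building a grouping\<close>

definition homt :: "'a::arith \<Rightarrow> 'a \<Rightarrow> 'a \<Rightarrow> bool" where
  "homt d Z \<tau> \<longleftrightarrow> (\<forall>c\<in>elts \<tau>. homs d (elts Z) c)"

lemma (in collection_class) dec_homt [dc]:
  assumes "rec S f" "rec S g" "rec S h" shows "dec S (\<lambda>x. homt (f x) (g x) (h x))"
proof -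
  have "dec S (\<lambda>z. homt (fs z) (fs (sn z)) (sn (sn z)))" unfolding homt_def by (intro dc)
  from dec_comp[OF this rec_pr[OF assms(1) rec_pr[OF assms(2,3)]]] show ?thesis by simp
qed

text \<open>Only the part of a family below \<open>\<langle>d, N\<rangle>\<close> bears on blocks
  below N, so quantifiers over families can be bounded.\<close>

lemma (in collection_class) homt_truncate:
  fixes Z d N :: 'a
  obtains Z' where "Z' < pw \<langle>d, N\<rangle>" "\<And>\<tau>. \<tau> < N \<Longrightarrow> homt d Z' \<tau> \<longleftrightarrow> homt d Z \<tau>"
proof -
  have d: "dec S (\<lambda>x. x \<in> elts Z)" by (intro dc)
  let ?Z = "cod {x. x < \<langle>d, N\<rangle> \<and> x \<in> elts Z}"
  have "homt d ?Z \<tau> \<longleftrightarrow> homt d Z \<tau>" if "\<tau> < N" for \<tau>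
    unfolding homt_def
  proof (intro ball_cong refl homs_cong[of "\<langle>d, N\<rangle>"])
    fix c assume "c \<in> elts \<tau>"
    then have "c < N" using elts_less[of c \<tau>] that by auto
    then show "\<langle>d, c\<rangle> \<le> \<langle>d, N\<rangle>" by (intro pr_mono) auto
  qed (simp add: elts_cod_Collect[OF d])
  then show ?thesis using that[of ?Z] cod_less_pw[OF d] by blast
qed

text \<open>A finite grouping is represented by the set of the codes of its blocks instead of a
  sequence; the numerical order of the codes has to be the order of the blocks.\<close>

definition okp :: "'a::arith set \<Rightarrow> 'a set \<Rightarrow> 'a \<Rightarrow> bool" where
  "okp L R \<tau> \<longleftrightarrow> (\<forall>c\<in>elts \<tau>. c \<in> L) \<and> (\<forall>c\<in>elts \<tau>. \<forall>c'\<in>elts \<tau>. c < c' \<longrightarrow>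
     (\<forall>x\<in>elts c. \<forall>y\<in>elts c'. x < y) \<and>
     ((\<forall>x\<in>elts c. \<forall>y\<in>elts c'. \<langle>x, y\<rangle> \<in> R) \<or> (\<forall>x\<in>elts c. \<forall>y\<in>elts c'. \<langle>x, y\<rangle> \<notin> R)))"

text \<open>A reservoir. Its elements see the numbers below n in the same colors, so a block taken
  from it can follow any block below n on which \<rho> is constant.\<close>

definition res :: "'a::arith set \<Rightarrow> 'a \<Rightarrow> 'a \<Rightarrow> 'a \<Rightarrow> bool" where
  "res R \<rho> n x \<longleftrightarrow> n \<le> x \<and> (\<forall>i<n. i \<in> elts \<rho> \<longleftrightarrow> \<langle>i, x\<rangle> \<in> R)"

definition okx :: "'a::arith set \<Rightarrow> 'a set \<Rightarrow> 'a \<Rightarrow> 'a \<Rightarrow> 'a \<Rightarrow> bool" where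
  "okx L R \<rho> n \<tau> \<longleftrightarrow> okp L R \<tau> \<and> (\<forall>c\<in>elts \<tau>. \<forall>x\<in>elts c. res R \<rho> n x)"

text \<open>P gives the limit colors. A block of constant limit color has a constant product with
  every later block from a reservoir whose pattern is a segment of P covering it.\<close>

definition Phom :: "'a::arith set \<Rightarrow> 'a \<Rightarrow> bool" where
  "Phom P \<tau> \<longleftrightarrow> (\<forall>c\<in>elts \<tau>. (\<forall>x\<in>elts c. x \<in> P) \<or> (\<forall>x\<in>elts c. x \<notin> P))"

text \<open>\<^term>\<open>avoids C L R \<rho> n s b E d N\<close> says that, up to the bound \<^term>\<open>N\<close>, some family of
  \<^term>\<open>d\<close> sets is such that no extension of \<^term>\<open>s\<close> by homogeneous blocks makes a
  computation in \<^term>\<open>{w. w < b} - elts E\<close> converge.\<close>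

definition avoids :: "'a::arith set \<Rightarrow> 'a set \<Rightarrow> 'a set \<Rightarrow> 'a \<Rightarrow> 'a \<Rightarrow> 'a \<Rightarrow> 'a \<Rightarrow> 'a \<Rightarrow> 'a \<Rightarrow> 'a \<Rightarrow> bool" where
  "avoids C L R \<rho> n s b E d N \<longleftrightarrow> (\<exists>Z<pw \<langle>d, N\<rangle>. \<forall>\<tau><N. okx L R \<rho> n \<tau> \<and> homt d Z \<tau> \<longrightarrow>
     (\<forall>w<b. w \<notin> elts E \<longrightarrow> \<not> cv C N w \<langle>0, un s \<tau>\<rangle>))"

text \<open>Since all families of d sets are allowed, this is stronger for larger d: d is the budget
  of further homogeneity demands that can still be imposed on \<tau>.\<close>

definition forces :: "'a::arith set \<Rightarrow> 'a set \<Rightarrow> 'a set \<Rightarrow> 'a \<Rightarrow> 'a \<Rightarrow> 'a \<Rightarrow> 'a \<Rightarrow> 'a \<Rightarrow> 'a \<Rightarrow> bool" where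
  "forces C L R \<rho> n s X d N \<longleftrightarrow> (\<forall>Z<pw \<langle>d, N\<rangle>. \<exists>\<tau><N. okx L R \<rho> n \<tau> \<and> elts \<tau> \<noteq> {} \<and> homt d Z \<tau> \<and>
     (\<forall>w\<in>elts X. cv C N w \<langle>0, un s \<tau>\<rangle>))"

context collection_class begin

lemma dec_elts_empty [dc]: assumes "rec S f" shows "dec S (\<lambda>x. elts (f x) = {})"
proof -
  have "dec S (\<lambda>x. \<forall>y\<in>elts (f x). False)" by (intro dc assms)
  moreover have "(\<forall>y\<in>elts (f x). False) \<longleftrightarrow> elts (f x) = {}" for x by blast
  ultimately show ?thesis by (simp only:)
qed

lemma dec_okp [dc]:
  assumes "L \<in> S" "R \<in> S" "rec S f" shows "dec S (\<lambda>x. okp L R (f x))"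
proof -
  have "dec S (okp L R)" unfolding okp_def[abs_def] by (intro dc assms)
  from dec_comp[OF this assms(3)] show ?thesis .
qed

lemma dec_res [dc]:
  assumes "R \<in> S" "rec S f" "rec S g" "rec S h" shows "dec S (\<lambda>x. res R (f x) (g x) (h x))"
proof -
  have "dec S (\<lambda>z. res R (fs z) (fs (sn z)) (sn (sn z)))" unfolding res_def by (intro dc assms(1))
  from dec_comp[OF this rec_pr[OF assms(2) rec_pr[OF assms(3,4)]]] show ?thesis by simp
qed

lemma dec_okx [dc]:
  assumes "L \<in> S" "R \<in> S" "rec S f" "rec S g" "rec S h" shows "dec S (\<lambda>x. okx L R (f x) (g x) (h x))"
proof -
  have "dec S (\<lambda>z. okx L R (fs z) (fs (sn z)) (sn (sn z)))" unfolding okx_def by (intro dc assms(1,2))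
  from dec_comp[OF this rec_pr[OF assms(3) rec_pr[OF assms(4,5)]]] show ?thesis by simp
qed

lemma dec_Phom [dc]:
  assumes "P \<in> S" "rec S f" shows "dec S (\<lambda>x. Phom P (f x))"
proof -
  have "dec S (Phom P)" unfolding Phom_def[abs_def] by (intro dc assms)
  from dec_comp[OF this assms(2)] show ?thesis .
qed

lemma dec_avoids [dc]:
  assumes "C \<in> S" "L \<in> S" "R \<in> S" "rec S f1" "rec S f2" "rec S f3" "rec S f4" "rec S f5" "rec S f6" "rec S f7"
  shows "dec S (\<lambda>x. avoids C L R (f1 x) (f2 x) (f3 x) (f4 x) (f5 x) (f6 x) (f7 x))"
proof -
  have "dec S (\<lambda>z. avoids C L R (fs z) (fs (sn z)) (fs (sn (sn z))) (fs (sn (sn (sn z)))) (fs (sn (sn (sn (sn z)))))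
      (fs (sn (sn (sn (sn (sn z)))))) (sn (sn (sn (sn (sn (sn z)))))))"
    unfolding avoids_def by (intro dc assms(1-3))
  from dec_comp[OF this rec_pr[OF assms(4) rec_pr[OF assms(5) rec_pr[OF assms(6) rec_pr[OF assms(7) rec_pr[OF assms(8) rec_pr[OF assms(9,10)]]]]]]]
  show ?thesis by simp
qed

lemma dec_forces [dc]:
  assumes "C \<in> S" "L \<in> S" "R \<in> S" "rec S f1" "rec S f2" "rec S f3" "rec S f4" "rec S f5" "rec S f6"
  shows "dec S (\<lambda>x. forces C L R (f1 x) (f2 x) (f3 x) (f4 x) (f5 x) (f6 x))"
proof -
  have "dec S (\<lambda>z. forces C L R (fs z) (fs (sn z)) (fs (sn (sn z))) (fs (sn (sn (sn z)))) (fs (sn (sn (sn (sn z)))))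
      (sn (sn (sn (sn (sn z))))))"
    unfolding forces_def by (intro dc assms(1-3))
  from dec_comp[OF this rec_pr[OF assms(4) rec_pr[OF assms(5) rec_pr[OF assms(6) rec_pr[OF assms(7) rec_pr[OF assms(8,9)]]]]]]
  show ?thesis by simp
qed

lemma avoidsI:
  assumes "\<And>\<tau> w. \<tau> < N \<Longrightarrow> okx L R \<rho> n \<tau> \<Longrightarrow> homt d Z \<tau> \<Longrightarrow> w < b \<Longrightarrow> w \<notin> elts E \<Longrightarrow> \<not> cv C N w \<langle>0, un s (\<tau>::'a)\<rangle>"
  shows "avoids C L R \<rho> n s b E d N"
proof -
  obtain Z' where "Z' < pw \<langle>d, N\<rangle>" "\<And>\<tau>. \<tau> < N \<Longrightarrow> homt d Z' \<tau> \<longleftrightarrow> homt d Z \<tau>" using homt_truncate by blast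
  then show ?thesis unfolding avoids_def using assms by blast
qed

lemma avoidsE:
  assumes "avoids C L R \<rho> n s b E d N"
  obtains Z :: 'a where "\<And>\<tau> w. \<tau> < N \<Longrightarrow> okx L R \<rho> n \<tau> \<Longrightarrow> homt d Z \<tau> \<Longrightarrow> w < b \<Longrightarrow> w \<notin> elts E \<Longrightarrow> \<not> cv C N w \<langle>0, un s \<tau>\<rangle>"
  using assms unfolding avoids_def by blast

lemma avoids_antimono:
  assumes "avoids C L R \<rho> n s b E d (N::'a)" "N' \<le> N" shows "avoids C L R \<rho> n s b E d N'"
proof -
  obtain Z where Z: "\<And>\<tau> w. \<tau> < N \<Longrightarrow> okx L R \<rho> n \<tau> \<Longrightarrow> homt d Z \<tau> \<Longrightarrow> w < b \<Longrightarrow> w \<notin> elts E \<Longrightarrow> \<not> cv C N w \<langle>0, un s \<tau>\<rangle>"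
    using avoidsE[OF assms(1)] by blast
  show ?thesis
  proof (rule avoidsI)
    fix \<tau> w assume *: "\<tau> < N'" "okx L R \<rho> n \<tau>" "homt d Z \<tau>" "w < b" "w \<notin> elts E"
    have "\<tau> < N" using *(1) assms(2) by (rule less_le_trans)
    then show "\<not> cv C N' w \<langle>0, un s \<tau>\<rangle>" using Z[OF _ *(2-5)] cv_mono[OF _ assms(2)] by blast
  qed
qed

lemma forcesD:
  assumes "forces C L R \<rho> n s X d N"
  obtains \<tau> :: 'a where "\<tau> < N" "okx L R \<rho> n \<tau>" "elts \<tau> \<noteq> {}" "homt d Z \<tau>" "\<And>w. w \<in> elts X \<Longrightarrow> cv C N w \<langle>0, un s \<tau>\<rangle>"
proof -
  obtain Z' where Z': "Z' < pw \<langle>d, N\<rangle>" "\<And>\<tau>. \<tau> < N \<Longrightarrow> homt d Z' \<tau> \<longleftrightarrow> homt d Z \<tau>" using homt_truncate by blast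
  then show ?thesis using assms that unfolding forces_def by meson
qed

lemma okx_empty [simp]: "okx L R \<rho> n 0"
  by (simp add: okx_def okp_def)

end

section \<open>The case in which every unbounded set has large homogeneous blocks\<close>

locale gp_stage =
  fixes S C T L R P and T' :: "'a::arith set set"
  assumes S: "good S C T" and T': "collection_class T'" "T \<subseteq> T'" "P \<in> T'"
    and L: "L \<in> S" and R: "R \<in> S" and L_ne: "\<And>c. c \<in> L \<Longrightarrow> elts c \<noteq> {}"
    and large: "\<And>X d. X \<in> S \<Longrightarrow> unb X \<Longrightarrow> \<exists>N. \<forall>Z. \<exists>c\<in>L. elts c \<subseteq> X \<and> \<langle>d, c\<rangle> < N \<and> homs d (elts Z) c"
    and res_unb: "\<And>n. unb {x. res R (sn (str P n)) n x}"
begin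

sublocale S: collection_class S using S by (simp add: good_def)
sublocale T: collection_class T using S by (simp add: good_def)
sublocale T': collection_class T' by (rule T')

lemma ST: "S \<subseteq> T" and CS: "C \<in> S" using S by (auto simp: good_def)

lemma in_T: "C \<in> T" "L \<in> T" "R \<in> T" and in_T': "C \<in> T'" "L \<in> T'" "R \<in> T'"
  using ST CS L R T' by auto

lemma elts_P: "elts (sn (str P n)) = {x. x < n \<and> x \<in> P}"
  using elts_sn_str T'.amen T'(3) by blast

lemma okx_blocks: assumes "okx L R \<rho> n \<tau>" "c \<in> elts \<tau>" shows "n < c" "x \<in> elts c \<Longrightarrow> n \<le> x"
proof -
  show ge: "n \<le> x" if "x \<in> elts c" for x using assms that unfolding okx_def res_def by blast
  have "c \<in> L" using assms unfolding okx_def okp_def by blast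
  then obtain x where "x \<in> elts c" using L_ne by blast
  then show "n < c" using ge elts_less le_less_trans by blast
qed

text \<open>The family that bars further computations may change with N. No infinite family has to
  be found, and the condition is Pi_1 over S with a segment of P as a parameter, hence decidable in
  \<open>T'\<close>.\<close>

definition Val0 :: "'a \<Rightarrow> 'a \<Rightarrow> 'a \<Rightarrow> 'a \<Rightarrow> 'a \<Rightarrow> bool" where
  "Val0 s n b E d \<longleftrightarrow> okp L R s \<and> (\<forall>x\<in>elts s. x < n) \<and> Phom P s \<and>
     (\<forall>w\<in>elts E. w < b \<and> cv C n w \<langle>0, s\<rangle>) \<and> (\<forall>N. avoids C L R (sn (str P n)) n s b E d N)"

lemma dec_Val0:
  assumes "rec T' f1" "rec T' f2" "rec T' f3" "rec T' f4" "rec T' f5"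
  shows "dec T' (\<lambda>x. Val0 (f1 x) (f2 x) (f3 x) (f4 x) (f5 x))"
proof -
  have "dec T (\<lambda>z. \<forall>N. avoids C L R (fs z) (fs (sn z)) (fs (sn (sn z))) (fs (sn (sn (sn z)))) (fs (sn (sn (sn (sn z)))))
      (sn (sn (sn (sn (sn z))))) N)"
    by (rule good_pi1[OF S]) (intro dc CS L R)
  then have av0: "dec T' (\<lambda>z. \<forall>N. avoids C L R (fs z) (fs (sn z)) (fs (sn (sn z))) (fs (sn (sn (sn z)))) (fs (sn (sn (sn (sn z)))))
      (sn (sn (sn (sn (sn z))))) N)"
    by (rule dec_mono[OF T'(2)])
  have "rec T' (\<lambda>z. \<langle>sn (str P (fs (sn z))), \<langle>fs (sn z), \<langle>fs z, \<langle>fs (sn (sn z)), \<langle>fs (sn (sn (sn z))), sn (sn (sn (sn z)))\<rangle>\<rangle>\<rangle>\<rangle>\<rangle>)"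
    unfolding str_def by (intro dc T'(3))
  from T'.dec_comp[OF av0 this]
  have av: "dec T' (\<lambda>z. \<forall>N. avoids C L R (sn (str P (fs (sn z)))) (fs (sn z)) (fs z) (fs (sn (sn z))) (fs (sn (sn (sn z))))
      (sn (sn (sn (sn z)))) N)" by simp
  have "dec T' (\<lambda>z. Val0 (fs z) (fs (sn z)) (fs (sn (sn z))) (fs (sn (sn (sn z)))) (sn (sn (sn (sn z)))))"
    unfolding Val0_def by (intro dc av in_T' T'(3))
  from T'.dec_comp[OF this T'.rec_pr[OF assms(1) T'.rec_pr[OF assms(2) T'.rec_pr[OF assms(3) T'.rec_pr[OF assms(4,5)]]]]]
  show ?thesis by simp
qed

text \<open>A single large block of the reservoir suffices. It is homogeneous for the given family
  and lies beyond n in code, so the computations in E, which converge within n, are not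
  disturbed.\<close>

lemma forces_base:
  assumes "Val0 s n b E d"
  shows "\<exists>N. forces C L R (sn (str P n)) n s E K N"
proof -
  let ?\<rho> = "sn (str P n)"
  let ?X = "{x. res R ?\<rho> n x}"
  have "?X \<in> S" by (rule S.dec_set) (intro dc R)
  from large[OF this res_unb] obtain N1 where N1: "\<And>Z. \<exists>c\<in>L. elts c \<subseteq> ?X \<and> \<langle>K, c\<rangle> < N1 \<and> homs K (elts Z) c" by blast
  let ?N = "N1 + n + pw N1"
  have le: "n \<le> ?N" "pw N1 \<le> ?N" by (simp_all add: add_increasing add_increasing2)
  have "\<exists>\<tau><?N. okx L R ?\<rho> n \<tau> \<and> elts \<tau> \<noteq> {} \<and> homt K Z \<tau> \<and> (\<forall>w\<in>elts E. cv C ?N w \<langle>0, un s \<tau>\<rangle>)" for Z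
  proof -
    obtain c where c: "c \<in> L" "elts c \<subseteq> ?X" "\<langle>K, c\<rangle> < N1" "homs K (elts Z) c" using N1 by blast
    have cN1: "c < N1" using pr_ge2 c(3) by (rule le_less_trans)
    have d: "dec S (\<lambda>x. x = c)" by (intro dc)
    let ?\<tau> = "cod {x. x < N1 \<and> x = c}"
    have e: "elts ?\<tau> = {c}" unfolding S.elts_cod_Collect[OF d] using cN1 by blast
    have "?\<tau> < pw N1" by (rule S.cod_less_pw[OF d])
    then have "?\<tau> < ?N" using le(2) by (rule less_le_trans)
    moreover have ok: "okx L R ?\<rho> n ?\<tau>" unfolding okx_def okp_def e using c(1,2) by auto
    moreover have "elts ?\<tau> \<noteq> {}" unfolding e by simp
    moreover have "homt K Z ?\<tau>" unfolding homt_def e using c(4) by simp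
    moreover have "cv C ?N w \<langle>0, un s ?\<tau>\<rangle>" if "w \<in> elts E" for w
    proof -
      have "cv C n w \<langle>0, s\<rangle>" using assms that unfolding Val0_def by blast
      moreover have "x \<in> elts s \<longleftrightarrow> x \<in> elts (un s ?\<tau>)" if "x < n" for x
        using okx_blocks(1)[OF ok, of c] that unfolding S.elts_un e by auto
      ultimately have "cv C n w \<langle>0, un s ?\<tau>\<rangle>" using S.cv_sets[of n s "un s ?\<tau>" n] by blast
      then show ?thesis using le(1) by (rule cv_mono)
    qed
    ultimately show ?thesis by blast
  qed
  then show ?thesis unfolding forces_def by blast
qed

text \<open>The budget \<^term>\<open>K\<close> for the number of sets in a family decreases while the set \<^term>\<open>X\<close> of
  convergent computations grows, so that an optimal \<^term>\<open>X\<close> leaves room for the product of the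
  families which witness that no further computation can be made to converge.\<close>

lemma optimal_set:
  assumes V: "Val0 s n b E d" and b': "b \<le> b'"
  obtains X K0 K1 where "\<And>w. w \<in> elts X \<Longrightarrow> w < b'" "\<And>w. w < b \<Longrightarrow> w \<in> elts X \<longleftrightarrow> w \<in> elts E"
    "K0 = \<langle>b' + d + 1 + 1, K1 + d + 1\<rangle> + 1" "\<exists>N. forces C L R (sn (str P n)) n s X K0 N"
    "\<And>w N. w < b' \<Longrightarrow> b \<le> w \<Longrightarrow> w \<notin> elts X \<Longrightarrow> \<exists>Z. \<forall>\<tau><N. okx L R (sn (str P n)) n \<tau> \<and> elts \<tau> \<noteq> {} \<and> homt K1 Z \<tau> \<longrightarrow>
       \<not> ((\<forall>v\<in>elts X. cv C N v \<langle>0, un s \<tau>\<rangle>) \<and> cv C N w \<langle>0, un s \<tau>\<rangle>)"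
proof -
  let ?\<rho> = "sn (str P n)"
  \<comment> \<open>The size of a joint family with columns \<open>\<langle>u, v\<rangle>\<close>: u
    = 0 for the d sets that bar computations below b, u = w + 1 for y sets barring a single
    \<open>w < b'\<close>, and u = b' + 1 for P. The bounds on u and v are rounded up to leave room
    for all of these.\<close>
  define f where "f y = \<langle>b' + d + 1 + 1, y + d + 1\<rangle> + 1" for y
  have "rec S f" unfolding f_def[abs_def] by (intro dc)
  then obtain g where g: "rec S g" "g 0 = f 0" "\<And>x. g (x + 1) = f (g x)" using good_iteration[OF S] by blast
  have gT: "rec T g" by (rule rec_mono[OF ST g(1)])
  have f_ge: "y \<le> f y" for y
  proof -
    have "y \<le> y + d + 1" by (simp add: add.assoc)
    also have "\<dots> \<le> \<langle>b' + d + 1 + 1, y + d + 1\<rangle>" by (rule pr_ge2)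
    also have "\<dots> \<le> f y" unfolding f_def by simp
    finally show ?thesis .
  qed
  have g_mono: "g x \<le> g (x + y)" for x y
  proof -
    have "dec S (\<lambda>y. g x \<le> g (x + y))" by (intro dc S.rec_comp[OF g(1)])
    then show ?thesis
    proof (rule S.dec_induct)
      fix y assume "g x \<le> g (x + y)"
      also have "\<dots> \<le> g (x + (y + 1))" using g(3)[of "x + y"] f_ge by (simp add: add.assoc)
      finally show "g x \<le> g (x + (y + 1))" .
    qed simp
  qed
  define rank where "rank X = rk b' (\<lambda>i. i \<in> elts X)" for X
  have rank_le: "rank X \<le> cp b'" for X
    unfolding rank_def by (rule S.rk_props(3)) (intro dc)
  have rec_rank: "rec T rank" unfolding rank_def[abs_def] by (rule T.rec_rk) (intro dc)
  define FF where "FF X K \<longleftrightarrow> (\<exists>N. forces C L R ?\<rho> n s X K N)" for X K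
  have "dec T (\<lambda>z. FF (fs z) (sn z))" unfolding FF_def
    by (rule good_sigma1[OF S]) (intro dc CS L R)
  then have dFF: "dec T (\<lambda>z. FF (h z) (k z))" if "rec T h" "rec T k" for h k
    using T.dec_comp2[of FF, OF _ that] by blast
  define adm where "adm X \<longleftrightarrow> (\<forall>w\<in>elts X. w < b') \<and> (\<forall>w<b. w \<in> elts X \<longleftrightarrow> w \<in> elts E)" for X
  \<comment> \<open>The deficit i of the rank from its bound \<open>cp b'\<close> goes down as X
    grows, and the budget \<open>g i\<close> with it. The least i yields an X of largest rank among
    those that can be forced within their budgets.\<close>
  define Ix where "Ix i \<longleftrightarrow> (\<exists>X<pw b'. adm X \<and> rank X + i = cp b' \<and> FF X (g i))" for i
  have dIx: "dec T Ix" unfolding Ix_def adm_def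
    by (intro dc dFF T.rec_comp[OF rec_rank] T.rec_comp[OF gT])
  have dE: "dec S (\<lambda>w. w \<in> elts E)" by (intro dc)
  let ?X0 = "cod {w. w < b' \<and> w \<in> elts E}"
  have Eb: "w < b" if "w \<in> elts E" for w using V that unfolding Val0_def by blast
  have e0: "elts ?X0 = elts E" unfolding S.elts_cod_Collect[OF dE] using Eb b' less_le_trans by blast
  have "\<exists>i. Ix i"
  proof -
    obtain i where i: "rank ?X0 + i = cp b'" using rank_le le_iff_add by metis
    have "FF ?X0 (g i)" using forces_base[OF V] unfolding FF_def forces_def e0 by blast
    moreover have "adm ?X0" unfolding adm_def e0 using Eb b' less_le_trans by blast
    ultimately have "Ix i" unfolding Ix_def using S.cod_less_pw[OF dE] i by blast
    then show ?thesis ..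
  qed
  then obtain i where i: "Ix i" and imin: "\<And>i'. i' < i \<Longrightarrow> \<not> Ix i'" using T.dec_least[OF dIx] by blast
  then obtain X where X: "adm X" "rank X + i = cp b'" "FF X (g i)" unfolding Ix_def by blast
  \<comment> \<open>\<open>g i\<close> is one application of f above the budgets of all smaller
    deficits. For i = 0 there are none, and \<open>g 0 = f 0\<close> provides K1 = 0.\<close>
  obtain K1 where K1: "g i = f K1" "\<And>i'. i' < i \<Longrightarrow> g i' \<le> K1"
  proof (cases i rule: arith_cases)
    case 1
    then show ?thesis using that[of 0] g(2) by simp
  next
    case (2 y)
    have "g i' \<le> g y" if "i' < i" for i'
    proof -
      have "i' \<le> y" using that unfolding 2 less_add1_iff .
      then show ?thesis using g_mono by (metis le_iff_add)
    qed
    then show ?thesis using that[of "g y"] g(3) 2 by blast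
  qed
  have "\<exists>Z. \<forall>\<tau><N. okx L R ?\<rho> n \<tau> \<and> elts \<tau> \<noteq> {} \<and> homt K1 Z \<tau> \<longrightarrow>
       \<not> ((\<forall>v\<in>elts X. cv C N v \<langle>0, un s \<tau>\<rangle>) \<and> cv C N w \<langle>0, un s \<tau>\<rangle>)" if w: "w < b'" "b \<le> w" "w \<notin> elts X" for w N
  proof -
    have d: "dec S (\<lambda>x. x \<in> elts X \<or> x = w)" by (intro dc)
    let ?X = "cod {x. x < b' \<and> (x \<in> elts X \<or> x = w)}"
    have e: "elts ?X = insert w (elts X)" unfolding S.elts_cod_Collect[OF d] using X(1) w unfolding adm_def by blast
    have a: "adm ?X" using X(1) w unfolding adm_def e by (auto simp: not_less[symmetric])
    have "rank X < rank ?X" unfolding rank_def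
    proof (rule S.rk_remove)
      show "dec S (\<lambda>i. i \<in> elts X)" "dec S (\<lambda>i. i \<in> elts ?X)" by (intro dc)+
    qed (use w e in auto)
    moreover obtain i' where i': "rank ?X + i' = cp b'" using rank_le le_iff_add by metis
    ultimately have "i' < i"
      using X(2) by (metis add_le_less_mono add_less_le_mono less_irrefl not_le)
    then have "\<not> FF ?X (g i')" using imin a i' S.cod_less_pw[OF d] unfolding Ix_def by blast
    then obtain Z where Z: "\<And>\<tau>. \<tau> < N \<Longrightarrow> \<not> (okx L R ?\<rho> n \<tau> \<and> elts \<tau> \<noteq> {} \<and> homt (g i') Z \<tau> \<and> (\<forall>v\<in>elts ?X. cv C N v \<langle>0, un s \<tau>\<rangle>))"
      unfolding FF_def forces_def by meson
    have "homt (g i') Z \<tau>" if "homt K1 Z \<tau>" for \<tau>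
      using that K1(2)[OF \<open>i' < i\<close>] homs_antimono unfolding homt_def by blast
    then show ?thesis using Z unfolding e by (intro exI[of _ Z]) blast
  qed
  then show ?thesis using that[of X "g i" K1] X(1,3) K1(1) unfolding adm_def FF_def f_def by blast
qed

end

section \<open>Extension of a condition by large blocks\<close>

context gp_stage begin

text \<open>The d sets that bar computations below b, the sets that bar each further w outside X,
  and P are joined into one family of \<open>K0\<close> sets. Forcing gives a \<tau> homogeneous for
  it. If a continuation is homogeneous for it too, then so is the union for all the parts, and
  nothing outside X converges on it; the joint family thus witnesses \<open>avoids\<close> for the
  extended condition.\<close>

lemma ext_step:
  assumes V: "Val0 s n b E d" and b': "b \<le> b'"
  obtains s' n' E' d' where "Val0 s' n' b' E' d'" "a \<le> n'" "n \<le> n'" "\<And>x. x < n \<Longrightarrow> x \<in> elts s' \<longleftrightarrow> x \<in> elts s"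
    "\<And>w. w < b \<Longrightarrow> w \<in> elts E' \<longleftrightarrow> w \<in> elts E" "\<exists>x\<in>elts s'. n \<le> x"
proof -
  define \<rho> where "\<rho> m = sn (str P m)" for m
  have elts_\<rho>: "elts (\<rho> m) = {x. x < m \<and> x \<in> P}" for m unfolding \<rho>_def by (rule elts_P)
  obtain X K0 K1 where X: "\<And>w. w \<in> elts X \<Longrightarrow> w < b'" "\<And>w. w < b \<Longrightarrow> w \<in> elts X \<longleftrightarrow> w \<in> elts E"
    and K: "K0 = \<langle>b' + d + 1 + 1, K1 + d + 1\<rangle> + 1" and forc: "\<exists>N. forces C L R (\<rho> n) n s X K0 N"
    and stop: "\<And>w N. w < b' \<Longrightarrow> b \<le> w \<Longrightarrow> w \<notin> elts X \<Longrightarrow> \<exists>Z. \<forall>\<tau><N. okx L R (\<rho> n) n \<tau> \<and> elts \<tau> \<noteq> {} \<and> homt K1 Z \<tau> \<longrightarrow>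
       \<not> ((\<forall>v\<in>elts X. cv C N v \<langle>0, un s \<tau>\<rangle>) \<and> cv C N w \<langle>0, un s \<tau>\<rangle>)"
    using optimal_set[OF V b'] unfolding \<rho>_def by blast
  obtain N0 where N0: "forces C L R (\<rho> n) n s X K0 N0" using forc by blast
  define n' where "n' = N0 + n + a"
  have le: "N0 \<le> n'" "n \<le> n'" "a \<le> n'" unfolding n'_def by (simp_all add: add.assoc add_increasing)
  have s1: "okp L R s" "\<And>x. x \<in> elts s \<Longrightarrow> x < n" "Phom P s" "\<And>w. w \<in> elts E \<Longrightarrow> cv C n w \<langle>0, s\<rangle>"
    and av: "\<And>N. avoids C L R (\<rho> n) n s b E d N"
    using V unfolding Val0_def \<rho>_def by blast+
  define G0 where "G0 \<tau> \<longleftrightarrow> okx L R (\<rho> n) n \<tau> \<and> elts \<tau> \<noteq> {} \<and> Phom P \<tau> \<and> (\<forall>w\<in>elts X. cv C N0 w \<langle>0, un s \<tau>\<rangle>)" for \<tau>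
  have res_cross: "\<langle>x, y\<rangle> \<in> R \<longleftrightarrow> x \<in> P" if "res R (\<rho> m) m y" "x < m" for x y m
    using that unfolding res_def elts_\<rho> by blast
  \<comment> \<open>Blocks of \<tau> lie below n' and have constant limit color; blocks of \<tau>'
    come from the reservoir at n', where the color of \<open>\<langle>x, y\<rangle>\<close> is the
    limit color of x.\<close>
  have ext_okx: "okx L R (\<rho> n) n (un \<tau> \<tau>')" if t: "G0 \<tau>" "\<tau> < N0" and t': "okx L R (\<rho> n') n' \<tau>'" for \<tau> \<tau>'
    unfolding okx_def okp_def
  proof (intro conjI ballI impI)
    have ok: "okx L R (\<rho> n) n \<tau>" and ph: "Phom P \<tau>" using t unfolding G0_def by blast+
    have small: "c < n'" "x < n'" if "c \<in> elts \<tau>" "x \<in> elts c" for c x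
      using elts_less[OF that(1)] elts_less[OF that(2)] t(2) le(1) by auto
    fix c assume c: "c \<in> elts (un \<tau> \<tau>')"
    then show "c \<in> L" using ok t' unfolding okx_def okp_def by auto
    show "res R (\<rho> n) n x" if x: "x \<in> elts c" for x
    proof (cases "c \<in> elts \<tau>")
      case True then show ?thesis using ok x unfolding okx_def by blast
    next
      case False
      then have "c \<in> elts \<tau>'" using c by auto
      then have "res R (\<rho> n') n' x" using t' x unfolding okx_def by blast
      then show ?thesis unfolding res_def elts_\<rho> using le(2) by auto
    qed
    fix c' assume c': "c' \<in> elts (un \<tau> \<tau>')" and cc: "c < c'"
    have old: "c' \<in> elts \<tau> \<Longrightarrow> c \<in> elts \<tau>"
    proof (rule ccontr)
      assume *: "c' \<in> elts \<tau>" "c \<notin> elts \<tau>"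
      then have "c \<in> elts \<tau>'" using c by auto
      from okx_blocks(1)[OF t' this] have "n' < c" .
      moreover have "c' < N0" using elts_less[OF *(1)] t(2) by (rule less_trans)
      ultimately show False using le(1) cc by (metis less_trans not_less)
    qed
    have pairs: "(\<forall>x\<in>elts c. \<forall>y\<in>elts c'. x < y) \<and> ((\<forall>x\<in>elts c. \<forall>y\<in>elts c'. \<langle>x, y\<rangle> \<in> R) \<or> (\<forall>x\<in>elts c. \<forall>y\<in>elts c'. \<langle>x, y\<rangle> \<notin> R))"
    proof (cases "c \<in> elts \<tau>")
      case True
      show ?thesis
      proof (cases "c' \<in> elts \<tau>")
        case True
        then show ?thesis using ok \<open>c \<in> elts \<tau>\<close> cc unfolding okx_def okp_def by blast
      next
        case False
        then have c't: "c' \<in> elts \<tau>'" using c' by auto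
        have rs: "res R (\<rho> n') n' y" if "y \<in> elts c'" for y using t' c't that unfolding okx_def by blast
        then have lt: "x < y" if "x \<in> elts c" "y \<in> elts c'" for x y
          using small(2)[OF True that(1)] that(2) unfolding res_def by (meson less_le_trans)
        have "\<langle>x, y\<rangle> \<in> R \<longleftrightarrow> x \<in> P" if "x \<in> elts c" "y \<in> elts c'" for x y
          by (rule res_cross[OF rs[OF that(2)] small(2)[OF True that(1)]])
        moreover have "(\<forall>x\<in>elts c. x \<in> P) \<or> (\<forall>x\<in>elts c. x \<notin> P)" using ph True unfolding Phom_def by blast
        ultimately show ?thesis using lt by blast
      qed
    next
      case False
      then have "c \<in> elts \<tau>'" "c' \<in> elts \<tau>'" using c c' old by auto
      then show ?thesis using t' cc unfolding okx_def okp_def by blast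
    qed
    show "x < y" if "x \<in> elts c" "y \<in> elts c'" for x y using pairs that by blast
    show "(\<forall>x\<in>elts c. \<forall>y\<in>elts c'. \<langle>x, y\<rangle> \<in> R) \<or> (\<forall>x\<in>elts c. \<forall>y\<in>elts c'. \<langle>x, y\<rangle> \<notin> R)" using pairs by blast
  qed
  \<comment> \<open>The argument by contradiction serves to bound N uniformly: the joint family has
    to be fixed for one level \<open>N2\<close> before \<tau> is known, and collection over
    \<open>\<tau> < N0\<close> turns the failures of all \<tau> into failures at
    \<open>B\<close>.\<close>
  have "\<exists>\<tau><N0. G0 \<tau> \<and> (\<forall>N. avoids C L R (\<rho> n') n' (un s \<tau>) b' X K0 N)"
  proof (rule ccontr)
    assume no: "\<not> ?thesis"
    define Q where "Q \<tau> N \<longleftrightarrow> (G0 \<tau> \<longrightarrow> \<not> avoids C L R (\<rho> n') n' (un s \<tau>) b' X K0 N)" for \<tau> N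
    have dQ: "dec T' (\<lambda>z. Q (fs z) (sn z))" unfolding Q_def G0_def by (intro dc in_T' T'(3))
    have "\<exists>N. Q \<tau> N" if "\<tau> < N0" for \<tau> using no that unfolding Q_def by blast
    from T'.dec_collection[of Q, OF dQ this] obtain B where B: "\<forall>\<tau><N0. \<exists>N<B. Q \<tau> N" by blast
    \<comment> \<open>Large enough for the code of the union of a \<tau> below N0 with a
      continuation below B.\<close>
    define N2 where "N2 = N0 + B + pw (N0 + B)"
    have N2: "N0 \<le> N2" "B \<le> N2" "pw (N0 + B) \<le> N2" unfolding N2_def by (simp_all add: add.assoc add_increasing add_increasing2)
    obtain Z0 where Z0: "\<And>\<tau> w. \<tau> < N2 \<Longrightarrow> okx L R (\<rho> n) n \<tau> \<Longrightarrow> homt d Z0 \<tau> \<Longrightarrow> w < b \<Longrightarrow> w \<notin> elts E \<Longrightarrow> \<not> cv C N2 w \<langle>0, un s \<tau>\<rangle>"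
      using S.avoidsE[OF av[of N2]] by blast
    define DN where "DN w Z \<longleftrightarrow> (w < b' \<and> b \<le> w \<and> w \<notin> elts X \<longrightarrow> (\<forall>\<tau><N2. okx L R (\<rho> n) n \<tau> \<and> elts \<tau> \<noteq> {} \<and> homt K1 Z \<tau> \<longrightarrow>
       \<not> ((\<forall>v\<in>elts X. cv C N2 v \<langle>0, un s \<tau>\<rangle>) \<and> cv C N2 w \<langle>0, un s \<tau>\<rangle>)))" for w Z
    define Zw where "Zw w = lst (DN w)" for w
    have DNex: "\<exists>Z. DN w Z" for w unfolding DN_def using stop[of w N2] by blast
    have dDN: "dec S (\<lambda>z. DN (fs z) (sn z))" unfolding DN_def by (intro dc CS L R)
    have recZw: "rec S Zw" unfolding Zw_def[abs_def] by (rule S.rec_lst[OF dDN DNex])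
    have DNZw: "DN w (Zw w)" for w
    proof -
      have "dec S (DN w)" using S.dec_comp2[of DN, OF dDN S.rec_const S.rec_id, of w] .
      then show ?thesis unfolding Zw_def using S.lst_props(1) DNex by blast
    qed
    have recZw': "rec T' Zw" by (rule rec_mono[OF _ recZw]) (use ST T' in blast)
    define ZP where "ZP z \<longleftrightarrow> (fs (fs z) = 0 \<and> \<langle>sn (fs z), sn z\<rangle> \<in> elts Z0) \<or>
      (\<exists>w<b'. fs (fs z) = w + 1 \<and> \<langle>sn (fs z), sn z\<rangle> \<in> elts (Zw w)) \<or> (fs (fs z) = b' + 1 \<and> sn z \<in> P)" for z
    have dZP: "dec T' ZP" unfolding ZP_def by (intro dc T'(3) T'.rec_comp[OF recZw'])
    define Zh where "Zh = cod {z. z < \<langle>K0, N2\<rangle> \<and> ZP z}"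
    have eZh: "elts Zh = {z. z < \<langle>K0, N2\<rangle> \<and> ZP z}" unfolding Zh_def by (rule T'.elts_cod_Collect[OF dZP])
    have nz: "w + 1 \<noteq> (0::'a)" for w by (metis less_add_one not_less_zero)
    have Zh: "homs d (elts Z0) c" "w < b' \<Longrightarrow> homs K1 (elts (Zw w)) c" "(\<forall>x\<in>elts c. x \<in> P) \<or> (\<forall>x\<in>elts c. x \<notin> P)"
      if h: "homs K0 (elts Zh) c" and c: "c < N2" for c w
    proof -
      have mem: "\<langle>j, x\<rangle> \<in> elts Zh \<longleftrightarrow> ZP \<langle>j, x\<rangle>" if "j < K0" "x \<in> elts c" for j x
      proof -
        have "x < N2" using elts_less[OF that(2)] c by (rule less_trans)
        then have "\<langle>j, x\<rangle> < \<langle>K0, N2\<rangle>" using that(1) by (intro pr_less_of_sum_less add_strict_mono)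
        then show ?thesis unfolding eZh by blast
      qed
      have dich: "(\<forall>x\<in>elts c. ZP \<langle>j, x\<rangle>) \<or> (\<forall>x\<in>elts c. \<not> ZP \<langle>j, x\<rangle>)" if "j < K0" for j
        using h that mem[OF that] unfolding homs_def by blast
      have jK: "\<langle>u, v\<rangle> < K0" if "u \<le> b' + d + 1 + 1" "v \<le> K1 + d + 1" for u v
        unfolding K less_add1_iff using that by (rule pr_mono)
      show "homs d (elts Z0) c" unfolding homs_def
      proof (intro allI impI)
        fix j assume "j < d"
        then have "j \<le> K1 + d + 1" by (simp add: add.assoc add_increasing add_increasing2 less_imp_le)
        then have "\<langle>0, j\<rangle> < K0" by (intro jK) simp
        moreover have "ZP \<langle>\<langle>0, j\<rangle>, x\<rangle> \<longleftrightarrow> \<langle>j, x\<rangle> \<in> elts Z0" for x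
          unfolding ZP_def fs_pr sn_pr using nz[symmetric] by blast
        ultimately show "(\<forall>x\<in>elts c. \<langle>j, x\<rangle> \<in> elts Z0) \<or> (\<forall>x\<in>elts c. \<langle>j, x\<rangle> \<notin> elts Z0)"
          using dich by blast
      qed
      show "homs K1 (elts (Zw w)) c" if w: "w < b'" unfolding homs_def
      proof (intro allI impI)
        fix j assume "j < K1"
        then have "j \<le> K1 + d + 1" by (simp add: add.assoc add_increasing2 less_imp_le)
        moreover have "w + 1 \<le> b' + d + 1 + 1"
        proof -
          have "w + 1 \<le> b'" using w by (simp add: add1_le_iff)
          also have "b' \<le> b' + d + 1 + 1" by (simp add: add.assoc)
          finally show ?thesis .
        qed
        ultimately have lt: "\<langle>w + 1, j\<rangle> < K0" by (intro jK)
        have "ZP \<langle>\<langle>w + 1, j\<rangle>, x\<rangle> \<longleftrightarrow> \<langle>j, x\<rangle> \<in> elts (Zw w)" for x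
          unfolding ZP_def using nz w by auto
        then show "(\<forall>x\<in>elts c. \<langle>j, x\<rangle> \<in> elts (Zw w)) \<or> (\<forall>x\<in>elts c. \<langle>j, x\<rangle> \<notin> elts (Zw w))"
          using dich[OF lt] by blast
      qed
      have "\<langle>b' + 1, 0\<rangle> < K0"
      proof (rule jK)
        have "b' + 1 \<le> b' + 1 + (d + 1)" by simp
        also have "\<dots> = b' + d + 1 + 1" by (simp add: algebra_simps)
        finally show "b' + 1 \<le> b' + d + 1 + 1" .
      qed simp
      moreover have "ZP \<langle>\<langle>b' + 1, 0\<rangle>, x\<rangle> \<longleftrightarrow> x \<in> P" for x unfolding ZP_def using nz by auto
      ultimately show "(\<forall>x\<in>elts c. x \<in> P) \<or> (\<forall>x\<in>elts c. x \<notin> P)" using dich by blast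
    qed
    obtain \<tau> where t: "\<tau> < N0" "okx L R (\<rho> n) n \<tau>" "elts \<tau> \<noteq> {}" "homt K0 Zh \<tau>" "\<And>w. w \<in> elts X \<Longrightarrow> cv C N0 w \<langle>0, un s \<tau>\<rangle>"
      using S.forcesD[OF N0, of Zh] by blast
    have tc: "c < N2" if "c \<in> elts \<tau>" for c using elts_less[OF that] t(1) N2(1) by auto
    have G0t: "G0 \<tau>" unfolding G0_def
    proof (intro conjI ballI)
      show "Phom P \<tau>" unfolding Phom_def using Zh(3) tc t(4) unfolding homt_def by blast
    qed (use t in auto)
    obtain N where N: "N < B" "Q \<tau> N" using B t(1) by blast
    have "\<not> avoids C L R (\<rho> n') n' (un s \<tau>) b' X K0 N" using N(2) G0t unfolding Q_def by blast
    then have nav: "\<not> avoids C L R (\<rho> n') n' (un s \<tau>) b' X K0 B" using S.avoids_antimono N(1) less_imp_le by blast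
    have "avoids C L R (\<rho> n') n' (un s \<tau>) b' X K0 B"
    proof (rule S.avoidsI)
      fix \<tau>' w assume t': "\<tau>' < B" "okx L R (\<rho> n') n' \<tau>'" "homt K0 Zh \<tau>'" and w: "w < b'" "w \<notin> elts X"
      define \<upsilon> where "\<upsilon> = un \<tau> \<tau>'"
      have u: "elts \<upsilon> = elts \<tau> \<union> elts \<tau>'" unfolding \<upsilon>_def by simp
      have t'c: "c < N2" if "c \<in> elts \<tau>'" for c using elts_less[OF that] t'(1) N2(2) by auto
      have "x < N0 + B" if "x \<in> elts \<tau>" for x
      proof -
        have "x < N0" using elts_less[OF that] t(1) by (rule less_trans)
        moreover have "N0 \<le> N0 + B" by simp
        ultimately show ?thesis by (rule less_le_trans)
      qed
      moreover have "x < N0 + B" if "x \<in> elts \<tau>'" for x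
      proof -
        have "x < B" using elts_less[OF that] t'(1) by (rule less_trans)
        moreover have "B \<le> N0 + B" by simp
        ultimately show ?thesis by (rule less_le_trans)
      qed
      ultimately have "\<upsilon> < pw (N0 + B)" unfolding \<upsilon>_def by (rule S.un_less_pw)
      then have uN2: "\<upsilon> < N2" using N2(3) by (rule less_le_trans)
      have uok: "okx L R (\<rho> n) n \<upsilon>" unfolding \<upsilon>_def by (rule ext_okx[OF G0t t(1) t'(2)])
      have hK: "homs K0 (elts Zh) c \<and> c < N2" if "c \<in> elts \<upsilon>" for c
        using that t(4) t'(3) tc t'c unfolding u homt_def by blast
      have h0: "homt d Z0 \<upsilon>" unfolding homt_def using Zh(1) hK by blast
      have hw: "homt K1 (Zw w) \<upsilon>" unfolding homt_def using Zh(2) hK w(1) by blast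
      have same: "elts (un (un s \<tau>) \<tau>') = elts (un s \<upsilon>)" unfolding S.elts_un u by blast
      \<comment> \<open>Below b the family \<open>Z0\<close> bars w. From b on, w could converge
        only if some computation in X failed to, but all of X already converges on \<tau> and
        continues to do so on the union.\<close>
      have "\<not> cv C N2 w \<langle>0, un s \<upsilon>\<rangle>"
      proof (cases "w < b")
        case True
        then show ?thesis using Z0[OF uN2 uok h0 True] X(2)[OF True] w(2) by blast
      next
        case False
        then have "b \<le> w" by simp
        have "elts \<upsilon> \<noteq> {}" using t(3) unfolding u by blast
        have "\<not> ((\<forall>v\<in>elts X. cv C N2 v \<langle>0, un s \<upsilon>\<rangle>) \<and> cv C N2 w \<langle>0, un s \<upsilon>\<rangle>)"
          using DNZw[of w, unfolded DN_def] w \<open>b \<le> w\<close> uN2 uok hw \<open>elts \<upsilon> \<noteq> {}\<close> by blast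
        moreover have "cv C N2 v \<langle>0, un s \<upsilon>\<rangle>" if v: "v \<in> elts X" for v
        proof -
          have "x \<in> elts (un s \<tau>) \<longleftrightarrow> x \<in> elts (un s \<upsilon>)" if "x < n'" for x
            using okx_blocks(1)[OF t'(2), of x] that unfolding S.elts_un u by auto
          then have "cv C N0 v \<langle>0, un s \<upsilon>\<rangle>" using t(5)[OF v] S.cv_sets[of n' "un s \<tau>" "un s \<upsilon>" N0] le(1) by blast
          then show ?thesis using N2(1) by (rule cv_mono)
        qed
        ultimately show ?thesis by blast
      qed
      then show "\<not> cv C B w \<langle>0, un (un s \<tau>) \<tau>'\<rangle>"
        using cv_mono[OF _ N2(2), of C w] S.cv_sets_eq[OF same] by blast
    qed
    then show False using nav by blast
  qed
  then obtain \<tau> where t: "\<tau> < N0" "G0 \<tau>" "\<And>N. avoids C L R (\<rho> n') n' (un s \<tau>) b' X K0 N" by blast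
  have ok: "okx L R (\<rho> n) n \<tau>" "elts \<tau> \<noteq> {}" "Phom P \<tau>" "\<And>w. w \<in> elts X \<Longrightarrow> cv C N0 w \<langle>0, un s \<tau>\<rangle>"
    using t(2) unfolding G0_def by blast+
  have okp: "okp L R (un s \<tau>)" unfolding okp_def
  proof (intro conjI ballI impI)
    fix c assume c: "c \<in> elts (un s \<tau>)"
    then show "c \<in> L" using s1(1) ok(1) unfolding okx_def okp_def by auto
    fix c' assume c': "c' \<in> elts (un s \<tau>)" and cc: "c < c'"
    have pairs: "(\<forall>x\<in>elts c. \<forall>y\<in>elts c'. x < y) \<and> ((\<forall>x\<in>elts c. \<forall>y\<in>elts c'. \<langle>x, y\<rangle> \<in> R) \<or> (\<forall>x\<in>elts c. \<forall>y\<in>elts c'. \<langle>x, y\<rangle> \<notin> R))"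
    proof (cases "c' \<in> elts \<tau>")
      case False
      then have "c' \<in> elts s" using c' by simp
      have "c \<notin> elts \<tau>"
      proof
        assume "c \<in> elts \<tau>"
        from okx_blocks(1)[OF ok(1) this] cc have "n < c'" by (rule less_trans)
        then show False using s1(2)[OF \<open>c' \<in> elts s\<close>] by (rule less_asym)
      qed
      then have "c \<in> elts s" using c by simp
      then show ?thesis using s1(1) \<open>c' \<in> elts s\<close> cc unfolding okp_def by blast
    next
      case c't: True
      show ?thesis
      proof (cases "c \<in> elts \<tau>")
        case True
        then show ?thesis using ok(1) c't cc unfolding okx_def okp_def by blast
      next
        case False
        then have cs: "c \<in> elts s" using c by simp
        have small: "x < n" if "x \<in> elts c" for x using elts_less[OF that] s1(2)[OF cs] by (rule less_trans)
        have rs: "res R (\<rho> n) n y" if "y \<in> elts c'" for y using ok(1) c't that unfolding okx_def by blast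
        then have lt: "x < y" if "x \<in> elts c" "y \<in> elts c'" for x y
          using small[OF that(1)] that(2) unfolding res_def by (meson less_le_trans)
        have "\<langle>x, y\<rangle> \<in> R \<longleftrightarrow> x \<in> P" if "x \<in> elts c" "y \<in> elts c'" for x y
          by (rule res_cross[OF rs[OF that(2)] small[OF that(1)]])
        moreover have "(\<forall>x\<in>elts c. x \<in> P) \<or> (\<forall>x\<in>elts c. x \<notin> P)" using s1(3) cs unfolding Phom_def by blast
        ultimately show ?thesis using lt by blast
      qed
    qed
    show "x < y" if "x \<in> elts c" "y \<in> elts c'" for x y using pairs that by blast
    show "(\<forall>x\<in>elts c. \<forall>y\<in>elts c'. \<langle>x, y\<rangle> \<in> R) \<or> (\<forall>x\<in>elts c. \<forall>y\<in>elts c'. \<langle>x, y\<rangle> \<notin> R)" using pairs by blast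
  qed
  have "Val0 (un s \<tau>) n' b' X K0" unfolding Val0_def
  proof (intro conjI ballI allI)
    show "x < n'" if "x \<in> elts (un s \<tau>)" for x
    proof (cases "x \<in> elts s")
      case True then show ?thesis using s1(2) le(2) less_le_trans by blast
    next
      case False
      then have "x \<in> elts \<tau>" using that by simp
      then show ?thesis using elts_less[of x \<tau>] t(1) le(1) by auto
    qed
    show "Phom P (un s \<tau>)" using s1(3) ok(3) unfolding Phom_def by auto
    show "w < b'" if "w \<in> elts X" for w using X(1) that .
    show "cv C n' w \<langle>0, un s \<tau>\<rangle>" if "w \<in> elts X" for w using cv_mono[OF ok(4)[OF that] le(1)] .
    show "avoids C L R (sn (str P n')) n' (un s \<tau>) b' X K0 N" for N using t(3) unfolding \<rho>_def .
  qed (rule okp)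
  moreover have "x \<in> elts (un s \<tau>) \<longleftrightarrow> x \<in> elts s" if "x < n" for x
    using okx_blocks(1)[OF ok(1), of x] that by auto
  moreover have "\<exists>x\<in>elts (un s \<tau>). n \<le> x"
  proof -
    obtain x where "x \<in> elts \<tau>" using ok(2) by blast
    then have "n < x" "x \<in> elts (un s \<tau>)" using okx_blocks(1)[OF ok(1)] by auto
    then show ?thesis using less_imp_le by blast
  qed
  ultimately show ?thesis using that le(2,3) X(2) by blast
qed

lemma Val0_start: "Val0 0 0 0 0 0"
  unfolding Val0_def okp_def Phom_def by (auto intro: S.avoidsI)

text \<open>The second conjunct makes the grouping infinite: except at the start, a condition
  contains a block with code at least its bound b.\<close>

definition Val :: "'a \<Rightarrow> bool" where
  "Val c \<longleftrightarrow> Val0 (fs (fs c)) (sn (fs c)) (fs (sn c)) (fs (sn (sn c))) (sn (sn (sn c))) \<and>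
     (fs (sn c) = 0 \<or> (\<exists>x\<in>elts (fs (fs c)). fs (sn c) \<le> x))"

lemma grouping_exists:
  assumes "countable T'"
  obtains S' C' G where "good S' C' T'" "S \<subseteq> S'" "G \<in> S'" "unb G" "G \<subseteq> L"
    "\<And>c c'. c \<in> G \<Longrightarrow> c' \<in> G \<Longrightarrow> c < c' \<Longrightarrow> (\<forall>x\<in>elts c. \<forall>y\<in>elts c'. x < y) \<and>
       ((\<forall>x\<in>elts c. \<forall>y\<in>elts c'. \<langle>x, y\<rangle> \<in> R) \<or> (\<forall>x\<in>elts c. \<forall>y\<in>elts c'. \<langle>x, y\<rangle> \<notin> R))"
proof (rule jump_control[where s = "\<lambda>c. fs (fs c)" and n = "\<lambda>c. sn (fs c)" and b = "\<lambda>c. fs (sn c)" and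
      E = "\<lambda>c. fs (sn (sn c))" and Val = Val and ?c0.0 = 0, OF S assms T'(1,2)])
  show "rec T' (\<lambda>c. fs (fs c))" "rec T' (\<lambda>c. sn (fs c))" "rec T' (\<lambda>c. fs (sn c))" "rec T' (\<lambda>c. fs (sn (sn c)))" by (intro dc)+
  show "fs (sn c) \<le> c" for c :: 'a using fs_le sn_le order_trans by blast
  show "dec T' Val" unfolding Val_def by (intro dc dec_Val0)
  show "Val 0" unfolding Val_def using Val0_start by simp
  show "\<exists>m\<le>sn (fs c). Uc C w (str (elts (fs (fs c))) m)" if "Val c" "w \<in> elts (fs (sn (sn c)))" for c w
  proof -
    have "cv C (sn (fs c)) w \<langle>0, fs (fs c)\<rangle>" using that unfolding Val_def Val0_def by blast
    from cv_Uc[OF this] show ?thesis unfolding rs_def sn_pr using less_imp_le by blast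
  qed
  show "\<not> Uc C w (str (elts (fs (fs c))) m)" if c: "Val c" "w < fs (sn c)" "w \<notin> elts (fs (sn (sn c)))" for c w m
  proof
    assume "Uc C w (str (elts (fs (fs c))) m)"
    then have "Uc C w (rs \<langle>0, fs (fs c)\<rangle> m)" by (simp add: rs_def)
    then obtain N where N: "cv C N w \<langle>0, fs (fs c)\<rangle>" using Uc_cv by blast
    have "avoids C L R (sn (str P (sn (fs c)))) (sn (fs c)) (fs (fs c)) (fs (sn c)) (fs (sn (sn c))) (sn (sn (sn c))) (N + 1)"
      using c(1) unfolding Val_def Val0_def by blast
    then obtain Z where Z: "\<And>\<tau> w. \<tau> < N + 1 \<Longrightarrow> okx L R (sn (str P (sn (fs c)))) (sn (fs c)) \<tau> \<Longrightarrow> homt (sn (sn (sn c))) Z \<tau> \<Longrightarrow>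
       w < fs (sn c) \<Longrightarrow> w \<notin> elts (fs (sn (sn c))) \<Longrightarrow> \<not> cv C (N + 1) w \<langle>0, un (fs (fs c)) \<tau>\<rangle>"
      using S.avoidsE by blast
    \<comment> \<open>The empty set of blocks is homogeneous for every family, so
      \<open>avoids\<close> speaks of the condition itself; N + 1 makes room for the code 0 of the
      empty set.\<close>
    have "\<not> cv C (N + 1) w \<langle>0, un (fs (fs c)) 0\<rangle>"
      by (rule Z) (use c in \<open>simp_all add: homt_def less_add1_iff\<close>)
    moreover have "cv C N w \<langle>0, un (fs (fs c)) 0\<rangle>" using N S.cv_sets_eq[of "un (fs (fs c)) 0" "fs (fs c)"] by simp
    ultimately show False using cv_mono[of C N w _ "N + 1"] by simp
  qed
  show "\<exists>c'. Val c' \<and> (sn (fs c) \<le> sn (fs c') \<and> fs (sn c) \<le> fs (sn c') \<and>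
      (\<forall>x<sn (fs c). x \<in> elts (fs (fs c')) \<longleftrightarrow> x \<in> elts (fs (fs c))) \<and>
      (\<forall>x<fs (sn c). x \<in> elts (fs (sn (sn c'))) \<longleftrightarrow> x \<in> elts (fs (sn (sn c))))) \<and> a \<le> fs (sn c') \<and> a \<le> sn (fs c')"
    if c: "Val c" for c a
  proof -
    let ?s = "fs (fs c)" and ?n = "sn (fs c)" and ?b = "fs (sn c)" and ?E = "fs (sn (sn c))" and ?d = "sn (sn (sn c))"
    have V: "Val0 ?s ?n ?b ?E ?d" using c unfolding Val_def by blast
    have bb: "?b \<le> ?b + a" "a \<le> ?b + a" by simp_all
    \<comment> \<open>Two extensions are made: the first raises the length to at least the new
      bound, so that the block added by the second lies beyond that bound.\<close>
    obtain s1 n1 E1 d1 where 1: "Val0 s1 n1 (?b + a) E1 d1" "?b + a \<le> n1" "?n \<le> n1"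
      "\<And>x. x < ?n \<Longrightarrow> x \<in> elts s1 \<longleftrightarrow> x \<in> elts ?s" "\<And>w. w < ?b \<Longrightarrow> w \<in> elts E1 \<longleftrightarrow> w \<in> elts ?E"
      using ext_step[OF V bb(1), of "?b + a"] by metis
    obtain s2 n2 E2 d2 where 2: "Val0 s2 n2 (?b + a) E2 d2" "a \<le> n2" "n1 \<le> n2"
      "\<And>x. x < n1 \<Longrightarrow> x \<in> elts s2 \<longleftrightarrow> x \<in> elts s1" "\<And>w. w < ?b + a \<Longrightarrow> w \<in> elts E2 \<longleftrightarrow> w \<in> elts E1" "\<exists>x\<in>elts s2. n1 \<le> x"
      using ext_step[OF 1(1) order_refl, of a] by metis
    have "\<exists>x\<in>elts s2. ?b + a \<le> x" using 2(6) 1(2) order_trans by blast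
    then have "Val \<langle>\<langle>s2, n2\<rangle>, \<langle>?b + a, \<langle>E2, d2\<rangle>\<rangle>\<rangle>" unfolding Val_def using 2(1) by simp
    moreover have "?n \<le> n2" using 1(3) 2(3) by (rule order_trans)
    moreover have "x \<in> elts s2 \<longleftrightarrow> x \<in> elts ?s" if "x < ?n" for x
      using 1(4)[OF that] 2(4)[OF less_le_trans[OF that 1(3)]] by blast
    moreover have "w \<in> elts E2 \<longleftrightarrow> w \<in> elts ?E" if "w < ?b" for w
      using 1(5)[OF that] 2(5)[OF less_le_trans[OF that bb(1)]] by blast
    ultimately show ?thesis using bb 2(2) by (intro exI[of _ "\<langle>\<langle>s2, n2\<rangle>, \<langle>?b + a, \<langle>E2, d2\<rangle>\<rangle>\<rangle>"]) simp
  qed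
  fix G C'
  assume G: "good (ext S G) C' T'" "S \<subseteq> ext S G" "G \<in> ext S G"
    and approx: "\<And>a. \<exists>c. Val c \<and> a \<le> sn (fs c) \<and> a \<le> fs (sn c) \<and> (\<forall>x<sn (fs c). x \<in> G \<longleftrightarrow> x \<in> elts (fs (fs c)))"
  have unbG: "unb G" unfolding unb_def
  proof
    fix a
    obtain c where c: "Val c" "a + 1 \<le> fs (sn c)" "\<forall>x<sn (fs c). x \<in> G \<longleftrightarrow> x \<in> elts (fs (fs c))" using approx[of "a + 1"] by blast
    have "fs (sn c) \<noteq> 0" using c(2) by (metis add1_le_iff not_less_zero)
    then obtain x where x: "x \<in> elts (fs (fs c))" "fs (sn c) \<le> x" using c(1) unfolding Val_def by blast
    have "x < sn (fs c)" using c(1) x(1) unfolding Val_def Val0_def by blast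
    then have "x \<in> G" using c(3) x(1) by blast
    moreover have "a < x" using c(2) x(2) add1_le_iff order_trans by blast
    ultimately show "\<exists>y>a. y \<in> G" by blast
  qed
  have G_elts: "c \<in> L \<and> (c' \<in> G \<longrightarrow> c < c' \<longrightarrow> (\<forall>x\<in>elts c. \<forall>y\<in>elts c'. x < y) \<and>
       ((\<forall>x\<in>elts c. \<forall>y\<in>elts c'. \<langle>x, y\<rangle> \<in> R) \<or> (\<forall>x\<in>elts c. \<forall>y\<in>elts c'. \<langle>x, y\<rangle> \<notin> R)))" if cG: "c \<in> G" for c c'
  proof -
    obtain v where v: "Val v" "c + c' + 1 \<le> sn (fs v)" "\<forall>x<sn (fs v). x \<in> G \<longleftrightarrow> x \<in> elts (fs (fs v))" using approx[of "c + c' + 1"] by blast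
    have "c < c + c' + 1" "c' < c + c' + 1" by (simp_all add: less_add1_iff)
    then have "c < sn (fs v)" "c' < sn (fs v)" using v(2) less_le_trans by blast+
    moreover have "okp L R (fs (fs v))" using v(1) unfolding Val_def Val0_def by blast
    ultimately show ?thesis using v(3) cG unfolding okp_def by blast
  qed
  show thesis
  proof (rule that[OF G unbG])
    show "G \<subseteq> L" using G_elts by blast
    fix c c' assume g: "c \<in> G" "c' \<in> G" "c < c'"
    show "(\<forall>x\<in>elts c. \<forall>y\<in>elts c'. x < y) \<and>
       ((\<forall>x\<in>elts c. \<forall>y\<in>elts c'. \<langle>x, y\<rangle> \<in> R) \<or> (\<forall>x\<in>elts c. \<forall>y\<in>elts c'. \<langle>x, y\<rangle> \<notin> R))"
      by (rule G_elts[OF g(1), THEN conjunct2, THEN mp, OF g(2), THEN mp, OF g(3)])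
  qed
qed

end

text \<open>In the grouping case, the patterns realized by some later number form a tree recursive
  in \<open>T\<close>. A generic path P through it assigns limit colors for which all reservoirs are
  unbounded; this replaces the passage to a set on which the coloring is stable.\<close>

theorem grouping_or_small:
  fixes S :: "'a::{arith,countable} set set"
  assumes S: "good S C T" and L: "L \<in> S" and R: "R \<in> S" and L_ne: "\<And>c. c \<in> L \<Longrightarrow> elts c \<noteq> {}"
  obtains (small) S' C' T' Y where "good S' C' T'" "S \<subseteq> S'" "Y \<in> S'" "unb Y" "\<And>c. c \<in> L \<Longrightarrow> \<not> elts c \<subseteq> Y"
  | (grouping) S' C' T' G where "good S' C' T'" "S \<subseteq> S'" "G \<in> S'" "unb G" "G \<subseteq> L"
    "\<And>c c'. c \<in> G \<Longrightarrow> c' \<in> G \<Longrightarrow> c < c' \<Longrightarrow> (\<forall>x\<in>elts c. \<forall>y\<in>elts c'. x < y) \<and>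
       ((\<forall>x\<in>elts c. \<forall>y\<in>elts c'. \<langle>x, y\<rangle> \<in> R) \<or> (\<forall>x\<in>elts c. \<forall>y\<in>elts c'. \<langle>x, y\<rangle> \<notin> R))"
proof (cases "\<forall>X\<in>S. unb X \<longrightarrow> (\<forall>d. \<exists>N. \<forall>Z. \<exists>c\<in>L. elts c \<subseteq> X \<and> \<langle>d, c\<rangle> < N \<and> homs d (elts Z) c)")
  case False
  then obtain X d where X: "X \<in> S" "unb X" and nl: "\<not> (\<exists>N. \<forall>Z. \<exists>c\<in>L. elts c \<subseteq> X \<and> \<langle>d, c\<rangle> < N \<and> homs d (elts Z) c)"
    unfolding Ball_def[of S] not_all not_imp by (elim exE conjE)
  have "\<exists>Z. \<forall>c\<in>L. elts c \<subseteq> X \<longrightarrow> \<langle>d, c\<rangle> < N \<longrightarrow> \<not> homs d (elts Z) c" for N using nl by blast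
  note X = X this
  show ?thesis by (rule avoid_large[OF S L X]) (rule small)
next
  case True
  interpret S: collection_class S using S by (simp add: good_def)
  interpret T: collection_class T using S by (simp add: good_def)
  let ?K = "\<lambda>\<sigma>. rs \<sigma> (fs \<sigma>) = \<sigma> \<and> (\<exists>y. res R (sn \<sigma>) (fs \<sigma>) y)"
  define K where "K = {\<sigma>. ?K \<sigma>}"
  have ST: "S \<subseteq> T" using S by (simp add: good_def)
  have "dec T (\<lambda>\<sigma>. \<exists>y. res R (sn \<sigma>) (fs \<sigma>) y)" by (rule good_sigma1[OF S]) (intro dc R)
  then have "dec T ?K" by (intro dc)
  then have KT: "K \<in> T" unfolding K_def by (rule T.dec_set)
  have "tree K" unfolding tree_def
  proof (intro conjI ballI allI impI)
    fix \<sigma> assume s: "\<sigma> \<in> K"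
    then show "rs \<sigma> (fs \<sigma>) = \<sigma>" unfolding K_def by blast
    fix m assume m: "m \<le> fs \<sigma>"
    obtain y where "res R (sn \<sigma>) (fs \<sigma>) y" using s unfolding K_def by blast
    then have "res R (sn (rs \<sigma> m)) m y" unfolding res_def S.elts_rs using m by auto
    then show "rs \<sigma> m \<in> K" unfolding K_def using S.rs_rs[of m m \<sigma>] by auto
  next
    fix n
    have d: "dec S (\<lambda>i. \<langle>i, n\<rangle> \<in> R)" by (intro dc R)
    \<comment> \<open>The number n realizes its own pattern of length n, as elements of a reservoir
      only have to be at least n.\<close>
    let ?\<sigma> = "\<langle>n, cod {i. i < n \<and> \<langle>i, n\<rangle> \<in> R}\<rangle>"
    have "rs ?\<sigma> n = ?\<sigma>" unfolding rs_def str_def sn_pr S.elts_cod_Collect[OF d] by (rule arg_cong[where f = "\<lambda>F. \<langle>n, cod F\<rangle>"]) blast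
    moreover have "res R (sn ?\<sigma>) n n" unfolding res_def sn_pr S.elts_cod_Collect[OF d] by blast
    ultimately show "\<exists>\<sigma>\<in>K. fs \<sigma> = n" unfolding K_def by (intro bexI[of _ ?\<sigma>]) auto
  qed
  moreover have "countable T" using S by (simp add: good_def)
  ultimately obtain P where P: "\<And>n. str P n \<in> K" "collection_class (ext T P)" "countable (ext T P)" "T \<subseteq> ext T P" "P \<in> ext T P"
    using generic_path[OF T.collection_class_axioms _ _ KT] by metis
  interpret E: collection_class "ext T P" by (rule P(2))
  have amP: "amen P" by (rule E.amen[OF P(5)])
  have "unb {x. res R (sn (str P n)) n x}" for n unfolding unb_def
  proof
    fix b
    \<comment> \<open>A longer segment of P is realized only by numbers not below its length, which
      pushes y past b.\<close>
    obtain y where y: "res R (sn (str P (n + b + 1))) (n + b + 1) y" using P(1)[of "n + b + 1"] unfolding K_def by auto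
    have le: "n \<le> n + b + 1" "b < n + b + 1"
      by (simp add: add.assoc, simp add: less_add1_iff)
    then have "b < y" using y unfolding res_def by (meson less_le_trans)
    moreover have "res R (sn (str P n)) n y"
    proof -
      have "n \<le> y" using y le(1) unfolding res_def by (blast intro: order_trans)
      moreover have "i \<in> P \<longleftrightarrow> \<langle>i, y\<rangle> \<in> R" if "i < n" for i
        using y less_le_trans[OF that le(1)] unfolding res_def elts_sn_str[OF amP] by blast
      ultimately show ?thesis unfolding res_def elts_sn_str[OF amP] by blast
    qed
    ultimately show "\<exists>y>b. y \<in> {x. res R (sn (str P n)) n x}" by blast
  qed
  then interpret gp_stage S C T L R P "ext T P"
    using True by unfold_locales (use S P L R L_ne in auto)
  show ?thesis
  proof (rule grouping_exists[OF P(3)])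
    fix S' C' G
    assume "good S' C' (ext T P)" "S \<subseteq> S'" "G \<in> S'" "unb G" "G \<subseteq> L"
      "\<And>c c'. c \<in> G \<Longrightarrow> c' \<in> G \<Longrightarrow> c < c' \<Longrightarrow> (\<forall>x\<in>elts c. \<forall>y\<in>elts c'. x < y) \<and>
       ((\<forall>x\<in>elts c. \<forall>y\<in>elts c'. \<langle>x, y\<rangle> \<in> R) \<or> (\<forall>x\<in>elts c. \<forall>y\<in>elts c'. \<langle>x, y\<rangle> \<notin> R))"
    then show ?thesis by (rule grouping)
  qed
qed

section \<open>Semantics and soundness\<close>

datatype 'a struc = Struc (zr: 'a) (on: 'a) (ad: "'a \<Rightarrow> 'a \<Rightarrow> 'a") (ml: "'a \<Rightarrow> 'a \<Rightarrow> 'a") (ls: "'a \<Rightarrow> 'a \<Rightarrow> bool")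

primrec tv :: "'a struc \<Rightarrow> (nat \<Rightarrow> 'a) \<Rightarrow> tm \<Rightarrow> 'a" where
  "tv M e (Var i) = e i"
| "tv M e Zero = zr M"
| "tv M e Unit = on M"
| "tv M e (s \<^bold>+ t) = ad M (tv M e s) (tv M e t)"
| "tv M e (s \<^bold>\<cdot> t) = ml M (tv M e s) (tv M e t)"

primrec sat :: "'a struc \<Rightarrow> 'a set set \<Rightarrow> (nat \<Rightarrow> 'a) \<Rightarrow> (nat \<Rightarrow> 'a set) \<Rightarrow> fm \<Rightarrow> bool" where
  "sat M D e s (t \<^bold>= u) \<longleftrightarrow> tv M e t = tv M e u"
| "sat M D e s (t \<^bold>< u) \<longleftrightarrow> ls M (tv M e t) (tv M e u)"
| "sat M D e s (t \<^bold>\<in> X) \<longleftrightarrow> tv M e t \<in> s X"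
| "sat M D e s Falsum \<longleftrightarrow> False"
| "sat M D e s (p \<^bold>\<longrightarrow> q) \<longleftrightarrow> (sat M D e s p \<longrightarrow> sat M D e s q)"
| "sat M D e s (AllN p) \<longleftrightarrow> (\<forall>x. sat M D (case_nat x e) s p)"
| "sat M D e s (AllS p) \<longleftrightarrow> (\<forall>X\<in>D. sat M D e (case_nat X s) p)"

definition models :: "'a struc \<Rightarrow> 'a set set \<Rightarrow> fm set \<Rightarrow> bool" where
  "models M D T \<longleftrightarrow> (\<forall>p\<in>T. \<forall>e s. (\<forall>i. s i \<in> D) \<longrightarrow> sat M D e s p)"

lemma tv_subst: "tv M e (subst_tm \<sigma> t) = tv M (\<lambda>i. tv M e (\<sigma> i)) t"
  by (induction t) auto

lemma tv_shift [simp]: "tv M e (shift d t) = tv M (\<lambda>i. e (i + d)) t"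
  by (simp add: shift_def tv_subst)

lemma sat_substN: "sat M D e s (substN \<sigma> p) \<longleftrightarrow> sat M D (\<lambda>i. tv M e (\<sigma> i)) s p"
proof (induction p arbitrary: e s \<sigma>)
  case (AllN p)
  have "(\<lambda>i. tv M (case_nat x e) (push_tm \<sigma> i)) = case_nat x (\<lambda>i. tv M e (\<sigma> i))" for x
    by (auto simp: push_tm_def split: nat.split)
  then show ?case using AllN by simp
qed (auto simp: tv_subst)

lemma sat_substS: "sat M D e s (substS \<rho> p) \<longleftrightarrow> sat M D e (\<lambda>i. s (\<rho> i)) p"
proof (induction p arbitrary: e s \<rho>)
  case (AllS p)
  have "(\<lambda>i. case_nat X s (push_ren \<rho> i)) = case_nat X (\<lambda>i. s (\<rho> i))" for X
    by (rule ext) (simp add: push_ren_def split: nat.split)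
  then show ?case using AllS by simp
qed auto

theorem soundness:
  assumes "T \<turnstile> p" "models M D T" "\<forall>i. s i \<in> D"
  shows "sat M D e s p"
  using assms(1,3)
proof (induction arbitrary: e s)
  case (Ax p) then show ?case using assms(2) by (auto simp: models_def)
next
  case (InstN p t)
  have "(\<lambda>i. tv M e (case_nat t Var i)) = case_nat (tv M e t) e" by (auto split: nat.split)
  then show ?case by (simp add: sat_substN)
next
  case (InstS p X)
  have "(\<lambda>i. s (case_nat X id i)) = case_nat (s X) s" by (rule ext) (simp split: nat.split)
  then show ?case using InstS by (simp add: sat_substS)
next
  case (GenS p)
  have "sat M D e (case_nat X s) p" if "X \<in> D" for X
    by (rule GenS.IH) (use GenS.prems that in \<open>auto split: nat.split\<close>)
  then show ?case by simp
next
  case (Leibniz u t p)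
  have "(\<lambda>i. tv M e (case_nat v Var i)) = case_nat (tv M e v) e" for v by (auto split: nat.split)
  then show ?case by (simp add: sat_substN)
qed (auto simp: sat_substN sat_substS)

section \<open>Completeness\<close>

lemma subst_tm_comp: "subst_tm \<sigma> (subst_tm \<tau> t) = subst_tm (\<lambda>i. subst_tm \<sigma> (\<tau> i)) t"
  by (induction t) auto

lemma substN_comp: "substN \<sigma> (substN \<tau> p) = substN (\<lambda>i. subst_tm \<sigma> (\<tau> i)) p"
proof (induction p arbitrary: \<sigma> \<tau>)
  case (AllN p)
  have "(\<lambda>i. subst_tm (push_tm \<sigma>) (push_tm \<tau> i)) = push_tm (\<lambda>i. subst_tm \<sigma> (\<tau> i))"
    by (auto simp: push_tm_def shift_def subst_tm_comp fun_eq_iff split: nat.split)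
  then show ?case using AllN by simp
qed (auto simp: subst_tm_comp)

lemma substS_comp: "substS \<sigma> (substS \<tau> p) = substS (\<lambda>i. \<sigma> (\<tau> i)) p"
proof (induction p arbitrary: \<sigma> \<tau>)
  case (AllS p)
  have "(\<lambda>i. push_ren \<sigma> (push_ren \<tau> i)) = push_ren (\<lambda>i. \<sigma> (\<tau> i))"
    by (auto simp: push_ren_def fun_eq_iff split: nat.split)
  then show ?case using AllS by simp
qed auto

lemma substN_substS: "substN \<sigma> (substS \<rho> p) = substS \<rho> (substN \<sigma> p)"
  by (induction p arbitrary: \<sigma> \<rho>) auto

lemma subst_tm_cong: "closed_tm m t \<Longrightarrow> (\<And>i. i < m \<Longrightarrow> \<sigma> i = \<tau> i) \<Longrightarrow> subst_tm \<sigma> t = subst_tm \<tau> t"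
  by (induction t) auto

lemma substN_cong: "closed_fm m n p \<Longrightarrow> (\<And>i. i < m \<Longrightarrow> \<sigma> i = \<tau> i) \<Longrightarrow> substN \<sigma> p = substN \<tau> p"
proof (induction p arbitrary: m n \<sigma> \<tau>)
  case (AllN p)
  have "substN (push_tm \<sigma>) p = substN (push_tm \<tau>) p"
    by (rule AllN.IH[of "Suc m" n]) (use AllN.prems in \<open>auto simp: push_tm_def split: nat.split\<close>)
  then show ?case by simp
next
  case (Imp p q)
  then show ?case using Imp.IH(1)[of m n \<sigma> \<tau>] Imp.IH(2)[of m n \<sigma> \<tau>] by simp
next
  case (AllS p)
  have "substN \<sigma> p = substN \<tau> p"
    by (rule AllS.IH[of m "Suc n"]) (use AllS.prems in simp_all)
  then show ?case by simp
qed (auto intro: subst_tm_cong)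

lemma substS_cong: "closed_fm m n p \<Longrightarrow> (\<And>i. i < n \<Longrightarrow> \<sigma> i = \<tau> i) \<Longrightarrow> substS \<sigma> p = substS \<tau> p"
proof (induction p arbitrary: m n \<sigma> \<tau>)
  case (AllS p)
  have "substS (push_ren \<sigma>) p = substS (push_ren \<tau>) p"
    by (rule AllS.IH[of m "Suc n"]) (use AllS.prems in \<open>auto simp: push_ren_def split: nat.split\<close>)
  then show ?case by simp
next
  case (Imp p q)
  then show ?case using Imp.IH(1)[of m n \<sigma> \<tau>] Imp.IH(2)[of m n \<sigma> \<tau>] by simp
next
  case (AllN p)
  have "substS \<sigma> p = substS \<tau> p"
    by (rule AllN.IH[of "Suc m" n]) (use AllN.prems in simp_all)
  then show ?case by simp
qed auto

lemma subst_tm_Var [simp]: "subst_tm Var t = t"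
  by (induction t) auto

lemma push_tm_Var [simp]: "push_tm Var = Var"
  by (auto simp: push_tm_def shift_def fun_eq_iff split: nat.split)

lemma substN_Var [simp]: "substN Var p = p"
  by (induction p) auto

lemma push_ren_id [simp]: "push_ren (\<lambda>i. i) = (\<lambda>i. i)"
  by (auto simp: push_ren_def fun_eq_iff split: nat.split)

lemma substS_id [simp]: "substS (\<lambda>i. i) p = p"
  by (induction p) auto

lemma closed_tm_mono: "closed_tm m t \<Longrightarrow> m \<le> m' \<Longrightarrow> closed_tm m' t"
  by (induction t) auto

lemma closed_fm_mono: "closed_fm m n p \<Longrightarrow> m \<le> m' \<Longrightarrow> n \<le> n' \<Longrightarrow> closed_fm m' n' p"
  by (induction p arbitrary: m n m' n') (auto intro: closed_tm_mono)

lemma closed_tm_ex: "\<exists>m. closed_tm m t"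
proof (induction t)
  case (Var i) then show ?case by (intro exI[of _ "Suc i"]) simp
next
  case (Add s t) then show ?case by (auto intro: closed_tm_mono[OF _ max.cobounded1] closed_tm_mono[OF _ max.cobounded2])
next
  case (Mul s t) then show ?case by (auto intro: closed_tm_mono[OF _ max.cobounded1] closed_tm_mono[OF _ max.cobounded2])
qed auto

lemma closed_fm_ex: "\<exists>k. closed_fm k k p"
proof (induction p)
  case (Eq s t)
  obtain m n where "closed_tm m s" "closed_tm n t" using closed_tm_ex by blast
  then show ?case by (intro exI[of _ "max m n"]) (auto intro: closed_tm_mono)
next
  case (Less s t)
  obtain m n where "closed_tm m s" "closed_tm n t" using closed_tm_ex by blast
  then show ?case by (intro exI[of _ "max m n"]) (auto intro: closed_tm_mono)
next
  case (Mem t X)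
  obtain m where "closed_tm m t" using closed_tm_ex by blast
  then show ?case by (intro exI[of _ "max m (Suc X)"]) (auto intro: closed_tm_mono)
next
  case (Imp p q)
  then obtain m n where "closed_fm m m p" "closed_fm n n q" by blast
  then show ?case by (intro exI[of _ "max m n"]) (auto intro: closed_fm_mono)
next
  case (AllN p) then obtain k where "closed_fm k k p" by blast
  then show ?case by (intro exI[of _ k]) (auto intro: closed_fm_mono)
next
  case (AllS p) then obtain k where "closed_fm k k p" by blast
  then show ?case by (intro exI[of _ k]) (auto intro: closed_fm_mono)
qed simp

text \<open>The first \<^term>\<open>n\<close> variables are instantiated one by one; the terms substituted first are
  shifted so that later instantiations bring them back.\<close>

lemma proves_inst_all: "T \<turnstile> p \<Longrightarrow> T \<turnstile> substN (\<lambda>i. if i < n then \<sigma> i else Var (i - n)) p"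
proof (induction n arbitrary: p \<sigma>)
  case (Suc n)
  let ?p = "instN (shift n (\<sigma> 0)) p"
  have "T \<turnstile> ?p" using proves.MP[OF proves.InstN proves.GenN[OF Suc.prems]] .
  from Suc.IH[OF this, of "\<lambda>i. \<sigma> (Suc i)"]
  have "T \<turnstile> substN (\<lambda>i. subst_tm (\<lambda>i. if i < n then \<sigma> (Suc i) else Var (i - n)) (case_nat (shift n (\<sigma> 0)) Var i)) p"
    by (simp add: substN_comp)
  also have "(\<lambda>i. subst_tm (\<lambda>i. if i < n then \<sigma> (Suc i) else Var (i - n)) (case_nat (shift n (\<sigma> 0)) Var i)) =
      (\<lambda>i. if i < Suc n then \<sigma> i else Var (i - Suc n))"
    by (auto simp: fun_eq_iff shift_def subst_tm_comp split: nat.split)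
  finally show ?case .
qed simp

lemma proves_substN: assumes "T \<turnstile> p" shows "T \<turnstile> substN \<sigma> p"
proof -
  obtain k where k: "closed_fm k k p" using closed_fm_ex by blast
  have "substN (\<lambda>i. if i < k then \<sigma> i else Var (i - k)) p = substN \<sigma> p" by (rule substN_cong[OF k]) simp
  then show ?thesis using proves_inst_all[OF assms, of k \<sigma>] by simp
qed

lemma proves_instS_all: "T \<turnstile> p \<Longrightarrow> T \<turnstile> substS (\<lambda>i. if i < n then \<rho> i else i - n) p"
proof (induction n arbitrary: p \<rho>)
  case (Suc n)
  let ?p = "instS (\<rho> 0 + n) p"
  have "T \<turnstile> ?p" using proves.MP[OF proves.InstS proves.GenS[OF Suc.prems]] .
  from Suc.IH[OF this, of "\<lambda>i. \<rho> (Suc i)"]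
  have "T \<turnstile> substS (\<lambda>i. let j = case_nat (\<rho> 0 + n) id i in if j < n then \<rho> (Suc j) else j - n) p"
    by (simp add: substS_comp Let_def)
  also have "(\<lambda>i. let j = case_nat (\<rho> 0 + n) id i in if j < n then \<rho> (Suc j) else j - n) =
      (\<lambda>i. if i < Suc n then \<rho> i else i - Suc n)"
    by (auto simp: fun_eq_iff split: nat.split)
  finally show ?case .
qed simp

lemma proves_substS: assumes "T \<turnstile> p" shows "T \<turnstile> substS \<rho> p"
proof -
  obtain k where k: "closed_fm k k p" using closed_fm_ex by blast
  have "substS (\<lambda>i. if i < k then \<rho> i else i - k) p = substS \<rho> p" by (rule substS_cong[OF k]) simp
  then show ?thesis using proves_instS_all[OF assms, of k \<rho>] by simp
qed

text \<open>Derivability from hypotheses whose free variables are treated as constants.\<close>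

inductive hyp :: "fm set \<Rightarrow> fm set \<Rightarrow> fm \<Rightarrow> bool" for T \<Gamma> where
  hyp_Hyp: "p \<in> \<Gamma> \<Longrightarrow> hyp T \<Gamma> p"
| hyp_Thm: "T \<turnstile> p \<Longrightarrow> hyp T \<Gamma> p"
| hyp_MP: "hyp T \<Gamma> (p \<^bold>\<longrightarrow> q) \<Longrightarrow> hyp T \<Gamma> p \<Longrightarrow> hyp T \<Gamma> q"

lemma hyp_empty: "hyp T {} p \<Longrightarrow> T \<turnstile> p"
  by (induction rule: hyp.induct) (auto intro: proves.MP)

lemma hyp_mono: "hyp T \<Gamma> p \<Longrightarrow> \<Gamma> \<subseteq> \<Delta> \<Longrightarrow> hyp T \<Delta> p"
  by (induction rule: hyp.induct) (auto intro: hyp.intros)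

lemma hyp_finite: "hyp T \<Gamma> p \<Longrightarrow> \<exists>\<Delta>. finite \<Delta> \<and> \<Delta> \<subseteq> \<Gamma> \<and> hyp T \<Delta> p"
proof (induction rule: hyp.induct)
  case (hyp_Hyp p) then show ?case by (intro exI[of _ "{p}"]) (auto intro: hyp.intros)
next
  case (hyp_Thm p) then show ?case by (intro exI[of _ "{}"]) (auto intro: hyp.intros)
next
  case (hyp_MP p q)
  then obtain A B where "finite A" "A \<subseteq> \<Gamma>" "hyp T A (p \<^bold>\<longrightarrow> q)" "finite B" "B \<subseteq> \<Gamma>" "hyp T B p" by blast
  then show ?case by (intro exI[of _ "A \<union> B"]) (auto intro: hyp.hyp_MP[of _ _ p] hyp_mono)
qed

lemma proves_id: "T \<turnstile> (p \<^bold>\<longrightarrow> p)"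
  by (rule proves.MP[OF proves.MP[OF proves.S proves.K] proves.K[of _ _ p]])

lemma deduction: "hyp T (insert a \<Gamma>) p \<Longrightarrow> hyp T \<Gamma> (a \<^bold>\<longrightarrow> p)"
proof (induction rule: hyp.induct)
  case (hyp_Hyp p)
  then show ?case
  proof (cases "p = a")
    case True then show ?thesis using proves_id hyp.hyp_Thm by blast
  next
    case False
    then have "hyp T \<Gamma> p" using hyp_Hyp by (auto intro: hyp.intros)
    then show ?thesis using hyp.hyp_MP[OF hyp.hyp_Thm[OF proves.K]] by blast
  qed
next
  case (hyp_Thm p)
  then show ?case using hyp.hyp_MP[OF hyp.hyp_Thm[OF proves.K] hyp.hyp_Thm] by blast
next
  case (hyp_MP p q)
  then show ?case using hyp.hyp_MP[OF hyp.hyp_MP[OF hyp.hyp_Thm[OF proves.S]]] by blast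
qed

lemma hyp_contr: "hyp T (insert (\<^bold>\<not> p) \<Gamma>) Falsum \<Longrightarrow> hyp T \<Gamma> p"
  using hyp_MP[OF hyp_Thm[OF proves.DN] deduction] .

lemma hyp_Falsum: "hyp T \<Gamma> Falsum \<Longrightarrow> hyp T \<Gamma> p"
  by (rule hyp_contr) (erule hyp_mono, blast)

lemma hyp_substN: "hyp T \<Gamma> p \<Longrightarrow> hyp T (substN \<sigma> ` \<Gamma>) (substN \<sigma> p)"
  by (induction rule: hyp.induct) (auto intro: hyp.intros proves_substN)

lemma hyp_substS: "hyp T \<Gamma> p \<Longrightarrow> hyp T (substS \<rho> ` \<Gamma>) (substS \<rho> p)"
  by (induction rule: hyp.induct) (auto intro: hyp.intros proves_substS)

lemma hyp_GenN: "hyp T (liftN ` \<Gamma>) p \<Longrightarrow> hyp T \<Gamma> (AllN p)"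
proof (induction rule: hyp.induct)
  case (hyp_Hyp p)
  then obtain g where "g \<in> \<Gamma>" "p = liftN g" by blast
  then show ?case using hyp_MP[OF hyp_Thm[OF proves.VacN] hyp.hyp_Hyp] by blast
next
  case (hyp_Thm p) then show ?case by (blast intro: hyp.hyp_Thm proves.GenN)
next
  case (hyp_MP p q)
  then show ?case using hyp.hyp_MP[OF hyp.hyp_MP[OF hyp.hyp_Thm[OF proves.DistN]]] by blast
qed

lemma hyp_GenS: "hyp T (liftS ` \<Gamma>) p \<Longrightarrow> hyp T \<Gamma> (AllS p)"
proof (induction rule: hyp.induct)
  case (hyp_Hyp p)
  then obtain g where "g \<in> \<Gamma>" "p = liftS g" by blast
  then show ?case using hyp_MP[OF hyp_Thm[OF proves.VacS] hyp.hyp_Hyp] by blast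
next
  case (hyp_Thm p) then show ?case by (blast intro: hyp.hyp_Thm proves.GenS)
next
  case (hyp_MP p q)
  then show ?case using hyp.hyp_MP[OF hyp.hyp_MP[OF hyp.hyp_Thm[OF proves.DistS]]] by blast
qed

text \<open>Renaming the fresh variable k to 0 and raising all others turns the hypotheses, in which
  k does not occur, into lifted ones.\<close>

lemma hyp_freshN:
  assumes h: "hyp T \<Gamma> (instN (Var k) q)" and \<Gamma>: "\<And>g. g \<in> \<Gamma> \<Longrightarrow> closed_fm k l g" and q: "closed_fm (Suc k) l q"
  shows "hyp T \<Gamma> (AllN q)"
proof -
  let ?\<sigma> = "\<lambda>i. if i = k then Var 0 else Var (Suc i)"
  have "substN ?\<sigma> ` \<Gamma> = liftN ` \<Gamma>" using \<Gamma> by (intro image_cong refl substN_cong) auto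
  moreover have "substN ?\<sigma> (instN (Var k) q) = q"
  proof -
    have "substN ?\<sigma> (instN (Var k) q) = substN Var q" unfolding substN_comp
      by (rule substN_cong[OF q]) (auto split: nat.split)
    then show ?thesis by simp
  qed
  ultimately have "hyp T (liftN ` \<Gamma>) q" using hyp_substN[OF h, of ?\<sigma>] by simp
  then show ?thesis by (rule hyp_GenN)
qed

lemma hyp_freshS:
  assumes h: "hyp T \<Gamma> (instS l q)" and \<Gamma>: "\<And>g. g \<in> \<Gamma> \<Longrightarrow> closed_fm k l g" and q: "closed_fm k (Suc l) q"
  shows "hyp T \<Gamma> (AllS q)"
proof -
  let ?\<rho> = "\<lambda>i. if i = l then 0 else Suc i"
  have "substS ?\<rho> ` \<Gamma> = liftS ` \<Gamma>" using \<Gamma> by (intro image_cong refl substS_cong) auto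
  moreover have "substS ?\<rho> (instS l q) = q"
  proof -
    have "substS ?\<rho> (instS l q) = substS (\<lambda>i. i) q" unfolding substS_comp
      by (rule substS_cong[OF q]) (auto split: nat.split)
    then show ?thesis by simp
  qed
  ultimately have "hyp T (liftS ` \<Gamma>) q" using hyp_substS[OF h, of ?\<rho>] by simp
  then show ?thesis by (rule hyp_GenS)
qed

instance tm :: countable by countable_datatype
instance fm :: countable by countable_datatype

text \<open>The hypotheses may be infinitely many, but a common bound on their variables is
  maintained. A variable beyond it is available as a counterexample to a universal formula that is
  refuted.\<close>

lemma lindenbaum_step:
  assumes cons: "\<not> hyp T \<Gamma> Falsum" and \<Gamma>: "\<And>g. g \<in> \<Gamma> \<Longrightarrow> closed_fm k k g"
  obtains \<Delta> j where "\<Gamma> \<subseteq> \<Delta>" "\<not> hyp T \<Delta> Falsum" "\<And>g. g \<in> \<Delta> \<Longrightarrow> closed_fm j j g"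
    "p \<in> \<Delta> \<or> (\<^bold>\<not> p) \<in> \<Delta>" "\<And>q. p = AllN q \<Longrightarrow> p \<in> \<Delta> \<or> (\<exists>t. (\<^bold>\<not> instN t q) \<in> \<Delta>)"
    "\<And>q. p = AllS q \<Longrightarrow> p \<in> \<Delta> \<or> (\<exists>X. (\<^bold>\<not> instS X q) \<in> \<Delta>)"
proof (cases "hyp T (insert p \<Gamma>) Falsum")
  case False
  obtain k' where k': "closed_fm k' k' p" using closed_fm_ex by blast
  show ?thesis
  proof (rule that[of "insert p \<Gamma>" "max k k'"])
    show "closed_fm (max k k') (max k k') g" if "g \<in> insert p \<Gamma>" for g
      using that closed_fm_mono[OF k'] closed_fm_mono[OF \<Gamma>] by auto
  qed (use False in auto)
next
  case True
  note result = that
  have np: "\<not> hyp T (insert (\<^bold>\<not> p) \<Gamma>) Falsum"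
  proof
    assume "hyp T (insert (\<^bold>\<not> p) \<Gamma>) Falsum"
    then have "hyp T \<Gamma> p" by (rule hyp_contr)
    moreover have "hyp T \<Gamma> (\<^bold>\<not> p)" using deduction[OF True] .
    ultimately show False using hyp_MP cons by blast
  qed
  obtain k' where k': "closed_fm k' k' p" using closed_fm_ex by blast
  define m where "m = max k k'"
  have cl: "closed_fm m m g" if "g \<in> insert (\<^bold>\<not> p) \<Gamma>" for g
    using that closed_fm_mono[OF k'] closed_fm_mono[OF \<Gamma>] unfolding m_def by auto
  have new: thesis if c: "\<not> hyp T (insert w (insert (\<^bold>\<not> p) \<Gamma>)) Falsum" and
    w: "\<And>q. p = AllN q \<Longrightarrow> \<exists>t. w = (\<^bold>\<not> instN t q)" "\<And>q. p = AllS q \<Longrightarrow> \<exists>X. w = (\<^bold>\<not> instS X q)" for w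
  proof -
    obtain k'' where k'': "closed_fm k'' k'' w" using closed_fm_ex by blast
    have "closed_fm (max m k'') (max m k'') g" if "g \<in> insert w (insert (\<^bold>\<not> p) \<Gamma>)" for g
    proof (cases "g = w")
      case True then show ?thesis using closed_fm_mono[OF k''] by simp
    next
      case False
      then have "closed_fm m m g" using that cl by blast
      then show ?thesis by (rule closed_fm_mono) simp_all
    qed
    then show ?thesis using c w by (intro result[of "insert w (insert (\<^bold>\<not> p) \<Gamma>)" "max m k''"]) (blast+)
  qed
  show ?thesis
  proof (cases p)
    case p: (AllN q)
    show ?thesis
    proof (rule new[of "\<^bold>\<not> instN (Var m) q"])
      show "\<not> hyp T (insert (\<^bold>\<not> instN (Var m) q) (insert (\<^bold>\<not> p) \<Gamma>)) Falsum"
      proof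
        assume "hyp T (insert (\<^bold>\<not> instN (Var m) q) (insert (\<^bold>\<not> p) \<Gamma>)) Falsum"
        then have "hyp T (insert (\<^bold>\<not> p) \<Gamma>) (instN (Var m) q)" by (rule hyp_contr)
        then have "hyp T (insert (\<^bold>\<not> p) \<Gamma>) p" unfolding p
          by (rule hyp_freshN[of _ _ _ _ m]) (use cl cl[of "\<^bold>\<not> p"] p in auto)
        then show False using np hyp_MP[OF hyp_Hyp[of "\<^bold>\<not> p"]] by blast
      qed
    qed (use p in auto)
  next
    case p: (AllS q)
    show ?thesis
    proof (rule new[of "\<^bold>\<not> instS m q"])
      show "\<not> hyp T (insert (\<^bold>\<not> instS m q) (insert (\<^bold>\<not> p) \<Gamma>)) Falsum"
      proof
        assume "hyp T (insert (\<^bold>\<not> instS m q) (insert (\<^bold>\<not> p) \<Gamma>)) Falsum"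
        then have "hyp T (insert (\<^bold>\<not> p) \<Gamma>) (instS m q)" by (rule hyp_contr)
        then have "hyp T (insert (\<^bold>\<not> p) \<Gamma>) p" unfolding p
          by (rule hyp_freshS[of _ _ _ _ m]) (use cl cl[of "\<^bold>\<not> p"] p in auto)
        then show False using np hyp_MP[OF hyp_Hyp[of "\<^bold>\<not> p"]] by blast
      qed
    qed (use p in auto)
  qed (rule new[of "\<^bold>\<not> p"]; use np in simp)+
qed

definition henkin :: "fm set \<Rightarrow> fm set \<Rightarrow> bool" where
  "henkin T H \<longleftrightarrow> (\<forall>p. hyp T H p \<longrightarrow> p \<in> H) \<and> (\<forall>p. p \<in> H \<or> (\<^bold>\<not> p) \<in> H) \<and> Falsum \<notin> H \<and>
     (\<forall>q. (\<forall>t. instN t q \<in> H) \<longrightarrow> AllN q \<in> H) \<and> (\<forall>q. (\<forall>X. instS X q \<in> H) \<longrightarrow> AllS q \<in> H)"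

lemma henkin_extension:
  assumes cons: "\<not> hyp T \<Gamma> Falsum" and \<Gamma>: "\<And>g. g \<in> \<Gamma> \<Longrightarrow> closed_fm k k g"
  obtains H where "\<Gamma> \<subseteq> H" "henkin T H"
proof -
  define good where "good \<Delta> \<longleftrightarrow> \<not> hyp T \<Delta> Falsum \<and> (\<exists>k. \<forall>g\<in>\<Delta>. closed_fm k k g) \<and> \<Gamma> \<subseteq> \<Delta>" for \<Delta>
  define nxt where "nxt p \<Delta> \<longleftrightarrow> (p \<in> \<Delta> \<or> (\<^bold>\<not> p) \<in> \<Delta>) \<and> (\<forall>q. p = AllN q \<longrightarrow> p \<in> \<Delta> \<or> (\<exists>t. (\<^bold>\<not> instN t q) \<in> \<Delta>)) \<and>
    (\<forall>q. p = AllS q \<longrightarrow> p \<in> \<Delta> \<or> (\<exists>X. (\<^bold>\<not> instS X q) \<in> \<Delta>))" for p \<Delta>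
  have "\<exists>\<Delta>'. good \<Delta>' \<and> (\<Delta> \<subseteq> \<Delta>' \<and> nxt p \<Delta>')" if "good \<Delta>" for \<Delta> p
  proof -
    obtain k where "\<not> hyp T \<Delta> Falsum" "\<And>g. g \<in> \<Delta> \<Longrightarrow> closed_fm k k g" using \<open>good \<Delta>\<close> unfolding good_def by blast
    then obtain \<Delta>' j where *: "\<Delta> \<subseteq> \<Delta>'" "\<not> hyp T \<Delta>' Falsum" "\<And>g. g \<in> \<Delta>' \<Longrightarrow> closed_fm j j g"
      "p \<in> \<Delta>' \<or> (\<^bold>\<not> p) \<in> \<Delta>'" "\<And>q. p = AllN q \<Longrightarrow> p \<in> \<Delta>' \<or> (\<exists>t. (\<^bold>\<not> instN t q) \<in> \<Delta>')"
      "\<And>q. p = AllS q \<Longrightarrow> p \<in> \<Delta>' \<or> (\<exists>X. (\<^bold>\<not> instS X q) \<in> \<Delta>')"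
      by (rule lindenbaum_step[of T \<Delta> k p]) blast+
    have "good \<Delta>'" unfolding good_def using * \<open>good \<Delta>\<close>[unfolded good_def] by blast
    moreover have "nxt p \<Delta>'" unfolding nxt_def using *(4-6) by blast
    ultimately show ?thesis using *(1) by blast
  qed
  moreover have "good \<Gamma>" unfolding good_def using cons \<Gamma> by blast
  ultimately have "\<exists>f. \<forall>n. good (f n) \<and> (f n \<subseteq> f (Suc n) \<and> nxt (from_nat n :: fm) (f (Suc n)))"
    by (intro dependent_nat_choice) auto
  then obtain f where f: "\<And>n. good (f n)" "\<And>n. f n \<subseteq> f (Suc n)" "\<And>n. nxt (from_nat n) (f (Suc n))" by blast
  have mono: "f i \<subseteq> f j" if "i \<le> j" for i j using that by (rule lift_Suc_mono_le[of f, OF f(2)])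
  define H where "H = (\<Union>n. f n)"
  have nxt: "\<exists>n. nxt p (f n)" for p
  proof
    show "nxt p (f (Suc (to_nat p)))" using f(3)[of "to_nat p"] by (simp only: from_nat_to_nat)
  qed
  have consH: "\<not> hyp T H Falsum"
  proof
    assume "hyp T H Falsum"
    from hyp_finite[OF this] obtain \<Delta> where D: "finite \<Delta>" "\<Delta> \<subseteq> H" "hyp T \<Delta> Falsum" by (elim exE conjE)
    have "\<exists>n. \<Delta> \<subseteq> f n" using D(1,2)
    proof (induction \<Delta>)
      case (insert a \<Delta>)
      then obtain n m where "\<Delta> \<subseteq> f n" "a \<in> f m" unfolding H_def by blast
      then have "insert a \<Delta> \<subseteq> f (max n m)" using mono[of n "max n m"] mono[of m "max n m"] by auto
      then show ?case by blast
    qed simp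
    then obtain n where "\<Delta> \<subseteq> f n" ..
    with D(3) have "hyp T (f n) Falsum" by (rule hyp_mono)
    then show False using f(1) unfolding good_def by blast
  qed
  have neg: "p \<in> H \<or> (\<^bold>\<not> p) \<in> H" for p using nxt[of p] unfolding nxt_def H_def by blast
  have cl: "p \<in> H" if "hyp T H p" for p
  proof (rule ccontr)
    assume "p \<notin> H"
    then have "hyp T H (\<^bold>\<not> p)" using neg hyp_Hyp by blast
    then show False using hyp_MP that consH by blast
  qed
  have contra: "False" if "p \<in> H" "(\<^bold>\<not> p) \<in> H" for p
    using that consH hyp_MP[OF hyp_Hyp hyp_Hyp] by blast
  have "AllN q \<in> H" if all: "\<And>t. instN t q \<in> H" for q
  proof -
    obtain n where "AllN q \<in> f n \<or> (\<exists>t. (\<^bold>\<not> instN t q) \<in> f n)" using nxt[of "AllN q"] unfolding nxt_def by blast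
    then show ?thesis using all contra unfolding H_def by blast
  qed
  moreover have "AllS q \<in> H" if all: "\<And>X. instS X q \<in> H" for q
  proof -
    obtain n where "AllS q \<in> f n \<or> (\<exists>X. (\<^bold>\<not> instS X q) \<in> f n)" using nxt[of "AllS q"] unfolding nxt_def by blast
    then show ?thesis using all contra unfolding H_def by blast
  qed
  moreover have "Falsum \<notin> H" using consH hyp_Hyp by blast
  ultimately have "henkin T H" unfolding henkin_def using cl neg by blast
  moreover have "\<Gamma> \<subseteq> H" using f(1)[of 0] unfolding good_def H_def by blast
  ultimately show ?thesis using that by blast
qed

lemma henkin_proves: "henkin T H \<Longrightarrow> T \<turnstile> p \<Longrightarrow> p \<in> H"
  unfolding henkin_def using hyp_Thm by blast

lemma henkin_Imp: "henkin T H \<Longrightarrow> (p \<^bold>\<longrightarrow> q) \<in> H \<longleftrightarrow> (p \<in> H \<longrightarrow> q \<in> H)"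
proof -
  assume H: "henkin T H"
  have mp: "q \<in> H" if "(p \<^bold>\<longrightarrow> q) \<in> H" "p \<in> H" for p q
    using H that hyp_MP[OF hyp_Hyp hyp_Hyp] unfolding henkin_def by blast
  have F: "Falsum \<notin> H" "p \<in> H \<or> (\<^bold>\<not> p) \<in> H" using H unfolding henkin_def by blast+
  have K: "(q \<^bold>\<longrightarrow> p \<^bold>\<longrightarrow> q) \<in> H" by (rule henkin_proves[OF H proves.K])
  have "(p \<^bold>\<longrightarrow> q) \<in> H" if np: "(\<^bold>\<not> p) \<in> H"
  proof -
    have "hyp T (insert p H) Falsum" using hyp_MP[OF hyp_Hyp[of "\<^bold>\<not> p"] hyp_Hyp[of p]] np by blast
    then have "hyp T H (p \<^bold>\<longrightarrow> q)" by (rule deduction[OF hyp_Falsum])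
    then show ?thesis using H unfolding henkin_def by blast
  qed
  then show ?thesis using mp F K by blast
qed

lemma henkin_AllN: "henkin T H \<Longrightarrow> AllN q \<in> H \<longleftrightarrow> (\<forall>t. instN t q \<in> H)"
  using henkin_Imp[of T H "AllN q"] henkin_proves[OF _ proves.InstN] unfolding henkin_def by blast

lemma henkin_AllS: "henkin T H \<Longrightarrow> AllS q \<in> H \<longleftrightarrow> (\<forall>X. instS X q \<in> H)"
  using henkin_Imp[of T H "AllS q"] henkin_proves[OF _ proves.InstS] unfolding henkin_def by blast

lemma instN_shift [simp]: "subst_tm (case_nat s Var) (shift (Suc 0) t) = t"
  by (simp add: shift_def subst_tm_comp)

lemma henkin_replace:
  assumes "henkin T H" "(s \<^bold>= t) \<in> H" "instN s p \<in> H" shows "instN t p \<in> H"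
  using henkin_proves[OF assms(1) proves.Leibniz[of T s t p]] assms henkin_Imp[OF assms(1)] by blast

primrec num :: "nat \<Rightarrow> tm" where
  "num 0 = Zero"
| "num (Suc n) = num n \<^bold>+ Unit"

text \<open>The carrier is a prescribed type, since class instances will be declared on it. The term
  model can be transferred there because it is countably infinite: the basic axioms keep the
  numerals distinct.\<close>

theorem completeness:
  fixes T \<Gamma> :: "fm set"
  assumes cons: "\<not> hyp T \<Gamma> Falsum" and \<Gamma>: "\<And>g. g \<in> \<Gamma> \<Longrightarrow> closed_fm k k g" and T: "basic_axioms \<subseteq> T"
    and inf: "infinite (UNIV :: 'a::countable set)"
  obtains M and D :: "'a::countable set set" and e s where "models M D T" "countable D" "\<And>i. s i \<in> D" "\<And>g. g \<in> \<Gamma> \<Longrightarrow> sat M D e s g"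
proof -
  obtain H where GH: "\<Gamma> \<subseteq> H" and H: "henkin T H" using henkin_extension[OF cons \<Gamma>] by blast
  note pr = henkin_proves[OF H] and imp = henkin_Imp[OF H]
  have refl: "(t \<^bold>= t) \<in> H" for t by (rule pr[OF proves.Refl])
  have rep: "instN t p \<in> H" if "(s \<^bold>= t) \<in> H" "instN s p \<in> H" for s t p by (rule henkin_replace[OF H that])
  have sym: "(t \<^bold>= s) \<in> H" if "(s \<^bold>= t) \<in> H" for s t
    using rep[OF that, of "Var 0 \<^bold>= shift 1 s"] refl by simp
  have trans: "(s \<^bold>= u) \<in> H" if "(s \<^bold>= t) \<in> H" "(t \<^bold>= u) \<in> H" for s t u
    using rep[OF that(2), of "shift 1 s \<^bold>= Var 0"] that(1) by simp
  define cls where "cls t = {u. (t \<^bold>= u) \<in> H}" for t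
  have cls: "cls s = cls t \<longleftrightarrow> (s \<^bold>= t) \<in> H" for s t
    unfolding cls_def using refl sym trans by blast
  have bot: "Falsum \<notin> H" using H unfolding henkin_def by blast
  have ax0: "(num n \<^bold>+ Unit \<^bold>= Zero) \<notin> H" for n
  proof -
    have "T \<turnstile> (\<^bold>\<not> (Var 0 \<^bold>+ Unit \<^bold>= Zero))" using T by (intro proves.Ax) (auto simp: basic_axioms_def)
    from pr[OF proves_substN[OF this, of "\<lambda>_. num n"]] show ?thesis using bot by (simp add: imp)
  qed
  have ax1: "(num m \<^bold>= num n) \<in> H" if "(num m \<^bold>+ Unit \<^bold>= num n \<^bold>+ Unit) \<in> H" for m n
  proof -
    have "T \<turnstile> (Var 0 \<^bold>+ Unit \<^bold>= Var 1 \<^bold>+ Unit \<^bold>\<longrightarrow> Var 0 \<^bold>= Var 1)" using T by (intro proves.Ax) (auto simp: basic_axioms_def)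
    from pr[OF proves_substN[OF this, of "case_nat (num m) (\<lambda>_. num n)"]] show ?thesis using that by (simp add: imp)
  qed
  have num_inj: "(num m \<^bold>= num n) \<in> H \<Longrightarrow> m = n" for m n
  proof (induction m arbitrary: n)
    case 0 then show ?case using ax0 sym by (cases n) auto
  next
    case (Suc m) then show ?case using ax0 ax1 by (cases n) auto
  qed
  have "inj (\<lambda>n. cls (num n))" by (rule injI) (use num_inj cls in blast)
  then have "infinite (range (\<lambda>n. cls (num n)))" by (rule range_inj_infinite)
  then have "infinite (range cls)" by (rule contrapos_nn) (erule finite_subset[rotated], blast)
  then have b1: "bij_betw (to_nat_on (range cls)) (range cls) UNIV" by (intro to_nat_on_infinite) auto
  have b2: "bij_betw (from_nat_into (UNIV :: 'a set)) UNIV UNIV" using inf by (intro bij_betw_from_nat_into) auto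
  define h where "h t = (from_nat_into UNIV (to_nat_on (range cls) (cls t)) :: 'a)" for t
  have h_eq: "h s = h t \<longleftrightarrow> (s \<^bold>= t) \<in> H" for s t
    unfolding h_def cls[symmetric] using b1 b2 by (metis bij_betw_imp_inj_on inj_onD rangeI UNIV_I)
  have h_surj: "\<exists>t. h t = x" for x
  proof -
    obtain n where "from_nat_into UNIV n = x" using b2 by (metis bij_betw_imp_surj_on UNIV_I imageE)
    moreover obtain t where "to_nat_on (range cls) (cls t) = n" using b1 by (metis bij_betw_imp_surj_on UNIV_I imageE)
    ultimately show ?thesis unfolding h_def by blast
  qed
  define g where "g x = (SOME t. h t = x)" for x
  have hg: "h (g x) = x" for x unfolding g_def using someI_ex[OF h_surj] .
  have gh: "(g (h t) \<^bold>= t) \<in> H" for t using hg h_eq by blast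
  define M where "M = Struc (h Zero) (h Unit) (\<lambda>x y. h (g x \<^bold>+ g y)) (\<lambda>x y. h (g x \<^bold>\<cdot> g y)) (\<lambda>x y. (g x \<^bold>< g y) \<in> H)"
  define ss where "ss X = {x. (g x \<^bold>\<in> X) \<in> H}" for X
  define D where "D = range ss"
  have addc: "(s \<^bold>+ t \<^bold>= s' \<^bold>+ t') \<in> H" if "(s \<^bold>= s') \<in> H" "(t \<^bold>= t') \<in> H" for s t s' t'
    using rep[OF that(1), of "shift 1 (s \<^bold>+ t) \<^bold>= Var 0 \<^bold>+ shift 1 t"] rep[OF that(2), of "shift 1 (s \<^bold>+ t) \<^bold>= shift 1 s' \<^bold>+ Var 0"] refl
    by simp
  have mulc: "(s \<^bold>\<cdot> t \<^bold>= s' \<^bold>\<cdot> t') \<in> H" if "(s \<^bold>= s') \<in> H" "(t \<^bold>= t') \<in> H" for s t s' t'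
    using rep[OF that(1), of "shift 1 (s \<^bold>\<cdot> t) \<^bold>= Var 0 \<^bold>\<cdot> shift 1 t"] rep[OF that(2), of "shift 1 (s \<^bold>\<cdot> t) \<^bold>= shift 1 s' \<^bold>\<cdot> Var 0"] refl
    by simp
  have lessc: "(s' \<^bold>< t') \<in> H" if "(s \<^bold>= s') \<in> H" "(t \<^bold>= t') \<in> H" "(s \<^bold>< t) \<in> H" for s t s' t'
    using rep[OF that(1), of "Var 0 \<^bold>< shift 1 t"] rep[OF that(2), of "shift 1 s' \<^bold>< Var 0"] that(3) by simp
  have memc: "(s' \<^bold>\<in> X) \<in> H" if "(s \<^bold>= s') \<in> H" "(s \<^bold>\<in> X) \<in> H" for s s' X
    using rep[OF that(1), of "Var 0 \<^bold>\<in> X"] that(2) by simp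
  have tvh: "tv M (\<lambda>i. h (\<sigma> i)) t = h (subst_tm \<sigma> t)" for \<sigma> t
  proof (induction t)
    case (Add s t) then show ?case by (simp add: M_def h_eq) (intro addc gh)
  next
    case (Mul s t) then show ?case by (simp add: M_def h_eq) (intro mulc gh)
  qed (simp_all add: M_def)
  have truth: "sat M D (\<lambda>i. h (\<sigma> i)) (\<lambda>i. ss (\<rho> i)) p \<longleftrightarrow> substN \<sigma> (substS \<rho> p) \<in> H" for \<sigma> \<rho> p
  proof (induction p arbitrary: \<sigma> \<rho>)
    case (Eq s t) then show ?case by (simp add: tvh h_eq)
  next
    case (Less s t)
    have "(g (h u) \<^bold>< g (h v)) \<in> H \<longleftrightarrow> (u \<^bold>< v) \<in> H" for u v
      using lessc[OF gh gh] lessc[OF sym[OF gh] sym[OF gh]] by blast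
    then show ?case by (simp add: tvh) (simp add: M_def)
  next
    case (Mem t X)
    have "(g (h u) \<^bold>\<in> Y) \<in> H \<longleftrightarrow> (u \<^bold>\<in> Y) \<in> H" for u Y
      using memc[OF gh] memc[OF sym[OF gh]] by blast
    then show ?case by (simp add: tvh ss_def)
  next
    case Falsum then show ?case using bot by simp
  next
    case (Imp p q) then show ?case by (simp add: imp)
  next
    case (AllN p)
    have "sat M D (case_nat (h t) (\<lambda>i. h (\<sigma> i))) (\<lambda>i. ss (\<rho> i)) p \<longleftrightarrow> instN t (substN (push_tm \<sigma>) (substS \<rho> p)) \<in> H" for t
    proof -
      have 1: "case_nat (h t) (\<lambda>i. h (\<sigma> i)) = (\<lambda>i. h (case_nat t \<sigma> i))" by (rule ext) (simp split: nat.split)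
      have 2: "(\<lambda>i. subst_tm (case_nat t Var) (push_tm \<sigma> i)) = case_nat t \<sigma>"
        by (rule ext) (simp add: push_tm_def split: nat.split)
      show ?thesis unfolding 1 AllN.IH substN_comp 2 ..
    qed
    then have "(\<forall>t. sat M D (case_nat (h t) (\<lambda>i. h (\<sigma> i))) (\<lambda>i. ss (\<rho> i)) p) \<longleftrightarrow> AllN (substN (push_tm \<sigma>) (substS \<rho> p)) \<in> H"
      unfolding henkin_AllN[OF H] by blast
    then show ?case using h_surj by simp metis
  next
    case (AllS p)
    have "sat M D (\<lambda>i. h (\<sigma> i)) (case_nat (ss X) (\<lambda>i. ss (\<rho> i))) p \<longleftrightarrow> instS X (substN \<sigma> (substS (push_ren \<rho>) p)) \<in> H" for X
    proof -
      have 1: "case_nat (ss X) (\<lambda>i. ss (\<rho> i)) = (\<lambda>i. ss (case_nat X \<rho> i))" by (rule ext) (simp split: nat.split)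
      have 2: "(\<lambda>i. case_nat X id (push_ren \<rho> i)) = case_nat X \<rho>"
        by (rule ext) (simp add: push_ren_def split: nat.split)
      show ?thesis unfolding 1 AllS.IH substN_substS[symmetric] substS_comp 2 ..
    qed
    then have "(\<forall>X. sat M D (\<lambda>i. h (\<sigma> i)) (case_nat (ss X) (\<lambda>i. ss (\<rho> i))) p) \<longleftrightarrow> AllS (substN \<sigma> (substS (push_ren \<rho>) p)) \<in> H"
      unfolding henkin_AllS[OF H] by blast
    then show ?case unfolding D_def by simp
  qed
  have "models M D T" unfolding models_def
  proof (intro ballI allI impI)
    fix p and e :: "nat \<Rightarrow> 'a" and s :: "nat \<Rightarrow> 'a set"
    assume p: "p \<in> T" and s: "\<forall>i. s i \<in> D"
    have e: "e = (\<lambda>i. h (g (e i)))" using hg by simp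
    have "\<exists>\<rho>. \<forall>i. s i = ss (\<rho> i)" using s unfolding D_def by (intro choice) auto
    then obtain \<rho> where "\<forall>i. s i = ss (\<rho> i)" ..
    then have s: "s = (\<lambda>i. ss (\<rho> i))" by auto
    have "substN (\<lambda>i. g (e i)) (substS \<rho> p) \<in> H"
      by (intro pr proves_substN proves_substS proves.Ax p)
    then have "sat M D (\<lambda>i. h (g (e i))) (\<lambda>i. ss (\<rho> i)) p" using truth[of "\<lambda>i. g (e i)" \<rho> p] by (simp only:)
    then show "sat M D e s p" using e s by simp
  qed
  moreover have "countable D" unfolding D_def by simp
  moreover have "ss i \<in> D" for i unfolding D_def by simp
  moreover have "sat M D (\<lambda>i. h (Var i)) ss q" if "q \<in> \<Gamma>" for q
    using truth[of Var "\<lambda>i. i" q] that GH by auto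
  ultimately show ?thesis using that[of M D ss "\<lambda>i. h (Var i)"] by blast
qed

section \<open>Arithmetic in models of \<open>RCA\<^sub>0\<close>\<close>

lemma models_mono: "models M D T \<Longrightarrow> T' \<subseteq> T \<Longrightarrow> models M D T'"
  unfolding models_def by blast

lemma modelsD: "models M D T \<Longrightarrow> p \<in> T \<Longrightarrow> \<forall>i. s i \<in> D \<Longrightarrow> sat M D e s p"
  unfolding models_def by blast

locale raw_model =
  fixes M :: "'a struc" and D :: "'a set set"
  assumes RCA0: "models M D RCA0" and D_ne: "D \<noteq> {}"
begin

abbreviation rz ("\<zero>") where "\<zero> \<equiv> zr M"
abbreviation ro ("\<one>") where "\<one> \<equiv> on M"
abbreviation ra (infixl "\<oplus>" 65) where "x \<oplus> y \<equiv> ad M x y"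
abbreviation rm (infixl "\<otimes>" 70) where "x \<otimes> y \<equiv> ml M x y"
abbreviation rl (infix "\<prec>" 50) where "x \<prec> y \<equiv> ls M x y"

definition s0 :: "nat \<Rightarrow> 'a set" where "s0 = (\<lambda>_. SOME X. X \<in> D)"

lemma s0: "\<forall>i. s0 i \<in> D"
  unfolding s0_def using D_ne by (simp add: some_in_eq)

lemma basic: "p \<in> basic_axioms \<Longrightarrow> sat M D e s0 p"
  by (rule modelsD[OF RCA0 _ s0]) (simp add: RCA0_def)

lemma b1: "x \<oplus> \<one> \<noteq> \<zero>"
  using basic[of "\<^bold>\<not> (Var 0 \<^bold>+ Unit \<^bold>= Zero)" "\<lambda>_. x"] by (simp add: basic_axioms_def)
lemma b2: "x \<oplus> \<one> = y \<oplus> \<one> \<Longrightarrow> x = y"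
  using basic[of "Var 0 \<^bold>+ Unit \<^bold>= Var 1 \<^bold>+ Unit \<^bold>\<longrightarrow> Var 0 \<^bold>= Var 1" "case_nat x (\<lambda>_. y)"] by (simp add: basic_axioms_def)
lemma b3: "x \<oplus> \<zero> = x"
  using basic[of "Var 0 \<^bold>+ Zero \<^bold>= Var 0" "\<lambda>_. x"] by (simp add: basic_axioms_def)
lemma b4: "x \<oplus> (y \<oplus> \<one>) = (x \<oplus> y) \<oplus> \<one>"
  using basic[of "Var 0 \<^bold>+ (Var 1 \<^bold>+ Unit) \<^bold>= (Var 0 \<^bold>+ Var 1) \<^bold>+ Unit" "case_nat x (\<lambda>_. y)"] by (simp add: basic_axioms_def)
lemma b5: "x \<otimes> \<zero> = \<zero>"
  using basic[of "Var 0 \<^bold>\<cdot> Zero \<^bold>= Zero" "\<lambda>_. x"] by (simp add: basic_axioms_def)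
lemma b6: "x \<otimes> (y \<oplus> \<one>) = (x \<otimes> y) \<oplus> x"
  using basic[of "Var 0 \<^bold>\<cdot> (Var 1 \<^bold>+ Unit) \<^bold>= (Var 0 \<^bold>\<cdot> Var 1) \<^bold>+ Var 0" "case_nat x (\<lambda>_. y)"] by (simp add: basic_axioms_def)
lemma b7: "\<not> x \<prec> \<zero>"
  using basic[of "\<^bold>\<not> (Var 0 \<^bold>< Zero)" "\<lambda>_. x"] by (simp add: basic_axioms_def)
lemma b8: "x \<prec> y \<oplus> \<one> \<longleftrightarrow> x \<prec> y \<or> x = y"
  using basic[of "Var 0 \<^bold>< Var 1 \<^bold>+ Unit \<^bold>\<longleftrightarrow> Var 0 \<^bold>< Var 1 \<^bold>\<or> Var 0 \<^bold>= Var 1" "case_nat x (\<lambda>_. y)"]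
  by (auto simp: basic_axioms_def)

lemma sigma1_induct:
  assumes q: "bounded q" and s: "\<forall>i. s i \<in> D"
    and 0: "\<exists>y. sat M D (case_nat y (case_nat \<zero> e)) s q"
    and Suc: "\<And>x y. sat M D (case_nat y (case_nat x e)) s q \<Longrightarrow> \<exists>y. sat M D (case_nat y (case_nat (x \<oplus> \<one>) e)) s q"
  shows "\<exists>y. sat M D (case_nat y (case_nat x e)) s q"
proof -
  have "induction_axiom (ExN q) \<in> RCA0" using q unfolding RCA0_def by auto
  from modelsD[OF RCA0 this s, of e]
  have *: "(\<exists>y. sat M D (case_nat y (case_nat \<zero> e)) s q) \<longrightarrow> (\<forall>x. (\<exists>y. sat M D (case_nat y (case_nat x e)) s q) \<longrightarrow>
      (\<exists>y. sat M D (case_nat y (case_nat (x \<oplus> \<one>) e)) s q)) \<longrightarrow> (\<forall>x. \<exists>y. sat M D (case_nat y (case_nat x e)) s q)"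
  proof -
    have 1: "(\<lambda>i. tv M e (case_nat Zero Var i)) = case_nat \<zero> e" by (rule ext) (simp split: nat.split)
    have 2: "(\<lambda>i. tv M (case_nat x e) (case_nat (Var 0 \<^bold>+ Unit) (\<lambda>i. Var (Suc i)) i)) = case_nat (x \<oplus> \<one>) e" for x
      by (rule ext) (simp split: nat.split)
    from \<open>sat M D e s (induction_axiom (ExN q))\<close> show ?thesis
      unfolding induction_axiom_def sat.simps(4,5,6) sat_substN 1 2 by blast
  qed
  then show ?thesis using 0 Suc by blast
qed

lemma push_tm_0: "push_tm \<sigma> 0 = Var 0"
  by (simp add: push_tm_def)

lemma push_tm_shift: "subst_tm (push_tm \<sigma>) (shift 1 t) = shift 1 (subst_tm \<sigma> t)"
  by (simp add: shift_def subst_tm_comp push_tm_def)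

lemma bounded_substN: "bounded p \<Longrightarrow> bounded (substN \<sigma> p)"
proof (induction arbitrary: \<sigma> rule: bounded.induct)
  case (6 p t)
  show ?case unfolding substN.simps subst_tm.simps push_tm_0 push_tm_shift by (rule bounded.intros(6)[OF 6(2)])
next
  case (7 p t)
  show ?case unfolding substN.simps subst_tm.simps push_tm_0 push_tm_shift by (rule bounded.intros(7)[OF 7(2)])
qed (auto intro: bounded.intros)

lemma sat_liftN: "sat M D (case_nat y e) s (liftN p) \<longleftrightarrow> sat M D e s p"
  by (simp add: sat_substN)

text \<open>Sigma_1 induction with a vacuous existential quantifier.\<close>

lemma open_induct:
  assumes p: "bounded p" and s: "\<forall>i. s i \<in> D"
    and 0: "sat M D (case_nat \<zero> e) s p"
    and Suc: "\<And>x. sat M D (case_nat x e) s p \<Longrightarrow> sat M D (case_nat (x \<oplus> \<one>) e) s p"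
  shows "sat M D (case_nat x e) s p"
  using sigma1_induct[OF bounded_substN[OF p, of "\<lambda>i. Var (Suc i)"] s, of e x] 0 Suc by (simp add: sat_liftN)

lemma add_assoc: "(x \<oplus> y) \<oplus> z = x \<oplus> (y \<oplus> z)"
  using open_induct[of "(Var 1 \<^bold>+ Var 2) \<^bold>+ Var 0 \<^bold>= Var 1 \<^bold>+ (Var 2 \<^bold>+ Var 0)" s0 "case_nat x (\<lambda>_. y)" z]
  by (simp add: bounded.intros s0 b3 b4 numeral_2_eq_2)

lemma add_0_left: "\<zero> \<oplus> x = x"
  using open_induct[of "Zero \<^bold>+ Var 0 \<^bold>= Var 0" s0 "\<lambda>_. x" x]
  by (simp add: bounded.intros s0 b3 b4)

lemma add_1_left: "(x \<oplus> \<one>) \<oplus> y = (x \<oplus> y) \<oplus> \<one>"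
  using open_induct[of "(Var 1 \<^bold>+ Unit) \<^bold>+ Var 0 \<^bold>= (Var 1 \<^bold>+ Var 0) \<^bold>+ Unit" s0 "\<lambda>_. x" y]
  by (simp add: bounded.intros s0 b3 b4)

lemma add_comm: "x \<oplus> y = y \<oplus> x"
  using open_induct[of "Var 0 \<^bold>+ Var 1 \<^bold>= Var 1 \<^bold>+ Var 0" s0 "\<lambda>_. y" x]
  by (simp add: bounded.intros s0 b3 b4 add_0_left add_1_left)

lemma mul_0_left: "\<zero> \<otimes> x = \<zero>"
  using open_induct[of "Zero \<^bold>\<cdot> Var 0 \<^bold>= Zero" s0 "\<lambda>_. x" x]
  by (simp add: bounded.intros s0 b3 b5 b6)

lemma mul_1_left: "(x \<oplus> \<one>) \<otimes> y = (x \<otimes> y) \<oplus> y"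
proof -
  have "(x \<otimes> z \<oplus> z) \<oplus> (x \<oplus> \<one>) = (x \<otimes> z \<oplus> x) \<oplus> (z \<oplus> \<one>)" for z
    by (metis add_assoc add_comm)
  then show ?thesis
    using open_induct[of "(Var 1 \<^bold>+ Unit) \<^bold>\<cdot> Var 0 \<^bold>= (Var 1 \<^bold>\<cdot> Var 0) \<^bold>+ Var 0" s0 "\<lambda>_. x" y]
    by (simp add: bounded.intros s0 b3 b5 b6)
qed

lemma mul_comm: "x \<otimes> y = y \<otimes> x"
  using open_induct[of "Var 0 \<^bold>\<cdot> Var 1 \<^bold>= Var 1 \<^bold>\<cdot> Var 0" s0 "\<lambda>_. y" x]
  by (simp add: bounded.intros s0 b5 b6 mul_0_left mul_1_left)

lemma distrib: "x \<otimes> (y \<oplus> z) = x \<otimes> y \<oplus> x \<otimes> z"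
  using open_induct[of "Var 1 \<^bold>\<cdot> (Var 2 \<^bold>+ Var 0) \<^bold>= Var 1 \<^bold>\<cdot> Var 2 \<^bold>+ Var 1 \<^bold>\<cdot> Var 0" s0 "case_nat x (\<lambda>_. y)" z]
  by (simp add: bounded.intros s0 b3 b4 b5 b6 add_assoc[symmetric] numeral_2_eq_2)

lemma mul_1_right: "x \<otimes> \<one> = x"
  using b6[of x \<zero>] by (simp add: add_0_left b5)

lemma mul_assoc: "(x \<otimes> y) \<otimes> z = x \<otimes> (y \<otimes> z)"
  using open_induct[of "(Var 1 \<^bold>\<cdot> Var 2) \<^bold>\<cdot> Var 0 \<^bold>= Var 1 \<^bold>\<cdot> (Var 2 \<^bold>\<cdot> Var 0)" s0 "case_nat x (\<lambda>_. y)" z]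
  by (simp add: bounded.intros s0 b5 b6 distrib mul_1_right numeral_2_eq_2)

lemma mul_1: "\<one> \<otimes> x = x"
  using mul_1_left[of \<zero> x] by (simp add: add_0_left mul_0_left)

lemma add_cancel: "x \<oplus> z = y \<oplus> z \<Longrightarrow> x = y"
  using open_induct[of "Var 1 \<^bold>+ Var 0 \<^bold>= Var 2 \<^bold>+ Var 0 \<^bold>\<longrightarrow> Var 1 \<^bold>= Var 2" s0 "case_nat x (\<lambda>_. y)" z]
  by (auto simp: bounded.intros s0 b3 b4 numeral_2_eq_2 dest: b2)

lemma zero_or_suc: "x = \<zero> \<or> (\<exists>y. x = y \<oplus> \<one>)"
  using sigma1_induct[of "Var 1 \<^bold>= Zero \<^bold>\<or> Var 1 \<^bold>= Var 0 \<^bold>+ Unit" s0 "\<lambda>_. x" x]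
  by (auto simp: bounded.intros s0)

lemma add_eq_0: "x \<oplus> y = \<zero> \<Longrightarrow> y = \<zero>"
  using zero_or_suc[of y] b1 b4 by metis

lemma less_add: "x \<prec> x \<oplus> (z \<oplus> \<one>)"
  using open_induct[of "Var 1 \<^bold>< Var 1 \<^bold>+ (Var 0 \<^bold>+ Unit)" s0 "\<lambda>_. x" z]
  by (simp add: bounded.intros s0 b3 b4 b8)

lemma less_ex: "x \<prec> y \<Longrightarrow> \<exists>z. y = x \<oplus> (z \<oplus> \<one>)"
proof -
  let ?q = "Var 2 \<^bold>< Var 1 \<^bold>\<longrightarrow> Var 1 \<^bold>= Var 2 \<^bold>+ (Var 0 \<^bold>+ Unit)"
  have "\<exists>z. sat M D (case_nat z (case_nat y (\<lambda>_. x))) s0 ?q"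
  proof (rule sigma1_induct)
    fix u v assume "sat M D (case_nat v (case_nat u (\<lambda>_. x))) s0 ?q"
    then have *: "x \<prec> u \<Longrightarrow> u = x \<oplus> (v \<oplus> \<one>)" by (simp add: numeral_2_eq_2)
    have "\<exists>w. x \<prec> u \<oplus> \<one> \<longrightarrow> u \<oplus> \<one> = x \<oplus> (w \<oplus> \<one>)"
    proof (cases "x \<prec> u")
      case True
      then show ?thesis using *[OF True] by (intro exI[of _ "v \<oplus> \<one>"]) (metis b4)
    next
      case False
      then show ?thesis by (intro exI[of _ \<zero>]) (auto simp: b8 add_0_left)
    qed
    then show "\<exists>w. sat M D (case_nat w (case_nat (u \<oplus> \<one>) (\<lambda>_. x))) s0 ?q" by (simp add: numeral_2_eq_2)
  qed (simp_all add: bounded.intros s0 b7)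
  then show "x \<prec> y \<Longrightarrow> ?thesis" by (simp add: numeral_2_eq_2)
qed

definition rle (infix "\<preceq>" 50) where "x \<preceq> y \<longleftrightarrow> (\<exists>z. y = x \<oplus> z)"

lemma less_iff: "x \<prec> y \<longleftrightarrow> x \<preceq> y \<and> \<not> y \<preceq> x"
proof
  assume "x \<prec> y"
  then obtain z where z: "y = x \<oplus> (z \<oplus> \<one>)" using less_ex by blast
  have "x \<noteq> (x \<oplus> (z \<oplus> \<one>)) \<oplus> w" for w
  proof
    assume "x = (x \<oplus> (z \<oplus> \<one>)) \<oplus> w"
    then have "\<zero> \<oplus> x = ((z \<oplus> \<one>) \<oplus> w) \<oplus> x" by (metis add_0_left add_assoc add_comm)
    then have "(z \<oplus> w) \<oplus> \<one> = \<zero>" using add_cancel add_1_left by metis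
    then show False using b1 by blast
  qed
  then show "x \<preceq> y \<and> \<not> y \<preceq> x" unfolding rle_def z by blast
next
  assume *: "x \<preceq> y \<and> \<not> y \<preceq> x"
  then obtain z where z: "y = x \<oplus> z" unfolding rle_def by blast
  have "z \<noteq> \<zero>" using * unfolding rle_def z using b3 by metis
  then show "x \<prec> y" using zero_or_suc[of z] less_add z by metis
qed

lemma linear: "x \<preceq> y \<or> y \<preceq> x"
proof -
  let ?q = "Var 2 \<^bold>= Var 1 \<^bold>+ Var 0 \<^bold>\<or> Var 1 \<^bold>= Var 2 \<^bold>+ Var 0"
  have "\<exists>z. sat M D (case_nat z (case_nat x (\<lambda>_. y))) s0 ?q"
  proof (rule sigma1_induct)
    have "\<exists>z. y = \<zero> \<oplus> z" using add_0_left by metis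
    then show "\<exists>z. sat M D (case_nat z (case_nat \<zero> (\<lambda>_. y))) s0 ?q" by (auto simp: numeral_2_eq_2)
    fix u z assume "sat M D (case_nat z (case_nat u (\<lambda>_. y))) s0 ?q"
    then consider "u = y \<oplus> z" | "y = u \<oplus> z" by (auto simp: numeral_2_eq_2)
    then have "\<exists>z. y = (u \<oplus> \<one>) \<oplus> z \<or> u \<oplus> \<one> = y \<oplus> z"
    proof cases
      case 1 then show ?thesis using b4 by metis
    next
      case 2 then show ?thesis using zero_or_suc[of z] b3 b4 add_1_left by metis
    qed
    then show "\<exists>z. sat M D (case_nat z (case_nat (u \<oplus> \<one>) (\<lambda>_. y))) s0 ?q" by (auto simp: numeral_2_eq_2)
  qed (simp_all add: bounded.intros s0)
  then have "\<exists>z. y = x \<oplus> z \<or> x = y \<oplus> z" by (auto simp: numeral_2_eq_2)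
  then show ?thesis unfolding rle_def by blast
qed

definition rminus (infixl "\<ominus>" 65) where "x \<ominus> y = (if y \<preceq> x then THE z. x = y \<oplus> z else \<zero>)"

lemma minus_eq: "(x \<oplus> y) \<ominus> x = y"
proof -
  have "(THE z. x \<oplus> y = x \<oplus> z) = y" by (rule the_equality) (use add_cancel add_comm in metis)+
  then show ?thesis unfolding rminus_def rle_def by auto
qed

lemma le_trans: "x \<preceq> y \<Longrightarrow> y \<preceq> z \<Longrightarrow> x \<preceq> z"
  unfolding rle_def using add_assoc by metis

lemma le_antisym: "x \<preceq> y \<Longrightarrow> y \<preceq> x \<Longrightarrow> x = y"
proof -
  assume "x \<preceq> y" "y \<preceq> x"
  then obtain u v where uv: "y = x \<oplus> u" "x = y \<oplus> v" unfolding rle_def by blast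
  then have "\<zero> \<oplus> x = (u \<oplus> v) \<oplus> x" by (metis add_0_left add_assoc add_comm)
  then have "u \<oplus> v = \<zero>" using add_cancel by metis
  then show "x = y" using add_eq_0 uv b3 by metis
qed

lemma minus_minus: "(x \<ominus> y) \<ominus> z = x \<ominus> (y \<oplus> z)"
proof (cases "y \<preceq> x")
  case True
  then obtain u where u: "x = y \<oplus> u" unfolding rle_def by blast
  show ?thesis
  proof (cases "z \<preceq> u")
    case True
    then obtain v where "u = z \<oplus> v" unfolding rle_def by blast
    then show ?thesis using u minus_eq add_assoc by metis
  next
    case False
    have "\<not> y \<oplus> z \<preceq> x"
    proof
      assume "y \<oplus> z \<preceq> x"
      then obtain w where "y \<oplus> u = (y \<oplus> z) \<oplus> w" unfolding rle_def u by blast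
      then have "u = z \<oplus> w" using add_cancel add_assoc add_comm by metis
      then show False using False unfolding rle_def by blast
    qed
    then show ?thesis using False u minus_eq unfolding rminus_def[of _ "y \<oplus> z"] rminus_def[of _ z] by simp
  qed
next
  case False
  have "\<not> y \<oplus> z \<preceq> x" using False le_trans unfolding rle_def by (metis add_assoc)
  moreover have "\<zero> \<ominus> z = \<zero>"
  proof (cases "z \<preceq> \<zero>")
    case True
    then have "z = \<zero>" unfolding rle_def using add_eq_0 add_comm by metis
    then show ?thesis using minus_eq[of \<zero> \<zero>] b3 by simp
  qed (simp add: rminus_def)
  ultimately show ?thesis using False unfolding rminus_def[of x] by simp
qed

lemma mul_strict_mono: "x \<prec> y \<Longrightarrow> \<zero> \<prec> z \<Longrightarrow> z \<otimes> x \<prec> z \<otimes> y"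
proof -
  assume "x \<prec> y" "\<zero> \<prec> z"
  then obtain u v where "y = x \<oplus> (u \<oplus> \<one>)" "z = v \<oplus> \<one>" using less_ex add_0_left by metis
  moreover from this have "z \<otimes> y = z \<otimes> x \<oplus> ((z \<otimes> u \<oplus> v) \<oplus> \<one>)" using distrib b6 b4 by metis
  ultimately show ?thesis using less_add by metis
qed

lemma zero_less_one: "\<zero> \<prec> \<one>"
  using b8[of \<zero> \<zero>] add_0_left[of \<one>] by simp

lemma zero_le: "\<zero> \<preceq> x"
  unfolding rle_def using add_0_left by metis

lemma semidom: "class.linordered_semidom (\<oplus>) (\<ominus>) (\<preceq>) (\<prec>) \<zero> (\<otimes>) \<one>"
proof (intro_locales, unfold_locales)
  show "(a \<oplus> b) \<oplus> c = a \<oplus> (b \<oplus> c)" for a b c by (rule add_assoc)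
  show "a \<oplus> b = b \<oplus> a" for a b by (rule add_comm)
  show "a \<oplus> b \<ominus> a = b" for a b by (rule minus_eq)
  show "a \<ominus> b \<ominus> c = a \<ominus> (b \<oplus> c)" for a b c by (rule minus_minus)
  show "x \<prec> y \<longleftrightarrow> x \<preceq> y \<and> \<not> y \<preceq> x" for x y by (rule less_iff)
  show "x \<preceq> x" for x unfolding rle_def using b3 by metis
  show "x \<preceq> y \<Longrightarrow> y \<preceq> z \<Longrightarrow> x \<preceq> z" for x y z by (rule le_trans)
  show "x \<preceq> y \<Longrightarrow> y \<preceq> x \<Longrightarrow> x = y" for x y by (rule le_antisym)
  show "a \<preceq> b \<Longrightarrow> c \<oplus> a \<preceq> c \<oplus> b" for a b c unfolding rle_def using add_assoc by metis
  show "x \<preceq> y \<or> y \<preceq> x" for x y by (rule linear)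
  show "\<zero> \<oplus> a = a" for a by (rule add_0_left)
  show "(a \<otimes> b) \<otimes> c = a \<otimes> (b \<otimes> c)" for a b c by (rule mul_assoc)
  show "a \<otimes> b = b \<otimes> a" for a b by (rule mul_comm)
  show "(a \<oplus> b) \<otimes> c = a \<otimes> c \<oplus> b \<otimes> c" for a b c using distrib mul_comm by metis
  show "\<zero> \<otimes> a = \<zero>" for a by (rule mul_0_left)
  show "a \<otimes> \<zero> = \<zero>" for a by (rule b5)
  show "a \<prec> b \<Longrightarrow> \<zero> \<prec> c \<Longrightarrow> c \<otimes> a \<prec> c \<otimes> b" for a b c by (rule mul_strict_mono)
  show "\<one> \<otimes> a = a" for a by (rule mul_1)
  show "\<zero> \<noteq> \<one>" using b1[of \<zero>] add_0_left by metis
  show "a \<otimes> (b \<oplus> c) = a \<otimes> b \<oplus> a \<otimes> c" for a b c by (rule distrib)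
  show "a \<noteq> \<zero> \<Longrightarrow> b \<noteq> \<zero> \<Longrightarrow> a \<otimes> b \<noteq> \<zero>" for a b
    using zero_or_suc[of a] zero_or_suc[of b] b1 b6 b4 by metis
  show "\<zero> \<prec> \<one>" by (rule zero_less_one)
  show "b \<preceq> a \<Longrightarrow> a \<ominus> b \<oplus> b = a" for a b unfolding rle_def using minus_eq add_comm by metis
  show "a \<otimes> (b \<ominus> c) = a \<otimes> b \<ominus> a \<otimes> c" for a b c
  proof (cases "c \<preceq> b")
    case True
    then show ?thesis unfolding rle_def using minus_eq distrib by metis
  next
    case False
    then have "b \<preceq> c" "b \<prec> c" using linear less_iff by blast+
    show ?thesis
    proof (cases "a = \<zero>")
      case True then show ?thesis using mul_0_left minus_eq[of \<zero> \<zero>] b3 by simp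
    next
      case False
      then have "\<zero> \<prec> a" using zero_le less_iff le_antisym by metis
      then have "\<not> a \<otimes> c \<preceq> a \<otimes> b" using mul_strict_mono[OF \<open>b \<prec> c\<close>] less_iff by blast
      then show ?thesis using \<open>\<not> c \<preceq> b\<close> b5 unfolding rminus_def[of b] rminus_def[of "a \<otimes> b"] by simp
    qed
  qed
qed

section \<open>Common multiples and products by Sigma_1 induction\<close>

lemma le_iff_less_suc: "x \<preceq> y \<longleftrightarrow> x \<prec> y \<oplus> \<one>"
  unfolding b8 using less_iff linear le_antisym rle_def b3 by metis

lemma factor_le: "\<zero> \<prec> i \<Longrightarrow> q \<preceq> i \<otimes> q"
proof -
  assume "\<zero> \<prec> i"
  then obtain j where "i = j \<oplus> \<one>" using zero_or_suc[of i] b7 by blast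
  then show ?thesis unfolding rle_def using mul_1_left add_comm by metis
qed

text \<open>Quotients are bounded by m, so the statement is Sigma_1 and induction on k applies,
  passing from m to m (k + 1).\<close>

lemma common_multiple: "\<exists>m. \<zero> \<prec> m \<and> (\<forall>i. \<zero> \<prec> i \<and> i \<preceq> k \<longrightarrow> (\<exists>q. m = i \<otimes> q))"
proof -
  let ?q = "Zero \<^bold>< Var 0 \<^bold>\<and> BAll (Var 1 \<^bold>+ Unit) (Zero \<^bold>< Var 0 \<^bold>\<longrightarrow> BEx (Var 1 \<^bold>+ Unit) (Var 2 \<^bold>= Var 1 \<^bold>\<cdot> Var 0))"
  have sat: "sat M D (case_nat m (case_nat k (\<lambda>_. \<zero>))) s0 ?q \<longleftrightarrow> \<zero> \<prec> m \<and> (\<forall>i. \<zero> \<prec> i \<and> i \<preceq> k \<longrightarrow> (\<exists>q. m = i \<otimes> q))" for m k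
  proof -
    have "sat M D (case_nat m (case_nat k (\<lambda>_. \<zero>))) s0 ?q \<longleftrightarrow>
        \<zero> \<prec> m \<and> (\<forall>i. \<zero> \<prec> i \<longrightarrow> i \<prec> k \<oplus> \<one> \<longrightarrow> (\<exists>q. q \<prec> m \<oplus> \<one> \<and> m = i \<otimes> q))"
      by (simp add: numeral_2_eq_2)
    also have "\<dots> \<longleftrightarrow> \<zero> \<prec> m \<and> (\<forall>i. \<zero> \<prec> i \<and> i \<preceq> k \<longrightarrow> (\<exists>q. m = i \<otimes> q))"
      unfolding le_iff_less_suc[symmetric] using factor_le by blast
    finally show ?thesis .
  qed
  have "\<exists>m. sat M D (case_nat m (case_nat k (\<lambda>_. \<zero>))) s0 ?q"
  proof (rule sigma1_induct)
    show "bounded ?q" by (intro bounded.intros)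
    have "\<not> (\<zero> \<prec> i \<and> i \<preceq> \<zero>)" for i using less_iff by blast
    then show "\<exists>m. sat M D (case_nat m (case_nat \<zero> (\<lambda>_. \<zero>))) s0 ?q" unfolding sat using zero_less_one by blast
    fix k m assume "sat M D (case_nat m (case_nat k (\<lambda>_. \<zero>))) s0 ?q"
    then have m: "\<zero> \<prec> m" "\<And>i. \<zero> \<prec> i \<Longrightarrow> i \<preceq> k \<Longrightarrow> \<exists>q. m = i \<otimes> q" unfolding sat by blast+
    show "\<exists>m. sat M D (case_nat m (case_nat (k \<oplus> \<one>) (\<lambda>_. \<zero>))) s0 ?q" unfolding sat
    proof (rule exI[of _ "m \<otimes> (k \<oplus> \<one>)"], intro conjI allI impI)
      have "\<zero> \<prec> k \<oplus> \<one>" using zero_le le_iff_less_suc by blast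
      then show "\<zero> \<prec> m \<otimes> (k \<oplus> \<one>)" using mul_strict_mono[OF _ m(1)] b5 by metis
      fix i assume i: "\<zero> \<prec> i \<and> i \<preceq> k \<oplus> \<one>"
      then consider "i \<preceq> k" | "i = k \<oplus> \<one>" unfolding le_iff_less_suc b8[of i "k \<oplus> \<one>"] by blast
      then show "\<exists>q. m \<otimes> (k \<oplus> \<one>) = i \<otimes> q"
      proof cases
        case 1 then show ?thesis using m(2)[of i] i mul_assoc by metis
      next
        case 2 then show ?thesis using mul_comm by metis
      qed
    qed
  qed (simp_all add: s0)
  then show ?thesis unfolding sat .
qed

lemma product: "\<exists>N. \<zero> \<prec> N \<and> (\<forall>i. i \<prec> k \<longrightarrow> (\<exists>q. N = (m \<otimes> (i \<oplus> \<one>) \<oplus> \<one>) \<otimes> q))"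
proof -
  let ?q = "Zero \<^bold>< Var 0 \<^bold>\<and> BAll (Var 1) (BEx (Var 1 \<^bold>+ Unit) (Var 2 \<^bold>= (Var 4 \<^bold>\<cdot> (Var 1 \<^bold>+ Unit) \<^bold>+ Unit) \<^bold>\<cdot> Var 0))"
  have pos: "\<zero> \<prec> m \<otimes> (i \<oplus> \<one>) \<oplus> \<one>" for i using zero_le le_iff_less_suc by blast
  have sat: "sat M D (case_nat N (case_nat k (\<lambda>_. m))) s0 ?q \<longleftrightarrow> \<zero> \<prec> N \<and> (\<forall>i. i \<prec> k \<longrightarrow> (\<exists>q. N = (m \<otimes> (i \<oplus> \<one>) \<oplus> \<one>) \<otimes> q))" for N k
  proof -
    have "sat M D (case_nat N (case_nat k (\<lambda>_. m))) s0 ?q \<longleftrightarrow>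
        \<zero> \<prec> N \<and> (\<forall>i. i \<prec> k \<longrightarrow> (\<exists>q. q \<prec> N \<oplus> \<one> \<and> N = (m \<otimes> (i \<oplus> \<one>) \<oplus> \<one>) \<otimes> q))"
      by (simp add: eval_nat_numeral)
    also have "\<dots> \<longleftrightarrow> \<zero> \<prec> N \<and> (\<forall>i. i \<prec> k \<longrightarrow> (\<exists>q. N = (m \<otimes> (i \<oplus> \<one>) \<oplus> \<one>) \<otimes> q))"
      unfolding le_iff_less_suc[symmetric] using factor_le[OF pos] by blast
    finally show ?thesis .
  qed
  have "\<exists>N. sat M D (case_nat N (case_nat k (\<lambda>_. m))) s0 ?q"
  proof (rule sigma1_induct)
    show "bounded ?q" by (intro bounded.intros)
    show "\<exists>N. sat M D (case_nat N (case_nat \<zero> (\<lambda>_. m))) s0 ?q" unfolding sat using zero_less_one b7 by blast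
    fix k N assume "sat M D (case_nat N (case_nat k (\<lambda>_. m))) s0 ?q"
    then have N: "\<zero> \<prec> N" "\<And>i. i \<prec> k \<Longrightarrow> \<exists>q. N = (m \<otimes> (i \<oplus> \<one>) \<oplus> \<one>) \<otimes> q" unfolding sat by blast+
    show "\<exists>N. sat M D (case_nat N (case_nat (k \<oplus> \<one>) (\<lambda>_. m))) s0 ?q" unfolding sat
    proof (rule exI[of _ "N \<otimes> (m \<otimes> (k \<oplus> \<one>) \<oplus> \<one>)"], intro conjI allI impI)
      show "\<zero> \<prec> N \<otimes> (m \<otimes> (k \<oplus> \<one>) \<oplus> \<one>)" using mul_strict_mono[OF pos N(1)] b5 by metis
      fix i assume "i \<prec> k \<oplus> \<one>"
      then consider "i \<prec> k" | "i = k" unfolding b8 by blast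
      then show "\<exists>q. N \<otimes> (m \<otimes> (k \<oplus> \<one>) \<oplus> \<one>) = (m \<otimes> (i \<oplus> \<one>) \<oplus> \<one>) \<otimes> q"
      proof cases
        case 1 then show ?thesis using N(2)[of i] mul_assoc by metis
      next
        case 2 then show ?thesis using mul_comm by metis
      qed
    qed
  qed (simp_all add: s0)
  then show ?thesis unfolding sat .
qed

lemma arith: "class.arith (\<oplus>) \<zero> (\<preceq>) (\<prec>) (\<ominus>) (\<otimes>) \<one>"
proof -
  interpret linordered_semidom "(\<oplus>)" "(\<ominus>)" "(\<preceq>)" "(\<prec>)" \<zero> "(\<otimes>)" \<one> by (rule semidom)
  show ?thesis
  proof (intro class.arith.intro, goal_cases)
    case 1
    show ?case by unfold_locales (rule rle_def)
  next
    case 2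
    show ?case by (rule semidom)
  next
    case 3
    show ?case
    proof
      show "a \<prec> b \<Longrightarrow> a \<oplus> \<one> \<preceq> b" for a b unfolding le_iff_less_suc using less_ex rle_def le_iff_less_suc add_assoc add_comm by metis
      show "\<exists>m. \<zero> \<prec> m \<and> (\<forall>i. \<zero> \<prec> i \<and> i \<preceq> k \<longrightarrow> dvd.dvd (\<otimes>) i m)" for k
        unfolding dvd.dvd_def by (rule common_multiple)
      show "\<exists>N. \<zero> \<prec> N \<and> (\<forall>i. i \<prec> k \<longrightarrow> dvd.dvd (\<otimes>) (m \<otimes> (i \<oplus> \<one>) \<oplus> \<one>) N)" for k m
        unfolding dvd.dvd_def by (rule product)
    qed
  qed
qed

end

section \<open>A countable model with a universal set for bounded formulas\<close>

lemma sat_induction_axiom: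
  "sat M D e s (induction_axiom p) \<longleftrightarrow> (sat M D (case_nat (zr M) e) s p \<and>
     (\<forall>x. sat M D (case_nat x e) s p \<longrightarrow> sat M D (case_nat (ad M x (on M)) e) s p) \<longrightarrow> (\<forall>x. sat M D (case_nat x e) s p))"
proof -
  have 1: "(\<lambda>i. tv M e (case_nat Zero Var i)) = case_nat (zr M) e" by (rule ext) (simp split: nat.split)
  have 2: "(\<lambda>i. tv M (case_nat x e) (case_nat (Var 0 \<^bold>+ Unit) (\<lambda>i. Var (Suc i)) i)) = case_nat (ad M x (on M)) e" for x
    by (rule ext) (simp split: nat.split)
  show ?thesis unfolding induction_axiom_def sat.simps sat_substN 1 2 by blast
qed

lemma sat_comprehension_axiom:
  "sat M D e s (comprehension_axiom p q) \<longleftrightarrow> ((\<forall>x. sat M D (case_nat x e) s p \<longleftrightarrow> sat M D (case_nat x e) s q) \<longrightarrow>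
     {x. sat M D (case_nat x e) s p} \<in> D)"
proof -
  have eq: "(\<exists>X\<in>D. \<forall>x. x \<in> X \<longleftrightarrow> P x) \<longleftrightarrow> {x. P x} \<in> D" for P
  proof
    assume "\<exists>X\<in>D. \<forall>x. x \<in> X \<longleftrightarrow> P x"
    then obtain X where "X \<in> D" "\<And>x. x \<in> X \<longleftrightarrow> P x" by blast
    moreover from this(2) have "X = {x. P x}" by blast
    ultimately show "{x. P x} \<in> D" by simp
  qed auto
  have 1: "sat M D e s (AllN (p \<^bold>\<longleftrightarrow> q)) \<longleftrightarrow> (\<forall>x. sat M D (case_nat x e) s p \<longleftrightarrow> sat M D (case_nat x e) s q)"
    by auto
  have 2: "sat M D e s (ExS (AllN (Var 0 \<^bold>\<in> 0 \<^bold>\<longleftrightarrow> liftS p))) \<longleftrightarrow> (\<exists>X\<in>D. \<forall>x. x \<in> X \<longleftrightarrow> sat M D (case_nat x e) s p)"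
    by (auto simp: sat_substS)
  show ?thesis unfolding comprehension_axiom_def sat.simps(5)[of M D e s "AllN _"] 1 2 eq ..
qed

lemma sat_collection_axiom:
  "sat M D e s (collection_axiom p) \<longleftrightarrow> ((\<forall>x. ls M x (e 0) \<longrightarrow> (\<exists>y. sat M D (case_nat y (case_nat x e)) s p)) \<longrightarrow>
     (\<exists>b. \<forall>x. ls M x (e 0) \<longrightarrow> (\<exists>y. ls M y b \<and> sat M D (case_nat y (case_nat x e)) s p)))"
proof -
  have 1: "(\<lambda>i. tv M (case_nat y (case_nat x (case_nat b e))) (Var (if i < 2 then i else Suc i))) = case_nat y (case_nat x e)" for x y b
    by (rule ext) (auto simp: numeral_2_eq_2 split: nat.split)
  show ?thesis unfolding collection_axiom_def sat.simps sat_substN 1 by (simp only: tv_shift tv.simps) simp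
qed

text \<open>Gives the consistency of the base theory, on which the choice of a model relies when
  there is no counterexample to conservation.\<close>

lemma nat_model: "models (Struc 0 1 (+) times (<)) (UNIV :: nat set set) (RCA0 \<union> B_Sigma0 2)"
  unfolding models_def
proof (intro ballI allI impI)
  fix p e s assume "p \<in> RCA0 \<union> B_Sigma0 2"
  then consider "p \<in> basic_axioms" | q where "p = induction_axiom q" | q r where "p = comprehension_axiom q r"
    | q where "p = collection_axiom q"
    unfolding RCA0_def B_Sigma0_def by blast
  then show "sat (Struc 0 1 (+) times (<)) (UNIV :: nat set set) e s p"
  proof cases
    case 1 then show ?thesis by (auto simp: basic_axioms_def)
  next
    case (2 q)
    show ?thesis unfolding 2 sat_induction_axiom by (auto intro: nat_induct)
  next
    case 3 then show ?thesis by (simp add: sat_comprehension_axiom)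
  next
    case (4 q)
    have "\<exists>b. \<forall>x<a. \<exists>y<b. P x y" if "\<forall>x<a. \<exists>y. P x y" for a :: nat and P :: "nat \<Rightarrow> nat \<Rightarrow> bool"
    proof -
      obtain f where f: "\<forall>x<a. P x (f x)" using \<open>\<forall>x<a. \<exists>y. P x y\<close> by metis
      have "f x < Suc (Max (f ` {..<a}))" if "x < a" for x using that by (simp add: le_imp_less_Suc)
      then show ?thesis using f by blast
    qed
    then show ?thesis unfolding 4 sat_collection_axiom by simp
  qed
qed

lemma tv_cong: "closed_tm m t \<Longrightarrow> (\<And>i. i < m \<Longrightarrow> e i = e' i) \<Longrightarrow> tv M e t = tv M e' t"
  by (induction t) auto

lemma sat_cong:
  "closed_fm m n p \<Longrightarrow> (\<And>i. i < m \<Longrightarrow> e i = e' i) \<Longrightarrow> (\<And>i. i < n \<Longrightarrow> s i = s' i) \<Longrightarrow> sat M D e s p \<longleftrightarrow> sat M D e' s' p"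
proof (induction p arbitrary: m n e e' s s')
  case (Eq t u) then show ?case using tv_cong[of m t e e'] tv_cong[of m u e e'] by simp
next
  case (Less t u) then show ?case using tv_cong[of m t e e'] tv_cong[of m u e e'] by simp
next
  case (Mem t X) then show ?case using tv_cong[of m t e e'] by simp
next
  case (Imp p q)
  have "sat M D e s p \<longleftrightarrow> sat M D e' s' p" by (rule Imp.IH(1)[of m n]) (use Imp.prems in simp_all)
  moreover have "sat M D e s q \<longleftrightarrow> sat M D e' s' q" by (rule Imp.IH(2)[of m n]) (use Imp.prems in simp_all)
  ultimately show ?case by simp
next
  case (AllN p)
  have "sat M D (case_nat x e) s p \<longleftrightarrow> sat M D (case_nat x e') s' p" for x
    by (rule AllN.IH[of "Suc m" n]) (use AllN.prems in \<open>auto split: nat.split\<close>)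
  then show ?case by simp
next
  case (AllS p)
  have "sat M D e (case_nat X s) p \<longleftrightarrow> sat M D e' (case_nat X s') p" for X
    by (rule AllS.IH[of m "Suc n"]) (use AllS.prems in \<open>auto split: nat.split\<close>)
  then show ?case by simp
qed simp

lemma closed_num [simp]: "closed_tm m (num n)"
  by (induction n) auto

context raw_model begin

lemma delta1_comprehension:
  assumes "bounded p" "bounded q" "\<forall>i. s i \<in> D"
    and "\<And>x. (\<exists>y. sat M D (case_nat y (case_nat x e)) s p) \<longleftrightarrow> (\<forall>y. sat M D (case_nat y (case_nat x e)) s q)"
  shows "{x. \<exists>y. sat M D (case_nat y (case_nat x e)) s p} \<in> D"
proof -
  have "comprehension_axiom (ExN p) (AllN q) \<in> RCA0" using assms(1,2) unfolding RCA0_def by auto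
  from modelsD[OF RCA0 this assms(3), of e] assms(4) show ?thesis unfolding sat_comprehension_axiom by simp
qed

lemma bounded_comprehension:
  assumes "bounded p" "\<forall>i. s i \<in> D" shows "{x. sat M D (case_nat x e) s p} \<in> D"
  using delta1_comprehension[OF bounded_substN[OF assms(1), of "\<lambda>i. Var (Suc i)"] bounded_substN[OF assms(1), of "\<lambda>i. Var (Suc i)"] assms(2), of e]
  by (simp add: sat_liftN)

lemma num_inj: "tv M e (num m) = tv M e (num n) \<Longrightarrow> m = n"
proof (induction m arbitrary: n)
  case 0 then show ?case using b1 by (cases n) (auto dest: sym)
next
  case (Suc m)
  then obtain k where k: "n = Suc k" using b1 by (cases n) auto
  show ?case using Suc.IH[of k] Suc.prems b2 unfolding k by simp
qed

lemma tv_pair_inj: "tv M e (pair t u) = tv M e' (pair t' u') \<Longrightarrow> tv M e t = tv M e' t' \<and> tv M e u = tv M e' u'"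
proof -
  interpret A: arith "(\<oplus>)" \<zero> "(\<preceq>)" "(\<prec>)" "(\<ominus>)" "(\<otimes>)" \<one> by (rule arith)
  show "tv M e (pair t u) = tv M e' (pair t' u') \<Longrightarrow> ?thesis"
    unfolding pair_def tv.simps by (rule A.pair_inject)
qed

lemma tv_pair_less: "tv M e u \<prec> tv M e (pair t u) \<oplus> \<one>"
proof -
  interpret A: arith "(\<oplus>)" \<zero> "(\<preceq>)" "(\<prec>)" "(\<ominus>)" "(\<otimes>)" \<one> by (rule arith)
  show ?thesis unfolding pair_def tv.simps le_iff_less_suc[symmetric] by (rule A.pair_ge)
qed

text \<open>For finitely many formulas a universal set is defined by a finite disjunction of bounded
  formulas, with standard numerals as indices. Compactness will yield one set for all
  formulas.\<close>

lemma finite_universal: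
  assumes "finite \<Theta>" "\<And>\<theta>. \<theta> \<in> \<Theta> \<Longrightarrow> bounded \<theta> \<and> closed_fm 1 0 \<theta>"
  obtains V where "V \<in> D" "\<And>\<theta> e s. \<theta> \<in> \<Theta> \<Longrightarrow> s 1 = V \<Longrightarrow> sat M D e s (AllN (pair (num (to_nat \<theta>)) (Var 0) \<^bold>\<in> 1 \<^bold>\<longleftrightarrow> \<theta>))"
proof -
  define e0 :: "nat \<Rightarrow> 'a" where "e0 = (\<lambda>_. \<zero>)"
  define P where "P z \<theta> \<longleftrightarrow> (\<exists>x. z = tv M (case_nat x e0) (pair (num (to_nat \<theta>)) (Var 0)) \<and> sat M D (case_nat x e0) s0 \<theta>)" for z and \<theta> :: fm
  have "\<exists>\<phi>. bounded \<phi> \<and> (\<forall>z. sat M D (case_nat z e0) s0 \<phi> \<longleftrightarrow> (\<exists>\<theta>\<in>\<Theta>. P z \<theta>))"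
    using assms
  proof (induction \<Theta>)
    case empty
    show ?case by (intro exI[of _ Falsum]) (simp add: bounded.intros)
  next
    case (insert \<theta> \<Theta>)
    then obtain \<phi> where \<phi>: "bounded \<phi>" "\<And>z. sat M D (case_nat z e0) s0 \<phi> \<longleftrightarrow> (\<exists>\<theta>\<in>\<Theta>. P z \<theta>)" by blast
    have \<theta>: "bounded \<theta>" "closed_fm 1 0 \<theta>" using insert.prems by blast+
    let ?\<psi> = "BEx (Var 0 \<^bold>+ Unit) (Var 1 \<^bold>= pair (num (to_nat \<theta>)) (Var 0) \<^bold>\<and> \<theta>)"
    have eq: "tv M e (pair (num (to_nat \<theta>)) (Var 0)) = tv M e' (pair (num (to_nat \<theta>)) (Var 0))" if "e 0 = e' 0" for e e'
      by (rule tv_cong[of 1]) (use that in \<open>simp_all add: pair_def\<close>)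
    have "sat M D (case_nat z e0) s0 ?\<psi> \<longleftrightarrow> P z \<theta>" for z
    proof -
      have 1: "sat M D (case_nat x (case_nat z e0)) s0 \<theta> \<longleftrightarrow> sat M D (case_nat x e0) s0 \<theta>" for x
        by (rule sat_cong[OF \<theta>(2)]) auto
      have 2: "tv M (case_nat x (case_nat z e0)) (pair (num (to_nat \<theta>)) (Var 0)) = tv M (case_nat x e0) (pair (num (to_nat \<theta>)) (Var 0))" for x
        by (rule eq) simp
      have "sat M D (case_nat z e0) s0 ?\<psi> \<longleftrightarrow> (\<exists>x. x \<prec> z \<oplus> \<one> \<and> z = tv M (case_nat x e0) (pair (num (to_nat \<theta>)) (Var 0)) \<and>
          sat M D (case_nat x e0) s0 \<theta>)"
        unfolding sat.simps 1 2 by auto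
      also have "\<dots> \<longleftrightarrow> P z \<theta>" 
      proof -
        have "x \<prec> tv M (case_nat x e0) (pair (num (to_nat \<theta>)) (Var 0)) \<oplus> \<one>" for x
          using tv_pair_less[of "case_nat x e0" "Var 0" "num (to_nat \<theta>)"] by simp
        then show ?thesis unfolding P_def by blast
      qed
      finally show ?thesis .
    qed
    then show ?case using \<phi> \<theta>(1) by (intro exI[of _ "?\<psi> \<^bold>\<or> \<phi>"] conjI allI bounded.intros) (simp_all, blast)
  qed
  then obtain \<phi> where \<phi>: "bounded \<phi>" "\<And>z. sat M D (case_nat z e0) s0 \<phi> \<longleftrightarrow> (\<exists>\<theta>\<in>\<Theta>. P z \<theta>)" by blast
  let ?V = "{z. \<exists>\<theta>\<in>\<Theta>. P z \<theta>}"
  have "?V \<in> D" using bounded_comprehension[OF \<phi>(1) s0, of e0] unfolding \<phi>(2) .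
  moreover have "sat M D e s (AllN (pair (num (to_nat \<theta>)) (Var 0) \<^bold>\<in> 1 \<^bold>\<longleftrightarrow> \<theta>))" if \<theta>: "\<theta> \<in> \<Theta>" and s: "s 1 = ?V" for \<theta> e s
  proof -
    have cl: "closed_fm 1 0 \<theta>" using assms(2)[OF \<theta>] by blast
    have 1: "tv M (case_nat x e) (pair (num (to_nat \<theta>)) (Var 0)) = tv M (case_nat x e0) (pair (num (to_nat \<theta>)) (Var 0))" for x
      by (rule tv_cong[of 1]) (simp_all add: pair_def)
    have 2: "sat M D (case_nat x e) s \<theta> \<longleftrightarrow> sat M D (case_nat x e0) s0 \<theta>" for x by (rule sat_cong[OF cl]) simp_all
    have 3: "tv M (case_nat x e0) (pair (num (to_nat \<theta>)) (Var 0)) \<in> ?V \<longleftrightarrow> sat M D (case_nat x e0) s0 \<theta>" for x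
    proof
      assume "tv M (case_nat x e0) (pair (num (to_nat \<theta>)) (Var 0)) \<in> ?V"
      then obtain \<theta>' y where y: "tv M (case_nat x e0) (pair (num (to_nat \<theta>)) (Var 0)) = tv M (case_nat y e0) (pair (num (to_nat \<theta>')) (Var 0))"
        "sat M D (case_nat y e0) s0 \<theta>'" unfolding P_def by blast
      from tv_pair_inj[OF y(1)] have *: "tv M (case_nat x e0) (num (to_nat \<theta>)) = tv M (case_nat y e0) (num (to_nat \<theta>'))" by (rule conjunct1)
      have "x = y" using tv_pair_inj[OF y(1)] by simp
      have "tv M (case_nat x e0) (num (to_nat \<theta>)) = tv M (case_nat x e0) (num (to_nat \<theta>'))"
        using * unfolding \<open>x = y\<close> .
      from num_inj[OF this] have "\<theta> = \<theta>'" by simp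
      then show "sat M D (case_nat x e0) s0 \<theta>" using y \<open>x = y\<close> by simp
    qed (use \<theta> P_def in blast)
    show ?thesis unfolding sat.simps s 1 2 3 by blast
  qed
  ultimately show ?thesis using that by blast
qed

end

lemma hyp_soundness:
  assumes "hyp T \<Gamma> p" "models M D T" "\<forall>i. s i \<in> D" "\<And>g. g \<in> \<Gamma> \<Longrightarrow> sat M D e s g" shows "sat M D e s p"
  using assms(1) by induction (use assms soundness in auto)

abbreviation base_theory :: "fm set" where
  "base_theory \<equiv> RCA0 \<union> B_Sigma0 2"

definition universal_axiom :: "fm \<Rightarrow> fm" where
  "universal_axiom \<theta> = AllN (pair (num (to_nat \<theta>)) (Var 0) \<^bold>\<in> 1 \<^bold>\<longleftrightarrow> \<theta>)"

definition bounded_unary :: "fm set" where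
  "bounded_unary = {\<theta>. bounded \<theta> \<and> closed_fm 1 0 \<theta>}"

lemma completeness_ex:
  assumes "\<not> hyp T \<Gamma> Falsum" "\<And>g. g \<in> \<Gamma> \<Longrightarrow> closed_fm k k g" "basic_axioms \<subseteq> T" "infinite (UNIV :: 'a::countable set)"
  shows "\<exists>M (D :: 'a set set) e s. models M D T \<and> countable D \<and> (\<forall>i. s i \<in> D) \<and> (\<forall>g\<in>\<Gamma>. sat M D e s g)"
proof (rule completeness[OF assms])
  fix M and D :: "'a set set" and s e
  assume "models M D T" "countable D" "\<And>i. s i \<in> D" "\<And>g. g \<in> \<Gamma> \<Longrightarrow> sat M D e s g"
  then show ?thesis by (intro exI[of _ M] exI[of _ D] exI[of _ e] exI[of _ s]) simp
qed

text \<open>Completeness is used twice. A first model refutes q, and in it any finite part of the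
  universality axioms holds for a suitable value of set variable 1. As q mentions only set variable
  0, it stays refuted, so q's negation and all these axioms are consistent together.\<close>

lemma universal_model:
  assumes q: "closed_fm 0 1 q" "\<not> base_theory \<turnstile> AllS q" and inf: "infinite (UNIV :: 'a::countable set)"
  shows "\<exists>M (D :: 'a::countable set set) e s. models M D base_theory \<and> countable D \<and> (\<forall>i. s i \<in> D) \<and>
    \<not> sat M D e s q \<and> (\<forall>\<theta>\<in>bounded_unary. sat M D e s (universal_axiom \<theta>))"
proof -
  let ?T = base_theory
  have ax: "basic_axioms \<subseteq> ?T" unfolding RCA0_def by blast
  have closed_q: "closed_fm 2 2 q" using closed_fm_mono[OF q(1)] by simp
  have "\<not> hyp ?T {\<^bold>\<not> q} Falsum"
    using hyp_contr[of ?T q "{}"] hyp_empty proves.GenS q(2) by blast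
  moreover have "closed_fm 2 2 g" if "g \<in> {\<^bold>\<not> q}" for g using that closed_q by simp
  ultimately obtain M and D :: "'a set set" and e s where M: "models M D ?T" "\<And>i. s i \<in> D" "\<not> sat M D e s q"
    using completeness_ex[OF _ _ ax inf, of "{\<^bold>\<not> q}" 2] by auto
  interpret raw_model M D
    by unfold_locales (use M(2) models_mono[OF M(1)] in blast)+
  let ?\<Gamma> = "insert (\<^bold>\<not> q) (universal_axiom ` bounded_unary)"
  have "\<not> hyp ?T ?\<Gamma> Falsum"
  proof
    assume "hyp ?T ?\<Gamma> Falsum"
    from hyp_finite[OF this] obtain \<Delta> where \<Delta>: "finite \<Delta>" "\<Delta> \<subseteq> ?\<Gamma>" "hyp ?T \<Delta> Falsum" by blast
    then have "finite (\<Delta> - {\<^bold>\<not> q})" "\<Delta> - {\<^bold>\<not> q} \<subseteq> universal_axiom ` bounded_unary" by blast+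
    from finite_subset_image[OF this] obtain \<Theta> where \<Theta>: "\<Theta> \<subseteq> bounded_unary" "finite \<Theta>" "\<Delta> - {\<^bold>\<not> q} = universal_axiom ` \<Theta>" by blast
    have "bounded \<theta> \<and> closed_fm 1 0 \<theta>" if "\<theta> \<in> \<Theta>" for \<theta> using \<Theta>(1) that unfolding bounded_unary_def by blast
    from finite_universal[OF \<Theta>(2) this] obtain V where V: "V \<in> D"
      "\<And>\<theta> e s. \<theta> \<in> \<Theta> \<Longrightarrow> s 1 = V \<Longrightarrow> sat M D e s (universal_axiom \<theta>)" unfolding universal_axiom_def by metis
    let ?s = "case_nat (s 0) (\<lambda>_. V)"
    have "sat M D e ?s Falsum"
    proof (rule hyp_soundness[OF \<Delta>(3) M(1)])
      show "\<forall>i. ?s i \<in> D" using V M by (auto split: nat.split)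
      fix g assume "g \<in> \<Delta>"
      then consider "g = (\<^bold>\<not> q)" | \<theta> where "\<theta> \<in> \<Theta>" "g = universal_axiom \<theta>" using \<Theta>(3) by blast
      then show "sat M D e ?s g"
      proof cases
        case 1
        have "sat M D e ?s q \<longleftrightarrow> sat M D e s q" by (rule sat_cong[OF q(1)]) auto
        then show ?thesis using M(3) 1 by simp
      next
        case 2
        then show ?thesis using V(2)[of \<theta> ?s] by simp
      qed
    qed
    then show False by simp
  qed
  moreover have "closed_fm 2 2 g" if "g \<in> ?\<Gamma>" for g
    using that closed_q by (auto simp: universal_axiom_def bounded_unary_def pair_def elim!: closed_fm_mono)
  ultimately have "\<exists>M (D :: 'a set set) e s. models M D ?T \<and> countable D \<and> (\<forall>i. s i \<in> D) \<and> (\<forall>g\<in>?\<Gamma>. sat M D e s g)"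
    by (rule completeness_ex[OF _ _ ax inf])
  then show ?thesis by (elim exE) (intro exI, auto)
qed

subsection \<open>The type of numbers of the model\<close>

text \<open>The class \<open>arith\<close> needs a type, so the model is chosen once and for all. It refutes a
  counterexample to conservation if there is one, and \<^term>\<open>Falsum\<close> otherwise.\<close>

definition counterexample :: "fm \<Rightarrow> bool" where
  "counterexample q \<longleftrightarrow> arithmetical q \<and> closed_fm 0 1 q \<and> WKL0 \<union> {GP22} \<turnstile> AllS q \<and> \<not> base_theory \<turnstile> AllS q"

definition cx :: fm where
  "cx = (if \<exists>q. counterexample q then SOME q. counterexample q else Falsum)"

lemma counterexample_cx: "counterexample q \<Longrightarrow> counterexample cx"
  unfolding cx_def using someI[of counterexample q] by auto

lemma cx: "closed_fm 0 1 cx" "\<not> base_theory \<turnstile> AllS cx"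
proof -
  have "counterexample cx \<or> cx = Falsum" using counterexample_cx unfolding cx_def by metis
  moreover have "\<not> base_theory \<turnstile> AllS Falsum"
    using soundness[OF _ nat_model, of "AllS Falsum" "\<lambda>_. {}" "\<lambda>_. 0"] by auto
  ultimately show "closed_fm 0 1 cx" "\<not> base_theory \<turnstile> AllS cx" unfolding counterexample_def by auto
qed

text \<open>A fresh type, since \<open>nat\<close> already carries the standard arithmetic.\<close>

datatype mnum = MNum nat

instance mnum :: countable by countable_datatype

lemma infinite_mnum: "infinite (UNIV :: mnum set)"
proof -
  have "inj MNum" by (rule injI) simp
  then have "infinite (range MNum)" by (rule range_inj_infinite)
  then show ?thesis using finite_subset subset_UNIV by blast
qed

definition mstruc :: "mnum struc" where
  "mstruc = (SOME M. \<exists>(D :: mnum set set) e s. models M D base_theory \<and> countable D \<and> (\<forall>i. s i \<in> D) \<and>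
    \<not> sat M D e s cx \<and> (\<forall>\<theta>\<in>bounded_unary. sat M D e s (universal_axiom \<theta>)))"

lemma mstruc: "\<exists>(D :: mnum set set) e s. models mstruc D base_theory \<and> countable D \<and> (\<forall>i. s i \<in> D) \<and>
    \<not> sat mstruc D e s cx \<and> (\<forall>\<theta>\<in>bounded_unary. sat mstruc D e s (universal_axiom \<theta>))"
  unfolding mstruc_def by (rule someI_ex[OF universal_model[OF cx infinite_mnum]])

instantiation mnum :: "{zero, one, plus, times, minus, ord}" begin

definition "0 = zr mstruc"
definition "1 = on mstruc"
definition "x + y = ad mstruc x y"
definition "x * y = ml mstruc x y"
definition "x < y \<longleftrightarrow> ls mstruc x y"
definition "x \<le> y \<longleftrightarrow> raw_model.rle mstruc x y"
definition "x - y = raw_model.rminus mstruc x y"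

instance ..

end

instance mnum :: arith
proof (rule arith.intro_of_class)
  obtain D :: "mnum set set" and s :: "nat \<Rightarrow> mnum set" where D: "models mstruc D base_theory" "\<And>i. s i \<in> D" using mstruc by blast
  interpret raw_model mstruc D
    by unfold_locales (use D(2) models_mono[OF D(1)] in blast)+
  have "(0 :: mnum) = zr mstruc" "(1 :: mnum) = on mstruc" "(+) = ad mstruc" "times = ml mstruc" "(<) = ls mstruc"
    "(\<le>) = rle" "(-) = rminus"
    by (simp_all add: zero_mnum_def one_mnum_def plus_mnum_def times_mnum_def less_mnum_def less_eq_mnum_def minus_mnum_def fun_eq_iff)
  then show "class.arith (+) (0 :: mnum) (\<le>) (<) (-) times 1" using arith by simp
qed

definition std :: "'a::arith struc" where
  "std = Struc 0 1 (+) times (<)"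

lemma mstruc_std: "mstruc = std"
  unfolding std_def zero_mnum_def one_mnum_def plus_mnum_def[abs_def] times_mnum_def[abs_def] less_mnum_def[abs_def]
  by simp

section \<open>Definability by bounded formulas\<close>

lemma std_simps [simp]: "zr std = 0" "on std = 1" "ad std = (+)" "ml std = times" "ls std = (<)"
  by (simp_all add: std_def)

lemma tv_pair [simp]: "tv std e (pair t u) = \<langle>tv std e t, tv std e u\<rangle>"
  by (simp add: pair_def pr_def)

lemma closed_tm_pair [simp]: "closed_tm m (pair t u) \<longleftrightarrow> closed_tm m t \<and> closed_tm m u"
  by (auto simp: pair_def)

lemma closed_tm_shift: "closed_tm m t \<Longrightarrow> closed_tm (Suc m) (shift 1 t)"
  unfolding shift_def by (induction t) auto

lemma sat_arithmetical: "arithmetical q \<Longrightarrow> sat M D e s q \<longleftrightarrow> sat M D' e s q"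
  by (induction q arbitrary: e) auto

lemma bounded_arithmetical: "bounded q \<Longrightarrow> arithmetical q"
  by (induction rule: bounded.induct) auto

lemma fs_iff: "a = fs z \<longleftrightarrow> (\<exists>b<z + 1. z = \<langle>a, b\<rangle>) \<or> a = 0 \<and> \<not> (\<exists>u<z + 1. \<exists>v<z + 1. z = \<langle>u, v\<rangle>)"
proof (cases "\<exists>u v. z = \<langle>u, v\<rangle>")
  case True
  then obtain u v where "z = \<langle>u, v\<rangle>" by blast
  then show ?thesis using pr_ge1[of u v] pr_ge2[of v u] by (auto simp: less_add1_iff)
next
  case False
  then show ?thesis by (auto simp: fs_def)
qed

lemma sn_iff: "b = sn z \<longleftrightarrow> (\<exists>a<z + 1. z = \<langle>a, b\<rangle>) \<or> b = 0 \<and> \<not> (\<exists>u<z + 1. \<exists>v<z + 1. z = \<langle>u, v\<rangle>)"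
proof (cases "\<exists>u v. z = \<langle>u, v\<rangle>")
  case True
  then obtain u v where "z = \<langle>u, v\<rangle>" by blast
  then show ?thesis using pr_ge1[of u v] pr_ge2[of v u] by (auto simp: less_add1_iff)
next
  case False
  then show ?thesis by (auto simp: sn_def)
qed

text \<open>Bounded formulas saying that \<^term>\<open>q\<close> holds after a new variable 0 has been set to the
  value of \<^term>\<open>t\<close>, respectively to the first or second component of variable \<^term>\<open>j\<close>.\<close>

definition LetE :: "tm \<Rightarrow> fm \<Rightarrow> fm" where
  "LetE t q = BEx (t \<^bold>+ Unit) (Var 0 \<^bold>= shift 1 t \<^bold>\<and> q)"

definition FsE :: "nat \<Rightarrow> fm \<Rightarrow> fm" where
  "FsE j q = BEx (Var j \<^bold>+ Unit) ((BEx (Var (Suc j) \<^bold>+ Unit) (Var (Suc (Suc j)) \<^bold>= pair (Var 1) (Var 0)) \<^bold>\<or>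
     (Var 0 \<^bold>= Zero \<^bold>\<and> \<^bold>\<not> BEx (Var (Suc j) \<^bold>+ Unit) (BEx (Var (Suc (Suc j)) \<^bold>+ Unit) (Var (Suc (Suc (Suc j))) \<^bold>= pair (Var 1) (Var 0))))) \<^bold>\<and> q)"

definition SnE :: "nat \<Rightarrow> fm \<Rightarrow> fm" where
  "SnE j q = BEx (Var j \<^bold>+ Unit) ((BEx (Var (Suc j) \<^bold>+ Unit) (Var (Suc (Suc j)) \<^bold>= pair (Var 0) (Var 1)) \<^bold>\<or>
     (Var 0 \<^bold>= Zero \<^bold>\<and> \<^bold>\<not> BEx (Var (Suc j) \<^bold>+ Unit) (BEx (Var (Suc (Suc j)) \<^bold>+ Unit) (Var (Suc (Suc (Suc j))) \<^bold>= pair (Var 1) (Var 0))))) \<^bold>\<and> q)"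

lemma sat_LetE [simp]: "sat std D e s (LetE t q) \<longleftrightarrow> sat std D (case_nat (tv std e t) e) s q"
  by (auto simp: LetE_def less_add1_iff)

lemma sat_FsE [simp]: "sat std D e s (FsE j q) \<longleftrightarrow> sat std D (case_nat (fs (e j)) e) s q"
proof -
  have "sat std D e s (FsE j q) \<longleftrightarrow> (\<exists>a<e j + 1. a = fs (e j) \<and> sat std D (case_nat a e) s q)"
    unfolding fs_iff FsE_def by auto
  then show ?thesis using fs_le[of "e j"] by (auto simp: less_add1_iff)
qed

lemma sat_SnE [simp]: "sat std D e s (SnE j q) \<longleftrightarrow> sat std D (case_nat (sn (e j)) e) s q"
proof -
  have "sat std D e s (SnE j q) \<longleftrightarrow> (\<exists>a<e j + 1. a = sn (e j) \<and> sat std D (case_nat a e) s q)"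
    unfolding sn_iff SnE_def by auto
  then show ?thesis using sn_le[of "e j"] by (auto simp: less_add1_iff)
qed

definition bc :: "nat \<Rightarrow> nat \<Rightarrow> fm \<Rightarrow> bool" where
  "bc m n q \<longleftrightarrow> bounded q \<and> closed_fm m n q"

lemma bc_Eq: "closed_tm m t \<Longrightarrow> closed_tm m u \<Longrightarrow> bc m n (t \<^bold>= u)" by (simp add: bc_def bounded.intros)
lemma bc_Less: "closed_tm m t \<Longrightarrow> closed_tm m u \<Longrightarrow> bc m n (t \<^bold>< u)" by (simp add: bc_def bounded.intros)
lemma bc_Mem: "closed_tm m t \<Longrightarrow> i < n \<Longrightarrow> bc m n (t \<^bold>\<in> i)" by (simp add: bc_def bounded.intros)
lemma bc_Falsum: "bc m n Falsum" by (simp add: bc_def bounded.intros)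
lemma bc_Imp: "bc m n p \<Longrightarrow> bc m n q \<Longrightarrow> bc m n (p \<^bold>\<longrightarrow> q)" by (simp add: bc_def bounded.intros)
lemma bc_BAll: "closed_tm m t \<Longrightarrow> bc (Suc m) n q \<Longrightarrow> bc m n (BAll t q)"
  using closed_tm_shift[of m t] by (simp add: bc_def bounded.intros del: One_nat_def)
lemma bc_BEx: "closed_tm m t \<Longrightarrow> bc (Suc m) n q \<Longrightarrow> bc m n (BEx t q)"
  using closed_tm_shift[of m t] by (simp add: bc_def bounded.intros del: One_nat_def)
lemma bc_mono: "bc m n q \<Longrightarrow> m \<le> m' \<Longrightarrow> bc m' n q" using closed_fm_mono[of m n q m' n] by (simp add: bc_def)

lemma bc_LetE: "closed_tm m t \<Longrightarrow> bc (Suc m) n q \<Longrightarrow> bc m n (LetE t q)"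
  unfolding LetE_def by (intro bc_BEx bc_Imp bc_Eq bc_Falsum closed_tm_shift) simp_all

lemma bc_FsE: "j < m \<Longrightarrow> bc (Suc m) n q \<Longrightarrow> bc m n (FsE j q)"
  unfolding FsE_def by (intro bc_BEx bc_Imp bc_Eq bc_Falsum) simp_all

lemma bc_SnE: "j < m \<Longrightarrow> bc (Suc m) n q \<Longrightarrow> bc m n (SnE j q)"
  unfolding SnE_def by (intro bc_BEx bc_Imp bc_Eq bc_Falsum) simp_all

lemmas bc_intros = bc_Eq bc_Less bc_Mem bc_Falsum bc_Imp bc_BAll bc_LetE bc_FsE bc_SnE

text \<open>All that a formula speaks about, parameters included, is packed into its one number
  variable and unpacked by \<open>FsE\<close> and \<open>SnE\<close>.\<close>

definition sat1 :: "(nat \<Rightarrow> 'a::arith set) \<Rightarrow> fm \<Rightarrow> 'a \<Rightarrow> bool" where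
  "sat1 s q x \<longleftrightarrow> sat std {} (\<lambda>_. x) s q"

lemma sat_sat1: "bc 1 n q \<Longrightarrow> sat std {} (case_nat x e) s q \<longleftrightarrow> sat1 s q x"
  unfolding bc_def sat1_def using sat_cong[of 1 n q "case_nat x e" "\<lambda>_. x" s s] by simp

text \<open>An elementary function is evaluated on a stack of intermediate values, which is stored
  together with the argument and with the parameters of the function.\<close>

lemma stack_op2:
  assumes T: "\<And>e. tv std e T = h (e 1) (e 3 :: 'a::arith)" "closed_tm 9 T" and \<theta>: "bc 1 n \<theta>"
  shows "\<exists>\<theta>'. bc 1 n \<theta>' \<and>
    (\<forall>x a b st. sat1 s \<theta>' \<langle>\<langle>x, \<langle>b, \<langle>a, st\<rangle>\<rangle>\<rangle>, p\<rangle> \<longleftrightarrow> sat1 s \<theta> \<langle>\<langle>x, \<langle>h a b, st\<rangle>\<rangle>, p :: 'a\<rangle>)"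
proof (intro exI conjI allI)
  let ?\<theta> = "FsE 0 (SnE 1 (FsE 1 (SnE 2 (FsE 0 (SnE 1 (FsE 0 (SnE 1
    (LetE (pair (pair (Var 5) (pair T (Var 0))) (Var 6)) \<theta>))))))))"
  show "bc 1 n ?\<theta>" by (intro bc_intros bc_mono[OF \<theta>]) (use T(2) in \<open>simp_all add: eval_nat_numeral\<close>)
  show "sat1 s ?\<theta> \<langle>\<langle>x, \<langle>b, \<langle>a, st\<rangle>\<rangle>\<rangle>, p\<rangle> \<longleftrightarrow> sat1 s \<theta> \<langle>\<langle>x, \<langle>h a b, st\<rangle>\<rangle>, p\<rangle>" for x a b st
    unfolding sat1_def[of s ?\<theta>] by (simp add: T(1) sat_sat1[OF \<theta>] eval_nat_numeral)
qed

lemma elem_stack: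
  assumes "elem_fun f" "bc 1 n \<theta>"
  shows "\<exists>\<theta>' p'. bc 1 n \<theta>' \<and> (\<forall>x st. sat1 s \<theta>' \<langle>\<langle>x, st\<rangle>, p'\<rangle> \<longleftrightarrow> sat1 s \<theta> \<langle>\<langle>x, \<langle>f x, st\<rangle>\<rangle>, p :: 'a::arith\<rangle>)"
  using assms
proof (induction arbitrary: \<theta> p rule: elem_fun.induct)
  case elem_id
  let ?\<theta> = "FsE 0 (SnE 1 (FsE 1 (SnE 2 (LetE (pair (pair (Var 1) (pair (Var 1) (Var 0))) (Var 2)) \<theta>))))"
  have "bc 1 n ?\<theta>" by (intro bc_intros bc_mono[OF elem_id]) simp_all
  moreover have "sat1 s ?\<theta> \<langle>\<langle>x, st\<rangle>, p\<rangle> \<longleftrightarrow> sat1 s \<theta> \<langle>\<langle>x, \<langle>x, st\<rangle>\<rangle>, p\<rangle>" for x st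
    unfolding sat1_def[of s ?\<theta>] by (simp add: sat_sat1[OF elem_id] eval_nat_numeral)
  ultimately show ?case by blast
next
  case (elem_const c)
  let ?\<theta> = "FsE 0 (SnE 1 (FsE 1 (SnE 2 (FsE 2 (SnE 3 (LetE (pair (pair (Var 3) (pair (Var 0) (Var 2))) (Var 1)) \<theta>))))))"
  have "bc 1 n ?\<theta>" by (intro bc_intros bc_mono[OF elem_const]) simp_all
  moreover have "sat1 s ?\<theta> \<langle>\<langle>x, st\<rangle>, \<langle>p, c\<rangle>\<rangle> \<longleftrightarrow> sat1 s \<theta> \<langle>\<langle>x, \<langle>c, st\<rangle>\<rangle>, p\<rangle>" for x st
    unfolding sat1_def[of s ?\<theta>] by (simp add: sat_sat1[OF elem_const] eval_nat_numeral)
  ultimately show ?case by blast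
next
  case (elem_fs f)
  let ?\<theta> = "FsE 0 (SnE 1 (FsE 1 (SnE 2 (FsE 0 (SnE 1 (FsE 1 (LetE (pair (pair (Var 4) (pair (Var 0) (Var 1))) (Var 5)) \<theta>)))))))"
  have "bc 1 n ?\<theta>" by (intro bc_intros bc_mono[OF elem_fs.prems]) simp_all
  from elem_fs.IH[OF this, of p] obtain \<theta>' p' where *: "bc 1 n \<theta>'"
    "\<And>x st. sat1 s \<theta>' \<langle>\<langle>x, st\<rangle>, p'\<rangle> \<longleftrightarrow> sat1 s ?\<theta> \<langle>\<langle>x, \<langle>f x, st\<rangle>\<rangle>, p\<rangle>" by blast
  have "sat1 s ?\<theta> \<langle>\<langle>x, \<langle>a, st\<rangle>\<rangle>, p\<rangle> \<longleftrightarrow> sat1 s \<theta> \<langle>\<langle>x, \<langle>fs a, st\<rangle>\<rangle>, p\<rangle>" for x a st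
    unfolding sat1_def[of s ?\<theta>] by (simp add: sat_sat1[OF elem_fs.prems] eval_nat_numeral)
  then show ?case using * by blast
next
  case (elem_sn f)
  let ?\<theta> = "FsE 0 (SnE 1 (FsE 1 (SnE 2 (FsE 0 (SnE 1 (SnE 1 (LetE (pair (pair (Var 4) (pair (Var 0) (Var 1))) (Var 5)) \<theta>)))))))"
  have "bc 1 n ?\<theta>" by (intro bc_intros bc_mono[OF elem_sn.prems]) simp_all
  from elem_sn.IH[OF this, of p] obtain \<theta>' p' where *: "bc 1 n \<theta>'"
    "\<And>x st. sat1 s \<theta>' \<langle>\<langle>x, st\<rangle>, p'\<rangle> \<longleftrightarrow> sat1 s ?\<theta> \<langle>\<langle>x, \<langle>f x, st\<rangle>\<rangle>, p\<rangle>" by blast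
  have "sat1 s ?\<theta> \<langle>\<langle>x, \<langle>a, st\<rangle>\<rangle>, p\<rangle> \<longleftrightarrow> sat1 s \<theta> \<langle>\<langle>x, \<langle>sn a, st\<rangle>\<rangle>, p\<rangle>" for x a st
    unfolding sat1_def[of s ?\<theta>] by (simp add: sat_sat1[OF elem_sn.prems] eval_nat_numeral)
  then show ?case using * by blast
next
  case (elem_pr f g)
  obtain \<theta>1 where 1: "bc 1 n \<theta>1" "\<And>x a b st. sat1 s \<theta>1 \<langle>\<langle>x, \<langle>b, \<langle>a, st\<rangle>\<rangle>\<rangle>, p\<rangle> \<longleftrightarrow> sat1 s \<theta> \<langle>\<langle>x, \<langle>\<langle>a, b\<rangle>, st\<rangle>\<rangle>, p\<rangle>"
    using stack_op2[where T = "pair (Var 1) (Var 3)" and h = "\<lambda>a b. \<langle>a, b\<rangle>" and s = s and p = p, OF _ _ elem_pr.prems]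
    by (auto simp: eval_nat_numeral)
  obtain \<theta>2 p2 where 2: "bc 1 n \<theta>2" "\<And>x st. sat1 s \<theta>2 \<langle>\<langle>x, st\<rangle>, p2\<rangle> \<longleftrightarrow> sat1 s \<theta>1 \<langle>\<langle>x, \<langle>g x, st\<rangle>\<rangle>, p\<rangle>"
    using elem_pr.IH(2)[OF 1(1), of p] by blast
  show ?case using elem_pr.IH(1)[OF 2(1), of p2] unfolding 2(2) 1(2) .
next
  case (elem_add f g)
  obtain \<theta>1 where 1: "bc 1 n \<theta>1" "\<And>x a b st. sat1 s \<theta>1 \<langle>\<langle>x, \<langle>b, \<langle>a, st\<rangle>\<rangle>\<rangle>, p\<rangle> \<longleftrightarrow> sat1 s \<theta> \<langle>\<langle>x, \<langle>a + b, st\<rangle>\<rangle>, p\<rangle>"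
    using stack_op2[where T = "Var 1 \<^bold>+ Var 3" and h = "(+)" and s = s and p = p, OF _ _ elem_add.prems]
    by (auto simp: eval_nat_numeral)
  obtain \<theta>2 p2 where 2: "bc 1 n \<theta>2" "\<And>x st. sat1 s \<theta>2 \<langle>\<langle>x, st\<rangle>, p2\<rangle> \<longleftrightarrow> sat1 s \<theta>1 \<langle>\<langle>x, \<langle>g x, st\<rangle>\<rangle>, p\<rangle>"
    using elem_add.IH(2)[OF 1(1), of p] by blast
  show ?case using elem_add.IH(1)[OF 2(1), of p2] unfolding 2(2) 1(2) .
next
  case (elem_mult f g)
  obtain \<theta>1 where 1: "bc 1 n \<theta>1" "\<And>x a b st. sat1 s \<theta>1 \<langle>\<langle>x, \<langle>b, \<langle>a, st\<rangle>\<rangle>\<rangle>, p\<rangle> \<longleftrightarrow> sat1 s \<theta> \<langle>\<langle>x, \<langle>a * b, st\<rangle>\<rangle>, p\<rangle>"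
    using stack_op2[where T = "Var 1 \<^bold>\<cdot> Var 3" and h = "times" and s = s and p = p, OF _ _ elem_mult.prems]
    by (auto simp: eval_nat_numeral)
  obtain \<theta>2 p2 where 2: "bc 1 n \<theta>2" "\<And>x st. sat1 s \<theta>2 \<langle>\<langle>x, st\<rangle>, p2\<rangle> \<longleftrightarrow> sat1 s \<theta>1 \<langle>\<langle>x, \<langle>g x, st\<rangle>\<rangle>, p\<rangle>"
    using elem_mult.IH(2)[OF 1(1), of p] by blast
  show ?case using elem_mult.IH(1)[OF 2(1), of p2] unfolding 2(2) 1(2) .
qed

text \<open>All number parameters are merged into a single p. The formula itself is then free of
  constants and, if it has no set variables, can be looked up in the universal set.\<close>

theorem Delta0_definable:
  assumes "R \<in> Delta0 (s ` {..<n})"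
  shows "\<exists>\<theta> p. bc 1 n \<theta> \<and> (\<forall>x. x \<in> R \<longleftrightarrow> sat1 s \<theta> \<langle>x, p :: 'a::arith\<rangle>)"
  using assms
proof (induction rule: Delta0.induct)
  case (Delta0_base Y)
  then obtain i where i: "i < n" "Y = s i" by blast
  let ?\<theta> = "FsE 0 (Var 0 \<^bold>\<in> i)"
  have "bc 1 n ?\<theta>" using i by (intro bc_intros) simp_all
  moreover have "sat1 s ?\<theta> \<langle>x, 0\<rangle> \<longleftrightarrow> x \<in> Y" for x by (simp add: sat1_def i)
  ultimately show ?case by blast
next
  case (Delta0_compl Y)
  then obtain \<theta> p where "bc 1 n \<theta>" "\<And>x. x \<in> Y \<longleftrightarrow> sat1 s \<theta> \<langle>x, p\<rangle>" by blast
  then show ?case by (intro exI[of _ "\<^bold>\<not> \<theta>"] exI[of _ p]) (simp add: bc_intros sat1_def)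
next
  case (Delta0_inter Y Z)
  then obtain \<theta>1 p1 \<theta>2 p2 where 1: "bc 1 n \<theta>1" "\<And>x. x \<in> Y \<longleftrightarrow> sat1 s \<theta>1 \<langle>x, p1\<rangle>"
    and 2: "bc 1 n \<theta>2" "\<And>x. x \<in> Z \<longleftrightarrow> sat1 s \<theta>2 \<langle>x, p2\<rangle>" by blast
  let ?\<theta> = "FsE 0 (SnE 1 (FsE 0 (SnE 1 (LetE (pair (Var 3) (Var 1)) \<theta>1 \<^bold>\<and> LetE (pair (Var 3) (Var 0)) \<theta>2))))"
  have "bc 1 n ?\<theta>" by (intro bc_intros bc_mono[OF 1(1)] bc_mono[OF 2(1)]) simp_all
  moreover have "sat1 s ?\<theta> \<langle>x, \<langle>p1, p2\<rangle>\<rangle> \<longleftrightarrow> x \<in> Y \<inter> Z" for x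
    unfolding sat1_def[of s ?\<theta>] by (simp add: sat_sat1[OF 1(1)] sat_sat1[OF 2(1)] 1(2) 2(2) eval_nat_numeral)
  ultimately show ?case by blast
next
  case Delta0_less
  let ?\<theta> = "FsE 0 (FsE 0 (SnE 1 (Var 1 \<^bold>< Var 0)))"
  have "bc 1 n ?\<theta>" by (intro bc_intros) simp_all
  moreover have "sat1 s ?\<theta> \<langle>x, 0\<rangle> \<longleftrightarrow> x \<in> {z. fs z < sn z}" for x by (simp add: sat1_def)
  ultimately show ?case by blast
next
  case Delta0_eq
  let ?\<theta> = "FsE 0 (FsE 0 (SnE 1 (Var 1 \<^bold>= Var 0)))"
  have "bc 1 n ?\<theta>" by (intro bc_intros) simp_all
  moreover have "sat1 s ?\<theta> \<langle>x, 0\<rangle> \<longleftrightarrow> x \<in> {z. fs z = sn z}" for x by (simp add: sat1_def)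
  ultimately show ?case by blast
next
  case (Delta0_pre Y f)
  then obtain \<theta> p where \<theta>: "bc 1 n \<theta>" "\<And>x. x \<in> Y \<longleftrightarrow> sat1 s \<theta> \<langle>x, p\<rangle>" by blast
  let ?\<theta> = "FsE 0 (SnE 1 (FsE 1 (SnE 2 (FsE 0 (LetE (pair (Var 0) (Var 3)) \<theta>)))))"
  have "bc 1 n ?\<theta>" by (intro bc_intros bc_mono[OF \<theta>(1)]) simp_all
  from elem_stack[OF Delta0_pre(2) this, of s p] obtain \<theta>' p' where *: "bc 1 n \<theta>'"
    "\<And>x st. sat1 s \<theta>' \<langle>\<langle>x, st\<rangle>, p'\<rangle> \<longleftrightarrow> sat1 s ?\<theta> \<langle>\<langle>x, \<langle>f x, st\<rangle>\<rangle>, p\<rangle>" by blast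
  have 1: "sat1 s ?\<theta> \<langle>\<langle>x, \<langle>y, st\<rangle>\<rangle>, p\<rangle> \<longleftrightarrow> y \<in> Y" for x y st
    unfolding sat1_def[of s ?\<theta>] by (simp add: sat_sat1[OF \<theta>(1)] \<theta>(2) eval_nat_numeral)
  let ?\<psi> = "FsE 0 (SnE 1 (LetE (pair (pair (Var 1) Zero) (Var 0)) \<theta>'))"
  have "bc 1 n ?\<psi>" by (intro bc_intros bc_mono[OF *(1)]) simp_all
  moreover have "sat1 s ?\<psi> \<langle>x, p'\<rangle> \<longleftrightarrow> x \<in> {x. f x \<in> Y}" for x
  proof -
    have "sat1 s ?\<psi> \<langle>x, p'\<rangle> \<longleftrightarrow> sat1 s \<theta>' \<langle>\<langle>x, 0\<rangle>, p'\<rangle>"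
      unfolding sat1_def[of s ?\<psi>] by (simp add: sat_sat1[OF *(1)] del: pr_0)
    then show ?thesis unfolding *(2) 1 by simp
  qed
  ultimately show ?case by blast
next
  case (Delta0_ball Y)
  then obtain \<theta> p where \<theta>: "bc 1 n \<theta>" "\<And>x. x \<in> Y \<longleftrightarrow> sat1 s \<theta> \<langle>x, p\<rangle>" by blast
  let ?\<theta> = "FsE 0 (SnE 1 (FsE 1 (SnE 2 (BAll (Var 0) (LetE (pair (pair (Var 2) (Var 0)) (Var 3)) \<theta>)))))"
  have "bc 1 n ?\<theta>" by (intro bc_intros bc_mono[OF \<theta>(1)]) simp_all
  moreover have "sat1 s ?\<theta> \<langle>x, p\<rangle> \<longleftrightarrow> x \<in> {z. \<forall>y<sn z. \<langle>fs z, y\<rangle> \<in> Y}" for x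
    unfolding sat1_def[of s ?\<theta>] by (simp add: sat_sat1[OF \<theta>(1)] \<theta>(2) eval_nat_numeral)
  ultimately show ?case by blast
qed

section \<open>The sets of a model of \<open>RCA\<^sub>0 + B\<Sigma>\<^sup>0\<^sub>2\<close>\<close>

locale collection_model =
  fixes D :: "'a::{arith,countable} set set"
  assumes D_models: "models std D base_theory" and D_nonempty: "D \<noteq> {}"
begin

lemma raw: "raw_model std D"
  by unfold_locales (use D_nonempty models_mono[OF D_models] in blast)+

lemma Delta0_pair:
  assumes "X \<in> D" "Y \<in> D" shows "Delta0 {X, Y} \<subseteq> D"
proof
  interpret raw_model std D by (rule raw)
  fix R assume R: "R \<in> Delta0 {X, Y}"
  let ?s = "case_nat X (\<lambda>_. Y)"
  have "?s ` {..<2} = {X, Y}" by (auto simp: numeral_2_eq_2 lessThan_Suc)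
  with R have "R \<in> Delta0 (?s ` {..<2})" by (simp only:)
  from Delta0_definable[OF this] obtain \<theta> p where \<theta>: "bc 1 2 \<theta>" "\<And>x. x \<in> R \<longleftrightarrow> sat1 ?s \<theta> \<langle>x, p\<rangle>" by blast
  let ?q = "LetE (pair (Var 0) (Var 1)) \<theta>"
  have bq: "bounded ?q" using bc_LetE[of 2 "pair (Var 0) (Var 1)" 2 \<theta>] bc_mono[OF \<theta>(1), of 3] by (simp add: bc_def)
  have "sat std D (case_nat x (\<lambda>_. p)) ?s ?q \<longleftrightarrow> x \<in> R" for x
  proof -
    have "sat std D (case_nat x (\<lambda>_. p)) ?s ?q \<longleftrightarrow> sat std {} (case_nat x (\<lambda>_. p)) ?s ?q"
      by (rule sat_arithmetical[OF bounded_arithmetical[OF bq]])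
    then show ?thesis by (simp add: sat_sat1[OF \<theta>(1)] \<theta>(2))
  qed
  moreover have "{x. sat std D (case_nat x (\<lambda>_. p)) ?s ?q} \<in> D"
    by (rule bounded_comprehension[OF bq]) (use assms in \<open>auto split: nat.split\<close>)
  ultimately show "R \<in> D" by simp
qed

text \<open>The form in which Sigma_2 collection is used: the matrix is Pi_1, its bounded part given
  by a set K of the model.\<close>

lemma D_collection2:
  assumes K: "K \<in> D" and ex: "\<And>x. x < a \<Longrightarrow> \<exists>v. \<forall>t. \<langle>\<langle>x, v\<rangle>, t\<rangle> \<in> K"
  shows "\<exists>b. \<forall>x<a. \<exists>v<b. \<forall>t. \<langle>\<langle>x, v\<rangle>, t\<rangle> \<in> K"
proof -
  let ?p = "ExN (AllN (pair (pair (Var 3) (Var 2)) (Var 0) \<^bold>\<in> 0))"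
  have "Sigma0 2 ?p" by (simp add: numeral_2_eq_2 bounded.intros)
  then have "collection_axiom ?p \<in> base_theory" unfolding B_Sigma0_def by blast
  from modelsD[OF D_models this, of "\<lambda>_. K" "\<lambda>_. a"] K ex show ?thesis
    unfolding sat_collection_axiom by (auto simp: eval_nat_numeral)
qed

lemma D_delta0: "delta0_class D"
proof
  show "- X \<in> D" if "X \<in> D" for X
    by (rule subsetD[OF Delta0_pair[OF that that]]) (intro Delta0_compl Delta0_base, simp)
  show "X \<inter> Y \<in> D" if "X \<in> D" "Y \<in> D" for X Y
    by (rule subsetD[OF Delta0_pair[OF that]]) (intro Delta0_inter Delta0_base, simp_all)
  obtain X where X: "X \<in> D" using D_nonempty by blast
  show "{z. fs z < sn z} \<in> D" by (rule subsetD[OF Delta0_pair[OF X X] Delta0_less])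
  show "{z. fs z = sn z} \<in> D" by (rule subsetD[OF Delta0_pair[OF X X] Delta0_eq])
  show "{x. f x \<in> X} \<in> D" if "X \<in> D" "elem_fun f" for X f
    by (rule subsetD[OF Delta0_pair[OF that(1,1)]]) (intro Delta0_pre Delta0_base that(2), simp)
  show "{z. \<forall>y<sn z. \<langle>fs z, y\<rangle> \<in> X} \<in> D" if "X \<in> D" for X
    by (rule subsetD[OF Delta0_pair[OF that that]]) (intro Delta0_ball Delta0_base, simp)
qed

lemma D_class: "collection_class D"
proof -
  interpret raw_model std D by (rule raw)
  interpret delta0_class D by (rule D_delta0)
  show ?thesis
  proof unfold_locales
    fix X Y assume XY: "X \<in> D" "Y \<in> D" "\<And>x. (\<exists>y. \<langle>x, y\<rangle> \<in> X) \<longleftrightarrow> \<not> (\<exists>y. \<langle>x, y\<rangle> \<in> Y)"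
    have "{x. \<exists>y. sat std D (case_nat y (case_nat x (\<lambda>_. 0))) (case_nat X (\<lambda>_. Y)) (pair (Var 1) (Var 0) \<^bold>\<in> 0)} \<in> D"
    proof (rule delta1_comprehension)
      show "bounded (pair (Var 1) (Var 0) \<^bold>\<in> 0)" "bounded (\<^bold>\<not> (pair (Var 1) (Var 0) \<^bold>\<in> 1))" by (intro bounded.intros)+
      show "\<forall>i. case_nat X (\<lambda>_. Y) i \<in> D" using XY by (auto split: nat.split)
    qed (use XY(3) in simp)
    then show "{x. \<exists>y. \<langle>x, y\<rangle> \<in> X} \<in> D" by simp
  next
    fix X a assume X: "X \<in> D" "\<And>x. x < a \<Longrightarrow> \<exists>y. \<langle>x, y\<rangle> \<in> X"
    have "{z. fs z \<in> X} \<in> D" by (rule pre[OF X(1)]) (intro elem_intros)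
    from D_collection2[OF this, of a] X(2) show "\<exists>b. \<forall>x<a. \<exists>y<b. \<langle>x, y\<rangle> \<in> X" by simp
  next
    fix X x assume X: "X \<in> D" "x \<in> X"
    show "\<exists>y\<in>X. \<forall>z<y. z \<notin> X"
    proof (rule ccontr)
      assume no: "\<not> ?thesis"
      have "sat std D (case_nat y (\<lambda>_. 0)) (\<lambda>_. X) (BAll (Var 0) (\<^bold>\<not> (Var 0 \<^bold>\<in> 0)))" for y
      proof (rule open_induct)
        fix y assume "sat std D (case_nat y (\<lambda>_. 0)) (\<lambda>_. X) (BAll (Var 0) (\<^bold>\<not> (Var 0 \<^bold>\<in> 0)))"
        then have *: "\<forall>z<y. z \<notin> X" by simp
        then have "y \<notin> X" using no by blast
        then have "\<forall>z<y + 1. z \<notin> X" using * less_add1_iff order_le_less by metis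
        then show "sat std D (case_nat (ad std y (on std)) (\<lambda>_. 0)) (\<lambda>_. X) (BAll (Var 0) (\<^bold>\<not> (Var 0 \<^bold>\<in> 0)))" by simp
      next
        show "bounded (BAll (Var 0) (\<^bold>\<not> (Var 0 \<^bold>\<in> 0)))" by (intro bounded.intros)
      qed (use X in auto)
      from this[of "x + 1"] have "\<forall>z<x + 1. z \<notin> X" by simp
      then show False using X(2) less_add_one by blast
    qed
  qed
qed

end

section \<open>The jump and the initial controlled structure\<close>

context collection_model begin

text \<open>Sigma_2 collection bounds the witnesses for the elements of B below m, whence initial
  segments of B are coded. For collection, membership in R is certified by a segment of B with a
  bound for the witnesses of its elements. Correctness of such a certificate is Pi_1, so Sigma_2
  collection applies again.\<close>

lemma jump:
  assumes S: "collection_class S" "S \<subseteq> D" and E: "E \<in> S"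
  defines "B \<equiv> {i. \<exists>t. \<langle>i, t\<rangle> \<in> E}"
  shows "amen B" "delta0_collection (Delta0 (insert B S))"
proof -
  interpret D: collection_class D by (rule D_class)
  interpret S: collection_class S by fact
  have ED: "E \<in> D" using E S by blast
  have bound: "\<exists>b. \<forall>x<m. x \<in> B \<longleftrightarrow> (\<exists>v<b. \<langle>x, v\<rangle> \<in> E)" for m
  proof -
    have "dec D (\<lambda>z. \<langle>fs (fs z), sn (fs z)\<rangle> \<in> E \<or> \<langle>fs (fs z), sn z\<rangle> \<notin> E)" by (intro dc ED)
    from D_collection2[OF D.dec_set[OF this], of m]
    have "\<exists>b. \<forall>x<m. \<exists>v<b. \<forall>t. \<langle>x, v\<rangle> \<in> E \<or> \<langle>x, t\<rangle> \<notin> E" by simp blast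
    then obtain b where "\<And>x. x < m \<Longrightarrow> \<exists>v<b. \<forall>t. \<langle>x, v\<rangle> \<in> E \<or> \<langle>x, t\<rangle> \<notin> E" by blast
    then show ?thesis unfolding B_def by (intro exI[of _ b]) blast
  qed
  show am: "amen B" unfolding amen_def
  proof
    fix m
    obtain b where b: "\<And>x. x < m \<Longrightarrow> x \<in> B \<longleftrightarrow> (\<exists>v<b. \<langle>x, v\<rangle> \<in> E)" using bound by blast
    then have "{x. x < m \<and> x \<in> B} = {x. x < m \<and> (\<exists>v<b. \<langle>x, v\<rangle> \<in> E)}" by blast
    moreover have "dec D (\<lambda>x. \<exists>v<b. \<langle>x, v\<rangle> \<in> E)" by (intro dc ED)
    ultimately show "elts (cod {x. x < m \<and> x \<in> B}) = {x. x < m \<and> x \<in> B}" by simp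
  qed
  show "delta0_collection (Delta0 (insert B S))"
  proof unfold_locales
    fix R assume R: "R \<in> Delta0 (insert B S)"
    obtain W h where "W \<in> Delta0 S" and h: "poly_fun h"
      and Wh: "\<And>x m. h x \<le> m \<Longrightarrow> x \<in> R \<longleftrightarrow> \<langle>x, str B m\<rangle> \<in> W"
      using Delta0_normal_form[OF am R] by blast
    then have W: "W \<in> S" using S.Delta0_subset[OF subset_refl] by blast
    have WD: "W \<in> D" using W S by blast
    show "\<exists>y\<in>R. \<forall>z<y. z \<notin> R" if x: "x \<in> R" for x
    proof -
      have eq: "y \<in> R \<longleftrightarrow> \<langle>y, str B (h x)\<rangle> \<in> W" if "y \<le> x" for y
        by (rule Wh) (rule poly_mono[OF h that])
      have "dec S (\<lambda>y. \<langle>y, str B (h x)\<rangle> \<in> W)" by (intro dc W)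
      then obtain y where y: "\<langle>y, str B (h x)\<rangle> \<in> W" "\<And>z. z < y \<Longrightarrow> \<langle>z, str B (h x)\<rangle> \<notin> W" "y \<le> x"
        using S.dec_least[of "\<lambda>y. \<langle>y, str B (h x)\<rangle> \<in> W" x] eq[of x] x by blast
      have "z \<notin> R" if "z < y" for z using y(2)[OF that] eq[of z] that y(3) by simp
      then show ?thesis using y eq by blast
    qed
    fix a assume ex: "\<And>x. x < a \<Longrightarrow> \<exists>y. \<langle>x, y\<rangle> \<in> R"
    \<comment> \<open>v packs y, the segment of B and the bound for its positive part; t ranges over
      possible refutations of the negative part.\<close>
    define Q where "Q x v t \<longleftrightarrow> rs (fs (sn v)) (fs (fs (sn v))) = fs (sn v) \<and> fs (fs (sn v)) = h \<langle>x, fs v\<rangle> \<and>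
      (\<forall>i<fs (fs (sn v)). i \<in> elts (sn (fs (sn v))) \<longrightarrow> (\<exists>w<sn (sn v). \<langle>i, w\<rangle> \<in> E)) \<and>
      (\<forall>i<fs (fs (sn v)). i \<notin> elts (sn (fs (sn v))) \<longrightarrow> \<langle>i, t\<rangle> \<notin> E) \<and> \<langle>\<langle>x, fs v\<rangle>, fs (sn v)\<rangle> \<in> W" for x v t
    have "rec D (\<lambda>z. h \<langle>fs (fs z), fs (sn (fs z))\<rangle>)"
      by (rule D.rec_comp[OF D.rec_elem[OF poly_elem[OF h]]]) (intro dc)
    then have "dec D (\<lambda>z. Q (fs (fs z)) (sn (fs z)) (sn z))" unfolding Q_def by (intro dc ED WD)
    from D_collection2[OF D.dec_set[OF this], of a]
    have "\<exists>b. \<forall>x<a. \<exists>v<b. \<forall>t. Q x v t" if "\<And>x. x < a \<Longrightarrow> \<exists>v. \<forall>t. Q x v t" using that by simp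
    moreover have "\<exists>v. \<forall>t. Q x v t" if "x < a" for x
    proof -
      obtain y where y: "\<langle>x, y\<rangle> \<in> R" using ex \<open>x < a\<close> by blast
      let ?m = "h \<langle>x, y\<rangle>"
      obtain b where b: "\<And>i. i < ?m \<Longrightarrow> i \<in> B \<longleftrightarrow> (\<exists>v<b. \<langle>i, v\<rangle> \<in> E)" using bound by blast
      have "rs (str B ?m) ?m = str B ?m" unfolding rs_def str_def by (simp add: amenD[OF am])
      moreover have "\<langle>\<langle>x, y\<rangle>, str B ?m\<rangle> \<in> W" using Wh[of "\<langle>x, y\<rangle>" ?m] y by simp
      ultimately have "Q x \<langle>y, \<langle>str B ?m, b\<rangle>\<rangle> t" for t
        using b unfolding Q_def B_def by (simp add: elts_sn_str[OF am, unfolded B_def]) blast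
      then show ?thesis by blast
    qed
    ultimately obtain b where b: "\<And>x. x < a \<Longrightarrow> \<exists>v<b. \<forall>t. Q x v t" by blast
    have "\<langle>x, fs v\<rangle> \<in> R" if Q: "\<forall>t. Q x v t" for x v
    proof -
      let ?u = "fs (sn v)"
      have "i \<in> elts (sn ?u) \<longleftrightarrow> i \<in> B" if "i < fs ?u" for i
        using Q \<open>i < fs ?u\<close> unfolding Q_def B_def by blast
      then have "{i. i < fs ?u \<and> i \<in> elts (sn ?u)} = {i. i < fs ?u \<and> i \<in> B}" by blast
      then have "rs ?u (fs ?u) = str B (fs ?u)" unfolding rs_def str_def by simp
      then have "?u = str B (h \<langle>x, fs v\<rangle>)" using Q unfolding Q_def by metis
      moreover have "\<langle>\<langle>x, fs v\<rangle>, ?u\<rangle> \<in> W" using Q unfolding Q_def by blast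
      ultimately show ?thesis using Wh[of "\<langle>x, fs v\<rangle>", OF order_refl] by simp
    qed
    note R = this
    have "\<exists>y<b. \<langle>x, y\<rangle> \<in> R" if "x < a" for x
    proof -
      obtain v where v: "v < b" "\<forall>t. Q x v t" using b[OF \<open>x < a\<close>] by blast
      show ?thesis using R[OF v(2)] le_less_trans[OF fs_le v(1)] by blast
    qed
    then show "\<exists>b. \<forall>x<a. \<exists>y<b. \<langle>x, y\<rangle> \<in> R" by blast
  qed
qed

text \<open>The model as a whole may have no universal Sigma_1 set, so S is cut down to the sets
  recursive in A and V. Their Sigma_1 sets say that some segment of H satisfies a bounded formula
  without set variables, and V answers all questions about such formulas.\<close>

theorem good_entry:
  assumes countable: "countable D" and A: "A \<in> D" and V: "V \<in> D"
    and univ: "\<And>\<theta>. bounded \<theta> \<Longrightarrow> closed_fm 1 0 \<theta> \<Longrightarrow> \<exists>j. \<forall>x. \<langle>j, x\<rangle> \<in> V \<longleftrightarrow> sat std {} (\<lambda>_. x) (\<lambda>_. {}) \<theta>"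
  obtains S C T where "good S C T" "A \<in> S"
proof -
  interpret D: collection_class D by (rule D_class)
  let ?S0 = "Delta0 {}"
  define H where "H = {z. (fs z = 0 \<and> sn z \<in> A) \<or> (fs z = 1 \<and> sn z \<in> V)}"
  have "dec D (\<lambda>z. (fs z = 0 \<and> sn z \<in> A) \<or> (fs z = 1 \<and> sn z \<in> V))" by (intro dc A V)
  then have HD: "H \<in> D" unfolding H_def by (rule D.dec_set)
  have sub: "?S0 \<subseteq> D" by (rule D.Delta0_subset) simp
  define S where "S = ext ?S0 H"
  note S = D.collection_ext[OF sub HD, folded S_def]
  interpret S: collection_class S by (rule S(1))
  have "dec S (\<lambda>x. \<langle>0, x\<rangle> \<in> H)" "dec S (\<lambda>x. \<langle>1, x\<rangle> \<in> H)" by (intro dc S(3))+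
  then have AS: "A \<in> S" and VS: "V \<in> S" by (simp_all add: H_def dec_def)
  \<comment> \<open>An index pairs the place of a formula in V with its number parameter; the length
    of the segment of H acts as the computation time.\<close>
  define C where "C = {z. \<langle>fs (fs z), \<langle>\<langle>fs (sn z), str H (sn (sn z))\<rangle>, sn (fs z)\<rangle>\<rangle> \<in> V}"
  have "dec S (\<lambda>z. \<langle>fs (fs z), \<langle>\<langle>fs (sn z), str H (sn (sn z))\<rangle>, sn (fs z)\<rangle>\<rangle> \<in> V)"
    unfolding str_def by (intro dc VS S(3))
  then have CS: "C \<in> S" unfolding C_def by (rule S.dec_set)
  have universal: "\<exists>e. \<forall>x. (\<exists>y. \<langle>x, y\<rangle> \<in> W) \<longleftrightarrow> (\<exists>t. \<langle>e, \<langle>x, t\<rangle>\<rangle> \<in> C)" if W: "W \<in> S" for W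
  proof -
    obtain R0 where R0: "R0 \<in> Delta0 (insert H ?S0)" "\<And>z. z \<in> W \<longleftrightarrow> (\<exists>y. \<langle>z, y\<rangle> \<in> R0)"
      using W unfolding S_def ext_def Delta1_def Sg_def by auto
    let ?R = "{z. \<langle>\<langle>fs z, fs (sn z)\<rangle>, sn (sn z)\<rangle> \<in> R0}"
    have R: "?R \<in> Delta0 (insert H ?S0)" by (intro Delta0_pre R0 elem_intros)
    have WR: "(\<exists>y. \<langle>x, y\<rangle> \<in> W) \<longleftrightarrow> (\<exists>v. \<langle>x, v\<rangle> \<in> ?R)" for x unfolding R0(2) by simp (metis fs_pr sn_pr)
    obtain W' where W': "W' \<in> ?S0" "\<And>x m. \<langle>x, str H m\<rangle> \<in> W' \<Longrightarrow> \<exists>y\<le>m. \<langle>x, y\<rangle> \<in> ?R"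
      "\<And>x y. \<langle>x, y\<rangle> \<in> ?R \<Longrightarrow> \<exists>m. \<langle>x, str H m\<rangle> \<in> W'"
      using Sg_normal_form[OF D.amen[OF HD] Delta0.delta0_class_axioms R] by blast
    have W'0: "W' \<in> Delta0 ((\<lambda>_. {}) ` {..<0::nat})" using W'(1) by simp
    obtain \<theta> p where \<theta>: "bc 1 0 \<theta>" "\<And>x. x \<in> W' \<longleftrightarrow> sat1 (\<lambda>_. {}) \<theta> \<langle>x, p\<rangle>" using Delta0_definable[OF W'0] by blast
    obtain j where j: "\<And>x. \<langle>j, x\<rangle> \<in> V \<longleftrightarrow> sat1 (\<lambda>_. {}) \<theta> x"
      using univ[of \<theta>] \<theta>(1) unfolding bc_def sat1_def by blast
    have "\<langle>\<langle>j, p\<rangle>, \<langle>x, m\<rangle>\<rangle> \<in> C \<longleftrightarrow> \<langle>x, str H m\<rangle> \<in> W'" for x m by (simp add: C_def j \<theta>(2))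
    then have "(\<exists>y. \<langle>x, y\<rangle> \<in> W) \<longleftrightarrow> (\<exists>t. \<langle>\<langle>j, p\<rangle>, \<langle>x, t\<rangle>\<rangle> \<in> C)" for x unfolding WR using W'(2,3) by blast
    then show ?thesis by blast
  qed
  define E where "E = {z. \<langle>fs (fs z), \<langle>sn (fs z), sn z\<rangle>\<rangle> \<in> C}"
  have "dec S (\<lambda>z. \<langle>fs (fs z), \<langle>sn (fs z), sn z\<rangle>\<rangle> \<in> C)" by (intro dc CS)
  then have ES: "E \<in> S" unfolding E_def by (rule S.dec_set)
  define B where "B = {i. \<exists>t. \<langle>i, t\<rangle> \<in> E}"
  note J = jump[OF S(1) S(4) ES, folded B_def]
  interpret J: delta0_collection "Delta0 (insert B S)" by (rule J(2))
  let ?T = "ext S B"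
  have T: "collection_class ?T" "S \<subseteq> ?T" "B \<in> ?T"
    unfolding ext_def using J.collection_Delta1 J.subset_Delta1 Delta0_base by blast+
  have cS: "countable S" using S(4) countable by (rule countable_subset)
  have "good S C ?T" unfolding good_def
  proof (intro conjI ballI)
    show "countable ?T" by (rule countable_ext[OF J(1) S.delta0_class_axioms cS])
    have "B = {w. \<exists>t. \<langle>fs w, \<langle>sn w, t\<rangle>\<rangle> \<in> C}" unfolding B_def E_def by simp
    then show "{w. \<exists>t. \<langle>fs w, \<langle>sn w, t\<rangle>\<rangle> \<in> C} \<in> ?T" using T(3) by simp
  qed (use cS S(1) T CS universal in blast)+
  then show ?thesis using AS that by blast
qed

end

section \<open>Meaning of the coding formulas\<close>

definition fin :: "'a::arith \<Rightarrow> bool" where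
  "fin c \<longleftrightarrow> (\<forall>d<c. elts d \<noteq> elts c)"

definition fn :: "'a::arith set \<Rightarrow> bool" where
  "fn F \<longleftrightarrow> (\<forall>z. z \<in> F \<longrightarrow> (\<exists>x y. z = \<langle>x, y\<rangle>)) \<and> (\<forall>x. \<exists>y. \<langle>x, y\<rangle> \<in> F) \<and>
     (\<forall>x y y'. \<langle>x, y\<rangle> \<in> F \<and> \<langle>x, y'\<rangle> \<in> F \<longrightarrow> y = y')"

definition sq :: "'a::arith \<Rightarrow> 'a \<Rightarrow> bool" where
  "sq c l \<longleftrightarrow> fin c \<and> (\<forall>z. z \<in> elts c \<longrightarrow> (\<exists>x y. z = \<langle>x, y\<rangle>)) \<and>
     (\<forall>x y y'. \<langle>x, y\<rangle> \<in> elts c \<and> \<langle>x, y'\<rangle> \<in> elts c \<longrightarrow> y = y') \<and> (\<forall>j. j < l \<longleftrightarrow> (\<exists>v. \<langle>j, v\<rangle> \<in> elts c))"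

definition bsq :: "'a::arith \<Rightarrow> bool" where
  "bsq c \<longleftrightarrow> (\<exists>l. sq c l) \<and> (\<forall>i v. \<langle>i, v\<rangle> \<in> elts c \<longrightarrow> v < 1 + 1)"

definition btree :: "'a::arith set \<Rightarrow> bool" where
  "btree X \<longleftrightarrow> (\<forall>c. c \<in> X \<longrightarrow> bsq c) \<and> (\<forall>c d. c \<in> X \<and> bsq d \<and> elts d \<subseteq> elts c \<longrightarrow> d \<in> X)"

definition path :: "'a::arith set \<Rightarrow> 'a set \<Rightarrow> bool" where
  "path g X \<longleftrightarrow> fn g \<and> (\<forall>n. \<exists>c. sq c n \<and> elts c \<subseteq> g \<and> c \<in> X)"

definition pcol :: "'a::arith set \<Rightarrow> bool" where
  "pcol f \<longleftrightarrow> (\<forall>z. z \<in> f \<longrightarrow> (\<exists>x y v. z = \<langle>\<langle>x, y\<rangle>, v\<rangle> \<and> x < y \<and> v < 1 + 1)) \<and>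
     (\<forall>x y. x < y \<longrightarrow> (\<exists>v. \<langle>\<langle>x, y\<rangle>, v\<rangle> \<in> f)) \<and>
     (\<forall>x y v w. \<langle>\<langle>x, y\<rangle>, v\<rangle> \<in> f \<and> \<langle>\<langle>x, y\<rangle>, w\<rangle> \<in> f \<longrightarrow> v = w)"

definition grp :: "'a::arith set \<Rightarrow> 'a set \<Rightarrow> 'a set \<Rightarrow> bool" where
  "grp L f F \<longleftrightarrow> fn F \<and> (\<forall>n c. \<langle>n, c\<rangle> \<in> F \<longrightarrow> c \<in> L) \<and>
     (\<forall>m n c d. m < n \<and> \<langle>m, c\<rangle> \<in> F \<and> \<langle>n, d\<rangle> \<in> F \<longrightarrow>
       (\<forall>x y. x \<in> elts c \<and> y \<in> elts d \<longrightarrow> x < y) \<and> (\<exists>v. \<forall>x y. x \<in> elts c \<and> y \<in> elts d \<longrightarrow> \<langle>\<langle>x, y\<rangle>, v\<rangle> \<in> f))"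

lemma sat_in_code [simp]: "sat std D e s (in_code t c) \<longleftrightarrow> tv std e t \<in> elts (tv std e c)"
  by (auto simp: in_code_def elts_def eval_nat_numeral dvd_def mult.commute)

lemma sat_finset_code [simp]: "sat std D e s (finset_code c) \<longleftrightarrow> fin (tv std e c)"
  by (simp add: finset_code_def fin_def set_eq_iff) blast

lemma sat_code_sub_code [simp]: "sat std D e s (code_sub_code c d) \<longleftrightarrow> elts (tv std e c) \<subseteq> elts (tv std e d)"
  by (simp add: imp_conjL code_sub_code_def subset_iff)

lemma sat_code_sub_set [simp]: "sat std D e s (code_sub_set c X) \<longleftrightarrow> elts (tv std e c) \<subseteq> s X"
  by (simp add: imp_conjL code_sub_set_def subset_iff)

lemma sat_code_before [simp]:
  "sat std D e s (code_before c d) \<longleftrightarrow> (\<forall>x y. x \<in> elts (tv std e c) \<and> y \<in> elts (tv std e d) \<longrightarrow> x < y)"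
  by (simp add: imp_conjL code_before_def)

lemma sat_infinite_set [simp]: "sat std D e s (infinite_set X) \<longleftrightarrow> unb (s X)"
  by (simp add: imp_conjL infinite_set_def unb_def)

lemma sat_function_NN [simp]: "sat std D e s (function_NN F) \<longleftrightarrow> fn (s F)"
  by (simp add: imp_conjL function_NN_def fn_def eval_nat_numeral)

lemma sat_seq_code [simp]: "sat std D e s (seq_code c l) \<longleftrightarrow> sq (tv std e c) (tv std e l)"
  by (simp add: imp_conjL seq_code_def sq_def eval_nat_numeral iff_conv_conj_imp[symmetric]) blast

lemma sat_binary_seq_code [simp]: "sat std D e s (binary_seq_code c) \<longleftrightarrow> bsq (tv std e c)"
  by (simp add: imp_conjL binary_seq_code_def bsq_def)

lemma sat_binary_tree [simp]: "sat std D e s (binary_tree X) \<longleftrightarrow> btree (s X)"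
  by (simp add: imp_conjL binary_tree_def btree_def) blast

lemma sat_path_through [simp]: "sat std D e s (path_through g X) \<longleftrightarrow> path (s g) (s X)"
  by (simp add: imp_conjL path_through_def path_def)

lemma sat_pair_coloring [simp]: "sat std D e s (pair_coloring f) \<longleftrightarrow> pcol (s f)"
  by (simp add: imp_conjL pair_coloring_def pcol_def eval_nat_numeral) blast

lemma sat_constant_on_product [simp]: "sat std D e s (constant_on_product f c d) \<longleftrightarrow>
    (\<exists>v. \<forall>x y. x \<in> elts (tv std e c) \<and> y \<in> elts (tv std e d) \<longrightarrow> \<langle>\<langle>x, y\<rangle>, v\<rangle> \<in> s f)"
  by (simp add: imp_conjL constant_on_product_def eval_nat_numeral)

lemma sat_infinite_grouping [simp]: "sat std D e s (infinite_grouping L f F) \<longleftrightarrow> grp (s L) (s f) (s F)"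
  by (simp add: imp_conjL infinite_grouping_def grp_def eval_nat_numeral)

section \<open>Solving one instance\<close>

definition graph :: "('a::arith \<Rightarrow> 'a) \<Rightarrow> 'a set" where
  "graph g = {z. \<exists>x. z = \<langle>x, g x\<rangle>}"

lemma pr_in_graph [simp]: "\<langle>x, y\<rangle> \<in> graph g \<longleftrightarrow> y = g x"
  by (auto simp: graph_def)

lemma fn_graph: "fn (graph g)"
  unfolding fn_def by (auto simp: graph_def)

lemma fin_cod: "fin c \<Longrightarrow> cod (elts c) = c"
  unfolding cod_def by (rule lst_eqI) (auto simp: fin_def)

lemma fin_eqI: "fin c \<Longrightarrow> fin d \<Longrightarrow> elts c = elts d \<Longrightarrow> c = d"
  using fin_cod by metis

text \<open>Translates a string, which is a length with a coded set, into the code of the graph of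
  its characteristic function, the form in which \<open>binary_tree\<close> expects binary
  sequences.\<close>

definition chi :: "'a::arith \<Rightarrow> 'a" where
  "chi \<sigma> = cod {z. z < \<langle>fs \<sigma>, 1\<rangle> + 1 \<and> (\<exists>i<fs \<sigma>. z = \<langle>i, if i \<in> elts (sn \<sigma>) then 1 else 0\<rangle>)}"

context collection_class begin

lemma graph_in: "rec S g \<Longrightarrow> graph g \<in> S"
proof -
  assume g: "rec S g"
  have "dec S (\<lambda>z. \<exists>x<z + 1. z = \<langle>x, g x\<rangle>)" by (intro dc rec_comp[OF g])
  moreover have "(\<lambda>z. \<exists>x<z + 1. z = \<langle>x, g x\<rangle>) = (\<lambda>z. \<exists>x. z = \<langle>x, g x\<rangle>)"
    using pr_ge1 by (auto simp: less_add1_iff fun_eq_iff)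
  ultimately show ?thesis unfolding graph_def by (simp add: dec_def)
qed

lemma fin_cod_Collect: "dec S P \<Longrightarrow> fin (cod {x. x < k \<and> P x})"
proof -
  assume P: "dec S P"
  let ?F = "{x. x < k \<and> P x}"
  obtain c where c: "elts c = ?F" using ex_code[OF P] by blast
  have "dec S (\<lambda>d. (\<forall>x\<in>elts d. x \<in> elts c) \<and> (\<forall>x\<in>elts c. x \<in> elts d))" by (intro dc)
  moreover have "(\<lambda>d. (\<forall>x\<in>elts d. x \<in> elts c) \<and> (\<forall>x\<in>elts c. x \<in> elts d)) = (\<lambda>d. elts d = ?F)" using c by auto
  ultimately have "dec S (\<lambda>d. elts d = ?F)" by simp
  from lst_props(2)[OF this c] show ?thesis unfolding fin_def elts_cod_Collect[OF P] by (simp add: cod_def)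
qed

lemma dec_chi: "dec S (\<lambda>z. \<exists>i<fs \<sigma>. z = \<langle>i, if i \<in> elts (sn \<sigma>) then 1 else 0\<rangle>)"
  by (intro dc)

lemma elts_chi: "z \<in> elts (chi \<sigma>) \<longleftrightarrow> (\<exists>i<fs \<sigma>. z = \<langle>i, if i \<in> elts (sn \<sigma>) then 1 else 0 :: 'a\<rangle>)"
proof -
  have "\<langle>i, if i \<in> elts (sn \<sigma>) then 1 else 0\<rangle> < \<langle>fs \<sigma>, 1\<rangle> + 1" if "i < fs \<sigma>" for i
    unfolding less_add1_iff by (rule pr_mono) (use that in auto)
  then show ?thesis unfolding chi_def elts_cod_Collect[OF dec_chi] mem_Collect_eq by blast
qed

lemma fin_chi: "fin (chi (\<sigma>::'a))"
  unfolding chi_def by (rule fin_cod_Collect[OF dec_chi])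

lemma rec_chi: "rec S chi"
  unfolding chi_def[abs_def] by (intro dc)

lemma sq_chi: "sq (chi \<sigma>) (fs (\<sigma>::'a))"
  unfolding sq_def elts_chi by (auto simp: fin_chi)

lemma bsq_chi: "bsq (chi (\<sigma>::'a))"
proof -
  have "(1::'a) < 1 + 1" "(0::'a) < 1 + 1" unfolding less_add1_iff by simp_all
  then show ?thesis unfolding bsq_def elts_chi using sq_chi[of \<sigma>] by auto
qed

lemma bsq_chi_ex:
  assumes "sq c l" "bsq c" obtains \<sigma> where "chi \<sigma> = c" "fs \<sigma> = l" "rs \<sigma> l = (\<sigma>::'a)"
proof
  let ?\<sigma> = "\<langle>l, cod {i. i < l \<and> \<langle>i, 1\<rangle> \<in> elts c}\<rangle>"
  have "dec S (\<lambda>i. \<langle>i, 1\<rangle> \<in> elts c)" by (intro dc)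
  then have e: "elts (sn ?\<sigma>) = {i. i < l \<and> \<langle>i, 1\<rangle> \<in> elts c}" by simp
  show "fs ?\<sigma> = l" by simp
  show "rs ?\<sigma> l = ?\<sigma>" unfolding rs_def e str_def by (simp cong: conj_cong)
  have two: "v = 0 \<or> v = 1" if "v < 1 + 1" for v :: 'a
    using that unfolding less_add1_iff by (cases v rule: arith_cases) (auto simp: add_increasing)
  have dom: "j < l \<longleftrightarrow> (\<exists>v. \<langle>j, v\<rangle> \<in> elts c)" for j using assms(1) unfolding sq_def by blast
  have val: "v = 0 \<or> v = 1" if "\<langle>i, v\<rangle> \<in> elts c" for i v using assms(2) two that unfolding bsq_def by blast
  have uniq: "v = w" if "\<langle>i, v\<rangle> \<in> elts c" "\<langle>i, w\<rangle> \<in> elts c" for i v w using assms(1) that unfolding sq_def by blast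
  have pairs: "\<exists>x y. z = \<langle>x, y\<rangle>" if "z \<in> elts c" for z using assms(1) that unfolding sq_def by blast
  have "elts (chi ?\<sigma>) = elts c"
  proof (rule set_eqI)
    fix z
    have "(\<exists>i<l. z = \<langle>i, if \<langle>i, 1\<rangle> \<in> elts c then 1 else 0\<rangle>) \<longleftrightarrow> z \<in> elts c"
    proof
      assume "\<exists>i<l. z = \<langle>i, if \<langle>i, 1\<rangle> \<in> elts c then 1 else 0\<rangle>"
      then obtain i where i: "i < l" "z = \<langle>i, if \<langle>i, 1\<rangle> \<in> elts c then 1 else 0\<rangle>" by blast
      obtain v where "\<langle>i, v\<rangle> \<in> elts c" using dom i(1) by blast
      with val[OF this] i(2) show "z \<in> elts c" by (auto split: if_splits)
    next
      assume z: "z \<in> elts c"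
      then obtain i v where iv: "z = \<langle>i, v\<rangle>" using pairs by blast
      have "i < l" using dom z iv by blast
      moreover have "v = (if \<langle>i, 1\<rangle> \<in> elts c then 1 else 0)" using val[of i v] uniq[of i v 1] z iv by auto
      ultimately show "\<exists>i<l. z = \<langle>i, if \<langle>i, 1\<rangle> \<in> elts c then 1 else 0\<rangle>" using iv by blast
    qed
    moreover have "z \<in> elts (chi ?\<sigma>) \<longleftrightarrow> (\<exists>i<l. z = \<langle>i, if \<langle>i, 1\<rangle> \<in> elts c then 1 else 0\<rangle>)"
      unfolding elts_chi e fs_pr by (rule ex_cong1) auto
    ultimately show "z \<in> elts (chi ?\<sigma>) \<longleftrightarrow> z \<in> elts c" by (rule trans[rotated])
  qed
  moreover have "fin c" using assms(1) unfolding sq_def by blast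
  ultimately show "chi ?\<sigma> = c" using fin_eqI[OF fin_chi] by blast
qed

text \<open>X is only known to be unbounded as a set of codes. Sequences shorter than n are subsets
  of a fixed interval, so their least codes are below a value of \<open>pw\<close>; a larger code in
  X has length at least n, and its restrictions belong to X.\<close>

lemma tree_of_btree:
  assumes X: "X \<in> S" "btree X" "unb X"
  shows "tree {\<sigma>. rs \<sigma> (fs \<sigma>) = \<sigma> \<and> chi \<sigma> \<in> X}" (is "tree ?K")
proof -
  have restr: "rs \<sigma> m \<in> ?K" if \<sigma>: "\<sigma> \<in> ?K" and m: "m \<le> fs \<sigma>" for \<sigma> m
  proof -
    have "rs (rs \<sigma> m) (fs (rs \<sigma> m)) = rs \<sigma> m" using rs_rs[of m m \<sigma>] by simp
    moreover have "elts (chi (rs \<sigma> m)) \<subseteq> elts (chi \<sigma>)"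
      unfolding subset_iff elts_chi using m by (auto intro: less_le_trans)
    then have "chi (rs \<sigma> m) \<in> X" using \<sigma> X(2) bsq_chi unfolding btree_def by blast
    ultimately show ?thesis by simp
  qed
  have "\<exists>\<sigma>\<in>?K. fs \<sigma> = n" for n
  proof -
    let ?b = "\<langle>n, 1\<rangle> + 1"
    obtain c where c: "c > pw ?b" "c \<in> X" using X(3) unfolding unb_def by blast
    then have bc: "bsq c" using X(2) unfolding btree_def by blast
    then obtain l where l: "sq c l" unfolding bsq_def by blast
    have "n \<le> l"
    proof (rule ccontr)
      assume "\<not> n \<le> l"
      have "z < ?b" if zc: "z \<in> elts c" for z
      proof -
        obtain i v where z: "z = \<langle>i, v\<rangle>" using l zc unfolding sq_def by blast
        have "i < l" using l zc unfolding sq_def z by blast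
        then have "i \<le> n" using \<open>\<not> n \<le> l\<close> by simp
        moreover have "v \<le> 1" using bc zc unfolding bsq_def z by (simp add: less_add1_iff[symmetric])
        ultimately show ?thesis unfolding z less_add1_iff by (rule pr_mono)
      qed
      then have "{z. z < ?b \<and> z \<in> elts c} = elts c" by blast
      moreover have "dec S (\<lambda>z. z \<in> elts c)" by (intro dc)
      ultimately have "cod (elts c) < pw ?b" using cod_less_pw[of "\<lambda>z. z \<in> elts c" ?b] by simp
      moreover have "cod (elts c) = c" by (rule fin_cod) (use l in \<open>simp add: sq_def\<close>)
      ultimately show False using c by simp
    qed
    obtain \<sigma> where "chi \<sigma> = c" "fs \<sigma> = l" "rs \<sigma> l = \<sigma>" by (rule bsq_chi_ex[OF l bc])
    then have "rs \<sigma> n \<in> ?K" using \<open>n \<le> l\<close> c(2) by (intro restr) simp_all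
    then show ?thesis using fs_rs by blast
  qed
  then show ?thesis unfolding tree_def using restr by blast
qed

end

lemma solve_WKL:
  fixes S :: "'a::arith set set"
  assumes S: "good S C T" and X: "X \<in> S" "btree X" "unb X"
  shows "\<exists>S' C' g. good S' C' T \<and> S \<subseteq> S' \<and> g \<in> S' \<and> path g X"
proof -
  interpret S: collection_class S using S by (simp add: good_def)
  let ?K = "{\<sigma>. rs \<sigma> (fs \<sigma>) = \<sigma> \<and> chi \<sigma> \<in> X}"
  have "dec S (\<lambda>\<sigma>. rs \<sigma> (fs \<sigma>) = \<sigma> \<and> chi \<sigma> \<in> X)" by (intro dc X S.rec_chi)
  then have K: "?K \<in> S" by (rule S.dec_set)
  have "\<exists>G C'. good (ext S G) C' T \<and> S \<subseteq> ext S G \<and> G \<in> ext S G \<and> (\<forall>n. str G n \<in> ?K)"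
  proof (rule low_basis[OF S S.tree_of_btree[OF X] K])
    fix G C' assume "good (ext S G) C' T" "S \<subseteq> ext S G" "G \<in> ext S G" "\<And>n. str G n \<in> ?K"
    then show ?thesis by (intro exI[of _ G] exI[of _ C'] conjI allI)
  qed
  then obtain G C' where G: "good (ext S G) C' T" "S \<subseteq> ext S G" "G \<in> ext S G" "\<forall>n. str G n \<in> ?K"
    by (elim exE conjE)
  interpret E: collection_class "ext S G" using G(1) by (simp add: good_def)
  define h :: "'a \<Rightarrow> 'a" where "h x = (if x \<in> G then 1 else 0)" for x
  have "rec (ext S G) h" unfolding h_def[abs_def] by (intro dc G)
  then have "graph h \<in> ext S G" by (rule E.graph_in)
  moreover have "path (graph h) X" unfolding path_def
  proof (intro conjI allI exI fn_graph)
    fix n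
    show "sq (chi (str G n)) n" using S.sq_chi[of "str G n"] by simp
    show "chi (str G n) \<in> X" using G(4) by blast
    show "elts (chi (str G n)) \<subseteq> graph h"
      unfolding subset_iff S.elts_chi elts_sn_str[OF E.amen[OF G(3)]] by (auto simp: h_def split: if_splits)
  qed
  ultimately show ?thesis using G by blast
qed

text \<open>The next-element function is iterated, which draws on Sigma_1 induction through
  \<open>good_iteration\<close>.\<close>

lemma enumeration:
  assumes S: "good S C T" and G: "G \<in> S" "unb G"
  shows "\<exists>g. rec S g \<and> (\<forall>x. g x \<in> G) \<and> (\<forall>x y. x < y \<longrightarrow> g x < (g y :: 'a::arith))"
proof -
  interpret S: collection_class S using S by (simp add: good_def)
  define nx where "nx x = lst (\<lambda>y. y \<in> G \<and> x < y)" for x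
  have ex: "\<exists>y. y \<in> G \<and> x < y" for x using G(2) unfolding unb_def by blast
  have nx: "nx x \<in> G" "x < nx x" for x
  proof -
    have "dec S (\<lambda>y. y \<in> G \<and> x < y)" by (intro dc G)
    from S.lst_props(1)[OF this] ex[of x] show "nx x \<in> G" "x < nx x" unfolding nx_def by blast+
  qed
  have "rec S nx" unfolding nx_def[abs_def] by (intro S.rec_lst ex dc G)
  from good_iteration[OF S this, of "nx 0"] obtain g where g: "rec S g" "g 0 = nx 0" "\<And>x. g (x + 1) = nx (g x)" by metis
  have "g x \<in> G" for x
    by (rule S.dec_induct[of "\<lambda>x. g x \<in> G"]) (use g nx in \<open>auto intro!: S.dec_mem[OF G(1)]\<close>)
  moreover have "\<forall>x<y. g x < g y" for y
  proof (rule S.dec_induct[of "\<lambda>y. \<forall>x<y. g x < g y"])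
    show "dec S (\<lambda>y. \<forall>x<y. g x < g y)" by (intro dc S.rec_comp[OF g(1)])
    fix y assume *: "\<forall>x<y. g x < g y"
    have "g y < g (y + 1)" using nx g by simp
    then show "\<forall>x<y + 1. g x < g (y + 1)" using * by (auto simp: less_add1_iff order_le_less intro: less_trans)
  qed simp
  ultimately show ?thesis using g(1) by blast
qed

lemma solve_GP:
  fixes S :: "'a::{arith,countable} set set"
  assumes S: "good S C T" and L: "L \<in> S" "\<And>c. c \<in> L \<Longrightarrow> fin c" and f: "f \<in> S" "pcol f"
  shows "\<exists>S' C' T'. good S' C' T' \<and> S \<subseteq> S' \<and>
    ((\<exists>Y\<in>S'. unb Y \<and> (\<forall>c. c \<in> L \<longrightarrow> \<not> elts c \<subseteq> Y)) \<or> (\<exists>F\<in>S'. grp L f F))"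
proof -
  interpret S: collection_class S using S by (simp add: good_def)
  show ?thesis
  \<comment> \<open>If the empty set is large, repeating it gives a grouping. It is set apart
    because the construction relies on nonempty blocks to move upwards.\<close>
  proof (cases "\<exists>c\<in>L. elts c = {}")
    case True
    then obtain c where c: "c \<in> L" "elts c = {}" by blast
    have "graph (\<lambda>_. c) \<in> S" by (intro S.graph_in dc)
    moreover have "grp L f (graph (\<lambda>_. c))" unfolding grp_def using c by (auto simp: fn_graph)
    ultimately show ?thesis using S by blast
  next
    case False
    define R where "R = {z. \<langle>z, 1\<rangle> \<in> f}"
    have "dec S (\<lambda>z. \<langle>z, 1\<rangle> \<in> f)" by (intro dc f)
    then have R: "R \<in> S" unfolding R_def by (rule S.dec_set)
    have two: "v = 0 \<or> v = 1" if "v < 1 + 1" for v :: 'a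
      using that unfolding less_add1_iff by (cases v rule: arith_cases) (auto simp: add_increasing)
    have col: "\<langle>\<langle>x, y\<rangle>, 0\<rangle> \<in> f" if xy: "x < y" "\<langle>x, y\<rangle> \<notin> R" for x y
    proof -
      obtain v where v: "\<langle>\<langle>x, y\<rangle>, v\<rangle> \<in> f" using f(2) xy(1) unfolding pcol_def by blast
      then have "v < 1 + 1" using f(2) unfolding pcol_def by fastforce
      then show ?thesis using two v xy(2) unfolding R_def by blast
    qed
    from S L(1) R show ?thesis
    proof (rule grouping_or_small)
      show "elts c \<noteq> {}" if "c \<in> L" for c using False that by blast
    next
      fix S' C' T' Y assume "good S' C' T'" "S \<subseteq> S'" "Y \<in> S'" "unb Y" "\<And>c. c \<in> L \<Longrightarrow> \<not> elts c \<subseteq> Y"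
      then show ?thesis by blast
    next
      fix S' C' T' G assume *: "good S' C' T'" "S \<subseteq> S'" "G \<in> S'" "unb G" "G \<subseteq> L"
        "\<And>c c'. c \<in> G \<Longrightarrow> c' \<in> G \<Longrightarrow> c < c' \<Longrightarrow> (\<forall>x\<in>elts c. \<forall>y\<in>elts c'. x < y) \<and>
         ((\<forall>x\<in>elts c. \<forall>y\<in>elts c'. \<langle>x, y\<rangle> \<in> R) \<or> (\<forall>x\<in>elts c. \<forall>y\<in>elts c'. \<langle>x, y\<rangle> \<notin> R))"
      interpret S': collection_class S' using *(1) by (simp add: good_def)
      obtain g where g: "rec S' g" "\<And>x. g x \<in> G" "\<And>x y. x < y \<Longrightarrow> g x < g y" using enumeration[OF *(1,3,4)] by blast
      have "grp L f (graph g)" unfolding grp_def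
      proof (intro conjI fn_graph allI impI)
        show "c \<in> L" if "\<langle>n, c\<rangle> \<in> graph g" for n c using that g(2) *(5) by auto
        fix m n c d assume "m < n \<and> \<langle>m, c\<rangle> \<in> graph g \<and> \<langle>n, d\<rangle> \<in> graph g"
        then have "c \<in> G" "d \<in> G" "c < d" using g by auto
        note h = *(6)[OF this]
        then show "x < y" if "x \<in> elts c \<and> y \<in> elts d" for x y using that by blast
        from h have less: "\<And>x y. x \<in> elts c \<Longrightarrow> y \<in> elts d \<Longrightarrow> x < y" by blast
        from h consider "\<forall>x\<in>elts c. \<forall>y\<in>elts d. \<langle>x, y\<rangle> \<in> R" | "\<forall>x\<in>elts c. \<forall>y\<in>elts d. \<langle>x, y\<rangle> \<notin> R" by blast
        then show "\<exists>v. \<forall>x y. x \<in> elts c \<and> y \<in> elts d \<longrightarrow> \<langle>\<langle>x, y\<rangle>, v\<rangle> \<in> f"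
        proof cases
          case 1 then show ?thesis unfolding R_def by blast
        next
          case 2 then show ?thesis using col less by blast
        qed
      qed
      then show ?thesis using * S'.graph_in[OF g(1)] by blast
    qed
  qed
qed

section \<open>The extension\<close>

text \<open>Formulated so as to persist when S grows: both a solution and a set that refutes
  largeness of X are merely required to exist, and the hypotheses do not refer to S.\<close>

definition solved :: "'a::arith set \<Rightarrow> 'a set \<Rightarrow> 'a set set \<Rightarrow> bool" where
  "solved X Y S \<longleftrightarrow> (btree X \<and> unb X \<longrightarrow> (\<exists>g\<in>S. path g X)) \<and>
     ((\<forall>c. c \<in> X \<longrightarrow> fin c) \<and> pcol Y \<longrightarrow>
       (\<exists>Z\<in>S. unb Z \<and> (\<forall>c. c \<in> X \<longrightarrow> \<not> elts c \<subseteq> Z)) \<or> (\<exists>F\<in>S. grp X Y F))"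

definition controlled :: "'a::arith set set \<Rightarrow> bool" where
  "controlled S \<longleftrightarrow> (\<exists>C T. good S C T)"

lemma solve_step:
  fixes S :: "'a::{arith,countable} set set"
  assumes S: "controlled S" and XY: "X \<in> S" "Y \<in> S"
  shows "\<exists>S'. controlled S' \<and> S \<subseteq> S' \<and> solved X Y S'"
proof -
  obtain S1 where S1: "controlled S1" "S \<subseteq> S1" "btree X \<and> unb X \<Longrightarrow> \<exists>g\<in>S1. path g X"
  proof (cases "btree X \<and> unb X")
    case True
    obtain C T where "good S C T" using S unfolding controlled_def by blast
    from solve_WKL[OF this XY(1)] True have "\<exists>S1. controlled S1 \<and> S \<subseteq> S1 \<and> (\<exists>g\<in>S1. path g X)"
      unfolding controlled_def by blast
    then show ?thesis using that by blast
  next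
    case False
    then show ?thesis using that[of S] S by blast
  qed
  show ?thesis
  proof (cases "(\<forall>c. c \<in> X \<longrightarrow> fin c) \<and> pcol Y")
    case True
    obtain C T where "good S1 C T" using S1 unfolding controlled_def by blast
    from solve_GP[OF this, of X Y] True XY S1(2)
    have "\<exists>S'. controlled S' \<and> S1 \<subseteq> S' \<and> ((\<exists>Z\<in>S'. unb Z \<and> (\<forall>c. c \<in> X \<longrightarrow> \<not> elts c \<subseteq> Z)) \<or> (\<exists>F\<in>S'. grp X Y F))"
      unfolding controlled_def by blast
    then obtain S' where S': "controlled S'" "S1 \<subseteq> S'"
      "(\<exists>Z\<in>S'. unb Z \<and> (\<forall>c. c \<in> X \<longrightarrow> \<not> elts c \<subseteq> Z)) \<or> (\<exists>F\<in>S'. grp X Y F)" by (elim exE conjE)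
    have "btree X \<and> unb X \<longrightarrow> (\<exists>g\<in>S'. path g X)" using S1(3) S'(2) by blast
    then show ?thesis using S' S1(2) unfolding solved_def by blast
  next
    case False
    then have "solved X Y S1" using S1(3) unfolding solved_def by blast
    then show ?thesis using S1 by blast
  qed
qed

definition nxt :: "'a::arith set set \<Rightarrow> 'a set \<Rightarrow> 'a set \<Rightarrow> 'a set set" where
  "nxt S X Y = (SOME S'. controlled S' \<and> S \<subseteq> S' \<and> solved X Y S')"

text \<open>Stage \<^term>\<open>n\<close> treats the pair of sets that is coded by \<^term>\<open>n\<close>: both sets are given by
  their positions in an enumeration of an earlier stage.\<close>

function chain :: "'a::arith set set \<Rightarrow> nat \<Rightarrow> 'a set set" where
  "chain S 0 = S"
| "chain S (Suc n) = nxt (chain S n)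
     (from_nat_into (chain S (min n (fst (prod_decode n)))) (fst (prod_decode (snd (prod_decode n)))))
     (from_nat_into (chain S (min n (fst (prod_decode n)))) (snd (prod_decode (snd (prod_decode n)))))"
  by pat_completeness auto
termination by (relation "measure snd") auto

context
  fixes S :: "'a::{arith,countable} set set"
  assumes S: "controlled S"
begin

lemma chain_step:
  assumes "controlled (chain S n)" "\<And>i. i \<le> n \<Longrightarrow> chain S i \<subseteq> chain S n \<and> chain S i \<noteq> {}"
    and "i = min n (fst (prod_decode n))"
    and "X = from_nat_into (chain S i) (fst (prod_decode (snd (prod_decode n))))"
    and "Y = from_nat_into (chain S i) (snd (prod_decode (snd (prod_decode n))))"
  shows "controlled (chain S (Suc n))" "chain S n \<subseteq> chain S (Suc n)" "solved X Y (chain S (Suc n))"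
proof -
  have i: "chain S i \<subseteq> chain S n" "chain S i \<noteq> {}" using assms(2)[of i] assms(3) by simp_all
  have "X \<in> chain S n" "Y \<in> chain S n" unfolding assms(4,5) using i from_nat_into[OF i(2)] by blast+
  from someI_ex[OF solve_step[OF assms(1) this]]
  have "controlled (chain S (Suc n)) \<and> chain S n \<subseteq> chain S (Suc n) \<and> solved X Y (chain S (Suc n))"
    unfolding chain.simps nxt_def assms(3-5) .
  then show "controlled (chain S (Suc n))" "chain S n \<subseteq> chain S (Suc n)" "solved X Y (chain S (Suc n))" by blast+
qed

lemma chain_controlled: "controlled (chain S n) \<and> (\<forall>i\<le>n. chain S i \<subseteq> chain S n \<and> chain S i \<noteq> {})"
proof (induction n)
  case 0
  obtain C T where "good S C T" using S unfolding controlled_def by blast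
  then have "S \<noteq> {}" unfolding good_def by blast
  then show ?case using S by simp
next
  case (Suc n)
  note step = chain_step[of n, OF _ _ refl refl refl]
  have "controlled (chain S (Suc n))" "chain S n \<subseteq> chain S (Suc n)" by (rule step; use Suc in simp)+
  then show ?case using Suc by (auto simp: le_Suc_eq)
qed

lemma chain_mono: "i \<le> n \<Longrightarrow> chain S i \<subseteq> chain S n"
  using chain_controlled by blast

lemma chain_solved:
  assumes "X \<in> chain S i" "Y \<in> chain S i" shows "\<exists>n. solved X Y (chain S n)"
proof -
  obtain C T where "good (chain S i) C T" using chain_controlled unfolding controlled_def by blast
  then have c: "countable (chain S i)" unfolding good_def by blast
  obtain j k where jk: "from_nat_into (chain S i) j = X" "from_nat_into (chain S i) k = Y"
    using from_nat_into_surj[OF c] assms by metis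
  define n where "n = prod_encode (i, prod_encode (j, k))"
  have n: "fst (prod_decode n) = i" "fst (prod_decode (snd (prod_decode n))) = j" "snd (prod_decode (snd (prod_decode n))) = k"
    by (simp_all add: n_def)
  have "i \<le> n" unfolding n_def by (rule le_prod_encode_1)
  then have i: "i = min n (fst (prod_decode n))" using n(1) by simp
  have cc: "controlled (chain S n)" "\<And>i. i \<le> n \<Longrightarrow> chain S i \<subseteq> chain S n \<and> chain S i \<noteq> {}"
    using chain_controlled[of n] by blast+
  have "solved X Y (chain S (Suc n))"
    by (rule chain_step(3)[OF cc i]) (simp_all add: n jk)
  then show ?thesis ..
qed

end

subsection \<open>The union of the chain\<close>

context collection_class begin

lemma rec_tv: "(\<And>i. rec S (f i)) \<Longrightarrow> rec S (\<lambda>x. tv std (\<lambda>i. f i x) t)"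
  by (induction t) (auto intro: dc)

lemma dec_sat:
  assumes "bounded p" "\<And>i. rec S (f i)" "\<And>i. s i \<in> S"
  shows "dec S (\<lambda>x. sat std D (\<lambda>i. f i x) s p)"
  using assms(1,2)
proof (induction arbitrary: f rule: bounded.induct)
  case (1 t u) then show ?case by (simp add: dec_eq rec_tv)
next
  case (2 t u) then show ?case by (simp add: dec_less rec_tv)
next
  case (3 t X) then show ?case by (simp add: dec_mem rec_tv assms(3))
next
  case 4 then show ?case by (simp add: d0_const)
next
  case (5 p q) then show ?case by (simp add: d0_imp)
next
  case (6 p t)
  let ?f = "case_nat sn (\<lambda>i z. f i (fs z))"
  have "rec S (\<lambda>z. f i (fs z))" for i by (rule rec_comp[OF 6(3) rec_fs[OF rec_id]])
  then have "rec S (?f i)" for i by (auto split: nat.split intro: rec_sn[OF rec_id])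
  from 6(2)[OF this] have "dec S (\<lambda>z. sat std D (\<lambda>i. ?f i z) s p)" .
  moreover have "(\<lambda>i. ?f i z) = case_nat (sn z) (\<lambda>i. f i (fs z))" for z by (rule ext) (simp split: nat.split)
  ultimately have "dec S (\<lambda>z. sat std D (case_nat (sn z) (\<lambda>i. f i (fs z))) s p)" by simp
  from dec_all_less[OF this rec_tv[OF 6(3)]] show ?case by simp
next
  case (7 p t)
  let ?f = "case_nat sn (\<lambda>i z. f i (fs z))"
  have "rec S (\<lambda>z. f i (fs z))" for i by (rule rec_comp[OF 7(3) rec_fs[OF rec_id]])
  then have "rec S (?f i)" for i by (auto split: nat.split intro: rec_sn[OF rec_id])
  from 7(2)[OF this] have "dec S (\<lambda>z. sat std D (\<lambda>i. ?f i z) s p)" .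
  moreover have "(\<lambda>i. ?f i z) = case_nat (sn z) (\<lambda>i. f i (fs z))" for z by (rule ext) (simp split: nat.split)
  ultimately have "dec S (\<lambda>z. sat std D (case_nat (sn z) (\<lambda>i. f i (fs z))) s p)" by simp
  from dec_ex_less[OF this rec_tv[OF 7(3)]] show ?case by simp
qed

lemma dec_sat2:
  assumes "bounded p" "\<And>i. s i \<in> S"
  shows "dec S (\<lambda>z. sat std D (case_nat (sn z) (case_nat (fs z) e)) s p)"
proof -
  let ?f = "case_nat sn (case_nat fs (\<lambda>i z. e i))"
  have "rec S (?f i)" for i by (auto split: nat.split intro: rec_const rec_sn[OF rec_id] rec_fs[OF rec_id])
  from dec_sat[OF assms(1) this assms(2)] have "dec S (\<lambda>z. sat std D (\<lambda>i. ?f i z) s p)" .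
  moreover have "(\<lambda>i. ?f i z) = case_nat (sn z) (case_nat (fs z) e)" for z by (rule ext) (simp split: nat.split)
  ultimately show ?thesis by simp
qed

end

lemma sat_And: "sat M D e s (p \<^bold>\<and> q) \<longleftrightarrow> sat M D e s p \<and> sat M D e s q"
  by simp

lemma sat_largeness_notion:
  assumes "sat std D e s (largeness_notion L)"
  shows "\<forall>c. c \<in> s L \<longrightarrow> fin c" "\<forall>X\<in>D. unb X \<longrightarrow> (\<exists>c. c \<in> s L \<and> elts c \<subseteq> X)"
proof -
  note h = assms[unfolded largeness_notion_def sat_And]
  have 1: "sat std D e s (AllN (Var 0 \<^bold>\<in> L \<^bold>\<longrightarrow> finset_code (Var 0)))"
    and 2: "sat std D e s (AllS (infinite_set 0 \<^bold>\<longrightarrow> ExN (Var 0 \<^bold>\<in> Suc L \<^bold>\<and> code_sub_set (Var 0) 0)))"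
    by (rule conjunct1[OF h], rule conjunct2[OF conjunct2[OF h]])
  from 1 show "\<forall>c. c \<in> s L \<longrightarrow> fin c" by simp
  from 2 show "\<forall>X\<in>D. unb X \<longrightarrow> (\<exists>c. c \<in> s L \<and> elts c \<subseteq> X)" by simp
qed

lemma sat_basic_axioms: "p \<in> basic_axioms \<Longrightarrow> sat std D e s p"
  unfolding basic_axioms_def by (auto simp: less_add1_iff order_le_less add.assoc distrib_left)

text \<open>The parameters of a bounded formula lie in one stage. Sigma_1 induction then comes from
  the \<open>T\<close> of that stage, and Delta_1 comprehension from the stage itself.\<close>

theorem chain_model:
  fixes S :: "'a::{arith,countable} set set"
  assumes S: "controlled S"
  shows "models std (\<Union>n. chain S n) (WKL0 \<union> {GP22})"
  unfolding models_def
proof (intro ballI allI impI)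
  let ?U = "\<Union>n. chain S n"
  fix p and e :: "nat \<Rightarrow> 'a" and s :: "nat \<Rightarrow> 'a set"
  assume p: "p \<in> WKL0 \<union> {GP22}" and s: "\<forall>i. s i \<in> ?U"
  \<comment> \<open>An assignment may use sets from unboundedly many stages. Only the variables
    below k are kept; all others are reset to \<open>s 0\<close>.\<close>
  have common: "\<exists>n s'. (\<forall>i. s' i \<in> chain S n) \<and> (\<forall>i<k. s' i = s i)" for k
  proof -
    have "\<exists>n. \<forall>i\<le>k. s i \<in> chain S n"
    proof (induction k)
      case 0 then show ?case using s by auto
    next
      case (Suc k)
      then obtain n where n: "\<forall>i\<le>k. s i \<in> chain S n" by blast
      obtain m where m: "s (Suc k) \<in> chain S m" using s by blast
      have "\<forall>i\<le>Suc k. s i \<in> chain S (max m n)"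
        using n m chain_mono[OF S, of n "max m n"] chain_mono[OF S, of m "max m n"] by (auto simp: le_Suc_eq)
      then show ?case ..
    qed
    then obtain n where n: "\<forall>i\<le>k. s i \<in> chain S n" by blast
    show ?thesis by (rule exI[of _ n], rule exI[of _ "\<lambda>i. if i < k then s i else s 0"]) (use n in auto)
  qed
  have both: "\<exists>n C T s'. good (chain S n) C T \<and> (\<forall>i. s' i \<in> chain S n) \<and>
      (\<forall>e. sat std ?U e s q = sat std ?U e s' q) \<and> (\<forall>e. sat std ?U e s r = sat std ?U e s' r)" for q r
  proof -
    obtain k where k: "closed_fm k k (q \<^bold>\<longrightarrow> r)" using closed_fm_ex by blast
    obtain n s' where s': "\<forall>i. s' i \<in> chain S n" "\<forall>i<k. s' i = s i" using common by blast
    obtain C T where "good (chain S n) C T" using chain_controlled[OF S] unfolding controlled_def by blast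
    moreover have "sat std ?U e s q = sat std ?U e s' q" "sat std ?U e s r = sat std ?U e s' r" for e
      using sat_cong[of k k q e e s s' std ?U] sat_cong[of k k r e e s s' std ?U] k s'(2) by simp_all
    ultimately show ?thesis using s'(1) by blast
  qed
  consider "p \<in> basic_axioms" | q where "p = induction_axiom (ExN q)" "bounded q"
    | q r where "p = comprehension_axiom (ExN q) (AllN r)" "bounded q" "bounded r" | "p = WKL" | "p = GP22"
    using p unfolding WKL0_def RCA0_def by auto
  then show "sat std ?U e s p"
  proof cases
    case 1 then show ?thesis by (rule sat_basic_axioms)
  next
    case (2 q)
    obtain n C T s' where n: "good (chain S n) C T" "\<forall>i. s' i \<in> chain S n"
      and eq: "\<forall>e. sat std ?U e s q = sat std ?U e s' q" using both[of q q] by blast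
    interpret C: collection_class "chain S n" using n(1) by (simp add: good_def)
    interpret T: collection_class T using n(1) by (simp add: good_def)
    define P where "P x \<longleftrightarrow> (\<exists>y. sat std ?U (case_nat y (case_nat x e)) s' q)" for x
    have "dec T P" unfolding P_def[abs_def]
      by (rule good_sigma1[OF n(1)]) (rule C.dec_sat2[OF 2(2)], use n(2) in blast)
    from T.dec_induct[OF this] have "P 0 \<Longrightarrow> (\<And>x. P x \<Longrightarrow> P (x + 1)) \<Longrightarrow> P x" for x .
    moreover have "sat std ?U (case_nat x e) s (ExN q) \<longleftrightarrow> P x" for x unfolding P_def using eq by simp
    ultimately show ?thesis unfolding 2(1) sat_induction_axiom std_simps by blast
  next
    case (3 q r)
    obtain n C T s' where n: "good (chain S n) C T" "\<forall>i. s' i \<in> chain S n"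
      and eq: "\<forall>e. sat std ?U e s q = sat std ?U e s' q" "\<forall>e. sat std ?U e s r = sat std ?U e s' r"
      using both[of q r] by blast
    interpret C: collection_class "chain S n" using n(1) by (simp add: good_def)
    define P where "P x y \<longleftrightarrow> sat std ?U (case_nat y (case_nat x e)) s' q" for x y
    define Q where "Q x y \<longleftrightarrow> \<not> sat std ?U (case_nat y (case_nat x e)) s' r" for x y
    have dP: "dec (chain S n) (\<lambda>z. P (fs z) (sn z))" unfolding P_def by (rule C.dec_sat2[OF 3(2)]) (use n(2) in blast)
    have dQ: "dec (chain S n) (\<lambda>z. Q (fs z) (sn z))" unfolding Q_def
      by (rule C.d0_not, rule C.dec_sat2[OF 3(3)]) (use n(2) in blast)
    have sq: "sat std ?U (case_nat x e) s (ExN q) \<longleftrightarrow> (\<exists>y. P x y)" for x unfolding P_def using eq by simp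
    have sr: "sat std ?U (case_nat x e) s (AllN r) \<longleftrightarrow> \<not> (\<exists>y. Q x y)" for x unfolding Q_def using eq by simp
    show ?thesis unfolding 3(1) sat_comprehension_axiom sq sr
    proof
      assume "\<forall>x. (\<exists>y. P x y) \<longleftrightarrow> \<not> (\<exists>y. Q x y)"
      then have "dec (chain S n) (\<lambda>x. \<exists>y. P x y)" by (intro C.dec_delta1[OF dP dQ]) blast
      then have "{x. \<exists>y. P x y} \<in> chain S n" by (rule C.dec_set)
      then show "{x. \<exists>y. P x y} \<in> ?U" by blast
    qed
  next
    case 4
    have "\<exists>g\<in>?U. path g X" if X: "X \<in> ?U" "btree X" "unb X" for X
    proof -
      obtain i where "X \<in> chain S i" using X(1) by blast
      then obtain n where "solved X X (chain S n)" using chain_solved[OF S] by blast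
      then show ?thesis using X(2,3) unfolding solved_def by blast
    qed
    then show ?thesis unfolding 4 WKL_def by simp
  next
    case 5
    have "\<exists>F\<in>?U. grp L f F" if Lf: "L \<in> ?U" "f \<in> ?U" "pcol f" and L: "\<forall>c. c \<in> L \<longrightarrow> fin c"
      "\<forall>X\<in>?U. unb X \<longrightarrow> (\<exists>c. c \<in> L \<and> elts c \<subseteq> X)" for L f
    proof -
      obtain i j where "L \<in> chain S i" "f \<in> chain S j" using Lf by blast
      then have "L \<in> chain S (max i j)" "f \<in> chain S (max i j)"
        using chain_mono[OF S, of i "max i j"] chain_mono[OF S, of j "max i j"] by auto
      from chain_solved[OF S this] obtain n where "solved L f (chain S n)" ..
      then have "(\<exists>Z\<in>chain S n. unb Z \<and> (\<forall>c. c \<in> L \<longrightarrow> \<not> elts c \<subseteq> Z)) \<or> (\<exists>F\<in>chain S n. grp L f F)"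
        using Lf(3) L(1) unfolding solved_def by blast
      then show ?thesis
      proof
        \<comment> \<open>An unbounded set without large subsets belongs to the union and
          contradicts the last clause of \<open>largeness_notion\<close> there.\<close>
        assume "\<exists>Z\<in>chain S n. unb Z \<and> (\<forall>c. c \<in> L \<longrightarrow> \<not> elts c \<subseteq> Z)"
        then obtain Z where Z: "Z \<in> chain S n" "unb Z" "\<forall>c. c \<in> L \<longrightarrow> \<not> elts c \<subseteq> Z" by blast
        then have "Z \<in> ?U" by blast
        then show ?thesis using L(2) Z by blast
      qed blast
    qed
    note grouping = this
    show ?thesis unfolding 5 GP22_def sat.simps(7)
    proof (intro ballI)
      fix L f assume Lf: "L \<in> ?U" "f \<in> ?U"
      let ?s = "case_nat f (case_nat L s)"
      have "sat std ?U e ?s (ExS (infinite_grouping 2 1 0))" if h: "sat std ?U e ?s (largeness_notion 1)" "pcol f"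
      proof -
        have "\<exists>F\<in>?U. grp L f F" 
          by (rule grouping[OF Lf h(2)]) (use sat_largeness_notion[OF h(1)] in simp_all)
        then show ?thesis by (simp add: numeral_2_eq_2)
      qed
      then show "sat std ?U e ?s (largeness_notion 1 \<^bold>\<and> pair_coloring 0 \<^bold>\<longrightarrow> ExS (infinite_grouping 2 1 0))"
        unfolding sat.simps by simp
    qed
  qed
qed

theorem theorem4p2:
  shows "conservative_over Pi11 (WKL0 \<union> {GP22}) (RCA0 \<union> B_Sigma0 2)"
  unfolding conservative_over_def
proof (intro allI impI)
  fix p assume p: "Pi11 p \<and> sentence p \<and> WKL0 \<union> {GP22} \<turnstile> p"
  show "base_theory \<turnstile> p"
  proof (rule ccontr)
    assume no: "\<not> base_theory \<turnstile> p"
    obtain q where q: "arithmetical q" "p = AllS q" using p unfolding Pi11_def by blast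
    \<comment> \<open>The structure on \<open>mnum\<close> was chosen to refute \<open>cx\<close>,
      so the argument passes from q to \<open>cx\<close>, which is a counterexample as soon as there
      is one.\<close>
    then have "counterexample q" using p no unfolding counterexample_def by simp
    then have cx: "arithmetical cx" "closed_fm 0 1 cx" "WKL0 \<union> {GP22} \<turnstile> AllS cx"
      using counterexample_cx unfolding counterexample_def by blast+
    obtain D :: "mnum set set" and e s where D: "models std D base_theory" "countable D" "\<forall>i. s i \<in> D"
      "\<not> sat std D e s cx" "\<forall>\<theta>\<in>bounded_unary. sat std D e s (universal_axiom \<theta>)"
      using mstruc unfolding mstruc_std by (elim exE conjE)
    interpret collection_model D by unfold_locales (use D in auto)
    have univ: "\<exists>j. \<forall>x. \<langle>j, x\<rangle> \<in> s 1 \<longleftrightarrow> sat std {} (\<lambda>_. x) (\<lambda>_. {}) \<theta>" if \<theta>: "bounded \<theta>" "closed_fm 1 0 \<theta>" for \<theta>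
    proof -
      let ?j = "tv std e (num (to_nat \<theta>))"
      have "tv std (case_nat x e) (num (to_nat \<theta>)) = ?j" for x by (rule tv_cong[of 0]) simp_all
      moreover have "sat std D (case_nat x e) s \<theta> \<longleftrightarrow> sat std {} (\<lambda>_. x) (\<lambda>_. {}) \<theta>" for x
        unfolding sat_arithmetical[OF bounded_arithmetical[OF \<theta>(1)], of _ D _ _ "{}"] by (rule sat_cong[OF \<theta>(2)]) simp_all
      moreover have "sat std D e s (universal_axiom \<theta>)" using D(5) \<theta> unfolding bounded_unary_def by blast
      ultimately have "\<langle>?j, x\<rangle> \<in> s 1 \<longleftrightarrow> sat std {} (\<lambda>_. x) (\<lambda>_. {}) \<theta>" for x
        unfolding universal_axiom_def by auto
      then show ?thesis by blast
    qed
    obtain S C T where S: "good S C T" "s 0 \<in> S" by (rule good_entry[OF D(2) spec[OF D(3)] spec[OF D(3)] univ])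
    let ?U = "\<Union>n. chain S n"
    have cS: "controlled S" using S(1) unfolding controlled_def by blast
    have "chain S 0 \<subseteq> ?U" by blast
    then have A: "s 0 \<in> ?U" using S(2) by auto
    \<comment> \<open>Both models have the same numbers, and \<open>cx\<close> is arithmetical in
      one set variable, so its truth value at \<open>s 0\<close> is the same in D and in the
      union.\<close>
    have "sat std ?U e (\<lambda>_. s 0) (AllS cx)" by (rule soundness[OF cx(3) chain_model[OF cS]]) (use A in simp)
    then have "sat std ?U e (case_nat (s 0) (\<lambda>_. s 0)) cx" unfolding sat.simps(7) using A by (rule bspec)
    then have "sat std D e (case_nat (s 0) (\<lambda>_. s 0)) cx" using sat_arithmetical[OF cx(1)] by blast
    moreover have "sat std D e (case_nat (s 0) (\<lambda>_. s 0)) cx \<longleftrightarrow> sat std D e s cx" by (rule sat_cong[OF cx(2)]) simp_all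
    ultimately show False using D(4) by blast
  qed
qed

end
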